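(* (Provable in $\mathsf{S}$.) If $\mathsf{S}$ is consistent, then $\mathsf{C}$ does not prove the sentence "for every theorem $\sigma$ of $\mathsf{S}$, $(V;\in)\models^*\sigma$".
   Context: $\mathsf{S}$ is $\mathsf{ZF}$ with the Axiom of Infinity omitted; $\mathsf{C}$ is Gödel–Bernays class theory $\mathsf{GB}$ (class comprehension only for formulas without bound class variables) with the Axiom of Infinity omitted. $V$ is the class of all sets. For a formula $\phi$, a $\{\phi\}$-satisfaction relation for a structure $\mathfrak S$ is the class of pairs $\langle\psi,A\rangle$ ($\psi$ a subformula of $\phi$, $A$ a finite function into $|\mathfrak S|$ covering the free variables of $\psi$) at which $\psi$ is true according to a valuation obeying the usual Tarskian clauses. Universal satisfaction: $\mathfrak S\models^*\sigma$ (for a sentence $\sigma$) iff for every $\{\sigma\}$-satisfaction relation $S$ for $\mathfrak S$, $\langle\sigma,\emptyset\rangle\in S$. *)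

theory Defs
  imports Main
begin

section \<open>First-order logic in the language of membership and equality\<close>

datatype fm =
    Mem nat nat
  | Eql nat nat
  | Neg fm
  | Imp fm fm
  | Forall nat fm

abbreviation Conj :: "fm \<Rightarrow> fm \<Rightarrow> fm" where "Conj p q \<equiv> Neg (Imp p (Neg q))"
abbreviation Disj :: "fm \<Rightarrow> fm \<Rightarrow> fm" where "Disj p q \<equiv> Imp (Neg p) q"
abbreviation Iff :: "fm \<Rightarrow> fm \<Rightarrow> fm" where "Iff p q \<equiv> Conj (Imp p q) (Imp q p)"
abbreviation Exists :: "nat \<Rightarrow> fm \<Rightarrow> fm" where "Exists i p \<equiv> Neg (Forall i (Neg p))"

primrec FV :: "fm \<Rightarrow> nat set" where
  "FV (Mem i j) = {i, j}"
| "FV (Eql i j) = {i, j}"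
| "FV (Neg p) = FV p"
| "FV (Imp p q) = FV p \<union> FV q"
| "FV (Forall i p) = FV p - {i}"

text \<open>Tarski's complete axiomatization of first-order logic with equality for a language whose
  only terms are variables; it needs no substitution operation.\<close>

inductive logical_axiom :: "fm \<Rightarrow> bool" where
  P1: "logical_axiom (Imp p (Imp q p))"
| P2: "logical_axiom (Imp (Imp p (Imp q r)) (Imp (Imp p q) (Imp p r)))"
| P3: "logical_axiom (Imp (Imp (Neg p) (Neg q)) (Imp q p))"
| Q1: "logical_axiom (Imp (Forall i (Imp p q)) (Imp (Forall i p) (Forall i q)))"
| Q2: "logical_axiom (Imp (Forall i p) p)"
| Q3: "i \<notin> FV p \<Longrightarrow> logical_axiom (Imp p (Forall i p))"
| E1: "logical_axiom (Exists i (Eql i j))"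
| E2: "logical_axiom (Imp (Eql i j) (Imp (Eql i k) (Eql j k)))"
| E3: "logical_axiom (Imp (Eql i j) (Imp (Mem i k) (Mem j k)))"
| E4: "logical_axiom (Imp (Eql i j) (Imp (Mem k i) (Mem k j)))"

inductive proves :: "fm set \<Rightarrow> fm \<Rightarrow> bool"  (infix "\<turnstile>" 50) for T :: "fm set" where
  Log: "logical_axiom p \<Longrightarrow> T \<turnstile> p"
| Ax: "p \<in> T \<Longrightarrow> T \<turnstile> p"
| MP: "T \<turnstile> Imp p q \<Longrightarrow> T \<turnstile> p \<Longrightarrow> T \<turnstile> q"
| Gen: "T \<turnstile> p \<Longrightarrow> T \<turnstile> Forall i p"

definition consistent :: "fm set \<Rightarrow> bool" where
  "consistent T \<longleftrightarrow> \<not> (\<exists>p. T \<turnstile> p \<and> T \<turnstile> Neg p)"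


section \<open>A notation for concrete formulas\<close>

text \<open>
  A term of type \<open>hfm\<close> is a formula awaiting the number \<open>n\<close> of the next fresh variable; all
  variables in scope are numbered below \<open>n\<close>, and a quantifier binds \<open>n\<close> itself. Thus HOL binders
  do the naming of bound variables and no capture can occur. A closed \<open>hfm\<close> applied to \<open>0\<close> is
  a sentence.
\<close>

type_synonym hfm = "nat \<Rightarrow> fm"

definition hmem :: "nat \<Rightarrow> nat \<Rightarrow> hfm"  (infix "\<^bold>\<in>" 60) where
  "(x \<^bold>\<in> y) = (\<lambda>n. Mem x y)"
definition heq :: "nat \<Rightarrow> nat \<Rightarrow> hfm"  (infix "\<^bold>=" 60) where
  "(x \<^bold>= y) = (\<lambda>n. Eql x y)"
definition hnot :: "hfm \<Rightarrow> hfm"  ("\<^bold>\<not> _" [55] 55) where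
  "(\<^bold>\<not> A) = (\<lambda>n. Neg (A n))"
definition hand :: "hfm \<Rightarrow> hfm \<Rightarrow> hfm"  (infixr "\<^bold>\<and>" 45) where
  "(A \<^bold>\<and> B) = (\<lambda>n. Conj (A n) (B n))"
definition hor :: "hfm \<Rightarrow> hfm \<Rightarrow> hfm"  (infixr "\<^bold>\<or>" 40) where
  "(A \<^bold>\<or> B) = (\<lambda>n. Disj (A n) (B n))"
definition himp :: "hfm \<Rightarrow> hfm \<Rightarrow> hfm"  (infixr "\<^bold>\<longrightarrow>" 35) where
  "(A \<^bold>\<longrightarrow> B) = (\<lambda>n. Imp (A n) (B n))"
definition hiff :: "hfm \<Rightarrow> hfm \<Rightarrow> hfm"  (infixr "\<^bold>\<longleftrightarrow>" 35) where
  "(A \<^bold>\<longleftrightarrow> B) = (\<lambda>n. Iff (A n) (B n))"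
definition hall :: "(nat \<Rightarrow> hfm) \<Rightarrow> hfm"  (binder "\<^bold>\<forall>" 30) where
  "hall A = (\<lambda>n. Forall n (A n (Suc n)))"
definition hex :: "(nat \<Rightarrow> hfm) \<Rightarrow> hfm"  (binder "\<^bold>\<exists>" 30) where
  "hex A = (\<lambda>n. Exists n (A n (Suc n)))"


section \<open>The theories S and C\<close>

subsection \<open>S: ZF without Infinity\<close>

definition ax_ext :: hfm where
  "ax_ext = (\<^bold>\<forall>x. \<^bold>\<forall>y. (\<^bold>\<forall>z. z \<^bold>\<in> x \<^bold>\<longleftrightarrow> z \<^bold>\<in> y) \<^bold>\<longrightarrow> x \<^bold>= y)"
definition ax_found :: hfm where
  "ax_found = (\<^bold>\<forall>x. (\<^bold>\<exists>y. y \<^bold>\<in> x) \<^bold>\<longrightarrow> (\<^bold>\<exists>y. y \<^bold>\<in> x \<^bold>\<and> \<^bold>\<not> (\<^bold>\<exists>z. z \<^bold>\<in> x \<^bold>\<and> z \<^bold>\<in> y)))"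
definition ax_pair :: hfm where
  "ax_pair = (\<^bold>\<forall>x. \<^bold>\<forall>y. \<^bold>\<exists>z. \<^bold>\<forall>w. w \<^bold>\<in> z \<^bold>\<longleftrightarrow> w \<^bold>= x \<^bold>\<or> w \<^bold>= y)"
definition ax_union :: hfm where
  "ax_union = (\<^bold>\<forall>x. \<^bold>\<exists>u. \<^bold>\<forall>w. w \<^bold>\<in> u \<^bold>\<longleftrightarrow> (\<^bold>\<exists>y. y \<^bold>\<in> x \<^bold>\<and> w \<^bold>\<in> y))"
definition ax_power :: hfm where
  "ax_power = (\<^bold>\<forall>x. \<^bold>\<exists>p. \<^bold>\<forall>w. w \<^bold>\<in> p \<^bold>\<longleftrightarrow> (\<^bold>\<forall>z. z \<^bold>\<in> w \<^bold>\<longrightarrow> z \<^bold>\<in> x))"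

definition S_single :: "fm list" where
  "S_single = [ax_ext 0, ax_found 0, ax_pair 0, ax_union 0, ax_power 0]"

text \<open>The free variables of schema instances (the parameters) may be universally generalized by
  the rule \<open>Gen\<close>. The hypothesis of Replacement says that \<open>p\<close>, as a relation between \<open>z\<close> and \<open>w\<close>,
  is single-valued on \<open>x\<close>.\<close>

inductive_set S_axioms :: "fm set" where
  single: "p \<in> set S_single \<Longrightarrow> p \<in> S_axioms"
| separation: "distinct [x, y, z] \<Longrightarrow> y \<notin> FV p \<Longrightarrow>
    Exists y (Forall z (Iff (Mem z y) (Conj (Mem z x) p))) \<in> S_axioms"
| replacement: "distinct [x, y, z, w, u] \<Longrightarrow> y \<notin> FV p \<Longrightarrow> u \<notin> FV p \<Longrightarrow>
    Imp (Forall z (Imp (Mem z x) (Exists u (Forall w (Imp p (Eql w u))))))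
        (Exists y (Forall w (Iff (Mem w y) (Exists z (Conj (Mem z x) p))))) \<in> S_axioms"


subsection \<open>C: GB without Infinity\<close>

text \<open>C is formulated with a single sort of variables, ranging over classes; sets are the classes
  that are members of some class. \<open>relV\<close> relativizes all quantifiers to sets; free variables still
  range over classes.\<close>

primrec relV :: "fm \<Rightarrow> fm" where
  "relV (Mem i j) = Mem i j"
| "relV (Eql i j) = Eql i j"
| "relV (Neg p) = Neg (relV p)"
| "relV (Imp p q) = Imp (relV p) (relV q)"
| "relV (Forall i p) = Forall i (Imp (Exists (Suc i) (Mem i (Suc i))) (relV p))"

definition rel :: "hfm \<Rightarrow> hfm" where
  "rel A = (\<lambda>n. relV (A n))"

definition hset :: "nat \<Rightarrow> hfm" where
  "hset x = (\<^bold>\<exists>y. x \<^bold>\<in> y)"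

definition hpair :: "nat \<Rightarrow> nat \<Rightarrow> nat \<Rightarrow> hfm" where
  "hpair x y p = (\<^bold>\<exists>a. \<^bold>\<exists>b. (\<^bold>\<forall>w. w \<^bold>\<in> a \<^bold>\<longleftrightarrow> w \<^bold>= x) \<^bold>\<and> (\<^bold>\<forall>w. w \<^bold>\<in> b \<^bold>\<longleftrightarrow> w \<^bold>= x \<^bold>\<or> w \<^bold>= y) \<^bold>\<and>
                    (\<^bold>\<forall>w. w \<^bold>\<in> p \<^bold>\<longleftrightarrow> w \<^bold>= a \<^bold>\<or> w \<^bold>= b))"

text \<open>\<open>hpairin x y F\<close> says that the ordered pair of \<open>x\<close> and \<open>y\<close> belongs to \<open>F\<close>.\<close>

definition hpairin :: "nat \<Rightarrow> nat \<Rightarrow> nat \<Rightarrow> hfm" where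
  "hpairin x y F = (\<^bold>\<exists>p. hpair x y p \<^bold>\<and> p \<^bold>\<in> F)"

definition hsingle_valued :: "nat \<Rightarrow> hfm" where
  "hsingle_valued F = (\<^bold>\<forall>x. \<^bold>\<forall>y. \<^bold>\<forall>z. hpairin x y F \<^bold>\<and> hpairin x z F \<^bold>\<longrightarrow> y \<^bold>= z)"

definition ax_class_replacement :: hfm where
  "ax_class_replacement =
     (\<^bold>\<forall>F. rel (hsingle_valued F \<^bold>\<longrightarrow>
       (\<^bold>\<forall>x. \<^bold>\<exists>y. \<^bold>\<forall>w. w \<^bold>\<in> y \<^bold>\<longleftrightarrow> (\<^bold>\<exists>z. z \<^bold>\<in> x \<^bold>\<and> hpairin z w F))))"

text \<open>First-order logic only guarantees that there is a class. That there is a set must be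
  postulated, since Infinity is not available to yield one.\<close>

definition ax_set_exists :: hfm where
  "ax_set_exists = (\<^bold>\<exists>x. hset x)"

definition C_single :: "fm list" where
  "C_single = [ax_ext 0, ax_set_exists 0, rel ax_found 0, rel ax_pair 0, rel ax_union 0,
               rel ax_power 0, ax_class_replacement 0]"

text \<open>The formulas without bound class variables: every quantifier is restricted to sets.\<close>

inductive predicative :: "fm \<Rightarrow> bool" where
  "predicative (Mem i j)"
| "predicative (Eql i j)"
| "predicative p \<Longrightarrow> predicative (Neg p)"
| "predicative p \<Longrightarrow> predicative q \<Longrightarrow> predicative (Imp p q)"
| "predicative p \<Longrightarrow> i \<noteq> j \<Longrightarrow> predicative (Forall i (Imp (Exists j (Mem i j)) p))"

inductive_set C_axioms :: "fm set" where
  single: "p \<in> set C_single \<Longrightarrow> p \<in> C_axioms"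
| comprehension: "predicative p \<Longrightarrow> y \<notin> FV p \<Longrightarrow> x \<noteq> y \<Longrightarrow> x \<noteq> j \<Longrightarrow>
    Exists y (Forall x (Imp (Exists j (Mem x j)) (Iff (Mem x y) p))) \<in> C_axioms"


section \<open>Syntax of formulas inside set theory\<close>

subsection \<open>Natural numbers and finite sequences\<close>

definition hempty :: "nat \<Rightarrow> hfm" where
  "hempty x = (\<^bold>\<forall>w. \<^bold>\<not> w \<^bold>\<in> x)"

definition hsucc :: "nat \<Rightarrow> nat \<Rightarrow> hfm" where
  "hsucc x y = (\<^bold>\<forall>w. w \<^bold>\<in> y \<^bold>\<longleftrightarrow> w \<^bold>\<in> x \<^bold>\<or> w \<^bold>= x)"

definition htransitive :: "nat \<Rightarrow> hfm" where
  "htransitive x = (\<^bold>\<forall>y. y \<^bold>\<in> x \<^bold>\<longrightarrow> (\<^bold>\<forall>z. z \<^bold>\<in> y \<^bold>\<longrightarrow> z \<^bold>\<in> x))"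

definition hordinal :: "nat \<Rightarrow> hfm" where
  "hordinal x = (htransitive x \<^bold>\<and> (\<^bold>\<forall>y. y \<^bold>\<in> x \<^bold>\<longrightarrow> htransitive y))"

definition hnat :: "nat \<Rightarrow> hfm" where
  "hnat n = (hordinal n \<^bold>\<and>
     (\<^bold>\<forall>m. m \<^bold>\<in> n \<^bold>\<or> m \<^bold>= n \<^bold>\<longrightarrow> hempty m \<^bold>\<or> (\<^bold>\<exists>k. hsucc k m)))"

definition hfunction :: "nat \<Rightarrow> hfm" where
  "hfunction f = ((\<^bold>\<forall>p. p \<^bold>\<in> f \<^bold>\<longrightarrow> (\<^bold>\<exists>x. \<^bold>\<exists>y. hpair x y p)) \<^bold>\<and> hsingle_valued f)"

definition hseq :: "nat \<Rightarrow> nat \<Rightarrow> hfm" where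
  "hseq s n = (hnat n \<^bold>\<and> hfunction s \<^bold>\<and> (\<^bold>\<forall>k. (\<^bold>\<exists>x. hpairin k x s) \<^bold>\<longleftrightarrow> k \<^bold>\<in> n))"

definition hfinite :: "nat \<Rightarrow> hfm" where
  "hfinite x = (\<^bold>\<exists>n. \<^bold>\<exists>s. hseq s n \<^bold>\<and>
     (\<^bold>\<forall>k. \<^bold>\<forall>l. \<^bold>\<forall>y. hpairin k y s \<^bold>\<and> hpairin l y s \<^bold>\<longrightarrow> k \<^bold>= l) \<^bold>\<and>
     (\<^bold>\<forall>y. y \<^bold>\<in> x \<^bold>\<longleftrightarrow> (\<^bold>\<exists>k. hpairin k y s)))"

text \<open>\<open>hgenerated step x\<close>: \<open>x\<close> occurs in a finite sequence each of whose entries \<open>y\<close> satisfies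
  \<open>step E y\<close>, where \<open>E\<close> is the predicate of being an earlier entry. This is the internal
  counterpart of an inductive definition.\<close>

definition hgenerated :: "((nat \<Rightarrow> hfm) \<Rightarrow> nat \<Rightarrow> hfm) \<Rightarrow> nat \<Rightarrow> hfm" where
  "hgenerated step x = (\<^bold>\<exists>s. \<^bold>\<exists>n. hseq s n \<^bold>\<and> (\<^bold>\<exists>k. k \<^bold>\<in> n \<^bold>\<and> hpairin k x s) \<^bold>\<and>
     (\<^bold>\<forall>k. k \<^bold>\<in> n \<^bold>\<longrightarrow>
        (\<^bold>\<exists>y. hpairin k y s \<^bold>\<and> step (\<lambda>a. \<^bold>\<exists>l. l \<^bold>\<in> k \<^bold>\<and> hpairin l a s) y)))"


subsection \<open>Codes of formulas\<close>

text \<open>A term of type \<open>trm\<close> is a definable term, given by the predicate ``\<open>x\<close> is its value''.\<close>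

type_synonym trm = "nat \<Rightarrow> hfm"

definition V :: "nat \<Rightarrow> trm" where
  "V x = (\<lambda>z. z \<^bold>= x)"

primrec num :: "nat \<Rightarrow> trm" where
  "num 0 = hempty"
| "num (Suc k) = (\<lambda>z. \<^bold>\<exists>y. num k y \<^bold>\<and> hsucc y z)"

definition tpair :: "trm \<Rightarrow> trm \<Rightarrow> trm" where
  "tpair s t = (\<lambda>z. \<^bold>\<exists>x. \<^bold>\<exists>y. s x \<^bold>\<and> t y \<^bold>\<and> hpair x y z)"

text \<open>Formulas are coded by tagged pairs, with the variable numbered \<open>i\<close> coded by the finite
  ordinal \<open>i\<close>.\<close>

definition qMem :: "trm \<Rightarrow> trm \<Rightarrow> trm" where "qMem i j = tpair (num 0) (tpair i j)"
definition qEql :: "trm \<Rightarrow> trm \<Rightarrow> trm" where "qEql i j = tpair (num 1) (tpair i j)"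
definition qNeg :: "trm \<Rightarrow> trm" where "qNeg p = tpair (num 2) p"
definition qImp :: "trm \<Rightarrow> trm \<Rightarrow> trm" where "qImp p q = tpair (num 3) (tpair p q)"
definition qForall :: "trm \<Rightarrow> trm \<Rightarrow> trm" where "qForall i p = tpair (num 4) (tpair i p)"

abbreviation qConj :: "trm \<Rightarrow> trm \<Rightarrow> trm" where "qConj p q \<equiv> qNeg (qImp p (qNeg q))"
abbreviation qIff :: "trm \<Rightarrow> trm \<Rightarrow> trm" where "qIff p q \<equiv> qConj (qImp p q) (qImp q p)"
abbreviation qExists :: "trm \<Rightarrow> trm \<Rightarrow> trm" where "qExists i p \<equiv> qNeg (qForall i (qNeg p))"

text \<open>The definable term denoting the code of a given formula.\<close>

primrec quote :: "fm \<Rightarrow> trm" where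
  "quote (Mem i j) = qMem (num i) (num j)"
| "quote (Eql i j) = qEql (num i) (num j)"
| "quote (Neg p) = qNeg (quote p)"
| "quote (Imp p q) = qImp (quote p) (quote q)"
| "quote (Forall i p) = qForall (num i) (quote p)"

definition hatomic :: "nat \<Rightarrow> hfm" where
  "hatomic y = (\<^bold>\<exists>i. \<^bold>\<exists>j. hnat i \<^bold>\<and> hnat j \<^bold>\<and> (qMem (V i) (V j) y \<^bold>\<or> qEql (V i) (V j) y))"

definition hform :: "nat \<Rightarrow> hfm" where
  "hform = hgenerated (\<lambda>E y.
     hatomic y \<^bold>\<or>
     (\<^bold>\<exists>p. E p \<^bold>\<and> qNeg (V p) y) \<^bold>\<or>
     (\<^bold>\<exists>p. \<^bold>\<exists>q. E p \<^bold>\<and> E q \<^bold>\<and> qImp (V p) (V q) y) \<^bold>\<or>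
     (\<^bold>\<exists>i. \<^bold>\<exists>p. hnat i \<^bold>\<and> E p \<^bold>\<and> qForall (V i) (V p) y))"

text \<open>\<open>q\<close> is an immediate subformula of \<open>p\<close>.\<close>

definition himmediate :: "nat \<Rightarrow> nat \<Rightarrow> hfm" where
  "himmediate q p = (qNeg (V q) p \<^bold>\<or> (\<^bold>\<exists>r. qImp (V q) (V r) p) \<^bold>\<or> (\<^bold>\<exists>r. qImp (V r) (V q) p) \<^bold>\<or>
                       (\<^bold>\<exists>i. qForall (V i) (V q) p))"

text \<open>\<open>s\<close>, with domain \<open>n + 1\<close>, is a path from \<open>p\<close> to \<open>q\<close> in the parse tree of \<open>p\<close>.\<close>

definition hpath :: "nat \<Rightarrow> nat \<Rightarrow> nat \<Rightarrow> nat \<Rightarrow> hfm" where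
  "hpath s n p q =
     ((\<^bold>\<exists>m. hsucc n m \<^bold>\<and> hseq s m) \<^bold>\<and>
      (\<^bold>\<exists>z. hempty z \<^bold>\<and> hpairin z p s) \<^bold>\<and> hpairin n q s \<^bold>\<and>
      (\<^bold>\<forall>k. \<^bold>\<forall>l. \<^bold>\<forall>x. \<^bold>\<forall>y. k \<^bold>\<in> n \<^bold>\<and> hsucc k l \<^bold>\<and> hpairin k x s \<^bold>\<and> hpairin l y s \<^bold>\<longrightarrow> himmediate y x))"

definition hsubformula :: "nat \<Rightarrow> nat \<Rightarrow> hfm" where
  "hsubformula q p = (\<^bold>\<exists>s. \<^bold>\<exists>n. hpath s n p q)"

text \<open>\<open>i\<close> occurs free in \<open>p\<close>: some path leads from \<open>p\<close> to an atomic formula in which \<open>i\<close>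
  occurs without passing through a quantification over \<open>i\<close>.\<close>

definition hfree :: "nat \<Rightarrow> nat \<Rightarrow> hfm" where
  "hfree i p = (\<^bold>\<exists>s. \<^bold>\<exists>n. \<^bold>\<exists>q. hpath s n p q \<^bold>\<and>
     (\<^bold>\<exists>j. qMem (V i) (V j) q \<^bold>\<or> qMem (V j) (V i) q \<^bold>\<or> qEql (V i) (V j) q \<^bold>\<or> qEql (V j) (V i) q) \<^bold>\<and>
     \<^bold>\<not> (\<^bold>\<exists>k. \<^bold>\<exists>x. \<^bold>\<exists>r. hpairin k x s \<^bold>\<and> qForall (V i) (V r) x))"

definition hsentence :: "nat \<Rightarrow> hfm" where
  "hsentence p = (hform p \<^bold>\<and> \<^bold>\<not> (\<^bold>\<exists>i. hfree i p))"


subsection \<open>Provability\<close>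

definition hlogical_axiom :: "nat \<Rightarrow> hfm" where
  "hlogical_axiom x =
     ((\<^bold>\<exists>p. \<^bold>\<exists>q. hform p \<^bold>\<and> hform q \<^bold>\<and> qImp (V p) (qImp (V q) (V p)) x) \<^bold>\<or>
      (\<^bold>\<exists>p. \<^bold>\<exists>q. \<^bold>\<exists>r. hform p \<^bold>\<and> hform q \<^bold>\<and> hform r \<^bold>\<and>
         qImp (qImp (V p) (qImp (V q) (V r))) (qImp (qImp (V p) (V q)) (qImp (V p) (V r))) x) \<^bold>\<or>
      (\<^bold>\<exists>p. \<^bold>\<exists>q. hform p \<^bold>\<and> hform q \<^bold>\<and>
         qImp (qImp (qNeg (V p)) (qNeg (V q))) (qImp (V q) (V p)) x) \<^bold>\<or>
      (\<^bold>\<exists>i. \<^bold>\<exists>p. \<^bold>\<exists>q. hnat i \<^bold>\<and> hform p \<^bold>\<and> hform q \<^bold>\<and>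
         qImp (qForall (V i) (qImp (V p) (V q)))
              (qImp (qForall (V i) (V p)) (qForall (V i) (V q))) x) \<^bold>\<or>
      (\<^bold>\<exists>i. \<^bold>\<exists>p. hnat i \<^bold>\<and> hform p \<^bold>\<and> qImp (qForall (V i) (V p)) (V p) x) \<^bold>\<or>
      (\<^bold>\<exists>i. \<^bold>\<exists>p. hnat i \<^bold>\<and> hform p \<^bold>\<and> \<^bold>\<not> hfree i p \<^bold>\<and> qImp (V p) (qForall (V i) (V p)) x) \<^bold>\<or>
      (\<^bold>\<exists>i. \<^bold>\<exists>j. hnat i \<^bold>\<and> hnat j \<^bold>\<and> qExists (V i) (qEql (V i) (V j)) x) \<^bold>\<or>
      (\<^bold>\<exists>i. \<^bold>\<exists>j. \<^bold>\<exists>k. hnat i \<^bold>\<and> hnat j \<^bold>\<and> hnat k \<^bold>\<and>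
         (qImp (qEql (V i) (V j)) (qImp (qEql (V i) (V k)) (qEql (V j) (V k))) x \<^bold>\<or>
          qImp (qEql (V i) (V j)) (qImp (qMem (V i) (V k)) (qMem (V j) (V k))) x \<^bold>\<or>
          qImp (qEql (V i) (V j)) (qImp (qMem (V k) (V i)) (qMem (V k) (V j))) x)))"

text \<open>\<open>hproves T x\<close>: there is a formal proof of \<open>x\<close> from the axioms satisfying \<open>T\<close>.\<close>

definition hproves :: "(nat \<Rightarrow> hfm) \<Rightarrow> nat \<Rightarrow> hfm" where
  "hproves T = hgenerated (\<lambda>E y.
     hlogical_axiom y \<^bold>\<or>
     T y \<^bold>\<or>
     (\<^bold>\<exists>p. \<^bold>\<exists>r. E r \<^bold>\<and> E p \<^bold>\<and> qImp (V p) (V y) r) \<^bold>\<or>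
     (\<^bold>\<exists>i. \<^bold>\<exists>p. E p \<^bold>\<and> hnat i \<^bold>\<and> qForall (V i) (V p) y))"

definition hconsistent :: "(nat \<Rightarrow> hfm) \<Rightarrow> hfm" where
  "hconsistent T = (\<^bold>\<not> (\<^bold>\<exists>p. \<^bold>\<exists>q. hproves T p \<^bold>\<and> qNeg (V p) q \<^bold>\<and> hproves T q))"

fun honeof :: "fm list \<Rightarrow> nat \<Rightarrow> hfm" where
  "honeof [] x = (\<^bold>\<not> x \<^bold>= x)"
| "honeof (p # ps) x = (quote p x \<^bold>\<or> honeof ps x)"

fun hdistinct :: "nat list \<Rightarrow> hfm" where
  "hdistinct [] = (\<^bold>\<forall>x. x \<^bold>= x)"
| "hdistinct (x # xs) = (foldr (\<lambda>y A. \<^bold>\<not> x \<^bold>= y \<^bold>\<and> A) xs (hdistinct xs))"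

definition hS_axiom :: "nat \<Rightarrow> hfm" where
  "hS_axiom a =
     (honeof S_single a \<^bold>\<or>
      (\<^bold>\<exists>x. \<^bold>\<exists>y. \<^bold>\<exists>z. \<^bold>\<exists>p. hnat x \<^bold>\<and> hnat y \<^bold>\<and> hnat z \<^bold>\<and> hdistinct [x, y, z] \<^bold>\<and>
         hform p \<^bold>\<and> \<^bold>\<not> hfree y p \<^bold>\<and>
         qExists (V y) (qForall (V z)
           (qIff (qMem (V z) (V y)) (qConj (qMem (V z) (V x)) (V p)))) a) \<^bold>\<or>
      (\<^bold>\<exists>x. \<^bold>\<exists>y. \<^bold>\<exists>z. \<^bold>\<exists>w. \<^bold>\<exists>u. \<^bold>\<exists>p. hnat x \<^bold>\<and> hnat y \<^bold>\<and> hnat z \<^bold>\<and> hnat w \<^bold>\<and> hnat u \<^bold>\<and>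
         hdistinct [x, y, z, w, u] \<^bold>\<and> hform p \<^bold>\<and> \<^bold>\<not> hfree y p \<^bold>\<and> \<^bold>\<not> hfree u p \<^bold>\<and>
         qImp
           (qForall (V z) (qImp (qMem (V z) (V x))
             (qExists (V u) (qForall (V w) (qImp (V p) (qEql (V w) (V u)))))))
           (qExists (V y) (qForall (V w)
             (qIff (qMem (V w) (V y)) (qExists (V z) (qConj (qMem (V z) (V x)) (V p)))))) a))"

definition hpredicative :: "nat \<Rightarrow> hfm" where
  "hpredicative = hgenerated (\<lambda>E y.
     hatomic y \<^bold>\<or>
     (\<^bold>\<exists>p. E p \<^bold>\<and> qNeg (V p) y) \<^bold>\<or>
     (\<^bold>\<exists>p. \<^bold>\<exists>q. E p \<^bold>\<and> E q \<^bold>\<and> qImp (V p) (V q) y) \<^bold>\<or>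
     (\<^bold>\<exists>i. \<^bold>\<exists>j. \<^bold>\<exists>p. hnat i \<^bold>\<and> hnat j \<^bold>\<and> \<^bold>\<not> i \<^bold>= j \<^bold>\<and> E p \<^bold>\<and>
        qForall (V i) (qImp (qExists (V j) (qMem (V i) (V j))) (V p)) y))"

definition hC_axiom :: "nat \<Rightarrow> hfm" where
  "hC_axiom a =
     (honeof C_single a \<^bold>\<or>
      (\<^bold>\<exists>x. \<^bold>\<exists>y. \<^bold>\<exists>j. \<^bold>\<exists>p. hnat x \<^bold>\<and> hnat y \<^bold>\<and> hnat j \<^bold>\<and> \<^bold>\<not> x \<^bold>= y \<^bold>\<and> \<^bold>\<not> x \<^bold>= j \<^bold>\<and>
         hpredicative p \<^bold>\<and> \<^bold>\<not> hfree y p \<^bold>\<and>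
         qExists (V y) (qForall (V x) (qImp (qExists (V j) (qMem (V x) (V j)))
           (qIff (qMem (V x) (V y)) (V p)))) a))"


section \<open>Universal satisfaction over the class of all sets\<close>

text \<open>\<open>A\<close> is a finite function covering the free variables of \<open>q\<close>.\<close>

definition hassignment :: "nat \<Rightarrow> nat \<Rightarrow> hfm" where
  "hassignment A q = (hfunction A \<^bold>\<and> hfinite A \<^bold>\<and> (\<^bold>\<forall>i. hfree i q \<^bold>\<longrightarrow> (\<^bold>\<exists>a. hpairin i a A)))"

text \<open>\<open>B\<close> is \<open>A\<close> with its value at \<open>i\<close> set to \<open>a\<close>.\<close>

definition hupdate :: "nat \<Rightarrow> nat \<Rightarrow> nat \<Rightarrow> nat \<Rightarrow> hfm" where
  "hupdate A i a B =
     (\<^bold>\<forall>p. p \<^bold>\<in> B \<^bold>\<longleftrightarrow> hpair i a p \<^bold>\<or> (p \<^bold>\<in> A \<^bold>\<and> \<^bold>\<not> (\<^bold>\<exists>b. hpair i b p)))"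

text \<open>The class \<open>S\<close> is a \<open>{f}\<close>-satisfaction relation for the structure of all sets with membership.
  In \<open>hunivsat\<close> this is relativized, so that only \<open>S\<close> is a class variable.\<close>

definition hsatrel :: "nat \<Rightarrow> nat \<Rightarrow> hfm" where
  "hsatrel S f =
     ((\<^bold>\<forall>x. x \<^bold>\<in> S \<^bold>\<longrightarrow> (\<^bold>\<exists>q. \<^bold>\<exists>A. hpair q A x \<^bold>\<and> hsubformula q f \<^bold>\<and> hassignment A q)) \<^bold>\<and>
      (\<^bold>\<forall>q. \<^bold>\<forall>A. hsubformula q f \<^bold>\<and> hassignment A q \<^bold>\<longrightarrow>
        (\<^bold>\<forall>i. \<^bold>\<forall>j. qMem (V i) (V j) q \<^bold>\<longrightarrow>
           (hpairin q A S \<^bold>\<longleftrightarrow> (\<^bold>\<exists>a. \<^bold>\<exists>b. hpairin i a A \<^bold>\<and> hpairin j b A \<^bold>\<and> a \<^bold>\<in> b))) \<^bold>\<and>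
        (\<^bold>\<forall>i. \<^bold>\<forall>j. qEql (V i) (V j) q \<^bold>\<longrightarrow>
           (hpairin q A S \<^bold>\<longleftrightarrow> (\<^bold>\<exists>a. \<^bold>\<exists>b. hpairin i a A \<^bold>\<and> hpairin j b A \<^bold>\<and> a \<^bold>= b))) \<^bold>\<and>
        (\<^bold>\<forall>p. qNeg (V p) q \<^bold>\<longrightarrow> (hpairin q A S \<^bold>\<longleftrightarrow> \<^bold>\<not> hpairin p A S)) \<^bold>\<and>
        (\<^bold>\<forall>p. \<^bold>\<forall>r. qImp (V p) (V r) q \<^bold>\<longrightarrow>
           (hpairin q A S \<^bold>\<longleftrightarrow> (hpairin p A S \<^bold>\<longrightarrow> hpairin r A S))) \<^bold>\<and>
        (\<^bold>\<forall>i. \<^bold>\<forall>p. qForall (V i) (V p) q \<^bold>\<longrightarrow>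
           (hpairin q A S \<^bold>\<longleftrightarrow> (\<^bold>\<forall>a. \<^bold>\<forall>B. hupdate A i a B \<^bold>\<longrightarrow> hpairin p B S)))))"

definition hunivsat :: "nat \<Rightarrow> hfm" where
  "hunivsat f = (\<^bold>\<forall>S. rel (hsatrel S f) \<^bold>\<longrightarrow> rel (\<^bold>\<exists>e. hempty e \<^bold>\<and> hpairin f e S))"

text \<open>The sentence of the language of C ``for every theorem \<open>f\<close> of S, the structure of all sets
  universally satisfies \<open>f\<close>''. Universal satisfaction being defined for sentences, a theorem is
  a provable sentence.\<close>

definition theorems_universally_satisfied :: fm where
  "theorems_universally_satisfied =
     (\<^bold>\<forall>f. hset f \<^bold>\<and> rel (hsentence f \<^bold>\<and> hproves hS_axiom f) \<^bold>\<longrightarrow> hunivsat f) 0"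

end

theory Submission
 imports Defs "HOL-Library.Nat_Bijection" "HOL-Library.Countable_Set"
begin

text \<open>If \<open>S\<close> proves everything, then it proves that every set is a member of itself, and for this
  sentence the empty class is a satisfaction relation: membership is irreflexive, so no Tarskian
  clause forces a pair into the class. Hence the sentence of the theorem implies the consistency of \<open>S\<close>
  over \<open>C\<close>, and it remains to run the second incompleteness theorem across the conservativity of \<open>C\<close>
  over \<open>S\<close>.

  In a model of \<open>S\<close> in which \<open>S\<close> is consistent, a Henkin construction yields definable structures for \<open>S\<close>,
  each with a truth predicate for a given definable set of formulas. The definable classes over such a
  structure satisfy any finite part of \<open>C\<close> needed, the sets of this class model again satisfy \<open>S\<close>, and
  the hereditarily finite sets of the ground model embed into them, so that provability persists.
  If \<open>C\<close> proved the sentence, then the consistency of \<open>S\<close> would hold once more in the new model, and a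
  diagonal sentence leads to a contradiction.

  Derivability in \<open>S\<close> is reduced to truth in all models by the same Henkin construction, carried out
  in the model of hereditarily finite sets on the natural numbers.\<close>

text \<open>Without Infinity a model of S need not have a set of all its natural numbers; its
  formulas, proofs and structures are definable classes, and each induction over them must be for a
  definable predicate. The ground model may be nonstandard, and then so may be its proofs in C and
  the instances of comprehension in them. Truth of all that it proves calls for a structure with a
  definable truth predicate for all internal formulas. The definable classes over a structure come
  without one, so only finitely many sentences are checked there; a second Henkin construction
  yields a structure that satisfies these and has full truth, and in it predicative comprehension
  follows by an internal induction from the class operations \<open>L_ops\<close>. The diagonal
  sentence \<open>delta\<close> says in effect that, if S is consistent and C proves the sentence of
  the theorem, then C does not prove \<open>delta\<close>. Truth of what is provable and persistence
  of provability take the place of the derivability conditions: \<open>delta\<close> holds in every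
  model of C, so C proves it, and this proof, present in every model of S, refutes the hypotheses of
  \<open>delta\<close> there.\<close>

abbreviation (input) iff_ascii :: "bool => bool => bool" (infixr "<->" 25) where "A <-> B == A = B"

section \<open>Semantics\<close>

primrec sat :: "'a set => ('a => 'a => bool) => ('a => 'a => bool) => (nat => 'a) => fm => bool" where
 "sat D R Q e (Mem i j) = R (e i) (e j)"
| "sat D R Q e (Eql i j) = Q (e i) (e j)"
| "sat D R Q e (Neg p) = (~ sat D R Q e p)"
| "sat D R Q e (Imp p q) = (sat D R Q e p --> sat D R Q e q)"
| "sat D R Q e (Forall i p) = (ALL a:D. sat D R Q (e(i := a)) p)"

lemma sat_MP: "sat D R Q e (Imp p q) ==> sat D R Q e p ==> sat D R Q e q" by simp
lemma sat_Exists: "sat D R Q e (Exists i p) = (EX a:D. sat D R Q (e(i := a)) p)" by simp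
lemma sat_Iff: "sat D R Q e (Iff p q) = (sat D R Q e p = sat D R Q e q)" by auto
lemma sat_Conj: "sat D R Q e (Conj p q) = (sat D R Q e p & sat D R Q e q)" by auto

lemma sat_cong: "(!!i. i : FV p ==> e i = e' i) ==> sat D R Q e p = sat D R Q e' p"
proof (induction p arbitrary: e e')
 case (Forall i p)
 have "sat D R Q (e(i := a)) p = sat D R Q (e'(i := a)) p" for a
  by (rule Forall.IH) (use Forall.prems in auto)
 thus ?case by simp
next
 case (Imp p q)
 have "sat D R Q e p = sat D R Q e' p" "sat D R Q e q = sat D R Q e' q"
  by (rule Imp.IH; use Imp.prems in auto)+
 thus ?case by simp
next
 case (Neg p)
 have "sat D R Q e p = sat D R Q e' p" by (rule Neg.IH) (use Neg.prems in auto)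
 thus ?case by simp
qed auto

text \<open>Equality is interpreted by a relation on both sides, so \<open>h\<close> may identify
  points: this covers passing to a quotient. Free variables may take values in \<open>W\<close>
  outside the range \<open>D\<close> of the quantifiers.\<close>

lemma sat_iso:
 assumes "D \<subseteq> W" "h ` D = D'" "!!x y. x : W ==> y : W ==> R x y = R' (h x) (h y)"
  "!!x y. x : W ==> y : W ==> Q x y = Q' (h x) (h y)"
  "!!i. i : FV p ==> e i : W & e' i = h (e i)"
 shows "sat D R Q e p = sat D' R' Q' e' p"
 using assms(5)
proof (induction p arbitrary: e e')
 case (Forall i p)
 have "sat D R Q (e(i := a)) p = sat D' R' Q' (e'(i := h a)) p" if "a : D" for a
  by (rule Forall.IH) (use Forall.prems that assms(1) in auto)
 thus ?case using assms(2) by auto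
next
 case (Imp p q)
 have "sat D R Q e p = sat D' R' Q' e' p" "sat D R Q e q = sat D' R' Q' e' q"
  by (rule Imp.IH; use Imp.prems in auto)+
 thus ?case by simp
next
 case (Neg p)
 have "sat D R Q e p = sat D' R' Q' e' p" by (rule Neg.IH) (use Neg.prems in auto)
 thus ?case by simp
qed (use assms in auto)

lemma sat_relV: "sat D R Q e (relV p) = sat {a:D. EX b:D. R a b} R Q e p"
 by (induction p arbitrary: e) auto

lemma finite_FV: "finite (FV p)"
 by (induction p) auto


section \<open>Truth conditions of the notation for concrete formulas\<close>

named_theorems sat_h

lemma sat_hmem [sat_h]: "sat D R Q e ((x \<^bold>\<in> y) n) = R (e x) (e y)" by (simp add: hmem_def)
lemma sat_heq [sat_h]: "sat D R Q e ((x \<^bold>= y) n) = Q (e x) (e y)" by (simp add: heq_def)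
lemma sat_hnot [sat_h]: "sat D R Q e ((\<^bold>\<not> A) n) = (~ sat D R Q e (A n))" by (simp add: hnot_def)
lemma sat_hand [sat_h]: "sat D R Q e ((A \<^bold>\<and> B) n) = (sat D R Q e (A n) & sat D R Q e (B n))" by (simp add: hand_def)
lemma sat_hor [sat_h]: "sat D R Q e ((A \<^bold>\<or> B) n) = (sat D R Q e (A n) | sat D R Q e (B n))" by (auto simp add: hor_def)
lemma sat_himp [sat_h]: "sat D R Q e ((A \<^bold>\<longrightarrow> B) n) = (sat D R Q e (A n) --> sat D R Q e (B n))" by (simp add: himp_def)
lemma sat_hiff [sat_h]: "sat D R Q e ((A \<^bold>\<longleftrightarrow> B) n) = (sat D R Q e (A n) = sat D R Q e (B n))" by (auto simp add: hiff_def)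
lemma sat_hall [sat_h]: "sat D R Q e (hall A n) = (ALL a:D. sat D R Q (e(n := a)) (A n (Suc n)))" by (simp add: hall_def)
lemma sat_hex [sat_h]: "sat D R Q e (hex A n) = (EX a:D. sat D R Q (e(n := a)) (A n (Suc n)))" by (simp add: hex_def)
lemma sat_rel [sat_h]: "sat D R Q e (rel A n) = sat {a:D. EX b:D. R a b} R Q e (A n)" by (simp add: rel_def sat_relV)

lemma upd_less [simp]: "x < (n::nat) ==> (e(n := a)) x = e x" by auto

section \<open>Families of definable predicates\<close>

text \<open>Definability is axiomatized by its closure properties because several notions of it are
  used: formulas (\<open>fo\<close>), formulas of a possibly nonstandard model
  (\<open>idfn\<close>), and arbitrary predicates of finite support (\<open>vdfn\<close>).
  Predicates act on whole environments, which makes renaming of variables available;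
  \<open>dfn_fin\<close> guarantees that only finitely many variables matter.\<close>

locale dfn0 =
 fixes E :: "'a => 'a => bool" and dfn :: "((nat => 'a) => bool) => bool"
 assumes dfn_mem: "dfn (%e. E (e i) (e j))"
  and dfn_eq: "dfn (%e. e i = e j)"
  and dfn_not: "dfn P ==> dfn (%e. ~ P e)"
  and dfn_imp: "dfn P ==> dfn Q ==> dfn (%e. P e --> Q e)"
  and dfn_upd: "dfn P ==> dfn (%e. ALL a. P (e(k := a)))"
  and dfn_fin: "dfn P ==> EX m. ALL e e'. (ALL i<m. e i = e' i) --> P e = P e'"
begin

text \<open>Substitution without a substitution operation: variable \<open>i\<close> is quantified
  under the guard \<open>e i = e j\<close>. As \<open>i\<close> and \<open>j\<close> differ, the
  guard picks out the value \<open>e j\<close>.\<close>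

lemma dfn_repl1:
 assumes "dfn P" "i ~= j" shows "dfn (%e. P (e(i := e j)))"
proof -
 have "dfn (%e. ALL a. (%e. e i = e j --> P e) (e(i := a)))"
  by (intro dfn_upd dfn_imp dfn_eq assms)
 moreover have "(%e. ALL a. (%e. e i = e j --> P e) (e(i := a))) = (%e. P (e(i := e j)))"
  using assms(2) by auto
 ultimately show ?thesis by simp
qed

text \<open>The variables below \<open>m\<close> are first moved to a fresh block, so that the single replacements
 do not interfere.\<close>

lemma dfn_ren:
 assumes "dfn P" shows "dfn (%e. P (%k. e (f k)))"
proof -
 obtain m where m: "!!e e'. (ALL i<m. e i = e' i) ==> P e = P e'" using dfn_fin[OF assms] by blast
 \<comment> \<open>\<open>N\<close> exceeds \<open>m\<close> and all \<open>f i\<close> with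
   \<open>i < m\<close>, so the block starting at \<open>N\<close> meets neither the old names nor
   the new ones.\<close>
 define N where "N = m + Suc (Max (insert 0 (f ` {..<m})))"
 have N: "f i < N" if "i < m" for i
 proof -
  have "f i \<le> Max (insert 0 (f ` {..<m}))" using that by (intro Max_ge) auto
  thus ?thesis unfolding N_def by simp
 qed
 have mN: "m < N" unfolding N_def by simp
 have 1: "n \<le> m ==> dfn (%e. P (%k. if k < n then e (N + k) else e k))" for n
 proof (induction n)
  case 0 thus ?case using assms by simp
 next
  case (Suc n)
  have "dfn (%e. (%e. P (%k. if k < n then e (N + k) else e k)) (e(n := e (N + n))))"
   by (rule dfn_repl1) (use Suc mN in auto)
  moreover have "(%k. if k < n then (e(n := e (N + n))) (N + k) else (e(n := e (N + n))) k) =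
   (%k. if k < Suc n then e (N + k) else e k)" for e :: "nat => 'a"
   using Suc.prems mN by (auto simp: fun_eq_iff less_Suc_eq)
  ultimately show ?case by simp
 qed
 define Q where "Q = (%e. P (%k. if k < m then e (N + k) else e k))"
 have 2: "n \<le> m ==> dfn (%e. Q (%k. if N \<le> k & k < N + n then e (f (k - N)) else e k))" for n
 proof (induction n)
  case 0
  have "(%k. if N \<le> k & k < N + 0 then e (f (k - N)) else e k) = e" for e :: "nat => 'a" by (auto simp: fun_eq_iff)
  thus ?case using 1[of m] by (simp only: Q_def order_refl)
 next
  case (Suc n)
  have "dfn (%e. (%e. Q (%k. if N \<le> k & k < N + n then e (f (k - N)) else e k)) (e(N + n := e (f n))))"
   by (rule dfn_repl1) (use Suc N[of n] in auto)
  moreover have "(%k. if N \<le> k & k < N + n then (e(N + n := e (f n))) (f (k - N)) else (e(N + n := e (f n))) k) =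
   (%k. if N \<le> k & k < N + Suc n then e (f (k - N)) else e k)" for e :: "nat => 'a"
  proof -
   have "f (k - N) ~= N + n" if "k < N + n" "N \<le> k" for k
    using N[of "k - N"] that Suc.prems by (cases "k - N < m") auto
   thus ?thesis by (auto simp: fun_eq_iff less_Suc_eq)
  qed
  ultimately show ?case by simp
 qed
 have "(%e. Q (%k. if N \<le> k & k < N + m then e (f (k - N)) else e k)) = (%e. P (%k. e (f k)))"
  unfolding Q_def by (intro ext m) auto
 thus ?thesis using 2[of m] by simp
qed

lemma dfn_and: "dfn P ==> dfn Q ==> dfn (%e. P e & Q e)"
 using dfn_not[OF dfn_imp[OF _ dfn_not]] by simp

lemma dfn_or: "dfn P ==> dfn Q ==> dfn (%e. P e | Q e)"
 using dfn_imp[OF dfn_not, of P Q] by (simp add: disj_imp)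

lemma dfn_iff: "dfn P ==> dfn Q ==> dfn (%e. P e = Q e)"
 using dfn_and[OF dfn_imp[of P Q] dfn_imp[of Q P]] by (simp add: iff_conv_conj_imp)

text \<open>The premise is in de Bruijn style: the bound variable sits at position 0 and the
  environment is shifted, so that nested binders are opened without naming variables. Reading
  position \<open>k - 1\<close> afterwards undoes the shift.\<close>

lemma dfn_all:
 assumes "dfn (%e. Q (%k. e (Suc k)) (e 0))" shows "dfn (%e. ALL z. Q e z)"
proof -
 have "dfn (%e. (%e. ALL z. (%e. Q (%k. e (Suc k)) (e 0)) (e(0 := z))) (%k. e (k - 1)))"
  by (rule dfn_ren, rule dfn_upd, rule assms)
 thus ?thesis by simp
qed

lemma dfn_ex:
 assumes "dfn (%e. Q (%k. e (Suc k)) (e 0))" shows "dfn (%e. EX z. Q e z)"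
 using dfn_not[OF dfn_all[of "%e z. ~ Q e z", OF dfn_not[OF assms]]] by simp

lemma dfn_const: "dfn (%e. c)"
proof -
 have "dfn (%e. e 0 = e 0)" by (rule dfn_eq)
 thus ?thesis using dfn_not by (cases c) force+
qed

lemma dfn_sat: "dfn (%e. sat UNIV E (=) e p)"
proof (induction p)
 case (Forall i p)
 thus ?case using dfn_upd[of "%e. sat UNIV E (=) e p" i] by simp
qed (auto intro: dfn_mem dfn_eq dfn_not dfn_imp)

end

text \<open>Definability with parameters. Genuine variables occupy the even positions and parameters
  the odd ones, so that parameters can be added without moving variables.\<close>

definition pdfn :: "(((nat => 'a) => bool) => bool) => ((nat => 'a) => bool) => bool" where
 "pdfn d P <-> (EX P0 c. d P0 & (ALL e. P e = P0 (%i. if even i then e (i div 2) else c i)))"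

lemma (in dfn0) pdfn_imp:
 assumes "pdfn dfn P" "pdfn dfn Q" shows "pdfn dfn (%e. P e --> Q e)"
proof -
 obtain P0 c where P: "dfn P0" "!!e. P e = P0 (%i. if even i then e (i div 2) else c i)"
  using assms(1) unfolding pdfn_def by blast
 obtain Q0 d where Q: "dfn Q0" "!!e. Q e = Q0 (%i. if even i then e (i div 2) else d i)"
  using assms(2) unfolding pdfn_def by blast
 \<comment> \<open>The parameters of \<open>P\<close> move from \<open>2k + 1\<close> to
   \<open>4k + 1\<close> and those of \<open>Q\<close> to \<open>4k + 3\<close>, so that both fit
   into one sequence.\<close>
 let ?f = "%i. if even i then i else 2 * i - 1" let ?g = "%i. if even i then i else 2 * i + 1"
 let ?c = "%i. if i mod 4 = 1 then c ((i + 1) div 2) else d ((i - 1) div 2)"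
 have "dfn (%e. P0 (%i. e (?f i)) --> Q0 (%i. e (?g i)))"
  by (rule dfn_imp[OF dfn_ren[OF P(1)] dfn_ren[OF Q(1)]])
 moreover have "(%i. (%i. if even i then e (i div 2) else ?c i) (?f i)) =
   (%i. if even i then e (i div 2) else c i)" for e
 proof
  fix i :: nat
  show "(%i. if even i then e (i div 2) else ?c i) (?f i) = (if even i then e (i div 2) else c i)"
  proof (cases "even i")
   case False
   then obtain k where "i = 2 * k + 1" by (rule oddE)
   moreover have "(4 * k + 1) mod 4 = 1" by presburger
   ultimately show ?thesis by simp
  qed simp
 qed
 moreover have "(%i. (%i. if even i then e (i div 2) else ?c i) (?g i)) =
   (%i. if even i then e (i div 2) else d i)" for e
 proof
  fix i :: nat
  show "(%i. if even i then e (i div 2) else ?c i) (?g i) = (if even i then e (i div 2) else d i)"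
  proof (cases "even i")
   case False
   then obtain k where "i = 2 * k + 1" by (rule oddE)
   moreover have "(2 * (2 * k + 1) + 1) mod 4 ~= (1::nat)" by presburger
   ultimately show ?thesis by simp
  qed simp
 qed
 ultimately show ?thesis unfolding pdfn_def P Q
  by (intro exI[of _ "%e. P0 (%i. e (?f i)) --> Q0 (%i. e (?g i))"] exI[of _ ?c]) (simp only: simp_thms)
qed

lemma (in dfn0) dfn0_pdfn: "dfn0 E (pdfn dfn)"
proof
 show "pdfn dfn (%e. E (e i) (e j))" for i j unfolding pdfn_def
  by (rule exI[of _ "%e. E (e (2*i)) (e (2*j))"]) (simp add: dfn_mem)
 show "pdfn dfn (%e. e i = e j)" for i j unfolding pdfn_def
  by (rule exI[of _ "%e. (e (2*i)) = (e (2*j))"]) (simp add: dfn_eq)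
 show "pdfn dfn (%e. ~ P e)" if "pdfn dfn P" for P
 proof -
  obtain P0 c where P: "dfn P0" "!!e. P e = P0 (%i. if even i then e (i div 2) else c i)"
   using \<open>pdfn dfn P\<close> unfolding pdfn_def by blast
  show ?thesis unfolding pdfn_def P by (intro exI[of _ "%e. ~ P0 e"] exI[of _ c]) (simp add: dfn_not P)
 qed
 show "pdfn dfn (%e. P e --> Q e)" if "pdfn dfn P" "pdfn dfn Q" for P Q
  by (rule pdfn_imp[OF that])
 show "pdfn dfn (%e. ALL a. P (e(k := a)))" if "pdfn dfn P" for P k
 proof -
  obtain P0 c where P: "dfn P0" "!!e. P e = P0 (%i. if even i then e (i div 2) else c i)"
   using \<open>pdfn dfn P\<close> unfolding pdfn_def by blast
  have "(%i. if even i then (e(k := a)) (i div 2) else c i) = (%i. if even i then e (i div 2) else c i)(2 * k := a)" for e a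
   by (auto simp: fun_eq_iff)
  thus ?thesis unfolding pdfn_def P using dfn_upd[OF P(1), of "2 * k"]
   by (intro exI[of _ "%e. ALL a. P0 (e(2 * k := a))"] exI[of _ c]) simp
 qed
 show "EX m. ALL e e'. (ALL i<m. e i = e' i) --> P e = P e'" if "pdfn dfn P" for P
 proof -
  obtain P0 c where P: "dfn P0" "!!e. P e = P0 (%i. if even i then e (i div 2) else c i)"
   using \<open>pdfn dfn P\<close> unfolding pdfn_def by blast
  obtain m where m: "!!e e'. (ALL i<m. e i = e' i) ==> P0 e = P0 e'" using dfn_fin[OF P(1)] by blast
  have "P e = P e'" if "ALL i<m. e i = e' i" for e e'
   unfolding P by (rule m) (use that in auto)
  thus ?thesis by blast
 qed
qed

lemma (in dfn0) pdfn_param: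
 assumes "pdfn dfn P" shows "pdfn dfn (%e. P (e(k := x)))"
proof -
 obtain P0 c where P: "dfn P0" "!!e. P e = P0 (%i. if even i then e (i div 2) else c i)"
  using assms unfolding pdfn_def by blast
 \<comment> \<open>The new parameter takes position 1; the old ones move up by two and stay at odd
   positions.\<close>
 let ?f = "%i. if i = 2 * k then 1 else if odd i then i + 2 else i"
 have "dfn (%e. P0 (%i. e (?f i)))" by (rule dfn_ren[OF P(1)])
 moreover have "(%i. if even i then (e(k := x)) (i div 2) else c i) =
   (%i. (%i. if even i then e (i div 2) else if i = 1 then x else c (i - 2)) (?f i))" for e
  by (auto simp: fun_eq_iff)
 ultimately show ?thesis unfolding pdfn_def P
  by (intro exI[of _ "%e. P0 (%i. e (?f i))"] exI[of _ "%i. if i = 1 then x else c (i - 2)"]) (simp only: simp_thms)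
qed

lemma (in dfn0) pdfn_I: "dfn P ==> pdfn dfn P"
 unfolding pdfn_def by (intro exI[of _ "%e. P (%i. e (2 * i))"]) (simp add: dfn_ren[of P "%i. 2 * i"])

definition fo :: "('a => 'a => bool) => ((nat => 'a) => bool) => bool" where
 "fo E P <-> (EX p. ALL e. P e = sat UNIV E (=) e p)"

lemma dfn0_fo: "dfn0 E (fo E)"
proof
 show "fo E (%e. E (e i) (e j))" for i j unfolding fo_def by (rule exI[of _ "Mem i j"]) simp
 show "fo E (%e. e i = e j)" for i j unfolding fo_def by (rule exI[of _ "Eql i j"]) simp
 show "fo E (%e. ~ P e)" if "fo E P" for P using that unfolding fo_def
  by (metis sat.simps(3))
 show "fo E (%e. P e --> Q e)" if "fo E P" "fo E Q" for P Q using that unfolding fo_def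
  by (metis sat.simps(4))
 show "fo E (%e. ALL a. P (e(k := a)))" if "fo E P" for P k
 proof -
  obtain p where "ALL e. P e = sat UNIV E (=) e p" using \<open>fo E P\<close> unfolding fo_def by blast
  thus ?thesis unfolding fo_def by (intro exI[of _ "Forall k p"]) simp
 qed
 show "EX m. ALL e e'. (ALL i<m. e i = e' i) --> P e = P e'" if "fo E P" for P
 proof -
  obtain p where p: "ALL e. P e = sat UNIV E (=) e p" using \<open>fo E P\<close> unfolding fo_def by blast
  have "i < Suc (Max (insert 0 (FV p)))" if "i : FV p" for i
   using Max_ge[of "insert 0 (FV p)" i] that finite_FV[of p] by (simp add: less_Suc_eq_le)
  thus ?thesis unfolding p[rule_format]
   by (intro exI[of _ "Suc (Max (insert 0 (FV p)))"] allI impI sat_cong) simp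
 qed
qed

section \<open>Models of S\<close>

text \<open>Separation and Replacement range over \<open>dfn\<close>; since \<open>dfn_param\<close>
  lets any variable be fixed, \<open>G\<close> and \<open>F\<close> carry their parameters tacitly.
  The internal mathematics is done once in this locale and reused for every model that
  arises.\<close>

locale smodel = dfn0 E dfn for E :: "'a => 'a => bool" (infix "<:" 50) and dfn +
 assumes dfn_param: "dfn P ==> dfn (%e. P (e(k := c)))"
  and ext: "(!!z. z <: x <-> z <: y) ==> x = y"
  and found: "y <: x ==> EX y. y <: x & ~ (EX z. z <: x & z <: y)"
  and pairing: "EX z. ALL w. w <: z <-> w = x | w = y"
  and union: "EX u. ALL w. w <: u <-> (EX y. y <: x & w <: y)"
  and power: "EX p. ALL w. w <: p <-> (ALL z. z <: w --> z <: x)"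
  and sep: "dfn (%e. G (e 0)) ==> EX y. ALL z. z <: y <-> z <: x & G z"
  and repl: "dfn (%e. F (e 0) (e 1)) ==> (!!z. z <: x ==> EX u. ALL w. F z w --> w = u) ==>
   EX y. ALL w. w <: y <-> (EX z. z <: x & F z w)"

lemma fresh_nat: "\<exists>i\<ge>m. i \<notin> FV p"
proof -
 have "infinite {m..}" by (rule infinite_Ici)
 hence "~ {m..} \<subseteq> FV p" using finite_FV finite_subset by blast
 thus ?thesis by auto
qed

lemma smodel_fo:
 assumes S: "!!p e. p : S_axioms ==> sat UNIV E (=) e p"
 shows "smodel E (pdfn (fo E))"
proof -
 interpret f: dfn0 E "fo E" by (rule dfn0_fo)
 interpret d: dfn0 E "pdfn (fo E)" by (rule f.dfn0_pdfn)
 have s: "sat UNIV E (=) e p" if "p : set S_single" for p e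
  using S S_axioms.single[OF that] by blast
 show ?thesis
 proof
  show "pdfn (fo E) P ==> pdfn (fo E) (%e. P (e(k := c)))" for P k c by (rule f.pdfn_param)
  show "x = y" if "!!z. E z x <-> E z y" for x y
   using s[of "ax_ext 0"] that by (simp add: S_single_def ax_ext_def sat_h)
  show "EX y. E y x & ~ (EX z. E z x & E z y)" if "E y x" for x y
   using s[of "ax_found 0"] that by (auto simp add: S_single_def ax_found_def sat_h)
  show "EX z. ALL w. E w z <-> w = x | w = y" for x y
   using s[of "ax_pair 0"] by (simp add: S_single_def ax_pair_def sat_h)
  show "EX u. ALL w. E w u <-> (EX y. E y x & E w y)" for x
   using s[of "ax_union 0"] by (simp add: S_single_def ax_union_def sat_h)
  show "EX p. ALL w. E w p <-> (ALL z. E z w --> E z x)" for x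
   using s[of "ax_power 0"] by (simp add: S_single_def ax_power_def sat_h)
  show "EX y. ALL z. E z y <-> E z x & P z" if P: "pdfn (fo E) (%e. P (e 0))" for P x
  proof -
   obtain p c where pc: "!!e. P (e 0) = sat UNIV E (=) (%i. if even i then e (i div 2) else c i) p"
    using P unfolding pdfn_def fo_def by metis
   obtain X Y where XY: "X \<ge> 1" "X \<notin> FV p" "Y \<ge> Suc X" "Y \<notin> FV p" using fresh_nat by metis
   have "Exists Y (Forall 0 (Iff (Mem 0 Y) (Conj (Mem 0 X) p))) : S_axioms"
    by (rule S_axioms.separation) (use XY in auto)
   from S[OF this, of "(%i. if even i then undefined else c i)(X := x)"]
   obtain y where y: "!!z. E z y <-> E z x & sat UNIV E (=) ((%i. if even i then undefined else c i)(X := x, Y := y, 0 := z)) p"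
    using XY by auto
   have "sat UNIV E (=) ((%i. if even i then undefined else c i)(X := x, Y := y, 0 := z)) p = P z" for z
    unfolding pc[of "(%i. undefined)(0 := z)", unfolded fun_upd_same]
    by (rule sat_cong) (use XY in \<open>auto elim!: evenE\<close>)
   thus ?thesis using y by auto
  qed
  show "EX y. ALL w. E w y <-> (EX z. E z x & F z w)"
   if F: "pdfn (fo E) (%e. F (e 0) (e 1))" and fn: "!!z. E z x ==> EX u. ALL w. F z w --> w = u" for F x
  proof -
   obtain p c where pc: "!!e. F (e 0) (e 1) = sat UNIV E (=) (%i. if even i then e (i div 2) else c i) p"
    using F unfolding pdfn_def fo_def by metis
   obtain X Y U where XY: "X \<ge> 3" "X \<notin> FV p" "Y \<ge> Suc X" "Y \<notin> FV p" "U \<ge> Suc Y" "U \<notin> FV p" using fresh_nat by metis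
   let ?e = "(%i. if even i then undefined else c i)(X := x)"
   \<comment> \<open>The schema is taken with the variables 0 and 2, the positions of
     \<open>e 0\<close> and \<open>e 1\<close> in the interleaved environment; \<open>X\<close>,
     \<open>Y\<close> and \<open>U\<close> avoid the parameters that \<open>p\<close>
     mentions.\<close>
   have ins: "Imp (Forall 0 (Imp (Mem 0 X) (Exists U (Forall 2 (Imp p (Eql 2 U))))))
    (Exists Y (Forall 2 (Iff (Mem 2 Y) (Exists 0 (Conj (Mem 0 X) p))))) : S_axioms"
    by (rule S_axioms.replacement) (use XY in auto)
   have F': "sat UNIV E (=) e' p = F z w"
    if "!!i. i : FV p ==> e' i = (?e(0 := z, 2 := w)) i" for z w e'
    unfolding pc[of "(%i. undefined)(1 := w, 0 := z)", unfolded fun_upd_same fun_upd_other[OF one_neq_zero]]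
    by (rule sat_cong) (use XY that in \<open>auto elim!: evenE\<close>)
   have F1: "sat UNIV E (=) (?e(0 := z, U := u, 2 := w)) p = F z w" for z u w
    by (rule F') (use XY in auto)
   have F2: "sat UNIV E (=) (?e(Y := y, 2 := w, 0 := z)) p = F z w" for y w z
    by (rule F') (use XY in auto)
   have ne: "X ~= 0" "X ~= 2" "Y ~= 0" "Y ~= 2" "U ~= 0" "U ~= 2" "X ~= Y" "X ~= U" "Y ~= U"
    using XY by auto
   have "sat UNIV E (=) ?e (Forall 0 (Imp (Mem 0 X) (Exists U (Forall 2 (Imp p (Eql 2 U))))))"
    using fn ne by (simp add: F1)
   hence "sat UNIV E (=) ?e (Exists Y (Forall 2 (Iff (Mem 2 Y) (Exists 0 (Conj (Mem 0 X) p)))))"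
    by (rule sat_MP[OF S[OF ins, of ?e]])
   then obtain y where y: "!!w. sat UNIV E (=) (?e(Y := y, 2 := w)) (Iff (Mem 2 Y) (Exists 0 (Conj (Mem 0 X) p)))"
    unfolding sat_Exists by (auto simp only: sat.simps(5) UNIV_I ball_UNIV)
   have "E w y <-> (EX z. E z x & F z w)" for w
    using y[of w] ne by (auto simp add: F2)
   thus ?thesis by blast
  qed
 qed
qed

text \<open>Every internal induction has a definability premise; these rules let
  \<open>intro\<close> settle it from the shape of the predicate.\<close>

named_theorems dfnI

context smodel
begin

definition dt :: "((nat => 'a) => 'a) => bool" where
 "dt t <-> dfn (%e. e 0 = t (%k. e (Suc k)))"

lemma dt_var [dfnI]: "dt (%e. e i)"
 unfolding dt_def by (rule dfn_eq)

lemma dt_con [dfnI]: "dt (%e. c)"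
proof -
 have "dfn (%e. (%e. e 0 = e 1) (e(1 := c)))" by (rule dfn_param) (rule dfn_eq)
 thus ?thesis unfolding dt_def by simp
qed

lemma dt_shift:
 assumes "dt x" shows "dt (%e. x (%k. e (Suc k)))"
 using dfn_ren[OF assms[unfolded dt_def], of "%k. if k = 0 then 0 else Suc k"] unfolding dt_def by simp

lemma dfn_app:
 assumes "dfn (%e. Q (%k. e (Suc k)) (e 0))" "dt x" shows "dfn (%e. Q e (x e))"
proof -
 have "dfn (%e. EX a. a = x e & Q e a)"
  by (intro dfn_ex dfn_and assms) (use assms(2) in \<open>simp add: dt_def\<close>)
 thus ?thesis by simp
qed

lemma dfn_app1:
 assumes "dfn (%e. R (e 0))" "dt x" shows "dfn (%e. R (x e))"
 by (rule dfn_app[of "%_. R"]) (rule assms)+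

lemma dfn_app2:
 assumes "dfn (%e. R (e 0) (e 1))" "dt x" "dt y" shows "dfn (%e. R (x e) (y e))"
proof (rule dfn_app[of "%e a. R (x e) a", OF dfn_app[of "%e a. R a (e 0)" "%e. x (%k. e (Suc k))"]])
 show "dfn (%e. R (e 0) (e (Suc 0)))" using assms(1) by simp
qed (rule assms(3) dt_shift[OF assms(2)])+

lemma dfn_app3:
 assumes "dfn (%e. R (e 0) (e 1) (e 2))" "dt x" "dt y" "dt z" shows "dfn (%e. R (x e) (y e) (z e))"
proof (rule dfn_app[of "%e a. R (x e) (y e) a", OF dfn_app[of "%e a. R (x (%k. e (Suc k))) a (e 0)" "%e. y (%k. e (Suc k))",
   OF dfn_app[of "%e a. R a (e 0) (e (Suc 0))" "%e. x (%k. e (Suc (Suc k)))"]]])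
 show "dfn (%e. R (e 0) (e (Suc 0)) (e (Suc (Suc 0))))" using assms(1) by (simp add: numeral_2_eq_2)
qed (rule assms(4) dt_shift[OF assms(3)] dt_shift[OF dt_shift[OF assms(2)]])+

lemma dt_app1: "dfn (%e. e 0 = f (e 1)) ==> dt x ==> dt (%e. f (x e))"
 unfolding dt_def[of "%e. f (x e)"] by (rule dfn_app2[of "%z x. z = f x"]) (assumption | rule dt_var | erule dt_shift)+

lemma dt_app2: "dfn (%e. e 0 = f (e 1) (e 2)) ==> dt x ==> dt y ==> dt (%e. f (x e) (y e))"
 unfolding dt_def[of "%e. f (x e) (y e)"] by (rule dfn_app3[of "%z x y. z = f x y"]) (assumption | rule dt_var | erule dt_shift)+

lemma dfn_memt [dfnI]: "dt x ==> dt y ==> dfn (%e. x e <: y e)"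
 by (rule dfn_app2[of "(<:)"]) (rule dfn_mem)

lemma dfn_eqt [dfnI]: "dt x ==> dt y ==> dfn (%e. x e = y e)"
 by (rule dfn_app2[of "(=)"]) (rule dfn_eq)

lemmas [dfnI] = dfn_not dfn_imp dfn_and dfn_or dfn_all dfn_ex dfn_const

lemma dfn_iff' [dfnI]: "dfn P ==> dfn Q ==> dfn (%e. P e <-> Q e)" by (rule dfn_iff)

subsection \<open>Basic set theory\<close>

lemma irrefl: "~ x <: x"
proof -
 obtain z where "ALL w. w <: z <-> w = x | w = x" using pairing[of x x] ..
 thus ?thesis using found[of x z] by simp
qed

lemma asym: "x <: y ==> ~ y <: x"
proof -
 obtain z where "ALL w. w <: z <-> w = x | w = y" using pairing[of x y] ..
 thus "x <: y ==> ~ y <: x" using found[of x z] by auto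
qed

definition emp :: 'a where "emp = (THE x. ALL w. ~ w <: x)"
text \<open>Adjunction of one element. Together with \<open>emp\<close> it generates the
  hereditarily finite sets, so finite objects can be built and inducted upon without
  cardinalities.\<close>

definition adj :: "'a => 'a => 'a" where "adj x y = (THE z. ALL w. w <: z <-> w <: x | w = y)"
definition opair :: "'a => 'a => 'a" where
 "opair x y = adj (adj emp (adj emp x)) (adj (adj emp x) y)"
definition suc :: "'a => 'a" where "suc x = adj x x"

lemma the_set:
 assumes "EX z. ALL w. w <: z <-> P w" shows "w <: (THE z. ALL w. w <: z <-> P w) <-> P w"
proof -
 have "EX! z. ALL w. w <: z <-> P w" using assms ext by metis
 from theI'[OF this] show ?thesis by blast
qed

lemma mem_emp [simp]: "~ w <: emp"
proof -
 have "EX z. ALL w. w <: z <-> False" using sep[of "%_. False"] dfn_const by blast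
 from the_set[OF this] show ?thesis unfolding emp_def by simp
qed

lemma mem_adj [simp]: "w <: adj x y <-> w <: x | w = y"
proof -
 obtain s where s: "ALL w. w <: s <-> w = y | w = y" using pairing by blast
 obtain p where p: "ALL w. w <: p <-> w = x | w = s" using pairing by blast
 obtain u where "ALL w. w <: u <-> (EX y. y <: p & w <: y)" using union by blast
 hence "EX z. ALL w. w <: z <-> w <: x | w = y" using s p by metis
 from the_set[OF this] show ?thesis unfolding adj_def .
qed

lemma emp_iff: "x = emp <-> (ALL w. ~ w <: x)" using ext[of x emp] by auto
lemma adj_iff: "z = adj x y <-> (ALL w. w <: z <-> w <: x | w = y)" using ext[of z "adj x y"] by auto
lemma adj_neq_emp [simp]: "adj x y ~= emp" "emp ~= adj x y" by (metis mem_adj mem_emp)+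

lemma opair_inj [simp]: "opair x y = opair x' y' <-> x = x' & y = y'"
proof
 assume *: "opair x y = opair x' y'"
 have s: "adj emp a = adj emp b <-> a = b" for a b by (metis mem_adj mem_emp)
 have m: "w <: opair a b <-> w = adj emp a | w = adj (adj emp a) b" for w a b unfolding opair_def by simp
 have p: "adj (adj emp a) b = adj emp c ==> a = c & b = c" for a b c by (metis mem_adj mem_emp)
 have "adj emp x <: opair x' y'" using m[of "adj emp x" x y] * by simp
 hence x: "x = x'" unfolding m using s p by metis
 have "adj (adj emp x) y <: opair x y" "adj (adj emp x') y' <: opair x' y'" using m by blast+
 hence "adj (adj emp x) y <: opair x' y'" "adj (adj emp x') y' <: opair x y" using * by simp_all
 thus "x = x' & y = y'" unfolding m x by (metis mem_adj mem_emp)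
qed simp

lemma opair_neq_emp [simp]: "opair x y ~= emp" "emp ~= opair x y" unfolding opair_def by simp_all

lemma dt_adj [dfnI]: "dt x ==> dt y ==> dt (%e. adj (x e) (y e))"
 by (rule dt_app2) (unfold adj_iff, intro dfnI)
lemma dt_opair [dfnI]: "dt x ==> dt y ==> dt (%e. opair (x e) (y e))"
 unfolding opair_def by (intro dfnI)
lemma dt_suc [dfnI]: "dt x ==> dt (%e. suc (x e))"
 unfolding suc_def by (intro dfnI)

definition sepset :: "'a => ('a => bool) => 'a" where
 "sepset x P = (THE z. ALL w. w <: z <-> w <: x & P w)"

lemma mem_sepset: "dfn (%e. P (e 0)) ==> w <: sepset x P <-> w <: x & P w"
 unfolding sepset_def by (rule the_set) (rule sep)

subsection \<open>Natural numbers\<close>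

definition Trans :: "'a => bool" where "Trans x <-> (ALL y. y <: x --> (ALL z. z <: y --> z <: x))"
text \<open>A transitive set of transitive sets is an ordinal by Foundation; that it and its members
  are zero or successors makes it finite. This avoids any quantification over subsets and matches
  \<open>hnat\<close>.\<close>

definition Nat :: "'a => bool" where
 "Nat n <-> (Trans n & (ALL y. y <: n --> Trans y)) & (ALL m. m <: n | m = n --> m = emp | (EX k. m = suc k))"

lemma dfn_Trans [dfnI]: "dt x ==> dfn (%e. Trans (x e))"
 unfolding Trans_def by (rule dfn_app1) (intro dfnI)
lemma dfn_Nat [dfnI]: "dt x ==> dfn (%e. Nat (x e))"
 by (rule dfn_app1) (unfold Nat_def, intro dfnI)

lemma mem_suc [simp]: "w <: suc x <-> w <: x | w = x" by (simp add: suc_def)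
lemma suc_neq_emp [simp]: "suc x ~= emp" "emp ~= suc x" by (simp_all add: suc_def)
lemma suc_inj [simp]: "suc x = suc y <-> x = y" by (metis mem_suc asym)

lemma Nat_emp [simp]: "Nat emp" by (simp add: Nat_def Trans_def)
lemma Nat_suc [simp]: "Nat n ==> Nat (suc n)" unfolding Nat_def Trans_def mem_suc by blast
lemma Nat_mem: "Nat n ==> m <: n ==> Nat m" unfolding Nat_def Trans_def by blast
lemma Nat_trans: "Nat n ==> m <: n ==> k <: m ==> k <: n" unfolding Nat_def Trans_def by blast
lemma Nat_cases: "Nat n ==> n = emp | (EX k. Nat k & n = suc k)"
 using Nat_mem[of n] unfolding Nat_def by (metis mem_suc)
lemma Nat_sucD: "Nat (suc n) ==> Nat n" by (rule Nat_mem[of "suc n"]) simp_all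

text \<open>The failures of \<open>P\<close> in \<open>n\<close> form a set by Separation, and
  Foundation gives one of them with no failure among its members. As \<open>n\<close> is transitive,
  \<open>step\<close> applies to it.\<close>

lemma trans_induct:
 assumes P: "dfn (%e. P (e 0))" and "Trans n" and step: "!!k. k <: n ==> (!!l. l <: k ==> P l) ==> P k" and "k <: n"
 shows "P k"
proof (rule ccontr)
 assume "~ P k"
 let ?X = "sepset n (%k. ~ P k)"
 have X: "w <: ?X <-> w <: n & ~ P w" for w by (rule mem_sepset) (intro dfnI P)
 have "k <: ?X" using X assms(4) \<open>~ P k\<close> by blast
 from found[OF this] show False using X step assms(2) unfolding Trans_def by blast
qed

lemma Nat_strong:
 assumes P: "dfn (%e. P (e 0))" and step: "!!k. Nat k ==> (!!l. l <: k ==> P l) ==> P k" and "Nat n"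
 shows "P n"
proof (rule trans_induct[OF P, of "suc n"])
 show "Trans (suc n)" using Nat_suc[OF assms(3)] by (simp add: Nat_def)
 show "P k" if "k <: suc n" "!!l. l <: k ==> P l" for k
  using step that Nat_mem[OF Nat_suc[OF assms(3)]] by blast
qed simp

lemma Nat_induct:
 assumes P: "dfn (%e. P (e 0))" and "P emp" and step: "!!k. Nat k ==> P k ==> P (suc k)" and "Nat n"
 shows "P n"
proof (rule Nat_strong[OF P _ assms(4)])
 fix k assume k: "Nat k" "!!l. l <: k ==> P l"
 consider "k = emp" | l where "Nat l" "k = suc l" using Nat_cases[OF k(1)] by blast
 thus "P k"
 proof cases
  case 1 thus ?thesis using assms(2) by simp
 next
  case 2 thus ?thesis using step[of l] k(2)[of l] by simp
 qed
qed

lemma suc_le: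
 assumes "Nat m" shows "k <: m ==> suc k = m | suc k <: m"
proof -
 have "k <: m --> suc k = m | suc k <: m"
  by (rule Nat_induct[OF _ _ _ assms]) (intro dfnI, auto)
 thus "k <: m ==> suc k = m | suc k <: m" by blast
qed

lemma Nat_linear: assumes "Nat m" "Nat n" shows "m <: n | m = n | n <: m"
proof -
 have z: "m = emp | emp <: m" by (rule Nat_induct[OF _ _ _ assms(1)]) (intro dfnI, auto)
 show ?thesis
  by (rule Nat_induct[OF _ _ _ assms(2)]) (intro dfnI, use z suc_le[OF assms(1)] in auto)
qed

lemma Nat_least:
 assumes P: "dfn (%e. P (e 0))" and "Nat n" "P n"
 shows "EX k. Nat k & P k & (ALL l. l <: k --> ~ P l)"
proof (rule ccontr)
 assume *: "~ ?thesis"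
 have "~ P n" by (rule Nat_strong[OF _ _ assms(2)]) (intro dfnI P, use * in blast)
 thus False using assms(3) by blast
qed

lemma Nat_max: assumes "Nat m" "Nat n" shows "EX k. Nat k & (ALL l. l <: m | l <: n --> l <: k)"
 using Nat_linear[OF assms] Nat_trans assms by metis

primrec nn :: "nat => 'a" where
 "nn 0 = emp" | "nn (Suc k) = suc (nn k)"

lemma Nat_nn [simp]: "Nat (nn k)" by (induction k) auto
lemma mem_nn: "w <: nn k <-> (EX l<k. w = nn l)" by (induction k) (auto simp: less_Suc_eq)
lemma nn_inj [simp]: "nn k = nn l <-> k = l"
proof (induction k arbitrary: l)
 case 0 thus ?case by (cases l) auto
next
 case (Suc k) thus ?case by (cases l) auto
qed

subsection \<open>Assignments\<close>

text \<open>Every set serves as an assignment, a default value being returned where it is not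
 single-valued.\<close>

definition lk :: "'a => 'a => 'a => 'a" where
 "lk A i d = (if EX! a. opair i a <: A then THE a. opair i a <: A else d)"
definition upd :: "'a => 'a => 'a => 'a" where
 "upd A i a = adj (sepset A (%p. ~ (EX b. p = opair i b))) (opair i a)"

lemma mem_upd: "p <: upd A i a <-> p = opair i a | (p <: A & ~ (EX b. p = opair i b))"
 unfolding upd_def mem_adj by (subst mem_sepset) (intro dfnI, auto)

lemma upd_iff: "B = upd A i a <-> (ALL p. p <: B <-> p = opair i a | (p <: A & ~ (EX b. p = opair i b)))"
 using ext[of B "upd A i a"] mem_upd[of _ A i a] by auto

lemma lk_iff: "z = lk A i d <-> (opair i z <: A & (ALL a. opair i a <: A --> a = z)) | (~ (EX a. opair i a <: A & (ALL b. opair i b <: A --> b = a)) & z = d)"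
proof (cases "EX! a. opair i a <: A")
 case True
 hence "lk A i d = (THE a. opair i a <: A)" by (simp add: lk_def)
 thus ?thesis using theI'[OF True] True by metis
qed (auto simp: lk_def)

lemma lk_upd: "lk (upd A i a) j d = (if j = i then a else lk A j d)"
proof (cases "j = i")
 case True thus ?thesis using lk_iff[of a "upd A i a" i d] by (auto simp: mem_upd)
next
 case False
 hence "opair j b <: upd A i a <-> opair j b <: A" for b by (auto simp: mem_upd)
 thus ?thesis using False by (simp add: lk_def)
qed

lemma lk_emp [simp]: "lk emp i d = d" using lk_iff[of "lk emp i d" emp i d] by simp

lemma lk_cases: "lk A i d = d | opair i (lk A i d) <: A" using lk_iff[of "lk A i d" A i d] by auto

lemma dt_app3: "dfn (%e. e 0 = f (e 1) (e 2) (e 3)) ==> dt x ==> dt y ==> dt z ==> dt (%e. f (x e) (y e) (z e))"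
proof -
 assume *: "dfn (%e. e 0 = f (e 1) (e 2) (e 3))" "dt x" "dt y" "dt z"
 have "dfn (%e. EX a. a = x (%k. e (Suc k)) & e 0 = f a (y (%k. e (Suc k))) (z (%k. e (Suc k))))"
 proof (intro dfn_ex dfn_and)
  show "dfn (%e. e 0 = x (%k. e (Suc (Suc k))))" using dt_shift[OF *(2)] unfolding dt_def by simp
  have y: "dt (%e. y (%k. e (Suc (Suc k))))" using dt_shift[OF dt_shift[OF *(3)]] by simp
  have z: "dt (%e. z (%k. e (Suc (Suc k))))" using dt_shift[OF dt_shift[OF *(4)]] by simp
  have "dfn (%e. EX b. b = z (%k. e (Suc (Suc k))) & e (Suc 0) = f (e 0) (y (%k. e (Suc (Suc k)))) b)"
  proof (intro dfn_ex dfn_and)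
   show "dfn (%e. e 0 = z (%k. e (Suc (Suc (Suc k)))))" using z unfolding dt_def by simp
   have "dfn (%e. EX c. c = y (%k. e (Suc (Suc (Suc k)))) & e (Suc (Suc 0)) = f (e (Suc 0)) c (e 0))"
   proof (intro dfn_ex dfn_and)
    show "dfn (%e. e 0 = y (%k. e (Suc (Suc (Suc (Suc k))))))" using dt_shift[OF y] unfolding dt_def by simp
    show "dfn (%e. e (Suc (Suc (Suc 0))) = f (e (Suc (Suc 0))) (e 0) (e (Suc 0)))"
     using dfn_ren[OF *(1), of "%k. if k = 0 then 3 else if k = 1 then 2 else if k = 2 then 0 else 1"]
     by (simp add: numeral_2_eq_2 numeral_3_eq_3)
   qed
   thus "dfn (%e. e (Suc (Suc 0)) = f (e (Suc 0)) (y (%k. e (Suc (Suc (Suc k))))) (e 0))" by simp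
  qed
  thus "dfn (%e. e (Suc 0) = f (e 0) (y (%k. e (Suc (Suc k)))) (z (%k. e (Suc (Suc k)))))" by simp
 qed
 thus ?thesis unfolding dt_def by simp
qed

lemma dt_lk [dfnI]: "dt x ==> dt y ==> dt z ==> dt (%e. lk (x e) (y e) (z e))"
 by (rule dt_app3) (unfold lk_iff, intro dfnI)
lemma dt_upd [dfnI]: "dt x ==> dt y ==> dt z ==> dt (%e. upd (x e) (y e) (z e))"
 by (rule dt_app3) (unfold upd_iff, intro dfnI)

subsection \<open>Inductively generated classes\<close>

definition Seq :: "'a => 'a => bool" where
 "Seq s n <-> Nat n & ((ALL p. p <: s --> (EX x y. p = opair x y)) &
   (ALL x y z. opair x y <: s & opair x z <: s --> y = z)) & (ALL k. (EX x. opair k x <: s) <-> k <: n)"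

lemma dfn_Seq [dfnI]: "dt x ==> dt y ==> dfn (%e. Seq (x e) (y e))"
 by (rule dfn_app2) (unfold Seq_def, intro dfnI)

lemma Seq_emp: "Seq emp emp" by (simp add: Seq_def)
lemma Seq_snoc: "Seq s n ==> Seq (adj s (opair n y)) (suc n)"
proof -
 assume S: "Seq s n"
 hence "~ opair n z <: s" for z unfolding Seq_def using irrefl by blast
 thus ?thesis using S unfolding Seq_def mem_adj mem_suc opair_inj by (metis Nat_suc)
qed
lemma Seq_fun: "Seq s n ==> opair k x <: s ==> opair k y <: s ==> x = y" unfolding Seq_def by blast
lemma Seq_dom: "Seq s n ==> opair k x <: s ==> k <: n" unfolding Seq_def by blast
lemma Seq_ex: "Seq s n ==> k <: n ==> EX x. opair k x <: s" unfolding Seq_def by blast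

text \<open>One normal form with a base, one-premise rules and two-premise rules serves all internal
  inductive definitions below, among them sums, formulas, proofs and refutations; hence one
  induction principle suffices.\<close>

definition stp :: "('a => bool) => ('a => 'a => bool) => ('a => 'a => 'a => bool) => ('a => bool) => 'a => bool" where
 "stp B R1 R2 X y <-> B y | (EX p. X p & R1 p y) | (EX p q. X p & X q & R2 p q y)"

lemma stp_mono: "stp B R1 R2 X y ==> (!!a. X a ==> X' a) ==> stp B R1 R2 X' y"
 unfolding stp_def by blast

definition valid :: "('a => bool) => ('a => 'a => bool) => ('a => 'a => 'a => bool) => 'a => 'a => bool" where
 "valid B R1 R2 s n <-> Seq s n &
   (ALL k. k <: n --> (EX y. opair k y <: s & stp B R1 R2 (%a. EX l. l <: k & opair l a <: s) y))"

definition ent :: "'a => 'a => 'a => bool" where "ent s n a <-> (EX k. k <: n & opair k a <: s)"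

definition gen :: "('a => bool) => ('a => 'a => bool) => ('a => 'a => 'a => bool) => 'a => bool" where
 "gen B R1 R2 x <-> (EX s n. valid B R1 R2 s n & ent s n x)"

lemma gen_cases:
 assumes "gen B R1 R2 x"
 shows "B x | (EX p. gen B R1 R2 p & R1 p x) | (EX p q. gen B R1 R2 p & gen B R1 R2 q & R2 p q x)"
proof -
 obtain s n k where s: "valid B R1 R2 s n" "k <: n" "opair k x <: s" using assms unfolding gen_def ent_def by blast
 then obtain y where y: "opair k y <: s" "stp B R1 R2 (%a. EX l. l <: k & opair l a <: s) y" unfolding valid_def by blast
 have "y = x" using Seq_fun s y unfolding valid_def by blast
 have "gen B R1 R2 a" if "l <: k" "opair l a <: s" for l a
  using that s Seq_dom unfolding gen_def ent_def valid_def by blast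
 thus ?thesis using y unfolding stp_def \<open>y = x\<close> by blast
qed

text \<open>Induction along the positions of one construction sequence: the generated class may fail
  to be a set, but the sequence is one.\<close>

lemma gen_induct:
 assumes "gen B R1 R2 x" and P: "dfn (%e. P (e 0))"
  and base: "!!y. B y ==> P y"
  and R1: "!!p y. gen B R1 R2 p ==> P p ==> R1 p y ==> P y"
  and R2: "!!p q y. gen B R1 R2 p ==> P p ==> gen B R1 R2 q ==> P q ==> R2 p q y ==> P y"
 shows "P x"
proof -
 obtain s n k where s: "valid B R1 R2 s n" "k <: n" "opair k x <: s" using assms(1) unfolding gen_def ent_def by blast
 have S: "Seq s n" using s unfolding valid_def by blast
 have g: "gen B R1 R2 a" if "opair l a <: s" for l a
  using that s Seq_dom unfolding gen_def ent_def valid_def by blast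
 have "ALL x. opair k x <: s --> P x"
 proof (rule trans_induct[where P = "%k. ALL x. opair k x <: s --> P x", OF _ _ _ s(2)])
  show "dfn (%e. ALL x. opair (e 0) x <: s --> P x)" by (intro dfnI dfn_app1[OF P])
  show "Trans n" using S unfolding Seq_def Nat_def by blast
  fix k assume k: "k <: n" and IH: "!!l. l <: k ==> ALL x. opair l x <: s --> P x"
  obtain y where y: "opair k y <: s" "stp B R1 R2 (%a. EX l. l <: k & opair l a <: s) y" using k s unfolding valid_def by blast
  have 1: "gen B R1 R2 a & P a" if "EX l. l <: k & opair l a <: s" for a using that g IH by blast
  from y(2) consider "B y" | p where "EX l. l <: k & opair l p <: s" "R1 p y"
   | p q where "EX l. l <: k & opair l p <: s" "EX l. l <: k & opair l q <: s" "R2 p q y" unfolding stp_def by blast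
  hence "P y"
  proof cases
   case 1 thus ?thesis by (rule base)
  next
   case 2 thus ?thesis using R1 1 by blast
  next
   case 3 thus ?thesis using R2 1 by blast
  qed
  thus "ALL x. opair k x <: s --> P x" using Seq_fun[OF S _ y(1)] by metis
 qed
 thus ?thesis using s by blast
qed

lemma valid_snoc:
 assumes "valid B R1 R2 s n" "stp B R1 R2 (ent s n) y"
 shows "valid B R1 R2 (adj s (opair n y)) (suc n)" "ent (adj s (opair n y)) (suc n) a <-> ent s n a | a = y"
proof -
 have S: "Seq s n" using assms unfolding valid_def by blast
 have n: "~ opair n z <: s" for z using Seq_dom[OF S] irrefl by blast
 have e: "(%a. EX l. l <: k & opair l a <: adj s (opair n y)) = (%a. EX l. l <: k & opair l a <: s)"
  if "k <: n | k = n" for k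
  using that irrefl[of n] S Nat_trans[of n k n] unfolding Seq_def by (auto simp: fun_eq_iff)
 show "valid B R1 R2 (adj s (opair n y)) (suc n)" unfolding valid_def
 proof (intro conjI allI impI Seq_snoc[OF S])
  fix k assume "k <: suc n"
  then consider "k <: n" | "k = n" by auto
  thus "EX ya. opair k ya <: adj s (opair n y) & stp B R1 R2 (%a. EX l. l <: k & opair l a <: adj s (opair n y)) ya"
  proof cases
   case 1
   then obtain z where "opair k z <: s" "stp B R1 R2 (%a. EX l. l <: k & opair l a <: s) z"
    using assms unfolding valid_def by blast
   thus ?thesis using e 1 by auto
  next
   case 2
   have "stp B R1 R2 (%a. EX l. l <: n & opair l a <: s) y" using assms(2) unfolding ent_def .
   thus ?thesis using e[of n] 2 by auto
  qed
 qed
 show "ent (adj s (opair n y)) (suc n) a <-> ent s n a | a = y"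
  unfolding ent_def using n Seq_dom[OF S] by auto
qed

lemma gen_base: "B x ==> gen B R1 R2 x"
proof -
 assume "B x"
 hence "stp B R1 R2 (ent emp emp) x" unfolding stp_def by blast
 moreover have "valid B R1 R2 emp emp" by (simp add: valid_def Seq_emp)
 ultimately show ?thesis using valid_snoc unfolding gen_def by blast
qed

lemma gen_1: "gen B R1 R2 p ==> R1 p x ==> gen B R1 R2 x"
proof -
 assume "gen B R1 R2 p" "R1 p x"
 then obtain s n where "valid B R1 R2 s n" "ent s n p" unfolding gen_def by blast
 moreover have "stp B R1 R2 (ent s n) x" using calculation \<open>R1 p x\<close> unfolding stp_def by blast
 ultimately show ?thesis using valid_snoc unfolding gen_def by blast
qed

lemma dfn_valid:
 assumes B: "!!f i. dfn (%e. B (%k. e (f k)) (e i))"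
  and R1: "!!f i j. dfn (%e. R1 (%k. e (f k)) (e i) (e j))"
  and R2: "!!f i j k. dfn (%e. R2 (%k. e (f k)) (e i) (e j) (e k))"
 shows "dfn (%e. valid (B (%k. e (f k))) (R1 (%k. e (f k))) (R2 (%k. e (f k))) (e i) (e j))"
 unfolding valid_def stp_def by (intro dfnI B R1 R2)

lemma dfn_valid0:
 assumes B: "dfn (%e. B (e 0))" and R1: "dfn (%e. R1 (e 0) (e 1))" and R2: "dfn (%e. R2 (e 0) (e 1) (e 2))"
  and "dt x" "dt y"
 shows "dfn (%e. valid B R1 R2 (x e) (y e))"
 by (rule dfn_app2[OF _ assms(4,5)], rule dfn_valid[where B = "%_. B" and ?R1.0 = "%_. R1" and ?R2.0 = "%_. R2"])
  (intro dfn_app1[OF B] dfn_app2[OF R1] dfn_app3[OF R2] dfnI)+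

lemma dfn_ent [dfnI]: "dt x ==> dt y ==> dt z ==> dfn (%e. ent (x e) (y e) (z e))"
 by (rule dfn_app3) (unfold ent_def, intro dfnI)

text \<open>Each premise comes with its own construction sequence, and the two have to be merged:
  the entries of \<open>t\<close> are appended to \<open>s\<close> one at a time, each staying
  justified because \<open>stp\<close> is monotone. The merging is an internal induction, whence the
  definability premises.\<close>

lemma gen_2:
 assumes B: "dfn (%e. B (e 0))" and R1: "dfn (%e. R1 (e 0) (e 1))" and R2: "dfn (%e. R2 (e 0) (e 1) (e 2))"
  and "gen B R1 R2 p" "gen B R1 R2 q" "R2 p q x"
 shows "gen B R1 R2 x"
proof -
 obtain s n where s: "valid B R1 R2 s n" "ent s n p" using assms(4) unfolding gen_def by blast
 obtain t m where t: "valid B R1 R2 t m" "ent t m q" using assms(5) unfolding gen_def by blast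
 have T: "Seq t m" "Nat m" using t unfolding valid_def Seq_def by blast+
 let ?P = "%k. k <: m | k = m --> (EX u l. valid B R1 R2 u l & (ALL a. ent s n a --> ent u l a) & (ALL j. j <: k --> (ALL a. opair j a <: t --> ent u l a)))"
 have "?P m"
 proof (rule Nat_induct[where P = ?P, OF _ _ _ T(2)])
  show "dfn (%e. ?P (e 0))" by (intro dfnI dfn_valid0 B R1 R2)
  show "?P emp" using s(1) by auto
  fix k assume k: "Nat k" "?P k"
  show "?P (suc k)"
  proof
   assume *: "suc k <: m | suc k = m"
   hence km: "k <: m" using Nat_trans[OF T(2), of "suc k" k] by auto
   then obtain u l where u: "valid B R1 R2 u l" "!!a. ent s n a ==> ent u l a" "!!j a. j <: k ==> opair j a <: t ==> ent u l a"
    using k by blast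
   obtain y where y: "opair k y <: t" "stp B R1 R2 (%a. EX l. l <: k & opair l a <: t) y" using km t unfolding valid_def by blast
   have st: "stp B R1 R2 (ent u l) y" by (rule stp_mono[OF y(2)]) (use u(3) in blast)
   have "ALL j. j <: suc k --> (ALL a. opair j a <: t --> ent (adj u (opair l y)) (suc l) a)"
    using u(3) Seq_fun[OF T(1) y(1)] valid_snoc(2)[OF u(1) st] by auto
   thus "EX u l. valid B R1 R2 u l & (ALL a. ent s n a --> ent u l a) & (ALL j. j <: suc k --> (ALL a. opair j a <: t --> ent u l a))"
    using valid_snoc[OF u(1) st] u(2) by blast
  qed
 qed
 then obtain u l where u: "valid B R1 R2 u l" "ent u l p" "ent u l q" using s t unfolding ent_def[of t] by blast
 hence "stp B R1 R2 (ent u l) x" using assms(6) unfolding stp_def by blast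
 thus ?thesis using valid_snoc[OF u(1)] unfolding gen_def by blast
qed

lemma dfn_gen:
 assumes B: "dfn (%e. B (%k. e (Suc k)) (e 0))"
  and R1: "dfn (%e. R1 (%k. e (Suc (Suc k))) (e 1) (e 0))"
  and R2: "dfn (%e. R2 (%k. e (Suc (Suc (Suc k)))) (e 2) (e 1) (e 0))" and x: "dt x"
 shows "dfn (%e. gen (B e) (R1 e) (R2 e) (x e))"
proof (rule dfn_app[OF _ x])
 have B': "dfn (%e. B (%k. e (f k)) (e i))" for f i
  using dfn_ren[OF B, of "%k. if k = 0 then i else f (k - 1)"] by simp
 have R1': "dfn (%e. R1 (%k. e (f k)) (e i) (e j))" for f i j
  using dfn_ren[OF R1, of "%k. if k = 0 then j else if k = 1 then i else f (k - 2)"] by simp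
 have R2': "dfn (%e. R2 (%k. e (f k)) (e i) (e j) (e l))" for f i j l
  using dfn_ren[OF R2, of "%k. if k = 0 then l else if k = 1 then j else if k = 2 then i else f (k - 3)"]
  by (simp add: numeral_2_eq_2 numeral_3_eq_3)
 show "dfn (%e. gen (B (%k. e (Suc k))) (R1 (%k. e (Suc k))) (R2 (%k. e (Suc k))) (e 0))"
  unfolding gen_def by (intro dfnI dfn_valid B' R1' R2')
qed

lemma dfn_gen0:
 assumes "dfn (%e. B (e 0))" "dfn (%e. R1 (e 0) (e 1))" "dfn (%e. R2 (e 0) (e 1) (e 2))" "dt x"
 shows "dfn (%e. gen B R1 R2 (x e))"
 by (rule dfn_gen[where B = "%_. B" and ?R1.0 = "%_. R1" and ?R2.0 = "%_. R2", OF _ _ _ assms(4)])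
  (intro dfn_app1[OF assms(1)] dfn_app2[OF assms(2)] dfn_app3[OF assms(3)] dfnI)+

subsection \<open>Hereditarily finite sets\<close>

text \<open>The two-premise rule is adjunction. Without Infinity the hereditarily finite sets may be
  all the sets there are, so they can only be a class.\<close>

definition HF :: "'a => bool" where
 "HF = gen (%x. x = emp) (%_ _. False) (%p q y. y = adj p q)"

lemma HF_emp [simp]: "HF emp" unfolding HF_def by (rule gen_base) simp
lemma HF_adj [simp]: "HF x ==> HF y ==> HF (adj x y)" unfolding HF_def by (rule gen_2) (intro dfnI | simp)+

lemma HF_induct:
 assumes "HF x" "dfn (%e. P (e 0))" "P emp" "!!x y. HF x ==> P x ==> HF y ==> P y ==> P (adj x y)"
 shows "P x"
 by (rule gen_induct[OF assms(1)[unfolded HF_def] assms(2)]) (use assms(3,4) in \<open>auto simp: HF_def\<close>)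

lemma dfn_HF [dfnI]: "dt x ==> dfn (%e. HF (x e))"
 unfolding HF_def by (intro dfn_gen0 dfnI)

lemma HF_opair [simp]: "HF x ==> HF y ==> HF (opair x y)" unfolding opair_def by simp
lemma HF_suc [simp]: "HF x ==> HF (suc x)" unfolding suc_def by simp

lemma HF_Nat [simp]: "Nat n ==> HF n"
 by (rule Nat_induct[where P = HF]) (intro dfnI, auto)

lemma HF_mem:
 assumes "HF x" "y <: x" shows "HF y"
proof -
 have "ALL y. y <: x --> HF y" by (rule HF_induct[OF assms(1)]) (intro dfnI, auto)
 thus ?thesis using assms by blast
qed

lemma HF_subset:
 assumes "HF x" "!!w. w <: y ==> w <: x" shows "HF y"
proof -
 have "ALL y. (ALL w. w <: y --> w <: x) --> HF y"
 proof (rule HF_induct[OF assms(1)])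
  show "dfn (%e. ALL y. (ALL w. w <: y --> w <: e 0) --> HF y)" by (intro dfnI)
  show "ALL y. (ALL w. w <: y --> w <: emp) --> HF y" by (metis HF_emp emp_iff mem_emp)
  fix x z assume x: "HF z" "ALL y. (ALL w. w <: y --> w <: x) --> HF y"
  show "ALL y. (ALL w. w <: y --> w <: adj x z) --> HF y"
  proof (intro allI impI)
   fix y assume y: "ALL w. w <: y --> w <: adj x z"
   let ?y = "sepset y (%w. w ~= z)"
   have m: "w <: ?y <-> w <: y & w ~= z" for w by (rule mem_sepset) (intro dfnI)
   have "HF ?y" using x(2) y m by auto
   moreover have "z <: y ==> y = adj ?y z" unfolding adj_iff m by blast
   moreover have "~ z <: y ==> y = ?y" by (rule ext) (use m in blast)
   ultimately show "HF y" using x(1) HF_adj by metis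
  qed
 qed
 thus ?thesis using assms by blast
qed

lemma HF_upd [simp]: "HF A ==> HF i ==> HF a ==> HF (upd A i a)"
 by (rule HF_subset[of "adj A (opair i a)"]) (auto simp: mem_upd)

text \<open>Adjunction preserves the statement that \<open>P\<close> holds of a set and of all its
  members; \<open>step\<close> then applies to the new set.\<close>

lemma HF_eps_induct:
 assumes P: "dfn (%e. P (e 0))" and step: "!!x. HF x ==> (!!y. y <: x ==> P y) ==> P x" and "HF x"
 shows "P x"
proof -
 have "P x & (ALL y. y <: x --> P y)"
 proof (rule HF_induct[OF assms(3)])
  show "P emp & (ALL y. y <: emp --> P y)" using step[of emp] by simp
  show "P (adj x y) & (ALL z. z <: adj x y --> P z)"
   if "HF x" "P x & (ALL y. y <: x --> P y)" "HF y" "P y & (ALL z. z <: y --> P z)" for x y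
   using step[of "adj x y"] that by auto
 qed (intro dfnI dfn_app1[OF P])
 thus ?thesis by blast
qed

end

section \<open>Arithmetized syntax in models of S\<close>

context smodel
begin

definition cMem :: "'a => 'a => 'a" where "cMem i j = opair (nn 0) (opair i j)"
definition cEql :: "'a => 'a => 'a" where "cEql i j = opair (nn 1) (opair i j)"
definition cNeg :: "'a => 'a" where "cNeg p = opair (nn 2) p"
definition cImp :: "'a => 'a => 'a" where "cImp p q = opair (nn 3) (opair p q)"
definition cAll :: "'a => 'a => 'a" where "cAll i p = opair (nn 4) (opair i p)"
abbreviation cConj :: "'a => 'a => 'a" where "cConj p q \<equiv> cNeg (cImp p (cNeg q))"
abbreviation cIff :: "'a => 'a => 'a" where "cIff p q \<equiv> cConj (cImp p q) (cImp q p)"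
abbreviation cEx :: "'a => 'a => 'a" where "cEx i p \<equiv> cNeg (cAll i (cNeg p))"

lemmas c_defs = cMem_def cEql_def cNeg_def cImp_def cAll_def

lemma c_inj [simp]:
 "cMem i j = cMem i' j' <-> i = i' & j = j'" "cEql i j = cEql i' j' <-> i = i' & j = j'"
 "cNeg p = cNeg p' <-> p = p'" "cImp p q = cImp p' q' <-> p = p' & q = q'"
 "cAll i p = cAll i' p' <-> i = i' & p = p'"
 unfolding c_defs opair_inj nn_inj by blast+

lemma c_dist [simp]:
 "cMem i j ~= cEql k l" "cEql k l ~= cMem i j" "cMem i j ~= cNeg p" "cNeg p ~= cMem i j"
 "cMem i j ~= cImp p q" "cImp p q ~= cMem i j" "cMem i j ~= cAll k p" "cAll k p ~= cMem i j"
 "cEql i j ~= cNeg p" "cNeg p ~= cEql i j" "cEql i j ~= cImp p q" "cImp p q ~= cEql i j"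
 "cEql i j ~= cAll k p" "cAll k p ~= cEql i j" "cNeg r ~= cImp p q" "cImp p q ~= cNeg r"
 "cNeg r ~= cAll k p" "cAll k p ~= cNeg r" "cImp p q ~= cAll k r" "cAll k r ~= cImp p q"
 unfolding c_defs opair_inj nn_inj by simp_all

lemma dt_c [dfnI]:
 "dt x ==> dt y ==> dt (%e. cMem (x e) (y e))" "dt x ==> dt y ==> dt (%e. cEql (x e) (y e))"
 "dt x ==> dt (%e. cNeg (x e))" "dt x ==> dt y ==> dt (%e. cImp (x e) (y e))"
 "dt x ==> dt y ==> dt (%e. cAll (x e) (y e))"
 unfolding c_defs by (intro dfnI | assumption)+

primrec code :: "fm => 'a" where
 "code (Mem i j) = cMem (nn i) (nn j)"
| "code (Eql i j) = cEql (nn i) (nn j)"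
| "code (Neg p) = cNeg (code p)"
| "code (Imp p q) = cImp (code p) (code q)"
| "code (Forall i p) = cAll (nn i) (code p)"

lemma code_inj: "code p = code q <-> p = q"
proof (induction p arbitrary: q)
 case (Mem i j) thus ?case by (cases q) simp_all
next
 case (Eql i j) thus ?case by (cases q) simp_all
next
 case (Neg p) thus ?case by (cases q) simp_all
next
 case (Imp p1 p2) thus ?case by (cases q) simp_all
next
 case (Forall i p) thus ?case by (cases q) simp_all
qed

definition Fn :: "'a => bool" where
 "Fn f <-> (ALL p. p <: f --> (EX x y. p = opair x y)) & (ALL x y z. opair x y <: f & opair x z <: f --> y = z)"
definition Fin :: "'a => bool" where
 "Fin x <-> (EX n s. Seq s n & (ALL k l y. opair k y <: s & opair l y <: s --> k = l) & (ALL y. y <: x <-> (EX k. opair k y <: s)))"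
definition Atom :: "'a => bool" where
 "Atom y <-> (EX i j. Nat i & Nat j & (y = cMem i j | y = cEql i j))"
definition Form :: "'a => bool" where
 "Form = gen Atom (%p y. y = cNeg p | (EX i. Nat i & y = cAll i p)) (%p q y. y = cImp p q)"
definition Imm :: "'a => 'a => bool" where
 "Imm q p <-> p = cNeg q | (EX r. p = cImp q r) | (EX r. p = cImp r q) | (EX i. p = cAll i q)"
definition Path :: "'a => 'a => 'a => 'a => bool" where
 "Path s n p q <-> (EX m. m = suc n & Seq s m) & (EX z. z = emp & opair z p <: s) & opair n q <: s &
   (ALL k l x y. k <: n & l = suc k & opair k x <: s & opair l y <: s --> Imm y x)"
definition Sub :: "'a => 'a => bool" where "Sub q p <-> (EX s n. Path s n p q)"
definition FreeV :: "'a => 'a => bool" where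
 "FreeV i p <-> (EX s n q. Path s n p q & (EX j. q = cMem i j | q = cMem j i | q = cEql i j | q = cEql j i) &
   ~ (EX k x r. opair k x <: s & x = cAll i r))"
definition Sentence :: "'a => bool" where "Sentence p <-> Form p & ~ (EX i. FreeV i p)"
definition LogAx :: "'a => bool" where
 "LogAx x <->
   (EX p q. Form p & Form q & x = cImp p (cImp q p)) |
   (EX p q r. Form p & Form q & Form r & x = cImp (cImp p (cImp q r)) (cImp (cImp p q) (cImp p r))) |
   (EX p q. Form p & Form q & x = cImp (cImp (cNeg p) (cNeg q)) (cImp q p)) |
   (EX i p q. Nat i & Form p & Form q & x = cImp (cAll i (cImp p q)) (cImp (cAll i p) (cAll i q))) |
   (EX i p. Nat i & Form p & x = cImp (cAll i p) p) |
   (EX i p. Nat i & Form p & ~ FreeV i p & x = cImp p (cAll i p)) |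
   (EX i j. Nat i & Nat j & x = cEx i (cEql i j)) |
   (EX i j k. Nat i & Nat j & Nat k &
    (x = cImp (cEql i j) (cImp (cEql i k) (cEql j k)) |
     x = cImp (cEql i j) (cImp (cMem i k) (cMem j k)) |
     x = cImp (cEql i j) (cImp (cMem k i) (cMem k j))))"
definition Pv :: "('a => bool) => 'a => bool" where
 "Pv T = gen (%y. LogAx y | T y) (%p y. EX i. Nat i & y = cAll i p) (%p r y. r = cImp p y)"
definition SAx :: "'a => bool" where
 "SAx a <-> (EX p:set S_single. a = code p) |
   (EX x y z p. Nat x & Nat y & Nat z & distinct [x, y, z] & Form p & ~ FreeV y p &
    a = cEx y (cAll z (cIff (cMem z y) (cConj (cMem z x) p)))) |
   (EX x y z w u p. Nat x & Nat y & Nat z & Nat w & Nat u & distinct [x, y, z, w, u] &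
    Form p & ~ FreeV y p & ~ FreeV u p &
    a = cImp (cAll z (cImp (cMem z x) (cEx u (cAll w (cImp p (cEql w u))))))
       (cEx y (cAll w (cIff (cMem w y) (cEx z (cConj (cMem z x) p))))))"
definition Pred :: "'a => bool" where
 "Pred = gen Atom (%p y. y = cNeg p |
   (EX i j. Nat i & Nat j & i ~= j & y = cAll i (cImp (cEx j (cMem i j)) p))) (%p q y. y = cImp p q)"
definition CAx :: "'a => bool" where
 "CAx a <-> (EX p:set C_single. a = code p) |
   (EX x y j p. Nat x & Nat y & Nat j & x ~= y & x ~= j & Pred p & ~ FreeV y p &
    a = cEx y (cAll x (cImp (cEx j (cMem x j)) (cIff (cMem x y) p))))"

subsection \<open>Evaluation of the concrete formulas\<close>

abbreviation tru :: "(nat => 'a) => fm => bool" where "tru \<equiv> sat UNIV (<:) (=)"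

lemma opair_iff: "p = opair x y <->
 (EX a b. (ALL w. w <: a <-> w = x) & (ALL w. w <: b <-> w = x | w = y) & (ALL w. w <: p <-> w = a | w = b))"
proof
 assume "p = opair x y"
 thus "EX a b. (ALL w. w <: a <-> w = x) & (ALL w. w <: b <-> w = x | w = y) & (ALL w. w <: p <-> w = a | w = b)"
  unfolding opair_def by (intro exI[of _ "adj emp x"] exI[of _ "adj (adj emp x) y"]) simp
next
 assume "EX a b. (ALL w. w <: a <-> w = x) & (ALL w. w <: b <-> w = x | w = y) & (ALL w. w <: p <-> w = a | w = b)"
 then obtain a b where *: "ALL w. w <: a <-> w = x" "ALL w. w <: b <-> w = x | w = y" "ALL w. w <: p <-> w = a | w = b" by blast
 hence "a = adj emp x" "b = adj (adj emp x) y" "p = adj (adj emp a) b" unfolding adj_iff by simp_all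
 thus "p = opair x y" unfolding opair_def by simp
qed

lemma suc_iff: "y = suc x <-> (ALL w. w <: y <-> w <: x | w = x)" unfolding suc_def by (rule adj_iff)

lemma tru_hpair [sat_h]: "x < n ==> y < n ==> p < n ==> tru e (hpair x y p n) <-> e p = opair (e x) (e y)"
 unfolding opair_iff by (simp add: hpair_def sat_h)
lemma tru_hpairin [sat_h]: "x < n ==> y < n ==> f < n ==> tru e (hpairin x y f n) <-> opair (e x) (e y) <: e f"
 by (simp add: hpairin_def sat_h)
lemma tru_hempty [sat_h]: "x < n ==> tru e (hempty x n) <-> e x = emp"
 by (simp add: hempty_def sat_h emp_iff)
lemma tru_hsucc [sat_h]: "x < n ==> y < n ==> tru e (hsucc x y n) <-> e y = suc (e x)"
 by (simp add: hsucc_def sat_h suc_iff)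
lemma tru_htransitive [sat_h]: "x < n ==> tru e (htransitive x n) <-> Trans (e x)"
 by (simp add: htransitive_def sat_h Trans_def)
lemma tru_hnat [sat_h]: "x < n ==> tru e (hnat x n) <-> Nat (e x)"
 by (simp add: hnat_def hordinal_def sat_h Nat_def)
lemma tru_hfunction [sat_h]: "x < n ==> tru e (hfunction x n) <-> Fn (e x)"
 by (simp add: hfunction_def hsingle_valued_def sat_h Fn_def)
lemma tru_hseq [sat_h]: "x < n ==> y < n ==> tru e (hseq x y n) <-> Seq (e x) (e y)"
 by (simp add: hseq_def sat_h Seq_def Fn_def)
lemma tru_hfinite [sat_h]: "x < n ==> tru e (hfinite x n) <-> Fin (e x)"
 by (simp add: hfinite_def sat_h Fin_def)

text \<open>Inside \<open>step\<close> the predicate \<open>E\<close> is an HOL function applied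
  under further binders, so its meaning has to be specified at all later values of the
  fresh-variable counter and in all environments that agree with the present one below it.\<close>

lemma tru_hgenerated:
 assumes st: "!!X Ef y n' e'. n \<le> n' ==> y < n' ==>
   (!!a n'' e''. n' \<le> n'' ==> a < n'' ==> (!!i. i < n' ==> e'' i = e' i) ==> tru e'' (Ef a n'') <-> X (e'' a)) ==>
   tru e' (step Ef y n') <-> stp B R1 R2 X (e' y)"
  and "x < n"
 shows "tru e (hgenerated step x n) <-> gen B R1 R2 (e x)"
proof -
 have "tru (e(n := s, Suc n := m, Suc (Suc n) := k, Suc (Suc (Suc n)) := y))
   (step (%a. \<^bold>\<exists>l. l \<^bold>\<in> Suc (Suc n) \<^bold>\<and> hpairin l a n) (Suc (Suc (Suc n))) (Suc (Suc (Suc (Suc n))))) <->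
  stp B R1 R2 (%a. EX l. l <: k & opair l a <: s) y" for s m k y
  by (subst st[where X = "%a. EX l. l <: k & opair l a <: s"]) (auto simp: sat_h)
 thus ?thesis using assms(2) unfolding gen_def valid_def ent_def by (auto simp add: hgenerated_def sat_h)
qed

text \<open>Quantifying over later counters \<open>m\<close> and over environments that agree below
  \<open>n\<close> makes a denotation stable under the binders that compound terms insert.\<close>

definition den :: "trm => nat => (nat => 'a) => 'a => bool" where
 "den t n e a <-> (ALL m e' z. n \<le> m --> z < m --> (ALL i<n. e' i = e i) --> tru e' (t z m) = (e' z = a))"
text \<open>With the value given by a description, denotation turns into the equations
  \<open>okt_q\<close>, along which the simplifier evaluates quoted terms.\<close>

definition tv :: "trm => nat => (nat => 'a) => 'a" where "tv t n e = (THE a. den t n e a)"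
definition okt :: "trm => nat => (nat => 'a) => bool" where "okt t n e <-> den t n e (tv t n e)"

lemma den_at: "den t n e a ==> n \<le> m ==> z < m ==> (!!i. i < n ==> e' i = e i) ==> tru e' (t z m) = (e' z = a)"
 unfolding den_def by simp

lemma den_tv: "den t n e a ==> tv t n e = a"
 unfolding tv_def
proof (rule the_equality)
 fix b assume d: "den t n e a" "den t n e b"
 have "tru (e(n := b)) (t n (Suc n)) = (b = a)" "tru (e(n := b)) (t n (Suc n)) = (b = b)"
  using den_at[OF d(1), of "Suc n" n "e(n := b)"] den_at[OF d(2), of "Suc n" n "e(n := b)"] by simp_all
 thus "b = a" by simp
qed

lemma den_okt: "den t n e a ==> okt t n e & tv t n e = a"
 using den_tv okt_def by metis

lemma okt_sat: "okt t n e ==> y < n ==> tru e (t y n) <-> e y = tv t n e"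
 using den_at[of t n e "tv t n e" n y e] unfolding okt_def by simp

lemma den_tpair: "den s n e a ==> den t n e b ==> den (tpair s t) n e (opair a b)"
 unfolding den_def[of "tpair s t"] by (simp add: tpair_def sat_h den_at[of s n e a] den_at[of t n e b])

lemma den_num: "den (num k) n e (nn k)"
proof (induction k)
 case 0 thus ?case by (simp add: den_def sat_h)
next
 case (Suc k) thus ?case unfolding den_def[of "num (Suc k)"] by (simp add: sat_h den_at[of "num k" n e "nn k"])
qed

lemma den_V: "x < n ==> den (V x) n e (e x)"
 unfolding den_def V_def by (simp add: sat_h)

lemma den_q:
 "den s n e a ==> den t n e b ==> den (qMem s t) n e (cMem a b)"
 "den s n e a ==> den t n e b ==> den (qEql s t) n e (cEql a b)"
 "den s n e a ==> den (qNeg s) n e (cNeg a)"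
 "den s n e a ==> den t n e b ==> den (qImp s t) n e (cImp a b)"
 "den s n e a ==> den t n e b ==> den (qForall s t) n e (cAll a b)"
 unfolding c_defs qMem_def qEql_def qNeg_def qImp_def qForall_def by (intro den_tpair den_num; assumption)+

lemma den_quote: "den (quote p) n e (code p)"
 by (induction p) (auto intro: den_q den_num)

lemma okt_V [simp]: "x < n ==> okt (V x) n e" "x < n ==> tv (V x) n e = e x"
 using den_okt[OF den_V] by blast+

lemma okt_q:
 "okt s n e ==> okt t n e ==> okt (qMem s t) n e & tv (qMem s t) n e = cMem (tv s n e) (tv t n e)"
 "okt s n e ==> okt t n e ==> okt (qEql s t) n e & tv (qEql s t) n e = cEql (tv s n e) (tv t n e)"
 "okt s n e ==> okt (qNeg s) n e & tv (qNeg s) n e = cNeg (tv s n e)"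
 "okt s n e ==> okt t n e ==> okt (qImp s t) n e & tv (qImp s t) n e = cImp (tv s n e) (tv t n e)"
 "okt s n e ==> okt t n e ==> okt (qForall s t) n e & tv (qForall s t) n e = cAll (tv s n e) (tv t n e)"
 by (rule den_okt[OF den_q(1)] den_okt[OF den_q(2)] den_okt[OF den_q(3)] den_okt[OF den_q(4)] den_okt[OF den_q(5)];
  simp only: okt_def)+

lemmas okt_q' [simp] = okt_q[THEN conjunct1] okt_q[THEN conjunct2]

lemmas tru_q [sat_h] = okt_sat[of "qMem s t" for s t] okt_sat[of "qEql s t" for s t] okt_sat[of "qNeg s" for s]
 okt_sat[of "qImp s t" for s t] okt_sat[of "qForall s t" for s t]

lemma tru_quote [sat_h]: "y < n ==> tru e (quote p y n) <-> e y = code p"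
 using okt_sat[of "quote p"] den_okt[OF den_quote] by auto

lemma tru_hatomic [sat_h]: "y < n ==> tru e (hatomic y n) <-> Atom (e y)"
 by (simp add: hatomic_def sat_h Atom_def)

lemma tru_hform [sat_h]: "y < n ==> tru e (hform y n) <-> Form (e y)"
 unfolding hform_def Form_def by (rule tru_hgenerated) (simp add: sat_h stp_def, blast, assumption)

lemma tru_himmediate [sat_h]: "x < n ==> y < n ==> tru e (himmediate x y n) <-> Imm (e x) (e y)"
 by (simp add: himmediate_def sat_h Imm_def)

lemma tru_hpath [sat_h]: "s < n ==> x < n ==> p < n ==> q < n ==> tru e (hpath s x p q n) <-> Path (e s) (e x) (e p) (e q)"
 by (simp add: hpath_def sat_h Path_def)

lemma tru_hsubformula [sat_h]: "p < n ==> q < n ==> tru e (hsubformula q p n) <-> Sub (e q) (e p)"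
 by (simp add: hsubformula_def sat_h Sub_def)

lemma tru_hfree [sat_h]: "i < n ==> p < n ==> tru e (hfree i p n) <-> FreeV (e i) (e p)"
 by (simp add: hfree_def sat_h FreeV_def)

lemma tru_hsentence [sat_h]: "p < n ==> tru e (hsentence p n) <-> Sentence (e p)"
 by (simp add: hsentence_def sat_h Sentence_def)

lemma tru_hlogical_axiom [sat_h]: "x < n ==> tru e (hlogical_axiom x n) <-> LogAx (e x)"
 by (simp add: hlogical_axiom_def sat_h LogAx_def)

lemma tru_hproves:
 assumes "!!x n e. x < n ==> tru e (hT x n) <-> T (e x)" "x < n"
 shows "tru e (hproves hT x n) <-> Pv T (e x)"
 unfolding hproves_def Pv_def by (rule tru_hgenerated) (simp add: sat_h stp_def assms(1), blast, rule assms)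

lemma tru_honeof [sat_h]: "x < n ==> tru e (honeof ps x n) <-> (EX p:set ps. e x = code p)"
 by (induction ps) (auto simp: sat_h)

lemma tru_hdistinct [sat_h]: "ALL x:set xs. x < n ==> tru e (hdistinct xs n) <-> distinct (map e xs)"
proof (induction xs)
 case (Cons x xs)
 have "tru e (foldr (%y A. \<^bold>\<not> x \<^bold>= y \<^bold>\<and> A) ys (hdistinct xs) n) <-> e x \<notin> e ` set ys & tru e (hdistinct xs n)" for ys
  by (induction ys) (auto simp: sat_h)
 thus ?case using Cons by simp
qed (simp add: sat_h)

lemma tru_hS_axiom [sat_h]: "x < n ==> tru e (hS_axiom x n) <-> SAx (e x)"
 by (simp add: hS_axiom_def sat_h SAx_def del: hdistinct.simps distinct.simps distinct_length_2_or_more)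

lemma tru_hpredicative [sat_h]: "y < n ==> tru e (hpredicative y n) <-> Pred (e y)"
 unfolding hpredicative_def Pred_def by (rule tru_hgenerated) (simp add: sat_h stp_def, blast, assumption)

lemma tru_hC_axiom [sat_h]: "x < n ==> tru e (hC_axiom x n) <-> CAx (e x)"
 by (simp add: hC_axiom_def sat_h CAx_def)

lemma tru_provesS [sat_h]: "x < n ==> tru e (hproves hS_axiom x n) <-> Pv SAx (e x)"
 by (rule tru_hproves) (simp_all add: sat_h)
lemma tru_provesC [sat_h]: "x < n ==> tru e (hproves hC_axiom x n) <-> Pv CAx (e x)"
 by (rule tru_hproves) (simp_all add: sat_h)

definition Con :: "('a => bool) => bool" where "Con T <-> ~ (EX p. Pv T p & Pv T (cNeg p))"

lemma tru_conS: "tru e (hconsistent hS_axiom n) <-> Con SAx"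
 by (simp add: hconsistent_def sat_h Con_def)

lemma tru_target: "tru e ((hconsistent hS_axiom \<^bold>\<longrightarrow>
      \<^bold>\<not> (\<^bold>\<exists>t. quote p t \<^bold>\<and> hproves hC_axiom t)) 0) <-> (Con SAx --> ~ Pv CAx (code p))"
 by (simp add: sat_h tru_conS)

lemma dfn_truI: "(!!e. P (e 0) <-> tru e p) ==> dt x ==> dfn (%e. P (x e))"
 by (rule dfn_app1) (simp_all add: dfn_sat)

lemma dfn_Form [dfnI]: "dt x ==> dfn (%e. Form (x e))"
 by (rule dfn_truI[where p = "hform 0 1"]) (simp_all add: sat_h)
lemma dfn_Pred [dfnI]: "dt x ==> dfn (%e. Pred (x e))"
 by (rule dfn_truI[where p = "hpredicative 0 1"]) (simp_all add: sat_h)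
lemma dfn_SAx [dfnI]: "dt x ==> dfn (%e. SAx (x e))"
 by (rule dfn_truI[where p = "hS_axiom 0 1"]) (simp_all add: sat_h)
lemma dfn_CAx [dfnI]: "dt x ==> dfn (%e. CAx (x e))"
 by (rule dfn_truI[where p = "hC_axiom 0 1"]) (simp_all add: sat_h)
lemma dfn_LogAx [dfnI]: "dt x ==> dfn (%e. LogAx (x e))"
 by (rule dfn_truI[where p = "hlogical_axiom 0 1"]) (simp_all add: sat_h)
lemma dfn_FreeV [dfnI]: "dt x ==> dt y ==> dfn (%e. FreeV (x e) (y e))"
proof (rule dfn_app2)
 have "dfn (%e. tru e (hfree 0 1 2))" by (rule dfn_sat)
 thus "dfn (%e. FreeV (e 0) (e 1))" by (simp add: sat_h)
qed

lemma dfn_Pv: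
 assumes "dfn (%e. T (e 0))" "dt x" shows "dfn (%e. Pv T (x e))"
 unfolding Pv_def by (intro dfn_gen0 dfnI dfn_app1[OF assms(1)] assms(2))

end

section \<open>Recursive behaviour of internal formulas and proofs\<close>

context smodel
begin

lemma dfn_Atom [dfnI]: "dt x ==> dfn (%e. Atom (x e))"
 by (rule dfn_app1) (unfold Atom_def, intro dfnI)

lemma Form_intros:
 shows Form_Mem': "Nat i ==> Nat j ==> Form (cMem i j)" and Form_Eql': "Nat i ==> Nat j ==> Form (cEql i j)"
  and Form_Neg': "Form p ==> Form (cNeg p)" and Form_Imp': "Form p ==> Form q ==> Form (cImp p q)"
  and Form_All': "Nat i ==> Form p ==> Form (cAll i p)"
proof -
 show "Form (cMem i j)" "Form (cEql i j)" if "Nat i" "Nat j" unfolding Form_def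
  by (rule gen_base, auto simp: Atom_def that)+
 show "Form (cNeg p)" if "Form p" using that unfolding Form_def by (rule gen_1) blast
 show "Form (cAll i p)" if "Nat i" "Form p" using that(2) unfolding Form_def by (rule gen_1) (use that in blast)
 show "Form (cImp p q)" if "Form p" "Form q" using that unfolding Form_def
  by - (rule gen_2, intro dfnI, intro dfnI, intro dfnI, assumption, assumption, rule refl)
qed

lemma Form_cases:
 assumes "Form x"
 obtains (Mem) i j where "Nat i" "Nat j" "x = cMem i j" | (Eql) i j where "Nat i" "Nat j" "x = cEql i j"
  | (Neg) p where "Form p" "x = cNeg p" | (Imp) p q where "Form p" "Form q" "x = cImp p q"
  | (All) i p where "Nat i" "Form p" "x = cAll i p"
 using gen_cases[OF assms[unfolded Form_def]] unfolding Atom_def Form_def[symmetric] by blast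

lemma Form_simps [simp]:
 "Form (cMem i j) <-> Nat i & Nat j" "Form (cEql i j) <-> Nat i & Nat j"
 "Form (cNeg p) <-> Form p" "Form (cImp p q) <-> Form p & Form q" "Form (cAll i p) <-> Nat i & Form p"
 by (auto intro: Form_intros elim: Form_cases)

lemma Form_induct:
 assumes "Form x" "dfn (%e. P (e 0))"
  and "!!i j. Nat i ==> Nat j ==> P (cMem i j)" "!!i j. Nat i ==> Nat j ==> P (cEql i j)"
  and "!!p. Form p ==> P p ==> P (cNeg p)" "!!p q. Form p ==> Form q ==> P p ==> P q ==> P (cImp p q)"
  and "!!i p. Nat i ==> Form p ==> P p ==> P (cAll i p)"
 shows "P x"
proof (rule gen_induct[OF assms(1)[unfolded Form_def] assms(2)])
 show "P y" if "Atom y" for y using that assms(3,4) unfolding Atom_def by blast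
qed (use assms(5-7) in \<open>auto simp: Form_def[symmetric]\<close>)

lemma Form_code [simp]: "Form (code p)" by (induction p) auto

lemma HF_c [simp]:
 "HF i ==> HF j ==> HF (cMem i j)" "HF i ==> HF j ==> HF (cEql i j)" "HF i ==> HF (cNeg i)"
 "HF i ==> HF j ==> HF (cImp i j)" "HF i ==> HF j ==> HF (cAll i j)"
 unfolding c_defs by simp_all

lemma HF_Form [simp]: "Form p ==> HF p"
 by (erule Form_induct) (intro dfnI, auto)

subsection \<open>Paths and free variables\<close>

text \<open>Common form of two notions given by paths in the parse tree: with nothing bad it yields
  subformulas, and with the quantifications over \<open>i\<close> bad it leads to the free
  occurrences of \<open>i\<close>.\<close>

definition Rch :: "('a => bool) => 'a => 'a => bool" where
 "Rch bad p q <-> (EX s n. Path s n p q & ~ (EX k x. opair k x <: s & bad x))"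

lemma dfn_Imm [dfnI]: "dt x ==> dt y ==> dfn (%e. Imm (x e) (y e))"
 by (rule dfn_app2) (unfold Imm_def, intro dfnI)

lemma dfn_Rch: assumes b: "dfn (%e. bad (e 0))" shows "dt x ==> dt y ==> dfn (%e. Rch bad (x e) (y e))"
 by (rule dfn_app2) (unfold Rch_def Path_def, intro dfnI dfn_app1[OF b])

lemma Rch_refl: assumes "~ bad p" shows "Rch bad p p"
proof -
 have "Path (adj emp (opair emp p)) emp p p"
  unfolding Path_def using Seq_snoc[OF Seq_emp, of p] by simp
 thus ?thesis unfolding Rch_def using assms by (intro exI conjI) auto
qed

lemma Rch_step: assumes "Rch bad p q" "Imm q' q" "~ bad q'" shows "Rch bad p q'"
proof -
 obtain s n where s: "Path s n p q" "~ (EX k x. opair k x <: s & bad x)" using assms(1) unfolding Rch_def by blast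
 have S: "Seq s (suc n)" using s(1) unfolding Path_def by blast
 hence n: "Nat n" using Nat_sucD unfolding Seq_def by blast
 have d: "opair k x <: s ==> k <: suc n" for k x by (rule Seq_dom[OF S])
 have "Path (adj s (opair (suc n) q')) (suc n) p q'"
  unfolding Path_def
 proof (intro conjI allI impI)
  show "EX m. m = suc (suc n) & Seq (adj s (opair (suc n) q')) m" using Seq_snoc[OF S] by blast
  show "EX z. z = emp & opair z p <: adj s (opair (suc n) q')" using s(1) unfolding Path_def by simp
  show "opair (suc n) q' <: adj s (opair (suc n) q')" by simp
  fix k l x y assume *: "k <: suc n & l = suc k & opair k x <: adj s (opair (suc n) q') & opair l y <: adj s (opair (suc n) q')"
  hence "k ~= suc n" using irrefl[of "suc n"] by metis
  hence x: "opair k x <: s" using * by simp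
  show "Imm y x"
  proof (cases "k = n")
   case True
   hence "x = q" using x s(1) Seq_fun[OF S] unfolding Path_def by blast
   have "~ opair (suc n) y <: s" using d irrefl by blast
   hence "y = q'" using * True by clarsimp
   thus ?thesis using \<open>x = q\<close> assms by simp
  next
   case False
   hence kn: "k <: n" using * by simp
   have l: "l = suc k" "opair l y <: adj s (opair (suc n) q')" using * by blast+
   hence "opair l y <: s" using False by simp
   thus ?thesis using s(1) kn x l(1) unfolding Path_def by blast
  qed
 qed
 thus ?thesis unfolding Rch_def using s(2) assms(3)
  by (intro exI[of _ "adj s (opair (suc n) q')"] exI[of _ "suc n"] conjI) (simp, metis mem_adj opair_inj)
qed

lemma Rch_induct:
 assumes "Rch bad p q" and P: "dfn (%e. P (e 0))" and base: "~ bad p ==> P p"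
  and step: "!!q q'. P q ==> Imm q' q ==> ~ bad q' ==> P q'"
 shows "P q"
proof -
 obtain s n where s: "Path s n p q" "~ (EX k x. opair k x <: s & bad x)" using assms(1) unfolding Rch_def by blast
 have S: "Seq s (suc n)" using s(1) unfolding Path_def by blast
 hence n: "Nat n" using Nat_sucD unfolding Seq_def by blast
 let ?Q = "%k. k <: suc n --> (ALL x. opair k x <: s --> P x)"
 have "?Q n"
 proof (rule Nat_induct[where P = ?Q, OF _ _ _ n])
  show "dfn (%e. ?Q (e 0))" by (intro dfnI dfn_app1[OF P])
  have "opair emp p <: s" using s(1) unfolding Path_def by blast
  thus "?Q emp" using base s(2) Seq_fun[OF S] by blast
  fix k assume k: "Nat k" "?Q k"
  show "?Q (suc k)"
  proof (intro impI allI)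
   fix x assume x: "suc k <: suc n" "opair (suc k) x <: s"
   have "k <: suc k" by simp
   hence kn: "k <: suc n" using Nat_trans[OF Nat_suc[OF n] x(1)] by blast
   obtain y where y: "opair k y <: s" using Seq_ex[OF S kn] by blast
   have "k ~= n" using x(1) irrefl by blast
   hence "k <: n" using kn by simp
   hence "Imm x y" using s(1) y x unfolding Path_def by blast
   thus "P x" using step[of y x] k kn y x s(2) by blast
  qed
 qed
 moreover have "opair n q <: s" using s(1) unfolding Path_def by blast
 ultimately show ?thesis by simp
qed

text \<open>Paths grow at their far end, while recursion over formulas splits off the first step.
  Inductions along the path reconcile the two; in one direction the right-hand side is the
  invariant.\<close>

lemma Rch_iff:
 assumes b: "dfn (%e. bad (e 0))"
 shows "Rch bad x q <-> ~ bad x & (q = x | (EX y. Imm y x & Rch bad y q))"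
proof
 assume r: "Rch bad x q"
 have "~ bad x" by (rule Rch_induct[OF r, where P = "%_. ~ bad x"]) (intro dfnI)
 moreover have "q = x | (EX y. Imm y x & Rch bad y q)"
 proof (rule Rch_induct[OF r, where P = "%q. q = x | (EX y. Imm y x & Rch bad y q)"])
  show "dfn (%e. e 0 = x | (EX y. Imm y x & Rch bad y (e 0)))" by (intro dfnI dfn_Rch[OF b])
  show "q' = x | (EX y. Imm y x & Rch bad y q')"
   if "q = x | (EX y. Imm y x & Rch bad y q)" "Imm q' q" "~ bad q'" for q q'
   using that Rch_refl[of bad q'] Rch_step[of bad _ q q'] by metis
 qed simp
 ultimately show "~ bad x & (q = x | (EX y. Imm y x & Rch bad y q))" by blast
next
 assume *: "~ bad x & (q = x | (EX y. Imm y x & Rch bad y q))"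
 have "Rch bad x q" if y: "Imm y x" "Rch bad y q" for y
 proof (rule Rch_induct[OF y(2), where P = "Rch bad x"])
  show "dfn (%e. Rch bad x (e 0))" by (intro dfn_Rch[OF b] dfnI)
  have x: "~ bad x" using * by simp
  show "~ bad y ==> Rch bad x y" by (rule Rch_step[OF Rch_refl[of bad, OF x] y(1)])
  show "!!q q'. Rch bad x q ==> Imm q' q ==> ~ bad q' ==> Rch bad x q'" by (rule Rch_step)
 qed
 thus "Rch bad x q" using * Rch_refl[of bad x] by metis
qed

definition Occ :: "'a => 'a => bool" where
 "Occ i q <-> (EX j. q = cMem i j | q = cMem j i | q = cEql i j | q = cEql j i)"

lemma FreeV_Rch: "FreeV i p <-> (EX q. Rch (%x. EX r. x = cAll i r) p q & Occ i q)"
 unfolding FreeV_def Rch_def Occ_def by blast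

lemma Sub_Rch: "Sub q p <-> Rch (%_. False) p q"
 unfolding Sub_def Rch_def by simp

lemma Imm_simps [simp]:
 "~ Imm x (cMem i j)" "~ Imm x (cEql i j)" "Imm x (cNeg p) <-> x = p" "Imm x (cImp p q) <-> x = p | x = q"
 "Imm x (cAll i p) <-> x = p"
 unfolding Imm_def by auto

lemma Occ_simps [simp]:
 "Occ i (cMem a b) <-> i = a | i = b" "Occ i (cEql a b) <-> i = a | i = b" "~ Occ i (cNeg p)" "~ Occ i (cImp p q)"
 "~ Occ i (cAll j p)"
 unfolding Occ_def by auto

lemma FreeV_iff: "FreeV i p <-> ~ (EX r. p = cAll i r) & (Occ i p | (EX y. Imm y p & FreeV i y))"
proof -
 have "dfn (%e. EX r. e 0 = cAll i r)" by (intro dfnI)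
 from Rch_iff[OF this, of p] show ?thesis unfolding FreeV_Rch by (simp only: ex_simps) metis
qed

lemma FreeV_simps [simp]:
 "FreeV i (cMem a b) <-> i = a | i = b" "FreeV i (cEql a b) <-> i = a | i = b"
 "FreeV i (cNeg p) <-> FreeV i p" "FreeV i (cImp p q) <-> FreeV i p | FreeV i q"
 "FreeV i (cAll j p) <-> i ~= j & FreeV i p"
 by (subst FreeV_iff, force)+

lemma FreeV_code: "FreeV x (code p) <-> (EX i:FV p. x = nn i)"
 by (induction p) auto


subsection \<open>Provability\<close>

lemma LogAx_Form: "LogAx x ==> Form x" unfolding LogAx_def by (elim disjE exE conjE) simp_all
lemma Pred_Form: "Pred x ==> Form x"
proof (unfold Pred_def, erule gen_induct)
 show "dfn (%e. Form (e 0))" by (intro dfnI)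
 show "Form y" if "Atom y" for y using that unfolding Atom_def by auto
qed auto
lemma SAx_Form: "SAx x ==> Form x" unfolding SAx_def by (elim disjE exE conjE bexE) simp_all
lemma CAx_Form: "CAx x ==> Form x" unfolding CAx_def by (elim disjE exE conjE bexE) (simp_all add: Pred_Form)

lemma Pv_log: "LogAx x ==> Pv T x" unfolding Pv_def by (rule gen_base) simp
lemma Pv_ax: "T x ==> Pv T x" unfolding Pv_def by (rule gen_base) simp
lemma Pv_Gen: "Pv T p ==> Nat i ==> Pv T (cAll i p)" unfolding Pv_def by (erule gen_1) blast
lemma Pv_MP: assumes T: "dfn (%e. T (e 0))" and "Pv T (cImp p q)" "Pv T p" shows "Pv T q"
 using assms(3,2) unfolding Pv_def
proof (rule gen_2[rotated 3])
 show "dfn (%e. LogAx (e 0) | T (e 0))" by (intro dfnI T)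
 show "dfn (%e. EX i. Nat i & e 1 = cAll i (e 0))" "dfn (%e. e 1 = cImp (e 0) (e 2))" by (intro dfnI)+
qed simp

lemma Pv_induct:
 assumes "Pv T x" "dfn (%e. P (e 0))"
  and "!!y. LogAx y ==> P y" "!!y. T y ==> P y"
  and "!!p y. Pv T (cImp p y) ==> Pv T p ==> P (cImp p y) ==> P p ==> P y"
  and "!!i p. Nat i ==> Pv T p ==> P p ==> P (cAll i p)"
 shows "P x"
proof (rule gen_induct[OF assms(1)[unfolded Pv_def] assms(2)], fold Pv_def)
 show "P y" if "LogAx y | T y" for y using that assms(3,4) by blast
 show "P y" if "Pv T p" "P p" "EX i. Nat i & y = cAll i p" for p y using that assms(6) by blast
 show "P y" if "Pv T p" "P p" "Pv T q" "P q" "q = cImp p y" for p q y using that assms(5) by blast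
qed

lemma Pv_Form: "Pv T x ==> (!!x. T x ==> Form x) ==> Form x"
 by (erule Pv_induct) (intro dfnI, auto simp: LogAx_Form)

lemma LogAxI:
 "Form p ==> Form q ==> LogAx (cImp p (cImp q p))"
 "Form p ==> Form q ==> Form r ==> LogAx (cImp (cImp p (cImp q r)) (cImp (cImp p q) (cImp p r)))"
 "Form p ==> Form q ==> LogAx (cImp (cImp (cNeg p) (cNeg q)) (cImp q p))"
 "Nat i ==> Form p ==> Form q ==> LogAx (cImp (cAll i (cImp p q)) (cImp (cAll i p) (cAll i q)))"
 "Nat i ==> Form p ==> LogAx (cImp (cAll i p) p)"
 "Nat i ==> Form p ==> ~ FreeV i p ==> LogAx (cImp p (cAll i p))"
 "Nat i ==> Nat j ==> LogAx (cEx i (cEql i j))"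
 "Nat i ==> Nat j ==> Nat k ==> LogAx (cImp (cEql i j) (cImp (cEql i k) (cEql j k)))"
 "Nat i ==> Nat j ==> Nat k ==> LogAx (cImp (cEql i j) (cImp (cMem i k) (cMem j k)))"
 "Nat i ==> Nat j ==> Nat k ==> LogAx (cImp (cEql i j) (cImp (cMem k i) (cMem k j)))"
 unfolding LogAx_def by blast+

lemma LogAx_code: "logical_axiom p ==> LogAx (code p)"
proof (induction rule: logical_axiom.induct)
 case (Q3 i p)
 hence "~ FreeV (nn i) (code p)" by (simp add: FreeV_code)
 thus ?case by (simp add: LogAxI)
qed (simp_all add: LogAxI)

lemma Pred_code: "predicative p ==> Pred (code p)"
proof (induction rule: predicative.induct)
 case (1 i j) show ?case unfolding Pred_def by (rule gen_base) (auto simp: Atom_def)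
next
 case (2 i j) show ?case unfolding Pred_def by (rule gen_base) (auto simp: Atom_def)
next
 case (3 p) thus ?case unfolding Pred_def by (elim gen_1) simp
next
 case (4 p q) thus ?case unfolding Pred_def by - (rule gen_2, (intro dfnI)+, assumption, assumption, simp)
next
 case (5 p i j)
 from 5(3) show ?case unfolding Pred_def
  by (rule gen_1) (use 5(2) in \<open>auto intro!: exI[of _ "nn i"] exI[of _ "nn j"]\<close>)
qed

lemma CAx_code: assumes "p : C_axioms" shows "CAx (code p)"
 using assms
proof cases
 case single thus ?thesis unfolding CAx_def by blast
next
 case (comprehension p' y x j)
 have "EX x y j p'. Nat x & Nat y & Nat j & x ~= y & x ~= j & Pred p' & ~ FreeV y p' &
    code p = cEx y (cAll x (cImp (cEx j (cMem x j)) (cIff (cMem x y) p')))"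
  by (rule exI[of _ "nn x"], rule exI[of _ "nn y"], rule exI[of _ "nn j"], rule exI[of _ "code p'"])
   (use comprehension in \<open>simp add: Pred_code FreeV_code\<close>)
 thus ?thesis unfolding CAx_def by blast
qed

lemma Pv_code: "T \<turnstile> p ==> dfn (%e. T' (e 0)) ==> (!!p. p : T ==> T' (code p)) ==> Pv T' (code p)"
proof (induction rule: proves.induct)
 case (MP p q)
 thus ?case using Pv_MP[of T' "code p" "code q"] by simp
qed (auto intro: Pv_log Pv_ax Pv_Gen LogAx_code)

end

section \<open>Hilbert-style derivations inside a model\<close>

locale hilb = smodel E dfn for E :: "'a => 'a => bool" (infix "<:" 50) and dfn +
 fixes T :: "'a => bool"
 assumes dT: "dfn (%e. T (e 0))" and TF: "T x ==> Form x"
begin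

text \<open>Theorems of \<open>T\<close> enter as a whole, already closed under generalization, and
  derivations from \<open>H\<close> use modus ponens alone; hence the deduction theorem has no
  condition on free variables.\<close>

definition Der :: "('a => bool) => 'a => bool" where
 "Der H = gen (%q. Pv T q | (H q & Form q)) (%_ _. False) (%p r q. r = cImp p q)"
definition Inc :: "('a => bool) => bool" where "Inc H <-> (EX q. Der H q & Der H (cNeg q))"

lemma dfn_PvT [dfnI]: "dt x ==> dfn (%e. Pv T (x e))" by (rule dfn_Pv[OF dT])

lemma dfn_Der:
 assumes "dfn (%e. H (%k. e (Suc k)) (e 0))" "dt x" shows "dfn (%e. Der (H e) (x e))"
 unfolding Der_def
 by (rule dfn_gen[where B = "%e q. Pv T q | (H e q & Form q)" and ?R1.0 = "%_ _ _. False" and ?R2.0 = "%_ p r q. r = cImp p q"])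
  (intro dfnI assms)+

lemma PvT_Form: "Pv T x ==> Form x" using Pv_Form[of T x] TF by blast

lemma Der_Pv: "Pv T q ==> Der H q" unfolding Der_def by (rule gen_base) blast
lemma Der_hyp: "H q ==> Form q ==> Der H q" unfolding Der_def by (rule gen_base) blast
lemma Der_Form: "Der H x ==> Form x"
proof (unfold Der_def, erule gen_induct)
 show "dfn (%e. Form (e 0))" by (intro dfnI)
qed (auto simp: PvT_Form)

lemma Der_induct:
 assumes "Der H x" "dfn (%e. P (e 0))" "!!y. Pv T y ==> P y" "!!y. H y ==> Form y ==> P y"
  "!!p y. Der H (cImp p y) ==> Der H p ==> P (cImp p y) ==> P p ==> P y"
 shows "P x"
 by (rule gen_induct[OF assms(1)[unfolded Der_def] assms(2)]) (use assms(3-5) in \<open>auto simp: Der_def[symmetric]\<close>)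

definition dH :: "('a => bool) => bool" where "dH H <-> dfn (%e. H (e 0))"

lemma dH_or [simp]: "dH H ==> dH H' ==> dH (%x. H x | H' x)" unfolding dH_def by (intro dfnI)
lemma dH_eq [simp]: "dH (%x. x = h)" unfolding dH_def by (intro dfnI)
lemma dH_F [simp]: "dH (%x. False)" unfolding dH_def by (intro dfnI)

lemma Der_MP: assumes "dH H" "Der H (cImp p q)" "Der H p" shows "Der H q"
 using assms(3,2) unfolding Der_def
proof (rule gen_2[rotated 3])
 show "dfn (%e. Pv T (e 0) | H (e 0) & Form (e 0))" using assms(1) unfolding dH_def by (intro dfnI)
 show "dfn (%e. e 1 = cImp (e 0) (e 2))" "dfn (%e. False)" by (intro dfnI)+
qed simp

lemma Der_mono: "dH H' ==> (!!x. H x ==> H' x) ==> Der H q ==> Der H' q"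
proof (erule Der_induct)
 assume "dH H'"
 thus "dfn (%e. Der H' (e 0))" unfolding dH_def by (intro dfn_Der[of "%_. H'"] dfnI)
qed (auto intro: Der_Pv Der_hyp Der_MP)

lemma ax1: "Form p ==> Form q ==> Der H (cImp p (cImp q p))"
 by (simp add: Der_Pv Pv_log LogAxI)
lemma ax2: "Form p ==> Form q ==> Form r ==> Der H (cImp (cImp p (cImp q r)) (cImp (cImp p q) (cImp p r)))"
 by (simp add: Der_Pv Pv_log LogAxI)
lemma ax3: "Form p ==> Form q ==> Der H (cImp (cImp (cNeg p) (cNeg q)) (cImp q p))"
 by (simp add: Der_Pv Pv_log LogAxI)
lemma axQ1: "Nat i ==> Form p ==> Form q ==> Der H (cImp (cAll i (cImp p q)) (cImp (cAll i p) (cAll i q)))"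
 by (simp add: Der_Pv Pv_log LogAxI)
lemma axQ2: "Nat i ==> Form p ==> Der H (cImp (cAll i p) p)"
 by (simp add: Der_Pv Pv_log LogAxI)
lemma axQ3: "Nat i ==> Form p ==> ~ FreeV i p ==> Der H (cImp p (cAll i p))"
 by (simp add: Der_Pv Pv_log LogAxI)
lemma axE1: "Nat i ==> Nat j ==> Der H (cEx i (cEql i j))"
 by (simp add: Der_Pv Pv_log LogAxI)
lemma axE2: "Nat i ==> Nat j ==> Nat k ==> Der H (cImp (cEql i j) (cImp (cEql i k) (cEql j k)))"
 by (simp add: Der_Pv Pv_log LogAxI)
lemma axE3: "Nat i ==> Nat j ==> Nat k ==> Der H (cImp (cEql i j) (cImp (cMem i k) (cMem j k)))"
 by (simp add: Der_Pv Pv_log LogAxI)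
lemma axE4: "Nat i ==> Nat j ==> Nat k ==> Der H (cImp (cEql i j) (cImp (cMem k i) (cMem k j)))"
 by (simp add: Der_Pv Pv_log LogAxI)

lemma imp_refl: assumes "dH H" "Form p" shows "Der H (cImp p p)"
proof -
 have "Der H (cImp (cImp p (cImp p p)) (cImp p p))"
  by (rule Der_MP[OF assms(1) ax2[of p "cImp p p" p] ax1]) (use assms in simp_all)
 thus ?thesis by (rule Der_MP[OF assms(1)]) (use assms in \<open>simp add: ax1\<close>)
qed

lemma imp_K: "dH H ==> Form p ==> Der H q ==> Der H (cImp p q)"
 by (rule Der_MP[OF _ ax1]) (auto dest: Der_Form)

lemma Deduct: assumes "dH H" "Form h" "Der (%x. H x | x = h) q" shows "Der H (cImp h q)"
 using assms(3)
proof (rule Der_induct)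
 show "dfn (%e. Der H (cImp h (e 0)))"
  using assms(1) unfolding dH_def by (intro dfn_Der[of "%_. H"] dfnI)
 show "Der H (cImp h y)" if "Pv T y" for y by (rule imp_K) (use that assms in \<open>auto intro: Der_Pv\<close>)
 show "Der H (cImp h y)" if "H y | y = h" "Form y" for y
  using that(1)
 proof
  assume "H y" thus ?thesis using imp_K[OF assms(1,2) Der_hyp] that by blast
 next
  assume "y = h" thus ?thesis using imp_refl[OF assms(1,2)] by simp
 qed
 show "Der H (cImp h y)" if "Der H (cImp h (cImp p y))" "Der H (cImp h p)" for p y
 proof -
  have "Form p" "Form y" using Der_Form[OF that(1)] by auto
  thus ?thesis using Der_MP[OF assms(1) Der_MP[OF assms(1) ax2[of h p y]]] that assms(2) by blast
 qed
qed

lemma Der_empty: "Der (%_. False) q ==> Pv T q"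
 by (erule Der_induct) (intro dfnI, auto intro: Pv_MP[OF dT])

lemma PvI1: "Der (%x. x = a) c ==> Form a ==> Pv T (cImp a c)"
 by (rule Der_empty, rule Deduct) simp_all
lemma PvI2: "Der (%x. x = a | x = b) c ==> Form a ==> Form b ==> Pv T (cImp a (cImp b c))"
 by (rule PvI1, rule Deduct) simp_all

lemma contr: assumes "dH H" "Der H p" "Der H (cNeg p)" "Form q" shows "Der H q"
proof -
 have "Der H (cImp (cNeg q) (cNeg p))" by (rule imp_K) (use assms in auto)
 hence "Der H (cImp p q)" using Der_MP[OF assms(1) ax3[of q p]] assms Der_Form[OF assms(2)] by blast
 thus ?thesis using Der_MP assms by blast
qed

text \<open>An inconsistency under \<open>cNeg p\<close> yields \<open>cNeg (cImp p p)\<close>, and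
  contraposition turns this into \<open>cImp (cImp p p) p\<close>.\<close>

lemma raa: assumes H: "dH H" and p: "Form p" and i: "Inc (%x. H x | x = cNeg p)" shows "Der H p"
proof -
 let ?H = "%x. H x | x = cNeg p"
 obtain q where q: "Der ?H q" "Der ?H (cNeg q)" using i unfolding Inc_def by blast
 have "Der ?H (cNeg (cImp p p))" by (rule contr[OF _ q]) (use H p in simp_all)
 hence "Der H (cImp (cNeg p) (cNeg (cImp p p)))" using Deduct[OF H] p by simp
 hence "Der H (cImp (cImp p p) p)" using Der_MP[OF H ax3[of p "cImp p p"]] p by simp
 thus ?thesis using Der_MP[OF H] imp_refl[OF H p] by blast
qed

lemma IncI: "Der H q ==> Der H (cNeg q) ==> Inc H" unfolding Inc_def by blast

lemma Inc_mono: "dH H' ==> (!!x. H x ==> H' x) ==> Inc H ==> Inc H'"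
 unfolding Inc_def using Der_mono[of H' H] by blast

lemma raa2: assumes H: "dH H" and p: "Form p" and i: "Inc (%x. H x | x = p)" shows "Der H (cNeg p)"
proof (rule raa[OF H])
 show "Form (cNeg p)" using p by simp
 let ?H = "%x. H x | x = cNeg (cNeg p)"
 have H': "dH ?H" using H by simp
 have "Inc (%x. ?H x | x = cNeg p)"
  by (rule IncI[of _ "cNeg p"]) (rule Der_hyp, simp, use p in simp)+
 hence "Der ?H p" by (rule raa[OF H' p])
 obtain q where q: "Der (%x. H x | x = p) q" "Der (%x. H x | x = p) (cNeg q)" using i unfolding Inc_def by blast
 have "Der H (cImp p q)" "Der H (cImp p (cNeg q))" using Deduct[OF H p] q by blast+
 hence "Der ?H (cImp p q)" "Der ?H (cImp p (cNeg q))" using Der_mono[OF H', of H] by blast+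
 thus "Inc ?H" using Der_MP[OF H'] \<open>Der ?H p\<close> IncI by blast
qed

lemma Inc_cut: assumes "dH H" "Form p" "Inc (%x. H x | x = p)" "Inc (%x. H x | x = cNeg p)" shows "Inc H"
 using raa[OF assms(1,2,4)] raa2[OF assms(1,2,3)] by (rule IncI)

lemma Der_Gen:
 assumes H: "dH H" "!!x. H x ==> ~ FreeV i x" and i: "Nat i" and "Der H q" shows "Der H (cAll i q)"
 using assms(4)
proof (rule Der_induct)
 show "dfn (%e. Der H (cAll i (e 0)))"
  using H(1) unfolding dH_def by (intro dfn_Der[of "%_. H"] dfnI)
 show "Der H (cAll i y)" if "Pv T y" for y using Der_Pv Pv_Gen that i by blast
 show "Der H (cAll i y)" if "H y" "Form y" for y using Der_MP[OF H(1) axQ3[OF i] Der_hyp] that H(2) by blast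
 show "Der H (cAll i y)" if "Der H (cImp p y)" "Der H (cAll i (cImp p y))" "Der H (cAll i p)" for p y
  using Der_MP[OF H(1) Der_MP[OF H(1) axQ1[OF i, of p y]]] that Der_Form[OF that(1)] by simp
qed

text \<open>The axiom that some \<open>z\<close> equals \<open>a\<close> justifies a fresh name for
  \<open>a\<close>: under \<open>cNeg q\<close> the equation would be refutable, and generalizing
  over \<open>z\<close> would contradict the axiom.\<close>

lemma Der_exE:
 assumes H: "dH H" "!!x. H x ==> ~ FreeV z x" and z: "Nat z" "Nat a" "z ~= a" and q: "~ FreeV z q"
  and d: "Der (%x. H x | x = cEql z a) q"
 shows "Der H q"
proof (rule raa[OF H(1)])
 have F: "Form q" using Der_Form d by blast
 thus "Form q" .
 let ?H = "%x. H x | x = cNeg q"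
 have H': "dH ?H" using H by simp
 have "Der (%x. ?H x | x = cEql z a) q" by (rule Der_mono[OF _ _ d]) (use H in auto)
 moreover have "Der (%x. ?H x | x = cEql z a) (cNeg q)" by (rule Der_hyp) (use F in auto)
 ultimately have "Inc (%x. ?H x | x = cEql z a)" by (rule IncI)
 from raa2[OF H' _ this] have "Der ?H (cNeg (cEql z a))" using z by simp
 hence "Der ?H (cAll z (cNeg (cEql z a)))"
  by (rule Der_Gen[OF H' _ z(1), rotated]) (use H q in auto)
 thus "Inc ?H" by (rule IncI) (rule axE1[OF z(1,2)])
qed

text \<open>The variable \<open>suc a\<close>, distinct from \<open>a\<close>, may be assumed equal
  to \<open>a\<close>; this equation, used twice in the euclidean law, gives reflexivity.\<close>

lemma eq_refl: assumes "Nat a" shows "Pv T (cEql a a)"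
proof (rule Der_empty, rule Der_exE[of _ "suc a" a])
 let ?H = "%x. False | x = cEql (suc a) a"
 have s: "Nat (suc a)" using assms by simp
 have h: "dH ?H" by simp
 have "Der ?H (cEql (suc a) a)" by (rule Der_hyp) (use assms in simp_all)
 thus "Der ?H (cEql a a)" using Der_MP[OF h Der_MP[OF h axE2[OF s assms assms]]] by blast
 show "suc a ~= a" using mem_suc[of a a] irrefl[of a] by metis
 thus "~ FreeV (suc a) (cEql a a)" by simp
qed (use assms in auto)

lemma eq_sym: "dH H ==> Der H (cEql a b) ==> Der H (cEql b a)"
proof -
 assume *: "dH H" "Der H (cEql a b)"
 hence n: "Nat a" "Nat b" using Der_Form[OF *(2)] by simp_all
 thus ?thesis using Der_MP[OF *(1) Der_MP[OF *(1) axE2[of a b a]]] * Der_Pv[OF eq_refl] by blast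
qed

end

section \<open>Substitution of variables inside a model\<close>

lemma the_iff: assumes "EX! x. P x" shows "q = (THE x. P x) <-> P q"
 using theI'[OF assms] the1_equality[OF assms, of q] by blast

context smodel
begin

text \<open>\<open>m\<close> bounds the free and the bound variables alike, so variables not below
  \<open>m\<close> can be substituted without capture.\<close>

definition FormB :: "'a => 'a => bool" where
 "FormB m = gen (%y. EX i j. i <: m & j <: m & (y = cMem i j | y = cEql i j))
   (%p y. y = cNeg p | (EX i. i <: m & y = cAll i p)) (%p q y. y = cImp p q)"

lemma dfn_FormB [dfnI]: assumes "dt m" "dt x" shows "dfn (%e. FormB (m e) (x e))"
proof (rule dfn_app2[OF _ assms])
 show "dfn (%e. FormB (e 0) (e 1))" unfolding FormB_def
  by (rule dfn_gen[where B = "%e y. EX i j. i <: e 0 & j <: e 0 & (y = cMem i j | y = cEql i j)"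
     and ?R1.0 = "%e p y. y = cNeg p | (EX i. i <: e 0 & y = cAll i p)" and ?R2.0 = "%e p q y. y = cImp p q"])
   (intro dfnI)+
qed

lemma FormB_intros:
 shows FormB_Mem: "i <: m ==> j <: m ==> FormB m (cMem i j)" and FormB_Eql: "i <: m ==> j <: m ==> FormB m (cEql i j)"
  and FormB_Neg: "FormB m p ==> FormB m (cNeg p)" and FormB_Imp: "FormB m p ==> FormB m q ==> FormB m (cImp p q)"
  and FormB_All: "i <: m ==> FormB m p ==> FormB m (cAll i p)"
proof -
 show "FormB m (cMem i j)" "FormB m (cEql i j)" if "i <: m" "j <: m" unfolding FormB_def
  by (rule gen_base, use that in blast)+
 show "FormB m (cNeg p)" if "FormB m p" using that unfolding FormB_def by (rule gen_1) blast
 show "FormB m (cAll i p)" if "i <: m" "FormB m p" using that(2) unfolding FormB_def by (rule gen_1) (use that in blast)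
 show "FormB m (cImp p q)" if "FormB m p" "FormB m q" using that unfolding FormB_def
  by - (rule gen_2, intro dfnI, intro dfnI, intro dfnI, assumption, assumption, rule refl)
qed

lemma FormB_induct:
 assumes "FormB m x" "dfn (%e. P (e 0))"
  and "!!i j. i <: m ==> j <: m ==> P (cMem i j)" "!!i j. i <: m ==> j <: m ==> P (cEql i j)"
  and "!!p. FormB m p ==> P p ==> P (cNeg p)" "!!p q. FormB m p ==> FormB m q ==> P p ==> P q ==> P (cImp p q)"
  and "!!i p. i <: m ==> FormB m p ==> P p ==> P (cAll i p)"
 shows "P x"
proof (rule gen_induct[OF assms(1)[unfolded FormB_def] assms(2)], fold FormB_def)
 show "P y" if "EX i j. i <: m & j <: m & (y = cMem i j | y = cEql i j)" for y using that assms(3,4) by blast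
 show "P y" if "FormB m p" "P p" "y = cNeg p | (EX i. i <: m & y = cAll i p)" for p y using that assms(5,7) by blast
 show "P y" if "FormB m p" "P p" "FormB m q" "P q" "y = cImp p q" for p q y using that assms(6) by blast
qed

lemma FormB_Form: assumes "Nat m" "FormB m p" shows "Form p"
 by (rule FormB_induct[OF assms(2)]) (intro dfnI, auto intro: Nat_mem[OF assms(1)])

lemma FormB_mono: assumes "FormB m p" "!!i. i <: m ==> i <: n" shows "FormB n p"
 by (rule FormB_induct[OF assms(1)]) (intro dfnI, auto intro: FormB_intros assms(2))

lemma Form_FormB: assumes "Form p" shows "EX m. Nat m & FormB m p"
proof (rule Form_induct[OF assms])
 show "dfn (%e. EX m. Nat m & FormB m (e 0))" by (intro dfnI)
 show "EX m. Nat m & FormB m (cMem i j)" "EX m. Nat m & FormB m (cEql i j)" if "Nat i" "Nat j" for i j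
  using Nat_max[of "suc i" "suc j"] that FormB_Mem FormB_Eql by (metis Nat_suc mem_suc)+
 show "EX m. Nat m & FormB m (cNeg p)" if "EX m. Nat m & FormB m p" for p using that FormB_Neg by blast
 show "EX m. Nat m & FormB m (cImp p q)" if "EX m. Nat m & FormB m p" "EX m. Nat m & FormB m q" for p q
  using that Nat_max FormB_Imp FormB_mono by metis
 show "EX m. Nat m & FormB m (cAll i p)" if "Nat i" "EX m. Nat m & FormB m p" for i p
  using that Nat_max[of "suc i"] FormB_All FormB_mono by (metis Nat_suc mem_suc)
qed

definition t3 :: "'a => 'a => 'a => 'a" where "t3 x y z = opair x (opair y z)"
lemma t3_inj [simp]: "t3 x y z = t3 x' y' z' <-> x = x' & y = y' & z = z'" by (simp add: t3_def)
lemma dt_t3 [dfnI]: "dt x ==> dt y ==> dt z ==> dt (%e. t3 (x e) (y e) (z e))"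
 unfolding t3_def by (intro dfnI)

text \<open>\<open>Sg p B q\<close>: replacing the free variables of \<open>p\<close> according to \<open>B\<close> yields \<open>q\<close>; bound variables are
 kept, so \<open>B\<close> must not cause captures.\<close>

definition SgB :: "'a => bool" where
 "SgB y <-> (EX i j B. Nat i & Nat j & (y = t3 (cMem i j) B (cMem (lk B i i) (lk B j j)) | y = t3 (cEql i j) B (cEql (lk B i i) (lk B j j))))"
definition Sg1 :: "'a => 'a => bool" where
 "Sg1 x y <-> (EX p B q. x = t3 p B q & y = t3 (cNeg p) B (cNeg q)) |
   (EX i p B q. Nat i & x = t3 p (upd B i i) q & y = t3 (cAll i p) B (cAll i q))"
definition Sg2 :: "'a => 'a => 'a => bool" where
 "Sg2 x x' y <-> (EX p p' B q q'. x = t3 p B q & x' = t3 p' B q' & y = t3 (cImp p p') B (cImp q q'))"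
definition Sg :: "'a => 'a => 'a => bool" where "Sg p B q <-> gen SgB Sg1 Sg2 (t3 p B q)"
definition sg :: "'a => 'a => 'a" where "sg p B = (THE q. Sg p B q | (~ (EX q. Sg p B q) & q = emp))"

lemma dfn_SgR: "dfn (%e. SgB (e 0))" "dfn (%e. Sg1 (e 0) (e 1))" "dfn (%e. Sg2 (e 0) (e 1) (e 2))"
 unfolding SgB_def Sg1_def Sg2_def by (intro dfnI)+

lemma dfn_Sg [dfnI]: "dt x ==> dt y ==> dt z ==> dfn (%e. Sg (x e) (y e) (z e))"
 unfolding Sg_def by (intro dfn_gen0 dfn_SgR dfnI)

lemma Sg_cases:
 assumes "Sg p B q"
 shows "(EX i j. Nat i & Nat j & p = cMem i j & q = cMem (lk B i i) (lk B j j)) |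
  (EX i j. Nat i & Nat j & p = cEql i j & q = cEql (lk B i i) (lk B j j)) |
  (EX p1 q1. p = cNeg p1 & q = cNeg q1 & Sg p1 B q1) |
  (EX i p1 q1. Nat i & p = cAll i p1 & q = cAll i q1 & Sg p1 (upd B i i) q1) |
  (EX p1 p2 q1 q2. p = cImp p1 p2 & q = cImp q1 q2 & Sg p1 B q1 & Sg p2 B q2)"
 using gen_cases[OF assms[unfolded Sg_def]]
proof (elim disjE exE conjE)
 assume "SgB (t3 p B q)" thus ?thesis unfolding SgB_def by auto
next
 fix x assume "gen SgB Sg1 Sg2 x" "Sg1 x (t3 p B q)" thus ?thesis unfolding Sg1_def Sg_def by auto
next
 fix x x' assume "gen SgB Sg1 Sg2 x" "gen SgB Sg1 Sg2 x'" "Sg2 x x' (t3 p B q)" thus ?thesis unfolding Sg2_def Sg_def by auto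
qed

lemma Sg_intros:
 shows "Nat i ==> Nat j ==> Sg (cMem i j) B (cMem (lk B i i) (lk B j j))"
  "Nat i ==> Nat j ==> Sg (cEql i j) B (cEql (lk B i i) (lk B j j))"
  "Sg p B q ==> Sg (cNeg p) B (cNeg q)" "Nat i ==> Sg p (upd B i i) q ==> Sg (cAll i p) B (cAll i q)"
  "Sg p B q ==> Sg p' B q' ==> Sg (cImp p p') B (cImp q q')"
proof -
 show "Nat i ==> Nat j ==> Sg (cMem i j) B (cMem (lk B i i) (lk B j j))"
  "Nat i ==> Nat j ==> Sg (cEql i j) B (cEql (lk B i i) (lk B j j))"
  unfolding Sg_def by (rule gen_base, auto simp: SgB_def)+
 show "Sg p B q ==> Sg (cNeg p) B (cNeg q)" "Nat i ==> Sg p (upd B i i) q ==> Sg (cAll i p) B (cAll i q)"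
  unfolding Sg_def by (erule gen_1, force simp: Sg1_def)+
 show "Sg p B q ==> Sg p' B q' ==> Sg (cImp p p') B (cImp q q')"
  unfolding Sg_def by (rule gen_2[OF dfn_SgR], assumption, assumption, force simp: Sg2_def)
qed

lemma Sg_inv:
 "Sg (cMem i j) B q ==> q = cMem (lk B i i) (lk B j j)" "Sg (cEql i j) B q ==> q = cEql (lk B i i) (lk B j j)"
 "Sg (cNeg p) B q ==> EX q'. q = cNeg q' & Sg p B q'" "Sg (cAll i p) B q ==> EX q'. q = cAll i q' & Sg p (upd B i i) q'"
 "Sg (cImp p p') B q ==> EX r r'. q = cImp r r' & Sg p B r & Sg p' B r'"
 by (drule Sg_cases, simp)+

lemma Sg_unique: assumes "Form p" shows "Sg p B q ==> Sg p B q' ==> q = q'"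
proof -
 have "ALL B q q'. Sg p B q --> Sg p B q' --> q = q'"
 proof (rule Form_induct[OF assms])
  show "dfn (%e. ALL B q q'. Sg (e 0) B q --> Sg (e 0) B q' --> q = q')" by (intro dfnI)
  show "ALL B q q'. Sg (cMem i j) B q --> Sg (cMem i j) B q' --> q = q'" for i j using Sg_inv(1) by blast
  show "ALL B q q'. Sg (cEql i j) B q --> Sg (cEql i j) B q' --> q = q'" for i j using Sg_inv(2) by blast
  show "ALL B q q'. Sg (cNeg p) B q --> Sg (cNeg p) B q' --> q = q'" if "ALL B q q'. Sg p B q --> Sg p B q' --> q = q'" for p
   using that Sg_inv(3) by metis
  show "ALL B q q'. Sg (cAll i p) B q --> Sg (cAll i p) B q' --> q = q'" if "ALL B q q'. Sg p B q --> Sg p B q' --> q = q'" for i p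
   using that Sg_inv(4) by metis
  show "ALL B q q'. Sg (cImp p p') B q --> Sg (cImp p p') B q' --> q = q'"
   if "ALL B q q'. Sg p B q --> Sg p B q' --> q = q'" "ALL B q q'. Sg p' B q --> Sg p' B q' --> q = q'" for p p'
   using that Sg_inv(5) by metis
 qed
 thus "Sg p B q ==> Sg p B q' ==> q = q'" by blast
qed

lemma Sg_Form: "Sg p B q ==> Form p"
proof -
 assume "Sg p B q"
 hence "ALL p' B' q'. t3 p B q = t3 p' B' q' --> Form p'" unfolding Sg_def
 proof (rule gen_induct)
  show "dfn (%e. ALL p' B' q'. e 0 = t3 p' B' q' --> Form p')" by (intro dfnI)
 qed (auto simp: SgB_def Sg1_def Sg2_def)
 thus ?thesis by blast
qed

lemma Sg_ex: assumes "Form p" shows "EX q. Sg p B q"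
proof -
 have "ALL B. EX q. Sg p B q"
 proof (rule Form_induct[OF assms])
  show "dfn (%e. ALL B. EX q. Sg (e 0) B q)" by (intro dfnI)
 qed (blast intro: Sg_intros)+
 thus ?thesis by blast
qed

lemma sg_ex1: "EX! q. Sg p B q | (~ (EX q. Sg p B q) & q = emp)"
 using Sg_unique[OF Sg_Form, of p B] by metis

lemma sg_iff: "q = sg p B <-> Sg p B q | (~ (EX q. Sg p B q) & q = emp)"
 unfolding sg_def by (rule the_iff[OF sg_ex1])

lemma dt_sg [dfnI]: "dt x ==> dt y ==> dt (%e. sg (x e) (y e))"
 by (rule dt_app2) (unfold sg_iff, intro dfnI)

lemma Sg_sg: "Form p ==> Sg p B (sg p B)" using sg_iff[of "sg p B" p B] Sg_ex by blast
lemma sgI: "Sg p B q ==> sg p B = q" using sg_iff[of q p B] by simp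

lemma sg_simps [simp]:
 "Nat i ==> Nat j ==> sg (cMem i j) B = cMem (lk B i i) (lk B j j)"
 "Nat i ==> Nat j ==> sg (cEql i j) B = cEql (lk B i i) (lk B j j)"
 "Form p ==> sg (cNeg p) B = cNeg (sg p B)"
 "Form p ==> Form q ==> sg (cImp p q) B = cImp (sg p B) (sg q B)"
 "Nat i ==> Form p ==> sg (cAll i p) B = cAll i (sg p (upd B i i))"
 by (rule sgI; intro Sg_intros Sg_sg; assumption)+

definition NB :: "'a => bool" where "NB B <-> (ALL i. Nat i --> Nat (lk B i i))"
lemma dfn_NB [dfnI]: "dt x ==> dfn (%e. NB (x e))" by (rule dfn_app1) (unfold NB_def, intro dfnI)
lemma NB_upd [simp]: "NB B ==> Nat a ==> NB (upd B i a)" unfolding NB_def by (simp add: lk_upd)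
lemma NB_emp [simp]: "NB emp" by (simp add: NB_def)

lemma Form_sg [simp]: assumes "Form p" "NB B" shows "Form (sg p B)"
proof -
 have "ALL B. NB B --> Form (sg p B)"
 proof (rule Form_induct[OF assms(1)])
  show "dfn (%e. ALL B. NB B --> Form (sg (e 0) B))" by (intro dfnI)
  show "ALL B. NB B --> Form (sg (cAll i p) B)" if "Nat i" "Form p" "ALL B. NB B --> Form (sg p B)" for i p
   using that by simp
 qed (auto simp: NB_def)
 thus ?thesis using assms by blast
qed

lemma sg_cong:
 assumes "FormB m p" "Nat m" "!!i. i <: m ==> lk B i i = lk B' i i" shows "sg p B = sg p B'"
proof -
 have n: "i <: m ==> Nat i" for i using Nat_mem[OF assms(2)] .
 have "ALL B B'. (ALL i. i <: m --> lk B i i = lk B' i i) --> sg p B = sg p B'"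
 proof (rule FormB_induct[OF assms(1)])
  show "dfn (%e. ALL B B'. (ALL i. i <: m --> lk B i i = lk B' i i) --> sg (e 0) B = sg (e 0) B')" by (intro dfnI)
 qed (auto simp: n FormB_Form[OF assms(2)] lk_upd)
 thus ?thesis using assms(3) by blast
qed

lemma sg_id:
 assumes "FormB m p" "Nat m" "!!i. i <: m ==> lk B i i = i" shows "sg p B = p"
proof -
 have n: "i <: m ==> Nat i" for i using Nat_mem[OF assms(2)] .
 have "ALL B. (ALL i. i <: m --> lk B i i = i) --> sg p B = p"
 proof (rule FormB_induct[OF assms(1)])
  show "dfn (%e. ALL B. (ALL i. i <: m --> lk B i i = i) --> sg (e 0) B = e 0)" by (intro dfnI)
 qed (auto simp: n FormB_Form[OF assms(2)] lk_upd)
 thus ?thesis using assms(3) by blast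
qed

lemma sg_fresh:
 assumes "FormB m p" "Nat m" "!!j. j <: m ==> lk B j j ~= k" shows "~ FreeV k (sg p B)"
proof -
 have n: "i <: m ==> Nat i" for i using Nat_mem[OF assms(2)] .
 have "ALL B. (ALL j. j <: m --> lk B j j ~= k) --> ~ FreeV k (sg p B)"
 proof (rule FormB_induct[OF assms(1)])
  show "dfn (%e. ALL B. (ALL j. j <: m --> lk B j j ~= k) --> ~ FreeV k (sg (e 0) B))" by (intro dfnI)
 qed (auto simp: n FormB_Form[OF assms(2)] lk_upd)
 thus ?thesis using assms(3) by blast
qed

subsection \<open>Shifting constants\<close>

text \<open>Addition enters as an inductively generated graph, which keeps it definable. It serves
  to move a constant \<open>c\<close> to the variable \<open>m + c\<close>, beyond all variables of
  the formulas at hand.\<close>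

definition Addr :: "'a => 'a => 'a => bool" where
 "Addr m c d <-> gen (%x. x = opair emp m) (%x y. EX c d. x = opair c d & y = opair (suc c) (suc d)) (%_ _ _. False) (opair c d)"

lemma dfn_Addr [dfnI]: assumes "dt m" "dt x" "dt y" shows "dfn (%e. Addr (m e) (x e) (y e))"
proof (rule dfn_app3[OF _ assms])
 show "dfn (%e. Addr (e 0) (e 1) (e 2))" unfolding Addr_def
  by (rule dfn_gen[where B = "%e x. x = opair emp (e 0)" and ?R1.0 = "%_ x y. EX c d. x = opair c d & y = opair (suc c) (suc d)"
     and ?R2.0 = "%_ _ _ _. False"]) (intro dfnI)+
qed

lemma Addr_iff:
 "Addr m c d <-> (c = emp & d = m) | (EX c' d'. Addr m c' d' & c = suc c' & d = suc d')"
proof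
 assume "Addr m c d"
 from gen_cases[OF this[unfolded Addr_def]]
 show "(c = emp & d = m) | (EX c' d'. Addr m c' d' & c = suc c' & d = suc d')" unfolding Addr_def[symmetric]
  by (auto simp: Addr_def)
next
 assume "(c = emp & d = m) | (EX c' d'. Addr m c' d' & c = suc c' & d = suc d')"
 thus "Addr m c d"
 proof (elim disjE exE conjE)
  assume "c = emp" "d = m" thus ?thesis unfolding Addr_def by (intro gen_base) simp
 next
  fix c' d' assume "Addr m c' d'" "c = suc c'" "d = suc d'"
  thus ?thesis unfolding Addr_def by (elim gen_1) blast
 qed
qed

lemma Addr_ex1: assumes "Nat c" shows "EX! d. Addr m c d"
proof (rule Nat_induct[OF _ _ _ assms])
 show "dfn (%e. EX! d. Addr m (e 0) d)" unfolding Ex1_def by (intro dfnI)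
 show "EX! d. Addr m emp d" using Addr_iff[of m emp] by auto
 show "EX! d. Addr m (suc k) d" if "EX! d. Addr m k d" for k
 proof -
  have "Addr m (suc k) x <-> (EX d. Addr m k d & x = suc d)" for x using Addr_iff[of m "suc k" x] by auto
  thus ?thesis using that by auto
 qed
qed

definition add :: "'a => 'a => 'a" where "add m c = (THE d. Addr m c d)"

lemma Addr_add: "Nat c ==> Addr m c d <-> d = add m c"
 unfolding add_def using the_iff[OF Addr_ex1] by blast

lemma add_emp [simp]: "add m emp = m"
 using Addr_add[of emp m m] Addr_iff[of m emp m] by simp

lemma add_suc [simp]: assumes "Nat c" shows "add m (suc c) = suc (add m c)"
proof -
 have "Addr m c (add m c)" using Addr_add[OF assms] by blast
 hence "Addr m (suc c) (suc (add m c))" using Addr_iff[of m "suc c" "suc (add m c)"] by blast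
 thus ?thesis using Addr_add[OF Nat_suc[OF assms]] by simp
qed

lemma Nat_add: assumes "Nat m" "Nat c" shows "Nat (add m c) & ~ add m c <: m"
proof -
 have "ALL d. Addr m c d --> Nat d & ~ d <: m"
 proof (rule Nat_induct[OF _ _ _ assms(2)])
  show "dfn (%e. ALL d. Addr m (e 0) d --> Nat d & ~ d <: m)" by (intro dfnI)
  show "ALL d. Addr m emp d --> Nat d & ~ d <: m" using assms irrefl by (simp add: Addr_add)
  show "ALL d. Addr m (suc k) d --> Nat d & ~ d <: m" if "Nat k" "ALL d. Addr m k d --> Nat d & ~ d <: m" for k
   using that Nat_trans[OF assms(1), of "suc (add m k)" "add m k"] by (auto simp: Addr_add)
 qed
 thus ?thesis using assms(2) by (simp add: Addr_add)
qed

lemma add_inj: assumes "Nat m" "Nat c" "Nat d" shows "add m c = add m d <-> c = d"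
proof -
 have lt: "add m c <: add m d" if "Nat d" "c <: d" for c d
 proof -
  have "ALL b. Addr m d b --> (ALL c a. c <: d --> Addr m c a --> a <: b)"
  proof (rule Nat_induct[OF _ _ _ that(1)])
   show "dfn (%e. ALL b. Addr m (e 0) b --> (ALL c a. c <: e 0 --> Addr m c a --> a <: b))" by (intro dfnI)
   show "ALL b. Addr m emp b --> (ALL c a. c <: emp --> Addr m c a --> a <: b)" by simp
   show "ALL b. Addr m (suc k) b --> (ALL c a. c <: suc k --> Addr m c a --> a <: b)"
    if "Nat k" "ALL b. Addr m k b --> (ALL c a. c <: k --> Addr m c a --> a <: b)" for k
    using that by (auto simp: Addr_add)
  qed
  thus ?thesis using that Nat_mem by (simp add: Addr_add)
 qed
 show ?thesis using lt[OF assms(2), of d] lt[OF assms(3), of c] Nat_linear[OF assms(2,3)] irrefl by metis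
qed

lemma dt_add: assumes "dt m" "dt c" "dfn (%e. P (%k. e (Suc k)) (e 0))"
 shows "dfn (%e. EX d. Addr (m e) (c e) d & P e d)"
 by (intro dfn_ex dfn_and assms dfn_Addr dt_shift[OF assms(1)] dt_shift[OF assms(2)] dt_var)

end

section \<open>A calculus of signed closures\<close>

context smodel
begin

text \<open>A closure pairs a formula with an assignment of natural numbers, which act as Henkin
  constants; the outer second component is the sign. Constants thus never have to be substituted
  into formulas.\<close>

definition pos :: "'a => 'a => 'a" where "pos p A = opair (opair p A) (nn 1)"
definition neg :: "'a => 'a => 'a" where "neg p A = opair (opair p A) (nn 0)"

lemma posneg [simp]: "pos p A = pos q B <-> p = q & A = B" "neg p A = neg q B <-> p = q & A = B"
 "pos p A ~= neg q B" "neg q B ~= pos p A"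
 unfolding pos_def neg_def opair_inj nn_inj by simp_all
lemma dt_posneg [dfnI]: "dt x ==> dt y ==> dt (%e. pos (x e) (y e))" "dt x ==> dt y ==> dt (%e. neg (x e) (y e))"
 unfolding pos_def neg_def by (intro dfnI | assumption)+
lemma HF_posneg [simp]: "HF p ==> HF A ==> HF (pos p A)" "HF p ==> HF A ==> HF (neg p A)"
 unfolding pos_def neg_def by simp_all

text \<open>The default \<open>emp\<close>, which is the constant 0, makes every set a total
  assignment of constants.\<close>

definition nv :: "'a => 'a => 'a" where "nv A i = (if Nat (lk A i emp) then lk A i emp else emp)"
lemma Nat_nv [simp]: "Nat (nv A i)" by (simp add: nv_def)
lemma nv_upd: "Nat a ==> nv (upd A i a) j = (if j = i then a else nv A j)" by (simp add: nv_def lk_upd)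
lemma dt_nv [dfnI]: "dt x ==> dt y ==> dt (%e. nv (x e) (y e))"
proof (rule dt_app2[of nv])
 have "z = nv A i <-> (Nat (lk A i emp) & z = lk A i emp) | (~ Nat (lk A i emp) & z = emp)" for z A i
  by (auto simp: nv_def)
 thus "dfn (%e. e 0 = nv (e 1) (e 2))" by (simp only:) (intro dfnI)
qed

definition pr :: "'a => 'a => 'a" where "pr c d = upd (upd emp (nn 0) c) (nn 1) d"
lemma dt_pr [dfnI]: "dt x ==> dt y ==> dt (%e. pr (x e) (y e))" unfolding pr_def by (intro dfnI)
lemma lk_pr [simp]: "lk (pr c d) (nn 0) k = c" "lk (pr c d) (nn 1) k = d"
 unfolding pr_def lk_upd nn_inj by simp_all
lemma nv_pr [simp]: "Nat c ==> nv (pr c d) (nn 0) = c" "Nat d ==> nv (pr c d) (nn 1) = d"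
 unfolding nv_def lk_pr by simp_all
lemma HF_pr [simp]: "HF c ==> HF d ==> HF (pr c d)" unfolding pr_def by (intro HF_upd) simp_all

text \<open>An atomic fact about constants has many closures, depending on the variables and the
  assignment chosen. The one with variables 0 and 1 under \<open>pr c d\<close> is its canonical
  form, to which \<open>Vio\<close> ties the others.\<close>

definition mem01 :: 'a where "mem01 = cMem (nn 0) (nn 1)"
definition eq01 :: 'a where "eq01 = cEql (nn 0) (nn 1)"

text \<open>An immediate conflict with a Tarski clause, with an equality law for the constants, or
  with an axiom of \<open>T\<close>, which has to be true under every assignment. The remaining
  clause, a false quantification having a witness, is the eigenvariable rule
  \<open>Ref1\<close>.\<close>

definition Vio :: "('a => bool) => 'a => bool" where
 "Vio T v <->
  (EX p A. pos p A <: v & neg p A <: v) |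
  (EX p A. pos (cNeg p) A <: v & pos p A <: v) |
  (EX p A. neg (cNeg p) A <: v & neg p A <: v) |
  (EX p q A. pos (cImp p q) A <: v & pos p A <: v & neg q A <: v) |
  (EX p q A. neg (cImp p q) A <: v & neg p A <: v) |
  (EX p q A. neg (cImp p q) A <: v & pos q A <: v) |
  (EX i p A c. Nat c & pos (cAll i p) A <: v & neg p (upd A i c) <: v) |
  (EX i j A. pos (cMem i j) A <: v & neg mem01 (pr (nv A i) (nv A j)) <: v) |
  (EX i j A. neg (cMem i j) A <: v & pos mem01 (pr (nv A i) (nv A j)) <: v) |
  (EX i j A. pos (cEql i j) A <: v & neg eq01 (pr (nv A i) (nv A j)) <: v) |
  (EX i j A. neg (cEql i j) A <: v & pos eq01 (pr (nv A i) (nv A j)) <: v) |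
  (EX c. Nat c & neg eq01 (pr c c) <: v) |
  (EX c d k. Nat c & Nat d & Nat k & pos eq01 (pr c d) <: v & pos eq01 (pr c k) <: v & neg eq01 (pr d k) <: v) |
  (EX c d k. Nat c & Nat d & Nat k & pos eq01 (pr c d) <: v & pos mem01 (pr c k) <: v & neg mem01 (pr d k) <: v) |
  (EX c d k. Nat c & Nat d & Nat k & pos eq01 (pr c d) <: v & pos mem01 (pr k c) <: v & neg mem01 (pr k d) <: v) |
  (EX p A. T p & neg p A <: v)"

definition IV :: "('a => bool) => 'a => bool" where
 "IV F v <-> HF v & (ALL x. x <: v --> (EX p A. F p & HF A & (x = pos p A | x = neg p A)))"
text \<open>The constant \<open>emp\<close> is excluded because \<open>nv\<close> returns it by
  default, so that it tacitly occurs in every assignment.\<close>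

definition fresh :: "'a => 'a => bool" where
 "fresh c v <-> Nat c & c ~= emp & (ALL p A i. pos p A <: v | neg p A <: v --> ~ opair i c <: A)"

definition Ref1 :: "('a => bool) => 'a => 'a => bool" where
 "Ref1 F w v <-> IV F v & (EX i p A c. w = adj v (neg p (upd A i c)) & neg (cAll i p) A <: v & fresh c v)"
definition Ref2 :: "('a => bool) => 'a => 'a => 'a => bool" where
 "Ref2 F w w' v <-> IV F v & (EX p A. F p & HF A & w = adj v (pos p A) & w' = adj v (neg p A))"
text \<open>A refutation calculus with immediate violations, an eigenvariable rule for false
  quantifications, and cut. As all formulas, cut formulas included, are confined to
  \<open>F\<close>, a truth predicate for \<open>F\<close> suffices for soundness.\<close>

definition Ref :: "('a => bool) => ('a => bool) => 'a => bool" where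
 "Ref T F = gen (%v. IV F v & Vio T v) (Ref1 F) (Ref2 F)"

lemma dfn_Vio: assumes T: "dfn (%e. T (e 0))" shows "dt x ==> dfn (%e. Vio T (x e))"
 by (rule dfn_app1) (unfold Vio_def, intro dfnI dfn_app1[OF T])
lemma dfn_fresh [dfnI]: "dt x ==> dt y ==> dfn (%e. fresh (x e) (y e))"
 by (rule dfn_app2) (unfold fresh_def, intro dfnI)

lemma dfn_RefU:
 assumes T: "dfn (%e. T (e 0))" and F: "dfn (%e. F (%k. e (Suc k)) (e 0))" and "dt v"
 shows "dfn (%e. Ref T (F e) (v e))"
proof -
 have F': "dfn (%e. F (%k. e (f k)) (e i))" for f i
  using dfn_ren[OF F, of "%k. if k = 0 then i else f (k - 1)"] by simp
 show ?thesis unfolding Ref_def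
  by (rule dfn_gen[where B = "%e v. IV (F e) v & Vio T v" and ?R1.0 = "%e. Ref1 (F e)" and ?R2.0 = "%e. Ref2 (F e)", OF _ _ _ assms(3)])
   (unfold Ref1_def Ref2_def IV_def, (intro dfnI dfn_Vio[OF T] F')+)
qed

lemma dfn_Ref:
 assumes T: "dfn (%e. T (e 0))" and F: "dfn (%e. F (e 0))" and "dt v"
 shows "dfn (%e. Ref T F (v e))"
 using dfn_RefU[of T "%_. F", OF T F assms(3)] by simp

lemma Ref_base: "IV F v ==> Vio T v ==> Ref T F v" unfolding Ref_def by (rule gen_base) blast
lemma Ref_eigen: "IV F v ==> neg (cAll i p) A <: v ==> fresh c v ==> Ref T F (adj v (neg p (upd A i c))) ==> Ref T F v"
 unfolding Ref_def by (erule gen_1) (unfold Ref1_def, blast)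
lemma Ref_cut:
 assumes T: "dfn (%e. T (e 0))" and F: "dfn (%e. F (e 0))"
  and "IV F v" "F p" "HF A" "Ref T F (adj v (pos p A))" "Ref T F (adj v (neg p A))"
 shows "Ref T F v"
 using assms(6,7) unfolding Ref_def
proof (rule gen_2[rotated 3])
 show "dfn (%e. IV F (e 0) & Vio T (e 0))" "dfn (%e. Ref1 F (e 0) (e 1))" "dfn (%e. Ref2 F (e 0) (e 1) (e 2))"
  unfolding IV_def Ref1_def Ref2_def by (intro dfnI dfn_Vio[OF T] dfn_app1[OF F])+
 show "Ref2 F (adj v (pos p A)) (adj v (neg p A)) v" using assms(3-5) unfolding Ref2_def by blast
qed

lemma IV_emp [simp]: "IV F emp" by (simp add: IV_def)
lemma IV_adj: "IV F v ==> F p ==> Form p ==> HF A ==> IV F (adj v (pos p A)) & IV F (adj v (neg p A))"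
 unfolding IV_def by auto
lemma IV_mem: "IV F v ==> pos p A <: v | neg p A <: v ==> F p & HF A"
 unfolding IV_def by (metis posneg)

lemma HF_bound: assumes "HF A" shows "EX m. Nat m & (ALL i c. opair i c <: A --> (Nat i --> i <: m) & (Nat c --> c <: m))"
proof (rule HF_induct[OF assms])
 show "dfn (%e. EX m. Nat m & (ALL i c. opair i c <: e 0 --> (Nat i --> i <: m) & (Nat c --> c <: m)))" by (intro dfnI)
 show "EX m. Nat m & (ALL i c. opair i c <: emp --> (Nat i --> i <: m) & (Nat c --> c <: m))" by (rule exI[of _ emp]) simp
 fix x y assume "EX m. Nat m & (ALL i c. opair i c <: x --> (Nat i --> i <: m) & (Nat c --> c <: m))"
 then obtain m where m: "Nat m" "!!i c. opair i c <: x ==> (Nat i --> i <: m) & (Nat c --> c <: m)" by blast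
 have "EX n. Nat n & (Nat i --> i <: n) & (Nat c --> c <: n) & (ALL l. l <: m --> l <: n)" for i c
 proof -
  have s: "EX n. Nat n & (Nat i --> i <: n) & (ALL l. l <: m --> l <: n)" if "Nat m" for i m
  proof (cases "Nat i")
   case True thus ?thesis using Nat_max[OF that Nat_suc[OF True]] by (metis mem_suc)
  next
   case False thus ?thesis using that by blast
  qed
  obtain n where n: "Nat n" "Nat i --> i <: n" "ALL l. l <: m --> l <: n" using s[OF m(1)] by blast
  thus ?thesis using s[OF n(1), of c] by blast
 qed
 hence "EX n. Nat n & (ALL i c. y = opair i c --> (Nat i --> i <: n) & (Nat c --> c <: n)) & (ALL l. l <: m --> l <: n)"
  using m(1) by (cases "EX i c. y = opair i c") auto
 thus "EX m. Nat m & (ALL i c. opair i c <: adj x y --> (Nat i --> i <: m) & (Nat c --> c <: m))"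
  using m(2) by (metis mem_adj)
qed

lemma fresh_ex: assumes "HF v" "IV F v" shows "EX c. fresh c v"
proof -
 have "(ALL p A. pos p A <: v | neg p A <: v --> HF A) --> (EX m. Nat m & (ALL p A i c. (pos p A <: v | neg p A <: v) & opair i c <: A --> (Nat c --> c <: m)))" (is "?P v")
 proof (rule HF_induct[OF assms(1), of ?P])
  show "dfn (%e. ?P (e 0))" by (intro dfnI)
  show "?P emp" by (intro impI exI[of _ emp]) simp
  fix x y assume IH: "?P x"
  show "?P (adj x y)"
  proof
   assume h: "ALL p A. pos p A <: adj x y | neg p A <: adj x y --> HF A"
   then obtain m where m: "Nat m" "ALL p A i c. (pos p A <: x | neg p A <: x) & opair i c <: A --> (Nat c --> c <: m)" using IH by auto
   have "EX n. Nat n & (ALL p A i c. (pos p A = y | neg p A = y) & opair i c <: A --> (Nat c --> c <: n))"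
   proof (cases "EX p A. pos p A = y | neg p A = y")
    case True
    then obtain p A where y: "pos p A = y | neg p A = y" by blast
    hence "HF A" using h by auto
    from HF_bound[OF this] obtain n where n: "Nat n" "!!i c. opair i c <: A ==> Nat c --> c <: n" by blast
    thus ?thesis using y by (metis posneg)
   qed (use m(1) in blast)
   then obtain n where n: "Nat n" "ALL p A i c. (pos p A = y | neg p A = y) & opair i c <: A --> (Nat c --> c <: n)" by blast
   then obtain k where "Nat k" "!!l. l <: m | l <: n ==> l <: k" using Nat_max[OF m(1) n(1)] by blast
   thus "EX m. Nat m & (ALL p A i c. (pos p A <: adj x y | neg p A <: adj x y) & opair i c <: A --> (Nat c --> c <: m))"
    using m(2) n(2) by (metis mem_adj)
  qed
 qed
 then obtain m where m: "Nat m" "!!p A i c. pos p A <: v | neg p A <: v ==> opair i c <: A ==> Nat c ==> c <: m"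
  using IV_mem[OF assms(2)] by blast
 hence "fresh (suc m) v" unfolding fresh_def using asym[of m "suc m"] Nat_suc suc_neq_emp(1) by (metis mem_suc)
 thus ?thesis by blast
qed

end

context hilb
begin

subsection \<open>From the closure calculus to derivations\<close>

lemma Pv_dist:
 assumes "Nat k" "Form p" "Form q" "Form a" "~ FreeV k a" "Pv T (cImp a (cImp p q))"
 shows "Pv T (cImp a (cImp (cAll k p) (cAll k q)))"
proof -
 have "Der (%x. x = a) (cImp p q)" using Der_MP[OF dH_eq Der_Pv[OF assms(6)] Der_hyp] assms(4) by blast
 hence "Der (%x. x = a) (cAll k (cImp p q))" by (rule Der_Gen[OF dH_eq _ assms(1), rotated]) (use assms in simp)
 hence "Der (%x. x = a) (cImp (cAll k p) (cAll k q))" using Der_MP[OF dH_eq axQ1] assms by blast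
 thus ?thesis by (rule PvI1) (rule assms)
qed

lemma eq_subst_atom:
 assumes n: "Nat a" "Nat b" "Nat x" "Nat y" "Nat x'" "Nat y'" and "x = x' | (x = a & x' = b)" "y = y' | (y = a & y' = b)"
 shows "Pv T (cImp (cEql a b) (cImp (cMem x y) (cMem x' y')))" "Pv T (cImp (cEql a b) (cImp (cEql x y) (cEql x' y')))"
proof -
 have h: "Der (%z. z = cEql a b | z = c) (cEql a b)" "Form c ==> Der (%z. z = cEql a b | z = c) c" for c
  by (rule Der_hyp; use n in simp)+
 show "Pv T (cImp (cEql a b) (cImp (cMem x y) (cMem x' y')))"
 proof (rule PvI2)
  let ?H = "%z. z = cEql a b | z = cMem x y"
  have H: "dH ?H" by simp
  have 1: "Der ?H (cMem x' y)" using assms(7) h(2)[of "cMem x y"] n Der_MP[OF H Der_MP[OF H axE3[of a b y] h(1)]] by auto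
  thus "Der ?H (cMem x' y')" using assms(8) n Der_MP[OF H Der_MP[OF H axE4[of a b x'] h(1)]] by auto
 qed (use n in simp_all)
 show "Pv T (cImp (cEql a b) (cImp (cEql x y) (cEql x' y')))"
 proof (rule PvI2)
  let ?H = "%z. z = cEql a b | z = cEql x y"
  have H: "dH ?H" by simp
  have e: "Der ?H (cEql u w) ==> u = a ==> Nat w ==> Der ?H (cEql b w)" for u w
   using n Der_MP[OF H Der_MP[OF H axE2[of a b w] h(1)]] by auto
  have 1: "Der ?H (cEql x' y)" using assms(7) h(2)[of "cEql x y"] n e[of x y] by auto
  show "Der ?H (cEql x' y')"
   using assms(8)
  proof
   assume "y = a & y' = b"
   thus ?thesis using eq_sym[OF H e[OF eq_sym[OF H 1]]] n by auto
  qed (use 1 in simp)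
 qed (use n in simp_all)
qed

text \<open>Both implications are carried together because negation exchanges them. The last premise
  keeps bound variables other than \<open>i\<close> away from \<open>a\<close> and \<open>b\<close>,
  so that the equation stays free when generalizing; \<open>i\<close> itself may be \<open>a\<close>
  or \<open>b\<close>, since below a quantifier over \<open>i\<close> both renamings reset
  \<open>i\<close> and coincide.\<close>

lemma Leibniz:
 assumes "FormB m p" "Nat m" "Nat a" "Nat b" "NB B" "NB B'" "i <: m"
  "!!j. j <: m ==> j ~= i ==> lk B j j = lk B' j j" "lk B i i = a" "lk B' i i = b" "!!k. k <: m ==> k ~= i ==> k ~= a & k ~= b"
 shows "Pv T (cImp (cEql a b) (cImp (sg p B) (sg p B')))" "Pv T (cImp (cEql a b) (cImp (sg p B') (sg p B)))"
proof -
 have n: "j <: m ==> Nat j" for j using Nat_mem[OF assms(2)] .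
 have fm: "FormB m p ==> Form p" for p using FormB_Form[OF assms(2)] .
 have ba: "Pv T (cImp (cEql a b) c)" if "Pv T (cImp (cEql b a) c)" for c
  by (rule PvI1, rule Der_MP[OF dH_eq Der_Pv[OF that] eq_sym[OF dH_eq Der_hyp]]) (use assms in simp_all)
 let ?R = "%B B'. NB B & NB B' & (ALL j. j <: m --> j ~= i --> lk B j j = lk B' j j) & lk B i i = a & lk B' i i = b"
 let ?P = "%p. ALL B B'. ?R B B' --> Pv T (cImp (cEql a b) (cImp (sg p B) (sg p B'))) & Pv T (cImp (cEql a b) (cImp (sg p B') (sg p B)))"
 have "?P p"
 proof (rule FormB_induct[OF assms(1), of ?P])
  show "dfn (%e. ?P (e 0))" by (intro dfnI)
  have at: "Nat (lk B j j)" "Nat (lk B' j j)" "lk B j j = lk B' j j | (lk B j j = a & lk B' j j = b)"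
   "lk B' j j = lk B j j | (lk B' j j = b & lk B j j = a)" if "?R B B'" "j <: m" for B B' j
   using that n unfolding NB_def by metis+
  show "?P (cMem j k)" if jk: "j <: m" "k <: m" for j k
  proof (intro allI impI)
   fix B B' assume R: "?R B B'"
   note 1 = at[OF R jk(1)] and 2 = at[OF R jk(2)]
   show "Pv T (cImp (cEql a b) (cImp (sg (cMem j k) B) (sg (cMem j k) B'))) & Pv T (cImp (cEql a b) (cImp (sg (cMem j k) B') (sg (cMem j k) B)))"
    using eq_subst_atom(1)[OF assms(3,4) 1(1) 2(1) 1(2) 2(2) 1(3) 2(3)]
     ba[OF eq_subst_atom(1)[OF assms(4,3) 1(2) 2(2) 1(1) 2(1) 1(4) 2(4)]] n[OF jk(1)] n[OF jk(2)] by simp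
  qed
  show "?P (cEql j k)" if jk: "j <: m" "k <: m" for j k
  proof (intro allI impI)
   fix B B' assume R: "?R B B'"
   note 1 = at[OF R jk(1)] and 2 = at[OF R jk(2)]
   show "Pv T (cImp (cEql a b) (cImp (sg (cEql j k) B) (sg (cEql j k) B'))) & Pv T (cImp (cEql a b) (cImp (sg (cEql j k) B') (sg (cEql j k) B)))"
    using eq_subst_atom(2)[OF assms(3,4) 1(1) 2(1) 1(2) 2(2) 1(3) 2(3)]
     ba[OF eq_subst_atom(2)[OF assms(4,3) 1(2) 2(2) 1(1) 2(1) 1(4) 2(4)]] n[OF jk(1)] n[OF jk(2)] by simp
  qed
  have F: "Form (cEql a b)" using assms by simp
  show "?P (cNeg p)" if "FormB m p" "?P p" for p
  proof (intro allI impI)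
   fix B B' assume R: "?R B B'"
   have c: "Pv T (cImp (cEql a b) (cImp (cNeg q) (cNeg r)))" if "Pv T (cImp (cEql a b) (cImp r q))" "Form q" "Form r" for q r
   proof (rule PvI2)
    let ?H = "%z. z = cEql a b | z = cNeg q"
    have H: "dH ?H" by simp
    have H': "dH (%x. ?H x | x = r)" by simp
    have "Der (%x. ?H x | x = r) q"
     by (rule Der_MP[OF H' Der_MP[OF H' Der_Pv[OF that(1)] Der_hyp] Der_hyp]) (use that F in auto)
    moreover have "Der (%x. ?H x | x = r) (cNeg q)" by (rule Der_hyp) (use that in auto)
    ultimately show "Der ?H (cNeg r)" using raa2[OF H that(3) IncI] by blast
   qed (use that F in auto)
   show "Pv T (cImp (cEql a b) (cImp (sg (cNeg p) B) (sg (cNeg p) B'))) & Pv T (cImp (cEql a b) (cImp (sg (cNeg p) B') (sg (cNeg p) B)))"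
    using c that R fm[OF that(1)] by auto
  qed
  show "?P (cImp p q)" if "FormB m p" "FormB m q" "?P p" "?P q" for p q
  proof (intro allI impI)
   fix B B' assume R: "?R B B'"
   have c: "Pv T (cImp (cEql a b) (cImp (cImp p q) (cImp p' q')))" if "Pv T (cImp (cEql a b) (cImp p' p))" "Pv T (cImp (cEql a b) (cImp q q'))"
    "Form p" "Form q" "Form p'" for p q p' q'
   proof (rule PvI2)
    let ?H = "%z. z = cEql a b | z = cImp p q"
    have H: "dH ?H" by simp
    let ?H' = "%x. ?H x | x = p'"
    have H': "dH ?H'" by simp
    have e: "Der ?H' (cEql a b)" by (rule Der_hyp) (use F in auto)
    have "Der ?H' p" by (rule Der_MP[OF H' Der_MP[OF H' Der_Pv[OF that(1)] e] Der_hyp]) (use that F in auto)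
    moreover have "Der ?H' (cImp p q)" by (rule Der_hyp) (use that F in auto)
    ultimately have "Der ?H' q" using Der_MP[OF H'] by blast
    hence "Der ?H' q'" using Der_MP[OF H' Der_MP[OF H' Der_Pv[OF that(2)] e]] by blast
    thus "Der ?H (cImp p' q')" by (rule Deduct[OF H that(5)])
   qed (use that F in auto)
   show "Pv T (cImp (cEql a b) (cImp (sg (cImp p q) B) (sg (cImp p q) B'))) & Pv T (cImp (cEql a b) (cImp (sg (cImp p q) B') (sg (cImp p q) B)))"
    using c that R fm[OF that(1)] fm[OF that(2)] by auto
  qed
  show "?P (cAll k p)" if k: "k <: m" and p: "FormB m p" and IH: "?P p" for k p
  proof (intro allI impI)
   fix B B' assume R: "?R B B'"
   have fp: "Form p" using fm[OF p] . have nk: "Nat k" using n[OF k] .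
   show "Pv T (cImp (cEql a b) (cImp (sg (cAll k p) B) (sg (cAll k p) B'))) & Pv T (cImp (cEql a b) (cImp (sg (cAll k p) B') (sg (cAll k p) B)))"
   proof (cases "k = i")
    case True
    have "sg p (upd B k k) = sg p (upd B' k k)" by (rule sg_cong[OF p assms(2)]) (use R True in \<open>auto simp: lk_upd\<close>)
    moreover have "Pv T (cImp (cEql a b) (cImp q q))" if "Form q" for q
     by (rule Der_empty, rule imp_K[OF dH_F F imp_refl[OF dH_F that]])
    ultimately show ?thesis using R fp nk by simp
   next
    case False
    have "?R (upd B k k) (upd B' k k)" using R False nk by (simp add: lk_upd)
    hence "Pv T (cImp (cEql a b) (cImp (sg p (upd B k k)) (sg p (upd B' k k))))" "Pv T (cImp (cEql a b) (cImp (sg p (upd B' k k)) (sg p (upd B k k))))"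
     using IH by blast+
    moreover have "~ FreeV k (cEql a b)" using assms(11)[OF k False] by simp
    ultimately show ?thesis using Pv_dist[OF nk _ _ F] R fp nk by simp
   qed
  qed
 qed
 thus "Pv T (cImp (cEql a b) (cImp (sg p B) (sg p B')))" "Pv T (cImp (cEql a b) (cImp (sg p B') (sg p B)))"
  using assms by blast+
qed

text \<open>Tarski's axioms instantiate a variable only by itself, so \<open>b\<close> is reached
  through the hypothesis \<open>i = b\<close>, Leibniz's law, and the removal of that hypothesis by
  \<open>Der_exE\<close>.\<close>

lemma inst:
 assumes p: "FormB m p" "Nat m" "i <: m" and b: "Nat b" "~ b <: m" and B: "NB B" "!!j. j <: m ==> j ~= i ==> lk B j j ~= i"
 shows "Pv T (cImp (cAll i (sg p (upd B i i))) (sg p (upd B i b)))"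
proof (rule PvI1)
 have i: "Nat i" "i ~= b" using Nat_mem[OF p(2,3)] p(3) b by auto
 have fp: "Form p" using FormB_Form p by blast
 let ?q = "sg p (upd B i i)" and ?q' = "sg p (upd B i b)"
 have F: "Form ?q" "Form ?q'" using fp B i b by simp_all
 thus "Form (cAll i ?q)" using i by simp
 have L: "Pv T (cImp (cEql i b) (cImp ?q ?q'))"
  by (rule Leibniz(1)[OF p(1,2) i(1) b(1) _ _ p(3)]) (use B i b in \<open>auto simp: lk_upd\<close>)
 let ?H = "%x. x = cAll i ?q"
 let ?H' = "%x. ?H x | x = cEql i b"
 have H': "dH ?H'" by simp
 have "Der ?H' (cAll i ?q)" by (rule Der_hyp) (use F i in auto)
 hence q: "Der ?H' ?q" using Der_MP[OF H' axQ2] i F by blast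
 have "Der ?H' (cEql i b)" by (rule Der_hyp) (use i b in auto)
 hence q': "Der ?H' ?q'" using Der_MP[OF H' Der_MP[OF H' Der_Pv[OF L]]] q by blast
 show "Der ?H ?q'"
 proof (rule Der_exE[OF dH_eq _ i(1) b(1) i(2) _ q'])
  show "~ FreeV i ?q'" by (rule sg_fresh[OF p(1,2)]) (use B i in \<open>auto simp: lk_upd\<close>)
 qed simp
qed

text \<open>Made for the eigenvariable rule: \<open>b\<close> is renamed back to \<open>i\<close>
  before generalizing over \<open>i\<close>, which is not free in the hypothesis.\<close>

lemma uninst:
 assumes p: "FormB m p" "Nat m" "i <: m" and b: "Nat b" "~ b <: m" and B: "NB B" "!!j. j <: m ==> j ~= i ==> lk B j j ~= i & lk B j j ~= b"
 shows "Pv T (cImp (cAll b (sg p (upd B i b))) (cAll i (sg p (upd B i i))))"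
proof (rule PvI1)
 have i: "Nat i" "i ~= b" using Nat_mem[OF p(2,3)] p(3) b by auto
 have fp: "Form p" using FormB_Form p by blast
 let ?q = "sg p (upd B i i)" and ?q' = "sg p (upd B i b)"
 have F: "Form ?q" "Form ?q'" using fp B i b by simp_all
 thus "Form (cAll b ?q')" using b by simp
 have L: "Pv T (cImp (cEql i b) (cImp ?q' ?q))"
  by (rule Leibniz(2)[OF p(1,2) i(1) b(1) _ _ p(3)]) (use B i b in \<open>auto simp: lk_upd\<close>)
 let ?H = "%x. x = cAll b ?q'"
 let ?H' = "%x. ?H x | x = cEql b i"
 have H': "dH ?H'" by simp
 have "Der ?H' (cAll b ?q')" by (rule Der_hyp) (use F b in auto)
 hence q': "Der ?H' ?q'" using Der_MP[OF H' axQ2] b F by blast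
 have "Der ?H' (cEql b i)" by (rule Der_hyp) (use i b in auto)
 hence "Der ?H' (cEql i b)" by (rule eq_sym[OF H'])
 hence q: "Der ?H' ?q" using Der_MP[OF H' Der_MP[OF H' Der_Pv[OF L]]] q' by blast
 have "Der ?H ?q"
 proof (rule Der_exE[OF dH_eq _ b(1) i(1) _ _ q])
  show "~ FreeV b ?q" by (rule sg_fresh[OF p(1,2)]) (use B i p(3) b in \<open>auto simp: lk_upd\<close>)
 qed (use i in simp_all)
 thus "Der ?H (cAll i ?q)"
 proof (rule Der_Gen[OF dH_eq _ i(1), rotated])
  have "~ FreeV i ?q'" by (rule sg_fresh[OF p(1,2)]) (use B i in \<open>auto simp: lk_upd\<close>)
  thus "~ FreeV i x" if "x = cAll b ?q'" for x using that by simp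
 qed
qed

end

lemma (in smodel) FormB_inv:
 assumes "FormB m p"
 shows "p = cMem i j ==> i <: m & j <: m" "p = cEql i j ==> i <: m & j <: m" "p = cNeg q ==> FormB m q"
  "p = cImp q r ==> FormB m q & FormB m r" "p = cAll i q ==> i <: m & FormB m q"
 using gen_cases[OF assms[unfolded FormB_def]] unfolding FormB_def[symmetric] by auto

context hilb
begin

text \<open>\<open>B\<close> turns the constants of a closure into variables: constant
  \<open>c\<close> becomes \<open>m + c\<close>. The graph \<open>Addr\<close> is used in place of
  the function \<open>add\<close> to keep this definable.\<close>

definition asg :: "'a => 'a => 'a => bool" where
 "asg m A B <-> (ALL j. j <: m --> Addr m (nv A j) (lk B j j))"
definition hyp :: "'a => 'a => 'a => bool" where
 "hyp m v x <-> (EX p A B. FormB m p & NB B & asg m A B & (pos p A <: v & x = sg p B | neg p A <: v & x = cNeg (sg p B)))"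

lemma asg_iff: "asg m A B <-> (ALL j. j <: m --> lk B j j = add m (nv A j))"
 unfolding asg_def by (simp add: Addr_add)

lemma asg_ex: assumes m: "Nat m" shows "EX B. NB B & asg m A B"
proof -
 have "EX B. NB B & (ALL j. j <: m --> Addr m (nv A j) (lk B j j))"
 proof (rule Nat_induct[of "%k. EX B. NB B & (ALL j. j <: k --> Addr m (nv A j) (lk B j j))", OF _ _ _ m])
  show "dfn (%e. EX B. NB B & (ALL j. j <: e 0 --> Addr m (nv A j) (lk B j j)))" by (intro dfnI)
  show "EX B. NB B & (ALL j. j <: emp --> Addr m (nv A j) (lk B j j))" by (rule exI[of _ emp]) simp
  fix k assume "Nat k" "EX B. NB B & (ALL j. j <: k --> Addr m (nv A j) (lk B j j))"
  then obtain B where "NB B" "ALL j. j <: k --> Addr m (nv A j) (lk B j j)" by blast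
  thus "EX B. NB B & (ALL j. j <: suc k --> Addr m (nv A j) (lk B j j))"
   by (intro exI[of _ "upd B k (add m (nv A k))"]) (auto simp: Addr_add lk_upd Nat_add[OF m])
 qed
 thus ?thesis unfolding asg_def .
qed

text \<open>The simultaneous substitution is carried out one variable at a time. The new variables
  are not below \<open>m\<close>, so they are neither captured nor replaced again by a later
  step.\<close>

lemma Pv_inst:
 assumes p: "Pv T p" "FormB m p" and m: "Nat m" and B: "NB B" "asg m A B"
 shows "Pv T (sg p B)"
proof -
 let ?Q = "%k. k = m | k <: m --> (ALL B. NB B & (ALL j. j <: k --> Addr m (nv A j) (lk B j j)) &
  (ALL j. j <: m & ~ j <: k --> lk B j j = j) --> Pv T (sg p B))"
 have "?Q m"
 proof (rule Nat_induct[of ?Q, OF _ _ _ m])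
  show "dfn (%e. ?Q (e 0))" by (intro dfnI)
  show "?Q emp" using p(1) sg_id[OF p(2) m] by auto
  fix k assume k: "Nat k" "?Q k"
  show "?Q (suc k)"
  proof (intro impI allI)
   fix B assume le: "suc k = m | suc k <: m"
    and R: "NB B & (ALL j. j <: suc k --> Addr m (nv A j) (lk B j j)) & (ALL j. j <: m & ~ j <: suc k --> lk B j j = j)"
   have km: "k <: m" using le Nat_trans[OF m, of "suc k" k] by auto
   let ?b = "add m (nv A k)"
   have b: "Nat ?b" "~ ?b <: m" using Nat_add[OF m] by auto
   have "NB (upd B k k) & (ALL j. j <: k --> Addr m (nv A j) (lk (upd B k k) j j)) & (ALL j. j <: m & ~ j <: k --> lk (upd B k k) j j = j)"
    using R k(1) irrefl[of k] by (auto simp: lk_upd)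
   hence "Pv T (sg p (upd B k k))" using k(2) km by blast
   hence "Pv T (cAll k (sg p (upd B k k)))" using Pv_Gen k(1) by blast
   moreover have "lk B j j ~= k" if "j <: m" "j ~= k" for j
   proof (cases "j <: k")
    case True
    hence "lk B j j = add m (nv A j)" using R by (simp add: Addr_add)
    thus ?thesis using Nat_add[OF m, of "nv A j"] km by auto
   next
    case False thus ?thesis using R that by auto
   qed
   ultimately have "Pv T (sg p (upd B k ?b))"
    using Pv_MP[OF dT inst[OF p(2) m km b]] R by blast
   moreover have "sg p (upd B k ?b) = sg p B"
    by (rule sg_cong[OF p(2) m]) (use R in \<open>auto simp: lk_upd Addr_add\<close>)
   ultimately show "Pv T (sg p B)" by simp
  qed
 qed
 thus ?thesis using B unfolding asg_def by blast
qed

lemma asg_upd: "asg m A B ==> Nat c ==> asg m (upd A i c) (upd B i (add m c))"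
 unfolding asg_iff by (simp add: lk_upd nv_upd)

lemma dfn_hyp [dfnI]: "dt x ==> dt y ==> dt z ==> dfn (%e. hyp (x e) (y e) (z e))"
 by (rule dfn_app3) (unfold hyp_def asg_def, intro dfnI)
lemma dH_hyp [simp]: "dH (hyp m v)" unfolding dH_def by (intro dfnI)

lemma IV_bound: assumes "IV F v" "!!x. F x ==> Form x" shows "EX m. Nat m & (ALL p A. pos p A <: v | neg p A <: v --> FormB m p)"
proof -
 let ?P = "%v. (ALL p A. pos p A <: v | neg p A <: v --> Form p) --> (EX m. Nat m & (ALL p A. pos p A <: v | neg p A <: v --> FormB m p))"
 have "?P v"
 proof (rule HF_induct[of v ?P])
  show "HF v" using assms unfolding IV_def by blast
  show "dfn (%e. ?P (e 0))" by (intro dfnI)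
  show "?P emp" by (intro impI exI[of _ emp]) simp
  fix x y assume IH: "?P x"
  show "?P (adj x y)"
  proof
   assume h: "ALL p A. pos p A <: adj x y | neg p A <: adj x y --> Form p"
   then obtain m where m: "Nat m" "ALL p A. pos p A <: x | neg p A <: x --> FormB m p" using IH by auto
   have "EX n. Nat n & (ALL p A. pos p A = y | neg p A = y --> FormB n p)"
   proof (cases "EX p A. pos p A = y | neg p A = y")
    case True
    then obtain p A where y: "pos p A = y | neg p A = y" by blast
    hence "Form p" using h by auto
    from Form_FormB[OF this] show ?thesis using y by (metis posneg)
   qed (use m(1) in blast)
   then obtain n where n: "Nat n" "ALL p A. pos p A = y | neg p A = y --> FormB n p" by blast
   obtain k where k: "Nat k" "!!l. l <: m | l <: n ==> l <: k" using Nat_max[OF m(1) n(1)] by blast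
   have "FormB k p" if "pos p A <: adj x y | neg p A <: adj x y" for p A
    using that m(2) n(2) k(2) FormB_mono[of m p k] FormB_mono[of n p k] by (metis mem_adj)
   thus "EX m. Nat m & (ALL p A. pos p A <: adj x y | neg p A <: adj x y --> FormB m p)" using k(1) by blast
  qed
 qed
 thus ?thesis using IV_mem[OF assms(1)] assms(2) by blast
qed

lemma Vio_Inc:
 assumes v: "Vio T v" and m: "Nat m" "nn 0 <: m" "nn 1 <: m" and bd: "!!p A. pos p A <: v | neg p A <: v ==> FormB m p"
 shows "Inc (hyp m v)"
proof -
 let ?H = "hyp m v"
 have F: "FormB m p ==> Form p" for p using FormB_Form[OF m(1)] .
 have P: "Der ?H (sg p B)" if "pos p A <: v" "NB B" "asg m A B" for p A B
  by (rule Der_hyp, unfold hyp_def) (use that bd F in blast, use that bd F in \<open>auto intro: Form_sg\<close>)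
 have N: "Der ?H (cNeg (sg p B))" if "neg p A <: v" "NB B" "asg m A B" for p A B
  by (rule Der_hyp, unfold hyp_def) (use that bd F in blast, use that bd F in \<open>auto intro: Form_sg\<close>)
 have F': "Form p" if "pos p A <: v | neg p A <: v" for p A using that bd F by blast
 have B: "EX B. NB B & asg m A B" for A using asg_ex[OF m(1)] .
 \<comment> \<open>The canonical atomic formulas contain the variables 0 and 1, which have to lie
   below \<open>m\<close> for \<open>asg\<close> to govern them.\<close>
 have e01: "sg mem01 B = cMem (add m c) (add m d)" "sg eq01 B = cEql (add m c) (add m d)"
  if "asg m (pr c d) B" "Nat c" "Nat d" for B c d
  using that m unfolding asg_iff mem01_def eq01_def by (simp_all del: nn.simps One_nat_def)
 have eP: "Der ?H (cEql (add m c) (add m d))" if "pos eq01 (pr c d) <: v" "Nat c" "Nat d" for c d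
  using P[OF that(1)] B[of "pr c d"] e01(2) that by metis
 have eN: "Der ?H (cNeg (cEql (add m c) (add m d)))" if "neg eq01 (pr c d) <: v" "Nat c" "Nat d" for c d
  using N[OF that(1)] B[of "pr c d"] e01(2) that by metis
 have mP: "Der ?H (cMem (add m c) (add m d))" if "pos mem01 (pr c d) <: v" "Nat c" "Nat d" for c d
  using P[OF that(1)] B[of "pr c d"] e01(1) that by metis
 have mN: "Der ?H (cNeg (cMem (add m c) (add m d)))" if "neg mem01 (pr c d) <: v" "Nat c" "Nat d" for c d
  using N[OF that(1)] B[of "pr c d"] e01(1) that by metis
 have na: "Nat c ==> Nat (add m c)" for c using Nat_add[OF m(1)] by blast
 have sm: "sg (cMem i j) B = cMem (add m (nv A i)) (add m (nv A j))" if "pos (cMem i j) A <: v | neg (cMem i j) A <: v" "asg m A B" for i j A B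
  using FormB_inv(1)[OF bd[OF that(1)] refl] that(2) Nat_mem[OF m(1)] unfolding asg_iff by simp
 have se: "sg (cEql i j) B = cEql (add m (nv A i)) (add m (nv A j))" if "pos (cEql i j) A <: v | neg (cEql i j) A <: v" "asg m A B" for i j A B
  using FormB_inv(2)[OF bd[OF that(1)] refl] that(2) Nat_mem[OF m(1)] unfolding asg_iff by simp
 have MP: "Der ?H (cImp p q) ==> Der ?H p ==> Der ?H q" for p q by (rule Der_MP[OF dH_hyp])
 from v show ?thesis unfolding Vio_def
 proof (elim disjE exE conjE)
  fix p A assume "pos p A <: v" "neg p A <: v" thus ?thesis using P N B[of A] IncI by blast
 next
  fix p A assume *: "pos (cNeg p) A <: v" "pos p A <: v"
  obtain C where C: "NB C" "asg m A C" using B by blast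
  have "sg (cNeg p) C = cNeg (sg p C)" using F'[of p A] * by simp
  thus ?thesis using P[OF *(1) C] P[OF *(2) C] IncI by metis
 next
  fix p A assume *: "neg (cNeg p) A <: v" "neg p A <: v"
  obtain C where C: "NB C" "asg m A C" using B by blast
  have "sg (cNeg p) C = cNeg (sg p C)" using F'[of p A] * by simp
  thus ?thesis using N[OF *(1) C] N[OF *(2) C] IncI by metis
 next
  fix p q A assume *: "pos (cImp p q) A <: v" "pos p A <: v" "neg q A <: v"
  obtain C where C: "NB C" "asg m A C" using B by blast
  have "sg (cImp p q) C = cImp (sg p C) (sg q C)" using F'[of "cImp p q" A] * by simp
  thus ?thesis using P[OF *(1) C] P[OF *(2) C] N[OF *(3) C] MP IncI by metis
 next
  fix p q A assume *: "neg (cImp p q) A <: v" "neg p A <: v"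
  obtain C where C: "NB C" "asg m A C" using B by blast
  have f: "Form p" "Form q" using F'[of "cImp p q" A] * by simp_all
  have e: "sg (cImp p q) C = cImp (sg p C) (sg q C)" using f by simp
  let ?H' = "%x. ?H x | x = sg p C"
  have H': "dH ?H'" by simp
  have 1: "Der ?H' (cNeg (sg p C))" by (rule Der_mono[OF H' _ N[OF *(2) C]]) (rule disjI1)
  have 2: "Der ?H' (sg p C)" by (rule Der_hyp) (simp_all add: f C)
  have "Der ?H' (sg q C)" by (rule contr[OF H' 2 1 Form_sg[OF f(2) C(1)]])
  hence "Der ?H (cImp (sg p C) (sg q C))" by (rule Deduct[OF dH_hyp, rotated]) (use f C in simp)
  thus ?thesis using N[OF *(1) C] e IncI by metis
 next
  fix p q A assume *: "neg (cImp p q) A <: v" "pos q A <: v"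
  obtain C where C: "NB C" "asg m A C" using B by blast
  have f: "Form p" "Form q" using F'[of "cImp p q" A] * by simp_all
  have e: "sg (cImp p q) C = cImp (sg p C) (sg q C)" using f by simp
  have "Der ?H (cImp (sg p C) (sg q C))" by (rule imp_K[OF dH_hyp _ P[OF *(2) C]]) (use f C in simp)
  thus ?thesis using N[OF *(1) C] e IncI by metis
 next
  fix i p A c assume *: "Nat c" "pos (cAll i p) A <: v" "neg p (upd A i c) <: v"
  obtain C where C: "NB C" "asg m A C" using B by blast
  have i: "i <: m" "FormB m p" using FormB_inv(5)[of m "cAll i p"] bd *(2) by blast+
  have f: "Nat i" "Form p" using F'[of "cAll i p" A] * by simp_all
  have b: "Nat (add m c)" "~ add m c <: m" using Nat_add[OF m(1) *(1)] by auto
  have "lk C j j ~= i" if "j <: m" for j using that C(2) Nat_add[OF m(1) Nat_nv, of A j] i(1) unfolding asg_iff by auto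
  hence "Pv T (cImp (cAll i (sg p (upd C i i))) (sg p (upd C i (add m c))))" using inst[OF i(2) m(1) i(1) b C(1)] by blast
  moreover have "Der ?H (cAll i (sg p (upd C i i)))" using P[OF *(2) C] f by simp
  ultimately have "Der ?H (sg p (upd C i (add m c)))" using MP Der_Pv by blast
  moreover have "Der ?H (cNeg (sg p (upd C i (add m c))))" using N[OF *(3) _ asg_upd[OF C(2) *(1)]] C(1) b by simp
  ultimately show ?thesis by (rule IncI)
 next
  fix i j A assume *: "pos (cMem i j) A <: v" "neg mem01 (pr (nv A i) (nv A j)) <: v"
  thus ?thesis using P[OF *(1)] B[of A] sm[of i j A] mN[OF *(2)] IncI by (metis Nat_nv)
 next
  fix i j A assume *: "neg (cMem i j) A <: v" "pos mem01 (pr (nv A i) (nv A j)) <: v"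
  thus ?thesis using N[OF *(1)] B[of A] sm[of i j A] mP[OF *(2)] IncI by (metis Nat_nv)
 next
  fix i j A assume *: "pos (cEql i j) A <: v" "neg eq01 (pr (nv A i) (nv A j)) <: v"
  thus ?thesis using P[OF *(1)] B[of A] se[of i j A] eN[OF *(2)] IncI by (metis Nat_nv)
 next
  fix i j A assume *: "neg (cEql i j) A <: v" "pos eq01 (pr (nv A i) (nv A j)) <: v"
  thus ?thesis using N[OF *(1)] B[of A] se[of i j A] eP[OF *(2)] IncI by (metis Nat_nv)
 next
  fix c assume "Nat c" "neg eq01 (pr c c) <: v"
  thus ?thesis using eN Der_Pv[OF eq_refl[OF na]] IncI by blast
 next
  fix c d k assume "Nat c" "Nat d" "Nat k" "pos eq01 (pr c d) <: v" "pos eq01 (pr c k) <: v" "neg eq01 (pr d k) <: v"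
  thus ?thesis using MP[OF MP[OF axE2 eP] eP] eN[of d k] IncI na by blast
 next
  fix c d k assume "Nat c" "Nat d" "Nat k" "pos eq01 (pr c d) <: v" "pos mem01 (pr c k) <: v" "neg mem01 (pr d k) <: v"
  thus ?thesis using MP[OF MP[OF axE3 eP] mP] mN[of d k] IncI na by blast
 next
  fix c d k assume "Nat c" "Nat d" "Nat k" "pos eq01 (pr c d) <: v" "pos mem01 (pr k c) <: v" "neg mem01 (pr k d) <: v"
  thus ?thesis using MP[OF MP[OF axE4 eP] mP] mN[of k d] IncI na by blast
 next
  fix p A assume *: "T p" "neg p A <: v"
  obtain C where C: "NB C" "asg m A C" using B by blast
  have "FormB m p" using bd *(2) by blast
  thus ?thesis using Der_Pv[OF Pv_inst[OF Pv_ax[of T, OF *(1)] _ m(1) C]] N[OF *(2) C] IncI by blast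
 qed
qed

text \<open>Each rule becomes a derivation once \<open>m\<close> exceeds all variables involved: cut
  is a case distinction, and the eigenvariable rule generalizes over the variable
  \<open>m + c\<close>. Different premises come with different bounds, so the claim is for all
  sufficiently large \<open>m\<close>.\<close>

lemma Ref_Inc:
 assumes R: "Ref T F v" and F: "!!x. F x ==> Form x"
 shows "EX m0. Nat m0 & (ALL m. Nat m & m0 <: m --> Inc (hyp m v))" (is "?P v")
proof (rule gen_induct[of _ _ _ v ?P, OF R[unfolded Ref_def]], fold Ref_def)
 show "dfn (%e. ?P (e 0))" unfolding Inc_def by (intro dfnI dfn_Der)
 have up: "EX k. Nat k & (ALL m. Nat m & k <: m --> a <: m & b <: m)" if ab: "Nat a" "Nat b" for a b
 proof -
  obtain k where "Nat k" "!!l. l <: suc a | l <: suc b ==> l <: k" using Nat_max[OF Nat_suc[OF ab(1)] Nat_suc[OF ab(2)]] by blast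
  thus ?thesis using Nat_trans by (metis mem_suc)
 qed
 show "?P v" if v: "IV F v & Vio T v" for v
 proof -
  obtain a where a: "Nat a" "!!p A. pos p A <: v | neg p A <: v ==> FormB a p" using IV_bound[of F v] F v by blast
  obtain k where k: "Nat k" "!!m. Nat m ==> k <: m ==> a <: m & nn 2 <: m" using up[OF a(1) Nat_nn[of 2]] by blast
  have "Inc (hyp m v)" if "Nat m" "k <: m" for m
  proof (rule Vio_Inc)
   have "nn 2 <: m" using k that by blast
   moreover have "nn 0 <: nn 2" "nn 1 <: nn 2" by (simp_all add: numeral_2_eq_2)
   ultimately show "nn 0 <: m" "nn 1 <: m" using Nat_trans[OF that(1)] by blast+
   show "FormB m p" if "pos p A <: v | neg p A <: v" for p A
    using FormB_mono[OF a(2)[OF that]] k \<open>Nat m\<close> \<open>k <: m\<close> Nat_trans by blast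
  qed (use that v in auto)
  thus ?thesis using k(1) by blast
 qed
 show "?P v" if h: "Ref T F w" "?P w" "Ref1 F w v" for w v
 proof -
  obtain i p A c where *: "IV F v" "w = adj v (neg p (upd A i c))" "neg (cAll i p) A <: v" "fresh c v"
   using h(3) unfolding Ref1_def by blast
  obtain m1 where m1: "Nat m1" "!!m. Nat m ==> m1 <: m ==> Inc (hyp m w)" using h(2) by blast
  obtain a where a: "Nat a" "!!p A. pos p A <: v | neg p A <: v ==> FormB a p" using IV_bound[of F v] F * by blast
  obtain k where k: "Nat k" "!!m. Nat m ==> k <: m ==> a <: m & m1 <: m" using up[OF a(1) m1(1)] by blast
  have "Inc (hyp m v)" if m: "Nat m" "k <: m" for m
  proof -
   have bd: "FormB m p" if "pos p A <: v | neg p A <: v" for p A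
    using FormB_mono[OF a(2)[OF that]] k m Nat_trans by blast
   have i: "i <: m" "FormB m p" using FormB_inv(5)[OF bd refl] *(3) by blast+
   have f: "Nat i" "Form p" using i FormB_Form[OF m(1)] Nat_mem[OF m(1)] by blast+
   obtain C where C: "NB C" "asg m A C" using asg_ex[OF m(1)] by blast
   have c: "Nat c" "c ~= emp" using *(4) unfolding fresh_def by auto
   let ?b = "add m c"
   have b: "Nat ?b" "~ ?b <: m" using Nat_add[OF m(1) c(1)] by auto
   \<comment> \<open>Freshness of \<open>c\<close>, together with \<open>c ~= emp\<close> for the
     default value, keeps the variable \<open>m + c\<close> out of all translated closures of
     \<open>v\<close>.\<close>
   have nb: "lk B' j j ~= ?b & lk B' j j ~= i" if "pos p' A' <: v | neg p' A' <: v" "asg m A' B'" "j <: m" for p' A' B' j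
   proof -
    have "nv A' j ~= c" using *(4) that(1) c(2) lk_cases[of A' j emp] unfolding fresh_def nv_def by metis
    moreover have "lk B' j j = add m (nv A' j)" using that unfolding asg_iff by blast
    ultimately show ?thesis using add_inj[OF m(1) Nat_nv c(1)] Nat_add[OF m(1) Nat_nv] i(1) by metis
   qed
   have fr: "~ FreeV ?b x" if "hyp m v x" for x
    using that sg_fresh[OF _ m(1)] nb unfolding hyp_def by (metis FreeV_simps(3))
   let ?q = "sg p (upd C i ?b)"
   \<comment> \<open>Renamings that belong to the same assignment agree below \<open>m\<close>, so
     the new closure contributes the single formula \<open>cNeg ?q\<close>.\<close>
   have "hyp m w x ==> hyp m v x | x = cNeg ?q" for x
   proof -
    assume "hyp m w x"
    then obtain p' A' B' where h: "FormB m p'" "NB B'" "asg m A' B'" "pos p' A' <: w & x = sg p' B' | neg p' A' <: w & x = cNeg (sg p' B')"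
     unfolding hyp_def by blast
    show ?thesis
    proof (cases "neg p' A' = neg p (upd A i c)")
     case True
     have "asg m (upd A i c) (upd C i ?b)" by (rule asg_upd[OF C(2) c(1)])
     moreover have e: "p' = p" "A' = upd A i c" using True by simp_all
     ultimately have "sg p B' = ?q" using h(3) by (intro sg_cong[OF i(2) m(1)]) (simp add: asg_iff)
     hence "sg p' B' = ?q" using e by simp
     moreover have "x = cNeg (sg p' B') | hyp m v x" using h *(2) unfolding hyp_def by auto
     ultimately show ?thesis by auto
    next
     case False
     thus ?thesis using h *(2) unfolding hyp_def by auto
    qed
   qed
   hence "Inc (%x. hyp m v x | x = cNeg ?q)" using Inc_mono[OF _ _ m1(2)[OF m(1)]] k m by simp
   hence "Der (hyp m v) ?q" by (rule raa[OF dH_hyp, rotated]) (use f C b in simp)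
   hence "Der (hyp m v) (cAll ?b ?q)" by (rule Der_Gen[OF dH_hyp _ b(1), rotated]) (rule fr)
   moreover have "Pv T (cImp (cAll ?b ?q) (cAll i (sg p (upd C i i))))"
    by (rule uninst[OF i(2) m(1) i(1) b C(1)]) (use nb *(3) C(2) in blast)
   ultimately have "Der (hyp m v) (sg (cAll i p) C)" using Der_MP[OF dH_hyp Der_Pv] f by simp
   moreover have "Der (hyp m v) (cNeg (sg (cAll i p) C))"
    by (rule Der_hyp, unfold hyp_def) (use *(3) C bd in blast, use f C in simp)
   ultimately show ?thesis by (rule IncI)
  qed
  thus ?thesis using k(1) by blast
 qed
 show "?P v" if h: "Ref T F w" "?P w" "Ref T F w'" "?P w'" "Ref2 F w w' v" for w w' v
 proof -
  obtain p A where *: "F p" "w = adj v (pos p A)" "w' = adj v (neg p A)" using h(5) unfolding Ref2_def by blast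
  obtain m1 where m1: "Nat m1" "!!m. Nat m ==> m1 <: m ==> Inc (hyp m w)" using h(2) by blast
  obtain m2 where m2: "Nat m2" "!!m. Nat m ==> m2 <: m ==> Inc (hyp m w')" using h(4) by blast
  obtain a where a: "Nat a" "FormB a p" using Form_FormB F *(1) by blast
  obtain k1 where k1: "Nat k1" "!!m. Nat m ==> k1 <: m ==> m1 <: m & m2 <: m" using up[OF m1(1) m2(1)] by blast
  obtain k where k: "Nat k" "!!m. Nat m ==> k <: m ==> k1 <: m & a <: m" using up[OF k1(1) a(1)] by blast
  have "Inc (hyp m v)" if m: "Nat m" "k <: m" for m
  proof -
   have p: "FormB m p" using FormB_mono[OF a(2)] k m Nat_trans by blast
   obtain C where C: "NB C" "asg m A C" using asg_ex[OF m(1)] by blast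
   have sgu: "asg m A B ==> sg p B = sg p C" for B
    by (rule sg_cong[OF p m(1)]) (use C(2) in \<open>simp add: asg_iff\<close>)
   have "hyp m w x ==> hyp m v x | x = sg p C" for x
   proof -
    assume "hyp m w x"
    then obtain p' A' B' where h: "FormB m p'" "NB B'" "asg m A' B'" "pos p' A' <: w & x = sg p' B' | neg p' A' <: w & x = cNeg (sg p' B')"
     unfolding hyp_def by blast
    have "(pos p' A' <: v & x = sg p' B' | neg p' A' <: v & x = cNeg (sg p' B')) | p' = p & A' = A & x = sg p' B'"
     using h(4) *(2) by auto
    thus "hyp m v x | x = sg p C"
    proof
     assume "pos p' A' <: v & x = sg p' B' | neg p' A' <: v & x = cNeg (sg p' B')"
     thus ?thesis using h(1-3) unfolding hyp_def by blast
    next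
     assume "p' = p & A' = A & x = sg p' B'"
     thus ?thesis using sgu[of B'] h(3) by simp
    qed
   qed
   moreover have "hyp m w' x ==> hyp m v x | x = cNeg (sg p C)" for x
   proof -
    assume "hyp m w' x"
    then obtain p' A' B' where h: "FormB m p'" "NB B'" "asg m A' B'" "pos p' A' <: w' & x = sg p' B' | neg p' A' <: w' & x = cNeg (sg p' B')"
     unfolding hyp_def by blast
    have "(pos p' A' <: v & x = sg p' B' | neg p' A' <: v & x = cNeg (sg p' B')) | p' = p & A' = A & x = cNeg (sg p' B')"
     using h(4) *(3) by auto
    thus "hyp m v x | x = cNeg (sg p C)"
    proof
     assume "pos p' A' <: v & x = sg p' B' | neg p' A' <: v & x = cNeg (sg p' B')"
     thus ?thesis using h(1-3) unfolding hyp_def by blast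
    next
     assume "p' = p & A' = A & x = cNeg (sg p' B')"
     thus ?thesis using sgu[of B'] h(3) by simp
    qed
   qed
   moreover have "Inc (hyp m w)" "Inc (hyp m w')" using m1(2) m2(2) k1(2) k(2) m by blast+
   ultimately have "Inc (%x. hyp m v x | x = sg p C)" "Inc (%x. hyp m v x | x = cNeg (sg p C))"
    using Inc_mono[of "%x. hyp m v x | x = sg p C" "hyp m w"] Inc_mono[of "%x. hyp m v x | x = cNeg (sg p C)" "hyp m w'"] by simp_all
   thus ?thesis by (rule Inc_cut[OF dH_hyp, rotated]) (use p m C FormB_Form in simp)
  qed
  thus ?thesis using k(1) by blast
 qed
qed

lemma Con_not_Ref: assumes "Con T" "!!x. F x ==> Form x" shows "~ Ref T F emp"
proof
 assume "Ref T F emp"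
 from Ref_Inc[OF this assms(2)] obtain m where m: "Nat m" "Inc (hyp m emp)" using Nat_suc by (metis mem_suc)
 have "Inc (%_. False)" by (rule Inc_mono[OF _ _ m(2)]) (auto simp: hyp_def)
 thus False using assms(1) Der_empty unfolding Inc_def Con_def by blast
qed

end

section \<open>Structures with a satisfaction predicate\<close>

locale tarski = smodel E dfn for E :: "'a => 'a => bool" (infix "<:" 50) and dfn +
 fixes F D :: "'a => bool" and d0 :: 'a and Mr Er V :: "'a => 'a => bool"
 assumes dF: "dfn (%e. F (e 0))" and dD: "dfn (%e. D (e 0))" and dMr: "dfn (%e. Mr (e 0) (e 1))"
  and dEr: "dfn (%e. Er (e 0) (e 1))" and dV: "dfn (%e. V (e 0) (e 1))"
  and HFD: "D c ==> HF c" and Dd0: "D d0"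
  and FForm: "F p ==> Form p" and FImm: "F p ==> Imm q p ==> F q"
  and Er_refl: "D c ==> Er c c"
  and Er_E: "D c ==> D d ==> D k ==> Er c d ==> Er c k ==> Er d k"
  and Mr_l: "D c ==> D d ==> D k ==> Er c d ==> Mr c k ==> Mr d k"
  and Mr_r: "D c ==> D d ==> D k ==> Er c d ==> Mr k c ==> Mr k d"
  and V_Mem0: "F (cMem i j) ==> HF B ==> V (cMem i j) B <->
   Mr (if D (lk B i d0) then lk B i d0 else d0) (if D (lk B j d0) then lk B j d0 else d0)"
  and V_Eql0: "F (cEql i j) ==> HF B ==> V (cEql i j) B <->
   Er (if D (lk B i d0) then lk B i d0 else d0) (if D (lk B j d0) then lk B j d0 else d0)"
  and V_Neg: "F (cNeg p) ==> HF B ==> V (cNeg p) B <-> ~ V p B"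
  and V_Imp: "F (cImp p q) ==> HF B ==> V (cImp p q) B <-> (V p B --> V q B)"
  and V_All: "F (cAll i p) ==> HF B ==> V (cAll i p) B <-> (ALL c. D c --> V p (upd B i c))"
begin

definition vl :: "'a => 'a => 'a" where "vl B i = (if D (lk B i d0) then lk B i d0 else d0)"

lemmas V_Mem = V_Mem0[folded vl_def] and V_Eql = V_Eql0[folded vl_def]

lemma D_vl [simp]: "D (vl B i)" by (simp add: vl_def Dd0)
lemma vl_upd: "D a ==> vl (upd B i a) j = (if j = i then a else vl B j)" by (simp add: vl_def lk_upd)

lemma dD' [dfnI]: "dt x ==> dfn (%e. D (x e))" by (rule dfn_app1[OF dD])
lemma dF' [dfnI]: "dt x ==> dfn (%e. F (x e))" by (rule dfn_app1[OF dF])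
lemma dMr' [dfnI]: "dt x ==> dt y ==> dfn (%e. Mr (x e) (y e))" by (rule dfn_app2[OF dMr])
lemma dEr' [dfnI]: "dt x ==> dt y ==> dfn (%e. Er (x e) (y e))" by (rule dfn_app2[OF dEr])
lemma dV' [dfnI]: "dt x ==> dt y ==> dfn (%e. V (x e) (y e))" by (rule dfn_app2[OF dV])

lemma dt_vl [dfnI]: "dt x ==> dt y ==> dt (%e. vl (x e) (y e))"
proof (rule dt_app2[of vl])
 have "z = vl A i <-> (D (lk A i d0) & z = lk A i d0) | (~ D (lk A i d0) & z = d0)" for z A i
  by (auto simp: vl_def)
 thus "dfn (%e. e 0 = vl (e 1) (e 2))" by (simp only:) (intro dfnI)
qed

lemma Er_sym: "D c ==> D d ==> Er c d ==> Er d c" using Er_E[of c d c] Er_refl by blast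
lemma Er_trans: "D c ==> D d ==> D k ==> Er c d ==> Er d k ==> Er c k" using Er_E[of d c k] Er_sym by blast

lemma V_cong:
 assumes "F p" "HF B" "HF B'" "!!i. FreeV i p ==> Er (vl B i) (vl B' i)" shows "V p B <-> V p B'"
proof -
 let ?P = "%p. F p --> (ALL B B'. HF B & HF B' & (ALL i. FreeV i p --> Er (vl B i) (vl B' i)) --> (V p B <-> V p B'))"
 have "?P p"
 proof (rule Form_induct[OF FForm[OF assms(1)], of ?P])
  show "dfn (%e. ?P (e 0))" by (intro dfnI)
  show "?P (cMem i j)" for i j
  proof (intro impI allI)
   fix B B' assume f: "F (cMem i j)" and R: "HF B & HF B' & (ALL k. FreeV k (cMem i j) --> Er (vl B k) (vl B' k))"
   hence "Er (vl B i) (vl B' i)" "Er (vl B j) (vl B' j)" by auto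
   moreover from this have "Er (vl B' i) (vl B i)" "Er (vl B' j) (vl B j)" using Er_sym by auto
   ultimately have "Mr (vl B i) (vl B j) <-> Mr (vl B' i) (vl B' j)" using Mr_l Mr_r by (meson D_vl)
   thus "V (cMem i j) B <-> V (cMem i j) B'" using V_Mem[OF f] R by simp
  qed
  show "?P (cEql i j)" for i j
  proof (intro impI allI)
   fix B B' assume f: "F (cEql i j)" and R: "HF B & HF B' & (ALL k. FreeV k (cEql i j) --> Er (vl B k) (vl B' k))"
   hence "Er (vl B i) (vl B' i)" "Er (vl B j) (vl B' j)" by auto
   moreover from this have "Er (vl B' i) (vl B i)" "Er (vl B' j) (vl B j)" using Er_sym by auto
   ultimately have "Er (vl B i) (vl B j) <-> Er (vl B' i) (vl B' j)" using Er_trans by (meson D_vl)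
   thus "V (cEql i j) B <-> V (cEql i j) B'" using V_Eql[OF f] R by simp
  qed
  show "?P (cNeg p)" if "?P p" for p using that V_Neg FImm[of "cNeg p"] by simp
  show "?P (cImp p q)" if "?P p" "?P q" for p q
  proof (intro impI allI)
   fix B B' assume f: "F (cImp p q)" and R: "HF B & HF B' & (ALL k. FreeV k (cImp p q) --> Er (vl B k) (vl B' k))"
   have "F p" "F q" using FImm[OF f] by auto
   hence "V p B <-> V p B'" "V q B <-> V q B'" using that R by auto
   thus "V (cImp p q) B <-> V (cImp p q) B'" using V_Imp[OF f] R by simp
  qed
  show "?P (cAll i p)" if "Nat i" "?P p" for i p
  proof (intro impI allI)
   fix B B' assume f: "F (cAll i p)" and R: "HF B & HF B' & (ALL k. FreeV k (cAll i p) --> Er (vl B k) (vl B' k))"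
   have p: "F p" using FImm[OF f] by auto
   have "V p (upd B i c) <-> V p (upd B' i c)" if "D c" for c
   proof -
    have "HF (upd B i c) & HF (upd B' i c) & (ALL k. FreeV k p --> Er (vl (upd B i c) k) (vl (upd B' i c) k))"
     using R that HFD \<open>Nat i\<close> Er_refl by (auto simp: vl_upd)
    thus ?thesis using p \<open>?P p\<close> by blast
   qed
   thus "V (cAll i p) B <-> V (cAll i p) B'" using V_All[OF f] R by simp
  qed
 qed
 thus ?thesis using assms by blast
qed

text \<open>A finite choice, made by an internal induction on \<open>m\<close>.\<close>

lemma ex_assignment:
 assumes G: "dfn (%e. G (e 0) (e 1))" and ex: "!!j. Nat j ==> EX c. D c & G j c" and m: "Nat m"
 shows "EX B. HF B & (ALL j. j <: m --> G j (vl B j))"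
proof (rule Nat_induct[of "%m. EX B. HF B & (ALL j. j <: m --> G j (vl B j))", OF _ _ _ m])
 show "dfn (%e. EX B. HF B & (ALL j. j <: e 0 --> G j (vl B j)))" by (intro dfnI dfn_app2[OF G])
 show "EX B. HF B & (ALL j. j <: emp --> G j (vl B j))" by (rule exI[of _ emp]) simp
 fix k assume k: "Nat k" "EX B. HF B & (ALL j. j <: k --> G j (vl B j))"
 then obtain B where B: "HF B" "!!j. j <: k ==> G j (vl B j)" by blast
 obtain c where c: "D c" "G k c" using ex k by blast
 have "HF (upd B k c)" using B k c HFD by simp
 moreover have "ALL j. j <: suc k --> G j (vl (upd B k c) j)" using B c irrefl by (auto simp: vl_upd)
 ultimately show "EX B. HF B & (ALL j. j <: suc k --> G j (vl B j))" by blast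
qed

lemma FreeV_bound: assumes "Form p" shows "EX m. Nat m & (ALL i. FreeV i p --> i <: m)"
proof -
 obtain m where m: "Nat m" "FormB m p" using Form_FormB[OF assms] by blast
 have "ALL i. FreeV i p --> i <: m" by (rule FormB_induct[OF m(2)]) (intro dfnI, auto)
 thus ?thesis using m by blast
qed

text \<open>A closure is realized through an interpretation \<open>I\<close> of its constants in the structure.\<close>

definition comp :: "'a => 'a => 'a => 'a => bool" where
 "comp I p A B <-> HF B & (ALL i. FreeV i p --> vl B i = vl I (nv A i))"
definition bad :: "'a => 'a => bool" where
 "bad I v <-> (EX p A B. comp I p A B & ((pos p A <: v & ~ V p B) | (neg p A <: v & V p B)))"

lemma comp_ex: assumes "Form p" shows "EX B. comp I p A B"
proof -
 obtain m where m: "Nat m" "ALL i. FreeV i p --> i <: m" using FreeV_bound[OF assms] by blast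
 have "EX B. HF B & (ALL j. j <: m --> vl I (nv A j) = vl B j)"
  by (rule ex_assignment[of "%j c. vl I (nv A j) = c", OF _ _ m(1)]) (intro dfnI, auto)
 thus ?thesis unfolding comp_def using m(2) by metis
qed

lemma Vio_bad:
 assumes v: "IV F v" "Vio T v" and T: "!!p B. T p ==> F p ==> HF B ==> V p B"
 shows "bad I v"
proof (rule ccontr)
 assume nb: "~ bad I v"
 have P: "V p B" if "pos p A <: v" "comp I p A B" for p A B using nb that unfolding bad_def by blast
 have N: "~ V p B" if "neg p A <: v" "comp I p A B" for p A B using nb that unfolding bad_def by blast
 have F: "F p" if "pos p A <: v | neg p A <: v" for p A using IV_mem[OF v(1) that] by blast
 have ex: "EX B. comp I p A B" if "pos p A <: v | neg p A <: v" for p A using comp_ex[OF FForm[OF F[OF that]]] .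
 have Fm: "Form p" if "pos p A <: v | neg p A <: v" for p A using FForm[OF F[OF that]] .
 have hf: "HF B" if "comp I p A B" for p A B using that unfolding comp_def by blast
 define W where "W = (%c. vl I c)"
 have c01: "EX B. comp I p (pr c d) B & vl B (nn 0) = W c & vl B (nn 1) = W d"
  if "p = mem01 | p = eq01" "Nat c" "Nat d" for p c d
 proof -
  have f: "Form p" "FreeV (nn 0) p" "FreeV (nn 1) p" using that(1) by (auto simp: mem01_def eq01_def simp del: nn.simps One_nat_def)
  obtain B where B: "comp I p (pr c d) B" using comp_ex[OF f(1)] by blast
  hence "vl B (nn 0) = W c" "vl B (nn 1) = W d"
   using f that unfolding comp_def W_def by (metis nv_pr)+
  thus ?thesis using B by blast
 qed
 have eP: "Er (W c) (W d)" if "pos eq01 (pr c d) <: v" "Nat c" "Nat d" for c d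
  using c01[of eq01 c d] P[OF that(1)] V_Eql[of "nn 0" "nn 1"] F[of eq01] that hf unfolding eq01_def by metis
 have eN: "~ Er (W c) (W d)" if "neg eq01 (pr c d) <: v" "Nat c" "Nat d" for c d
  using c01[of eq01 c d] N[OF that(1)] V_Eql[of "nn 0" "nn 1"] F[of eq01] that hf unfolding eq01_def by metis
 have mP: "Mr (W c) (W d)" if "pos mem01 (pr c d) <: v" "Nat c" "Nat d" for c d
  using c01[of mem01 c d] P[OF that(1)] V_Mem[of "nn 0" "nn 1"] F[of mem01] that hf unfolding mem01_def by metis
 have mN: "~ Mr (W c) (W d)" if "neg mem01 (pr c d) <: v" "Nat c" "Nat d" for c d
  using c01[of mem01 c d] N[OF that(1)] V_Mem[of "nn 0" "nn 1"] F[of mem01] that hf unfolding mem01_def by metis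
 have W: "D (W c)" for c unfolding W_def by simp
 from v(2) show False unfolding Vio_def
 proof (elim disjE exE conjE)
  fix p A assume "pos p A <: v" "neg p A <: v" thus ?thesis using P N ex by blast
 next
  fix p A assume *: "pos (cNeg p) A <: v" "pos p A <: v"
  obtain B where B: "comp I (cNeg p) A B" using ex * by blast
  hence "comp I p A B" unfolding comp_def by simp
  thus ?thesis using P[OF *(1) B] P[OF *(2)] V_Neg[OF F hf[OF B]] * by blast
 next
  fix p A assume *: "neg (cNeg p) A <: v" "neg p A <: v"
  obtain B where B: "comp I (cNeg p) A B" using ex * by blast
  hence "comp I p A B" unfolding comp_def by simp
  thus ?thesis using N[OF *(1) B] N[OF *(2)] V_Neg[OF F hf[OF B]] * by blast
 next
  fix p q A assume *: "pos (cImp p q) A <: v" "pos p A <: v" "neg q A <: v"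
  obtain B where B: "comp I (cImp p q) A B" using ex * by blast
  hence "comp I p A B" "comp I q A B" unfolding comp_def by simp_all
  thus ?thesis using P[OF *(1) B] P[OF *(2)] N[OF *(3)] V_Imp[OF F hf[OF B]] * by blast
 next
  fix p q A assume *: "neg (cImp p q) A <: v" "neg p A <: v"
  obtain B where B: "comp I (cImp p q) A B" using ex * by blast
  hence "comp I p A B" unfolding comp_def by simp
  thus ?thesis using N[OF *(1) B] N[OF *(2)] V_Imp[OF F hf[OF B]] * by blast
 next
  fix p q A assume *: "neg (cImp p q) A <: v" "pos q A <: v"
  obtain B where B: "comp I (cImp p q) A B" using ex * by blast
  hence "comp I q A B" unfolding comp_def by simp
  thus ?thesis using N[OF *(1) B] P[OF *(2)] V_Imp[OF F hf[OF B]] * by blast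
 next
  fix i p A c assume *: "Nat c" "pos (cAll i p) A <: v" "neg p (upd A i c) <: v"
  obtain B where B: "comp I (cAll i p) A B" using ex * by blast
  have "Nat i" using Fm[of "cAll i p" A] * by simp
  hence "comp I p (upd A i c) (upd B i (W c))" using B W HFD *(1) unfolding comp_def W_def by (auto simp: vl_upd nv_upd)
  thus ?thesis using P[OF *(2) B] N[OF *(3)] V_All[OF F hf[OF B]] * W by blast
 next
  fix i j A assume *: "pos (cMem i j) A <: v" "neg mem01 (pr (nv A i) (nv A j)) <: v"
  obtain B where B: "comp I (cMem i j) A B" using ex * by blast
  hence "vl B i = W (nv A i)" "vl B j = W (nv A j)" unfolding comp_def W_def by simp_all
  thus ?thesis using P[OF *(1) B] mN[OF *(2)] V_Mem[of i j B] F[of "cMem i j" A] hf[OF B] * by auto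
 next
  fix i j A assume *: "neg (cMem i j) A <: v" "pos mem01 (pr (nv A i) (nv A j)) <: v"
  obtain B where B: "comp I (cMem i j) A B" using ex * by blast
  hence "vl B i = W (nv A i)" "vl B j = W (nv A j)" unfolding comp_def W_def by simp_all
  thus ?thesis using N[OF *(1) B] mP[OF *(2)] V_Mem[of i j B] F[of "cMem i j" A] hf[OF B] * by auto
 next
  fix i j A assume *: "pos (cEql i j) A <: v" "neg eq01 (pr (nv A i) (nv A j)) <: v"
  obtain B where B: "comp I (cEql i j) A B" using ex * by blast
  hence "vl B i = W (nv A i)" "vl B j = W (nv A j)" unfolding comp_def W_def by simp_all
  thus ?thesis using P[OF *(1) B] eN[OF *(2)] V_Eql[of i j B] F[of "cEql i j" A] hf[OF B] * by auto
 next
  fix i j A assume *: "neg (cEql i j) A <: v" "pos eq01 (pr (nv A i) (nv A j)) <: v"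
  obtain B where B: "comp I (cEql i j) A B" using ex * by blast
  hence "vl B i = W (nv A i)" "vl B j = W (nv A j)" unfolding comp_def W_def by simp_all
  thus ?thesis using N[OF *(1) B] eP[OF *(2)] V_Eql[of i j B] F[of "cEql i j" A] hf[OF B] * by auto
 next
  fix c assume "Nat c" "neg eq01 (pr c c) <: v"
  thus ?thesis using eN Er_refl[OF W] by blast
 next
  fix c d k assume "Nat c" "Nat d" "Nat k" "pos eq01 (pr c d) <: v" "pos eq01 (pr c k) <: v" "neg eq01 (pr d k) <: v"
  thus ?thesis using eP[of c d] eP[of c k] eN[of d k] Er_E[OF W W W] by blast
 next
  fix c d k assume "Nat c" "Nat d" "Nat k" "pos eq01 (pr c d) <: v" "pos mem01 (pr c k) <: v" "neg mem01 (pr d k) <: v"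
  thus ?thesis using eP[of c d] mP[of c k] mN[of d k] Mr_l[OF W W W] by blast
 next
  fix c d k assume "Nat c" "Nat d" "Nat k" "pos eq01 (pr c d) <: v" "pos mem01 (pr k c) <: v" "neg mem01 (pr k d) <: v"
  thus ?thesis using eP[of c d] mP[of k c] mN[of k d] Mr_r[OF W W W] by blast
 next
  fix p A assume *: "T p" "neg p A <: v"
  obtain B where B: "comp I p A B" using ex * by blast
  show ?thesis using N[OF *(2) B] T[OF *(1) F hf[OF B]] * by blast
 qed
qed

text \<open>Soundness: a refuted set contains a false closure under every interpretation
  \<open>I\<close> of its constants. The quantifier over \<open>I\<close> belongs to the induction,
  because the eigenvariable rule changes the interpretation.\<close>

lemma not_Ref:
 assumes T: "!!p B. T p ==> F p ==> HF B ==> V p B"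
 shows "~ Ref T F emp"
proof
 assume R: "Ref T F emp"
 have "ALL I. HF I --> bad I emp"
 proof (rule gen_induct[of _ _ _ emp "%v. ALL I. HF I --> bad I v", OF R[unfolded Ref_def]], fold Ref_def)
  show "dfn (%e. ALL I. HF I --> bad I (e 0))" unfolding bad_def comp_def by (intro dfnI)
  show "ALL I. HF I --> bad I v" if "IV F v & Vio T v" for v using Vio_bad[of v T] T that by blast
  show "ALL I. HF I --> bad I v" if h: "ALL I. HF I --> bad I w" "Ref1 F w v" for w v
  proof (intro allI impI)
   fix I assume I: "HF I"
   obtain i p A c where *: "IV F v" "w = adj v (neg p (upd A i c))" "neg (cAll i p) A <: v" "fresh c v"
    using h(2) unfolding Ref1_def by blast
   have f: "F (cAll i p)" "F p" using IV_mem[OF *(1)] *(3) FImm[of "cAll i p" p] by auto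
   have n: "Nat i" "Form p" using FForm[OF f(1)] by simp_all
   have c: "Nat c" "c ~= emp" using *(4) unfolding fresh_def by auto
   obtain B where B: "comp I (cAll i p) A B" using comp_ex FForm[OF f(1)] by blast
   show "bad I v"
   proof (cases "V (cAll i p) B")
    case True thus ?thesis unfolding bad_def using B *(3) by blast
   next
    case False
    then obtain d where d: "D d" "~ V p (upd B i d)" using V_All[OF f(1)] B unfolding comp_def by blast
    \<comment> \<open>The fresh constant is reinterpreted as the counterexample \<open>d\<close>;
      this affects no closure of \<open>v\<close>.\<close>
    let ?I = "upd I c d"
    have "HF ?I" using I c d HFD by simp
    then obtain q A' B' where b: "comp ?I q A' B'" "(pos q A' <: w & ~ V q B') | (neg q A' <: w & V q B')"
     using h(1) unfolding bad_def by blast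
    show ?thesis
    proof (cases "(pos q A' <: v & ~ V q B') | (neg q A' <: v & V q B')")
     case True
     have "nv A' j ~= c" for j using *(4) True c(2) lk_cases[of A' j emp] unfolding fresh_def nv_def by metis
     hence "comp I q A' B'" using b(1) d(1) unfolding comp_def by (simp add: vl_upd)
     thus ?thesis unfolding bad_def using True by blast
    next
     case False
     hence q: "q = p" "A' = upd A i c" "V p B'" using b(2) *(2) by auto
     have "nv A j ~= c" for j using *(4) *(3) c(2) lk_cases[of A j emp] unfolding fresh_def nv_def by metis
     hence "vl B' j = vl (upd B i d) j" if "FreeV j p" for j
      using b(1) B that d(1) c(1) unfolding comp_def q by (simp add: vl_upd nv_upd)
     moreover have "HF B'" "HF (upd B i d)" using b(1) B n d HFD unfolding comp_def by simp_all
     ultimately have "V p B' = V p (upd B i d)" using V_cong[OF f(2)] Er_refl by (metis D_vl)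
     thus ?thesis using d q by blast
    qed
   qed
  qed
  show "ALL I. HF I --> bad I v" if h: "ALL I. HF I --> bad I w" "ALL I. HF I --> bad I w'" "Ref2 F w w' v" for w w' v
  proof (intro allI impI)
   fix I assume I: "HF I"
   obtain p A where *: "F p" "w = adj v (pos p A)" "w' = adj v (neg p A)" using h(3) unfolding Ref2_def by blast
   show "bad I v"
   proof (rule ccontr)
    assume nb: "~ bad I v"
    obtain B where B: "comp I p A B" "~ V p B" using h(1) I nb unfolding bad_def *(2) mem_adj by (metis posneg)
    obtain B' where B': "comp I p A B'" "V p B'" using h(2) I nb unfolding bad_def *(3) mem_adj by (metis posneg)
    have "V p B = V p B'" using V_cong[OF *(1)] B B' Er_refl unfolding comp_def by (metis D_vl)
    thus False using B B' by blast
   qed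
  qed
 qed
 hence "bad emp emp" using HF_emp by blast
 thus False unfolding bad_def by simp
qed

end

section \<open>Model existence\<close>

context smodel
begin

text \<open>\<open>St n N a b\<close>: step \<open>n\<close> of a counter running for each \<open>N\<close> through all \<open>a, b\<close> below \<open>N\<close>;
 it serves as a pairing function.\<close>

definition St :: "'a => 'a => 'a => 'a => bool" where
 "St n N a b <-> gen (%x. x = opair emp (t3 (suc emp) emp emp))
   (%x y. EX n N a b. x = opair n (t3 N a b) &
    ((suc b <: N & y = opair (suc n) (t3 N a (suc b))) |
     (~ suc b <: N & suc a <: N & y = opair (suc n) (t3 N (suc a) emp)) |
     (~ suc b <: N & ~ suc a <: N & y = opair (suc n) (t3 (suc N) emp emp)))) (%_ _ _. False) (opair n (t3 N a b))"

lemma dfn_St: "dfn (%e. St (e i) (e j) (e k) (e l))"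
 unfolding St_def by (intro dfn_gen0 dfnI)

lemma St_iff: "St n N a b <-> (n = emp & N = suc emp & a = emp & b = emp) |
 (EX n' N' a' b'. St n' N' a' b' & n = suc n' &
  ((suc b' <: N' & N = N' & a = a' & b = suc b') | (~ suc b' <: N' & suc a' <: N' & N = N' & a = suc a' & b = emp) |
   (~ suc b' <: N' & ~ suc a' <: N' & N = suc N' & a = emp & b = emp)))" (is "_ <-> ?R")
proof
 assume "St n N a b"
 from gen_cases[OF this[unfolded St_def]] show ?R
 proof (elim disjE exE conjE)
  assume "opair n (t3 N a b) = opair emp (t3 (suc emp) emp emp)" thus ?R by simp
 qed (auto simp: St_def)
next
 assume ?R
 thus "St n N a b"
 proof (elim disjE)
  assume "n = emp & N = suc emp & a = emp & b = emp" thus ?thesis unfolding St_def by (intro gen_base) simp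
 next
  assume "EX n' N' a' b'. St n' N' a' b' & n = suc n' &
  ((suc b' <: N' & N = N' & a = a' & b = suc b') | (~ suc b' <: N' & suc a' <: N' & N = N' & a = suc a' & b = emp) |
   (~ suc b' <: N' & ~ suc a' <: N' & N = suc N' & a = emp & b = emp))"
  then obtain n' N' a' b' where s: "St n' N' a' b'" "n = suc n'" "(suc b' <: N' & N = N' & a = a' & b = suc b') | (~ suc b' <: N' & suc a' <: N' & N = N' & a = suc a' & b = emp) |
   (~ suc b' <: N' & ~ suc a' <: N' & N = suc N' & a = emp & b = emp)" by blast
  show ?thesis using s(1) unfolding St_def
   by (rule gen_1) (rule exI[of _ n'], rule exI[of _ N'], rule exI[of _ a'], rule exI[of _ b'], use s(2,3) in auto)
 qed
qed

lemma St_props: assumes "Nat n"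
 shows "St n N a b ==> Nat N & a <: N & b <: N & N <: suc (suc n)" "St n N a b ==> St n N' a' b' ==> N = N' & a = a' & b = b'"
proof -
 have "ALL N a b. St n N a b --> Nat N & a <: N & b <: N & N <: suc (suc n)"
 proof (rule Nat_induct[of "%n. ALL N a b. St n N a b --> Nat N & a <: N & b <: N & N <: suc (suc n)", OF _ _ _ assms])
  show "dfn (%e. ALL N a b. St (e 0) N a b --> Nat N & a <: N & b <: N & N <: suc (suc (e 0)))" by (intro dfnI dfn_St)
  show "ALL N a b. St emp N a b --> Nat N & a <: N & b <: N & N <: suc (suc emp)"
   by (intro allI impI, subst (asm) St_iff) auto
  fix k assume k: "Nat k" "ALL N a b. St k N a b --> Nat N & a <: N & b <: N & N <: suc (suc k)"
  show "ALL N a b. St (suc k) N a b --> Nat N & a <: N & b <: N & N <: suc (suc (suc k))"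
  proof (intro allI impI)
   fix N a b assume "St (suc k) N a b"
   then obtain N' a' b' where s: "St k N' a' b'" "(suc b' <: N' & N = N' & a = a' & b = suc b') | (~ suc b' <: N' & suc a' <: N' & N = N' & a = suc a' & b = emp) |
   (~ suc b' <: N' & ~ suc a' <: N' & N = suc N' & a = emp & b = emp)" using St_iff[of "suc k" N a b] by auto
   have i: "Nat N'" "a' <: N'" "b' <: N'" "N' <: suc (suc k)" using k(2) s(1) by blast+
   have e: "emp <: N'" "emp <: suc N'" using i Nat_linear[OF i(1) Nat_emp] by auto
   have l: "suc N' = suc (suc k) | suc N' <: suc (suc k)" using suc_le[OF _ i(4)] k(1) by simp
   show "Nat N & a <: N & b <: N & N <: suc (suc (suc k))" using s(2)
   proof (elim disjE conjE)
    assume "suc b' <: N'" "N = N'" "a = a'" "b = suc b'" thus ?thesis using i by simp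
   next
    assume "~ suc b' <: N'" "suc a' <: N'" "N = N'" "a = suc a'" "b = emp" thus ?thesis using i e by simp
   next
    assume "~ suc b' <: N'" "~ suc a' <: N'" "N = suc N'" "a = emp" "b = emp"
    thus ?thesis using Nat_suc[OF i(1)] e(2) l by auto
   qed
  qed
 qed
 thus 1: "St n N a b ==> Nat N & a <: N & b <: N & N <: suc (suc n)" by blast
 have "ALL N a b N' a' b'. St n N a b --> St n N' a' b' --> N = N' & a = a' & b = b'"
 proof (rule Nat_induct[of "%n. ALL N a b N' a' b'. St n N a b --> St n N' a' b' --> N = N' & a = a' & b = b'", OF _ _ _ assms])
  show "dfn (%e. ALL N a b N' a' b'. St (e 0) N a b --> St (e 0) N' a' b' --> N = N' & a = a' & b = b')" by (intro dfnI dfn_St)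
  show "ALL N a b N' a' b'. St emp N a b --> St emp N' a' b' --> N = N' & a = a' & b = b'"
   using St_iff[of emp] by simp
  fix k assume k: "Nat k" "ALL N a b N' a' b'. St k N a b --> St k N' a' b' --> N = N' & a = a' & b = b'"
  show "ALL N a b N' a' b'. St (suc k) N a b --> St (suc k) N' a' b' --> N = N' & a = a' & b = b'"
  proof (intro allI impI)
   fix N a b N' a' b' assume *: "St (suc k) N a b" "St (suc k) N' a' b'"
   obtain M c d where s: "St k M c d" "(suc d <: M & N = M & a = c & b = suc d) | (~ suc d <: M & suc c <: M & N = M & a = suc c & b = emp) |
    (~ suc d <: M & ~ suc c <: M & N = suc M & a = emp & b = emp)" using St_iff[of "suc k" N a b] *(1) by auto
   obtain M' c' d' where s': "St k M' c' d'" "(suc d' <: M' & N' = M' & a' = c' & b' = suc d') | (~ suc d' <: M' & suc c' <: M' & N' = M' & a' = suc c' & b' = emp) |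
    (~ suc d' <: M' & ~ suc c' <: M' & N' = suc M' & a' = emp & b' = emp)" using St_iff[of "suc k" N' a' b'] *(2) by auto
   have "M = M' & c = c' & d = d'" using k(2) s(1) s'(1) by blast
   thus "N = N' & a = a' & b = b'" using s(2) s'(2) by auto
  qed
 qed
 thus "St n N a b ==> St n N' a' b' ==> N = N' & a = a' & b = b'" by blast
qed

lemma St_Nat: "St n N a b ==> Nat n"
proof -
 assume "St n N a b"
 hence "ALL m z. opair n (t3 N a b) = opair m z --> Nat m" unfolding St_def
 proof (rule gen_induct)
  show "dfn (%e. ALL m z. e 0 = opair m z --> Nat m)" by (intro dfnI)
 qed auto
 thus ?thesis by blast
qed

text \<open>The counter traverses the square of side \<open>N\<close> row by row, so it is enough to
  reach the first entry of each square; the last entry of one square leads to the first of the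
  next.\<close>

lemma St_onto: assumes a: "Nat a" and b: "Nat b" shows "EX n N. St n N a b"
proof -
 define R where "R = (%N a b. EX n. St n N a b)"
 have dR: "dfn (%e. R (e i) (e j) (e k))" for i j k unfolding R_def by (intro dfnI dfn_St)
 have dR': "dt x ==> dt y ==> dt z ==> dfn (%e. R (x e) (y e) (z e))" for x y z by (rule dfn_app3[OF dR[of 0 1 2]])
 have s1: "R N a b ==> suc b <: N ==> R N a (suc b)" for N a b
  unfolding R_def using St_iff[of "suc n" N a "suc b" for n] by blast
 have s2: "R N a b ==> ~ suc b <: N ==> suc a <: N ==> R N (suc a) emp" for N a b
  unfolding R_def using St_iff[of "suc n" N "suc a" emp for n] by blast
 have s3: "R N a b ==> ~ suc b <: N ==> ~ suc a <: N ==> R (suc N) emp emp" for N a b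
  unfolding R_def using St_iff[of "suc n" "suc N" emp emp for n] by blast
 have row: "ALL b. Nat b --> b <: N --> R N a b" if "R N a emp" "Nat N" for N a
 proof (intro allI impI)
  fix b assume b: "Nat b" "b <: N"
  have "b <: N --> R N a b"
  proof (rule Nat_induct[of "%b. b <: N --> R N a b", OF _ _ _ b(1)])
   show "suc k <: N --> R N a (suc k)" if "k <: N --> R N a k" for k
    using that s1[of N a k] Nat_trans[OF \<open>Nat N\<close>, of "suc k" k] by auto
  qed (intro dfnI dR', use that in auto)
  thus "R N a b" using b by blast
 qed
 have last: "EX b. Nat b & N = suc b" if "Nat N" "N ~= emp" for N using Nat_cases that by blast
 have col: "ALL a. Nat a --> a <: N --> R N a emp" if h: "R N emp emp" "Nat N" for N
 proof (intro allI impI)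
  fix a assume a: "Nat a" "a <: N"
  have "a <: N --> R N a emp"
  proof (rule Nat_induct[of "%a. a <: N --> R N a emp", OF _ _ _ a(1)])
   show "suc k <: N --> R N (suc k) emp" if "k <: N --> R N k emp" for k
   proof
    assume k: "suc k <: N"
    hence "R N k emp" using that Nat_trans[OF h(2), of "suc k" k] by auto
    moreover obtain b where b: "Nat b" "N = suc b" using last[OF h(2)] k by (metis mem_emp)
    ultimately have "R N k b" using row h(2) by auto
    thus "R N (suc k) emp" using s2[of N k b] k b irrefl by auto
   qed
  qed (intro dfnI dR', use h in auto)
  thus "R N a emp" using a by blast
 qed
 have all: "N ~= emp --> R N emp emp" if "Nat N" for N
 proof (rule Nat_induct[of "%N. N ~= emp --> R N emp emp", OF _ _ _ that])
  have "St emp (suc emp) emp emp" by (subst St_iff) simp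
  hence z: "R (suc emp) emp emp" unfolding R_def by blast
  show "suc k ~= emp --> R (suc k) emp emp" if k: "Nat k" "k ~= emp --> R k emp emp" for k
  proof (cases "k = emp")
   case True thus ?thesis using z by simp
  next
   case False
   then obtain b where b: "Nat b" "k = suc b" using last k by blast
   have "R k b emp" using col[of k] False k b by auto
   hence "R k b b" using row[of k b] k(1) b by auto
   thus ?thesis using s3[of k b b] b irrefl by auto
  qed
 qed (intro dfnI dR', auto)
 obtain N where N: "Nat N" "a <: N" "b <: N" using Nat_max[OF Nat_suc[OF a] Nat_suc[OF b]] by (metis mem_suc)
 hence "R N emp emp" using all by (metis mem_emp)
 hence "R N a emp" using col N a by blast
 thus ?thesis using row N b unfolding R_def by blast
qed

text \<open>A numbering of the hereditarily finite sets: step \<open>n\<close> of the counter names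
  a pair of numbers below \<open>suc n\<close>, and \<open>suc n\<close> numbers the adjunction of
  the corresponding sets. One set may receive several numbers.\<close>

definition Enum :: "'a => 'a => bool" where
 "Enum n x <-> gen (%z. z = opair emp emp) (%_ _. False)
   (%p q z. EX n N a b x y. St n N a b & p = opair a x & q = opair b y & z = opair (suc n) (adj x y)) (opair n x)"

lemma dfn_Enum_rel: "dfn (%e. EX n N a b x y. St n N a b & e 0 = opair a x & e 1 = opair b y & e 2 = opair (suc n) (adj x y))"
 by (intro dfnI dfn_St)

lemma dfn_Enum [dfnI]: "dt x ==> dt y ==> dfn (%e. Enum (x e) (y e))"
 unfolding Enum_def by (intro dfn_gen0 dfnI dfn_St)

lemma Enum_cases:
 assumes "Enum n z" shows "(n = emp & z = emp) | (EX k N a b x y. St k N a b & Enum a x & Enum b y & n = suc k & z = adj x y)"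
 using gen_cases[OF assms[unfolded Enum_def]]
proof (elim disjE exE conjE)
 assume "opair n z = opair emp emp" thus ?thesis by simp
next
 fix p q k N a b x y
 assume "gen (%z. z = opair emp emp) (%_ _. False)
   (%p q z. EX n N a b x y. St n N a b & p = opair a x & q = opair b y & z = opair (suc n) (adj x y)) p"
  "gen (%z. z = opair emp emp) (%_ _. False)
   (%p q z. EX n N a b x y. St n N a b & p = opair a x & q = opair b y & z = opair (suc n) (adj x y)) q"
  "St k N a b" "p = opair a x" "q = opair b y" "opair n z = opair (suc k) (adj x y)"
 hence "St k N a b & Enum a x & Enum b y & n = suc k & z = adj x y" unfolding Enum_def by simp
 thus ?thesis by blast
qed simp

lemma Enum_onto: assumes "HF x" shows "EX n. Nat n & Enum n x"
proof (rule HF_induct[OF assms, of "%x. EX n. Nat n & Enum n x"])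
 show "dfn (%e. EX n. Nat n & Enum n (e 0))" by (intro dfnI)
 have "Enum emp emp" unfolding Enum_def by (rule gen_base) simp
 thus "EX n. Nat n & Enum n emp" using Nat_emp by blast
 fix x y assume "EX n. Nat n & Enum n x" "EX n. Nat n & Enum n y"
 then obtain a b where ab: "Nat a" "Enum a x" "Nat b" "Enum b y" by blast
 obtain n N where n: "St n N a b" using St_onto ab by blast
 have "Enum (suc n) (adj x y)" unfolding Enum_def
 proof (rule gen_2)
  show "dfn (%e. EX n N a b x y. St n N a b & e 0 = opair a x & e 1 = opair b y & e 2 = opair (suc n) (adj x y))" by (rule dfn_Enum_rel)
  show "EX n' N a' b' x' y'. St n' N a' b' & opair a x = opair a' x' & opair b y = opair b' y' & opair (suc n) (adj x y) = opair (suc n') (adj x' y')"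
   using n by blast
 qed (use ab in \<open>auto simp: Enum_def intro: dfnI\<close>)
 thus "EX n. Nat n & Enum n (adj x y)" using St_Nat[OF n] Nat_suc by blast
qed

lemma Enum_fun: assumes "Nat n" shows "Enum n x ==> Enum n x' ==> x = x'"
proof -
 have "ALL x x'. Enum n x --> Enum n x' --> x = x'"
 proof (rule Nat_strong[of "%n. ALL x x'. Enum n x --> Enum n x' --> x = x'", OF _ _ assms])
  show "dfn (%e. ALL x x'. Enum (e 0) x --> Enum (e 0) x' --> x = x')" by (intro dfnI)
  fix k assume k: "Nat k" "!!l. l <: k ==> ALL x x'. Enum l x --> Enum l x' --> x = x'"
  show "ALL x x'. Enum k x --> Enum k x' --> x = x'"
  proof (intro allI impI)
   fix z z' assume z: "Enum k z" "Enum k z'"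
   show "z = z'"
   proof (cases "k = emp")
    case True thus ?thesis using Enum_cases[OF z(1)] Enum_cases[OF z(2)] by auto
   next
    case False
    obtain l N a b x y where l: "St l N a b" "Enum a x" "Enum b y" "k = suc l" "z = adj x y" using Enum_cases[OF z(1)] False by auto
    obtain l' N' a' b' x' y' where l': "St l' N' a' b'" "Enum a' x'" "Enum b' y'" "k = suc l'" "z' = adj x' y'" using Enum_cases[OF z(2)] False by auto
    have "l' = l" using l(4) l'(4) by simp
    hence e: "a' = a" "b' = b" using St_props(2)[OF St_Nat[OF l(1)] l(1)] l'(1) by auto
    have p: "Nat N" "a <: N" "b <: N" "N <: suc (suc l)" using St_props(1)[OF St_Nat[OF l(1)] l(1)] by auto
    have "a <: k" "b <: k" using p l(4) k(1) Nat_trans[of k N] by auto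
    thus ?thesis using k(2) l l' e by blast
   qed
  qed
 qed
 thus "Enum n x ==> Enum n x' ==> x = x'" by blast
qed

section \<open>Henkin completion of an irrefutable set of closures\<close>

lemma VioI:
 "pos p A <: v ==> neg p A <: v ==> Vio T v"
 "pos (cNeg p) A <: v ==> pos p A <: v ==> Vio T v"
 "neg (cNeg p) A <: v ==> neg p A <: v ==> Vio T v"
 "pos (cImp p q) A <: v ==> pos p A <: v ==> neg q A <: v ==> Vio T v"
 "neg (cImp p q) A <: v ==> neg p A <: v ==> Vio T v"
 "neg (cImp p q) A <: v ==> pos q A <: v ==> Vio T v"
 "Nat c ==> pos (cAll i p) A <: v ==> neg p (upd A i c) <: v ==> Vio T v"
 "pos (cMem i j) A <: v ==> neg mem01 (pr (nv A i) (nv A j)) <: v ==> Vio T v"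
 "neg (cMem i j) A <: v ==> pos mem01 (pr (nv A i) (nv A j)) <: v ==> Vio T v"
 "pos (cEql i j) A <: v ==> neg eq01 (pr (nv A i) (nv A j)) <: v ==> Vio T v"
 "neg (cEql i j) A <: v ==> pos eq01 (pr (nv A i) (nv A j)) <: v ==> Vio T v"
 "Nat c ==> neg eq01 (pr c c) <: v ==> Vio T v"
 "Nat c ==> Nat d ==> Nat k ==> pos eq01 (pr c d) <: v ==> pos eq01 (pr c k) <: v ==> neg eq01 (pr d k) <: v ==> Vio T v"
 "Nat c ==> Nat d ==> Nat k ==> pos eq01 (pr c d) <: v ==> pos mem01 (pr c k) <: v ==> neg mem01 (pr d k) <: v ==> Vio T v"
 "Nat c ==> Nat d ==> Nat k ==> pos eq01 (pr c d) <: v ==> pos mem01 (pr k c) <: v ==> neg mem01 (pr k d) <: v ==> Vio T v"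
 "T p ==> neg p A <: v ==> Vio T v"
 unfolding Vio_def
 subgoal by (rule disjI1, blast)
 subgoal by (rule disjI2, rule disjI1, blast)
 subgoal by (rule disjI2, rule disjI2, rule disjI1, blast)
 subgoal by (rule disjI2, rule disjI2, rule disjI2, rule disjI1, blast)
 subgoal by (rule disjI2, rule disjI2, rule disjI2, rule disjI2, rule disjI1, blast)
 subgoal by (rule disjI2, rule disjI2, rule disjI2, rule disjI2, rule disjI2, rule disjI1, blast)
 subgoal by (rule disjI2, rule disjI2, rule disjI2, rule disjI2, rule disjI2, rule disjI2, rule disjI1, blast)
 subgoal by (rule disjI2, rule disjI2, rule disjI2, rule disjI2, rule disjI2, rule disjI2, rule disjI2, rule disjI1, blast)
 subgoal by (rule disjI2, rule disjI2, rule disjI2, rule disjI2, rule disjI2, rule disjI2, rule disjI2, rule disjI2, rule disjI1, blast)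
 subgoal by (rule disjI2, rule disjI2, rule disjI2, rule disjI2, rule disjI2, rule disjI2, rule disjI2, rule disjI2, rule disjI2, rule disjI1, blast)
 subgoal by (rule disjI2, rule disjI2, rule disjI2, rule disjI2, rule disjI2, rule disjI2, rule disjI2, rule disjI2, rule disjI2, rule disjI2, rule disjI1, blast)
 subgoal by (rule disjI2, rule disjI2, rule disjI2, rule disjI2, rule disjI2, rule disjI2, rule disjI2, rule disjI2, rule disjI2, rule disjI2, rule disjI2, rule disjI1, blast)
 subgoal by (rule disjI2, rule disjI2, rule disjI2, rule disjI2, rule disjI2, rule disjI2, rule disjI2, rule disjI2, rule disjI2, rule disjI2, rule disjI2, rule disjI2, rule disjI1, blast)
 subgoal by (rule disjI2, rule disjI2, rule disjI2, rule disjI2, rule disjI2, rule disjI2, rule disjI2, rule disjI2, rule disjI2, rule disjI2, rule disjI2, rule disjI2, rule disjI2, rule disjI1, blast)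
 subgoal by (rule disjI2, rule disjI2, rule disjI2, rule disjI2, rule disjI2, rule disjI2, rule disjI2, rule disjI2, rule disjI2, rule disjI2, rule disjI2, rule disjI2, rule disjI2, rule disjI2, rule disjI1, blast)
 subgoal by (rule disjI2, rule disjI2, rule disjI2, rule disjI2, rule disjI2, rule disjI2, rule disjI2, rule disjI2, rule disjI2, rule disjI2, rule disjI2, rule disjI2, rule disjI2, rule disjI2, rule disjI2, blast)
 done

text \<open>Stage \<open>n\<close> decides the closure numbered \<open>n\<close>: it is made true if
  that stays irrefutable, and otherwise false, with a witness when it is a quantification. The union
  of the stages contains no violation, which is what the Tarski clauses for \<open>V\<close>
  express, and it is definable because refutability is.\<close>

theorem model_existence:
 assumes dT: "dfn (%e. T (e 0))" and dF: "dfn (%e. F (e 0))"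
  and FForm: "!!p. F p ==> Form p" and FImm: "!!p q. F p ==> Imm q p ==> F q" and F01: "F mem01" "F eq01"
  and v0: "IV F v0" "~ Ref T F v0"
 shows "EX V Mr Er. tarski E dfn F Nat emp Mr Er V & (ALL p A. T p --> F p --> HF A --> V p A) &
  (ALL p A. (pos p A <: v0 --> V p A) & (neg p A <: v0 --> ~ V p A))"
proof -
 define R where "R = Ref T F"
 have dR [dfnI]: "dt x ==> dfn (%e. R (x e))" for x unfolding R_def by (rule dfn_Ref[OF dT dF])
 have dF' [dfnI]: "dt x ==> dfn (%e. F (x e))" for x by (rule dfn_app1[OF dF])
 \<comment> \<open>Taking the least suitable constant as witness makes each stage unique, so the
   construction is definable without choice.\<close>
 define Lc where "Lc = (%v p A i q c. Nat c & ~ R (adj (adj v (neg p A)) (neg q (upd A i c))) &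
  (ALL d. d <: c --> R (adj (adj v (neg p A)) (neg q (upd A i d)))))"
 define Dec where "Dec = (%v p A w. (~ R (adj v (pos p A)) & w = adj v (pos p A)) |
  (R (adj v (pos p A)) & (EX i q c. p = cAll i q & Lc v p A i q c & w = adj (adj v (neg p A)) (neg q (upd A i c)))) |
  (R (adj v (pos p A)) & ~ (EX i q. p = cAll i q) & w = adj v (neg p A)))"
 define GR where "GR = (%n v w. (EX p A. Enum n (opair p A) & F p & HF A & Dec v p A w) |
  (~ (EX p A. Enum n (opair p A) & F p & HF A) & w = v))"
 define Stg where "Stg = (%n v. gen (%x. x = opair emp v0) (%x y. EX n v w. x = opair n v & GR n v w & y = opair (suc n) w) (%_ _ _. False) (opair n v))"
 have dGR: "dfn (%e. GR (e i) (e j) (e k))" for i j k unfolding GR_def Dec_def Lc_def by (intro dfnI)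
 have dStg: "dfn (%e. Stg (e i) (e j))" for i j unfolding Stg_def by (intro dfn_gen0 dfnI dGR)
 have S0: "Stg emp v0" unfolding Stg_def by (rule gen_base) simp
 have SS: "Stg n v ==> GR n v w ==> Stg (suc n) w" for n v w unfolding Stg_def by (erule gen_1) blast
 have Sc: "(n = emp & v = v0) | (EX k u. n = suc k & Stg k u & GR k u v)" if "Stg n v" for n v
  using gen_cases[OF that[unfolded Stg_def]] unfolding Stg_def by auto
 have good: "EX w. Dec v p A w" "Dec v p A w ==> IV F w & ~ R w & (ALL x. x <: v --> x <: w) &
   (pos p A <: w | (neg p A <: w & (ALL i q. p = cAll i q --> (EX c. Nat c & neg q (upd A i c) <: w))))"
  "Dec v p A w ==> Dec v p A w' ==> w = w'"
  if v: "IV F v" "~ R v" and p: "F p" "HF A" for v p A w w'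
 proof -
  have iv: "IV F (adj v (pos p A))" "IV F (adj v (neg p A))" using IV_adj[OF v(1) p(1) FForm[OF p(1)] p(2)] by auto
  have nn: "~ R (adj v (neg p A))" if "R (adj v (pos p A))"
   using Ref_cut[OF dT dF v(1) p] that v(2) unfolding R_def by blast
  have lc: "EX c. Lc v p A i q c" if "p = cAll i q" "R (adj v (pos p A))" for i q
  proof -
   obtain c where c: "fresh c (adj v (neg p A))" using fresh_ex iv unfolding IV_def by blast
   have "~ R (adj (adj v (neg p A)) (neg q (upd A i c)))"
    using Ref_eigen[OF iv(2) _ c, of i q A T] nn[OF that(2)] that(1) unfolding R_def by auto
   moreover have "Nat c" using c unfolding fresh_def by blast
   moreover have "dfn (%e. ~ R (adj (adj v (neg p A)) (neg q (upd A i (e 0)))))" by (intro dfnI dR)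
   ultimately have "EX c. Nat c & ~ R (adj (adj v (neg p A)) (neg q (upd A i c))) & (ALL l. l <: c --> ~ ~ R (adj (adj v (neg p A)) (neg q (upd A i l))))"
    using Nat_least[of "%c. ~ R (adj (adj v (neg p A)) (neg q (upd A i c)))" c] by blast
   thus ?thesis using that(1) unfolding Lc_def by blast
  qed
  show "EX w. Dec v p A w"
  proof (cases "R (adj v (pos p A)) & (EX i q. p = cAll i q)")
   case True
   then obtain i q where iq: "p = cAll i q" by blast
   obtain c where "Lc v p A i q c" using lc iq True by blast
   hence "Dec v p A (adj (adj v (neg p A)) (neg q (upd A i c)))" using True iq unfolding Dec_def by blast
   thus ?thesis ..
  next
   case False
   hence "Dec v p A (adj v (pos p A)) | Dec v p A (adj v (neg p A))" unfolding Dec_def by argo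
   thus ?thesis by blast
  qed
  have liv: "IV F (adj (adj v (neg p A)) (neg q (upd A i c)))" if "p = cAll i q" "Nat c" for i q c
  proof -
   have "F q" "Nat i" using FImm[OF p(1), of q] FForm[OF p(1)] that by auto
   thus ?thesis using IV_adj[OF iv(2) _ FForm, of q "upd A i c"] p that by auto
  qed
  show "IV F w & ~ R w & (ALL x. x <: v --> x <: w) &
   (pos p A <: w | (neg p A <: w & (ALL i q. p = cAll i q --> (EX c. Nat c & neg q (upd A i c) <: w))))" if "Dec v p A w"
   using that unfolding Dec_def
  proof (elim disjE exE conjE)
   assume "~ R (adj v (pos p A))" "w = adj v (pos p A)" thus ?thesis using iv by simp
  next
   fix i q c assume "p = cAll i q" "Lc v p A i q c" "w = adj (adj v (neg p A)) (neg q (upd A i c))"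
   thus ?thesis using liv[of i q c] unfolding Lc_def by auto
  next
   assume "R (adj v (pos p A))" "~ (EX i q. p = cAll i q)" "w = adj v (neg p A)"
   thus ?thesis using iv nn by auto
  qed
  show "w = w'" if d: "Dec v p A w" "Dec v p A w'"
  proof -
   have u: "c = c'" if "Lc v p' A i q c" "Lc v p' A i q c'" for p' i q c c'
    using that Nat_linear[of c c'] unfolding Lc_def by blast
   show ?thesis using d unfolding Dec_def by auto (drule (1) u, simp)
  qed
 qed
 have G: "IV F v & ~ R v" if "Stg n v" for n v
 proof -
  have "ALL m w. opair n v = opair m w --> IV F w & ~ R w"
   using that unfolding Stg_def
  proof -
   assume "gen (%x. x = opair emp v0) (%x y. EX n v w. x = opair n v & GR n v w & y = opair (suc n) w) (%_ _ _. False) (opair n v)"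
   hence "ALL m w. opair n v = opair m w --> IV F w & ~ R w"
   proof (rule gen_induct)
    show "dfn (%e. ALL m w. e 0 = opair m w --> IV F w & ~ R w)" unfolding IV_def by (intro dfnI)
    show "ALL m w. y = opair m w --> IV F w & ~ R w" if "y = opair emp v0" for y using that v0 unfolding R_def by auto
    show "ALL m w. y = opair m w --> IV F w & ~ R w"
     if h: "ALL m w. x = opair m w --> IV F w & ~ R w" "EX n v w. x = opair n v & GR n v w & y = opair (suc n) w" for x y
    proof -
     obtain n v w where *: "x = opair n v" "GR n v w" "y = opair (suc n) w" using h(2) by blast
     hence "IV F v" "~ R v" using h(1) by auto
     hence "IV F w & ~ R w" using *(2) good(2) unfolding GR_def by blast
     thus ?thesis using *(3) by simp
    qed
   qed simp
   thus ?thesis by blast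
  qed
  thus ?thesis by blast
 qed
 have GRt: "EX w. GR n v w" "GR n v w ==> x <: v ==> x <: w" "Nat n ==> GR n v w ==> GR n v w' ==> w = w'" if s: "Stg n v" for n v w w' x
 proof -
  have g: "IV F v" "~ R v" using G[OF s] by auto
  show "EX w. GR n v w" unfolding GR_def using good(1)[OF g] by blast
  show "x <: w" if "GR n v w" "x <: v" using that good(2)[OF g] unfolding GR_def by blast
  show "w = w'" if "Nat n" "GR n v w" "GR n v w'"
   using that(2,3) good(3)[OF g] Enum_fun[OF that(1)] unfolding GR_def by (metis opair_inj)
 qed
 have Sex: "EX v. Stg n v" if "Nat n" for n
 proof (rule Nat_induct[of "%n. EX v. Stg n v", OF _ _ _ that])
  show "EX v. Stg (suc k) v" if h: "EX v. Stg k v" for k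
  proof -
   obtain v where v: "Stg k v" using h by blast
   obtain w where "GR k v w" using GRt(1)[OF v] by blast
   thus ?thesis using SS[OF v] by blast
  qed
 qed (intro dfnI dStg, use S0 in blast)
 have Suni: "v = w" if "Nat n" "Stg n v" "Stg n w" for n v w
 proof -
  have "ALL v w. Stg n v --> Stg n w --> v = w"
  proof (rule Nat_induct[of "%n. ALL v w. Stg n v --> Stg n w --> v = w", OF _ _ _ that(1)])
   show "dfn (%e. ALL v w. Stg (e 0) v --> Stg (e 0) w --> v = w)" by (intro dfnI dStg)
   show "ALL v w. Stg emp v --> Stg emp w --> v = w" using Sc[of emp] by auto
   fix k assume k: "Nat k" "ALL v w. Stg k v --> Stg k w --> v = w"
   show "ALL v w. Stg (suc k) v --> Stg (suc k) w --> v = w"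
   proof (intro allI impI)
    fix v w assume vw: "Stg (suc k) v" "Stg (suc k) w"
    obtain u where u: "Stg k u" "GR k u v" using Sc[OF vw(1)] by auto
    obtain u' where u': "Stg k u'" "GR k u' w" using Sc[OF vw(2)] by auto
    have "u = u'" using k(2) u u' by blast
    thus "v = w" using GRt(3)[OF u(1) k(1) u(2)] u'(2) by blast
   qed
  qed
  thus ?thesis using that by blast
 qed
 have Smono: "x <: w" if "Nat n" "k <: n" "Stg k v" "Stg n w" "x <: v" for n k v w x
 proof -
  have "ALL w. k <: n --> Stg n w --> (ALL x. x <: v --> x <: w)"
  proof (rule Nat_induct[of "%n. ALL w. k <: n --> Stg n w --> (ALL x. x <: v --> x <: w)", OF _ _ _ that(1)])
   show "dfn (%e. ALL w. k <: e 0 --> Stg (e 0) w --> (ALL x. x <: v --> x <: w))"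
    by (intro dfnI dfn_app2[OF dStg[of 0 1]])
   show "ALL w. k <: emp --> Stg emp w --> (ALL x. x <: v --> x <: w)" by simp
   fix l assume l: "Nat l" "ALL w. k <: l --> Stg l w --> (ALL x. x <: v --> x <: w)"
   show "ALL w. k <: suc l --> Stg (suc l) w --> (ALL x. x <: v --> x <: w)"
   proof (intro allI impI)
    fix w x assume h: "k <: suc l" "Stg (suc l) w" "x <: v"
    obtain u where u: "Stg l u" "GR l u w" using Sc[OF h(2)] by auto
    have "x <: u"
    proof (cases "k = l")
     case True thus ?thesis using Suni[OF l(1)] that(3) u(1) h(3) by blast
    next
     case False thus ?thesis using l(2) h u(1) by auto
    qed
    thus "x <: w" using GRt(2)[OF u] by blast
   qed
  qed
  thus ?thesis using that by blast
 qed
 define In where "In = (%x. EX n v. Nat n & Stg n v & x <: v)"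
 have dIn: "dfn (%e. In (e 0))" unfolding In_def by (intro dfnI dStg)
 \<comment> \<open>The stages increase, so any three decisions meet in a later stage; three is the
   largest number of members that a violation involves.\<close>
 have joint: "EX v. IV F v & ~ Ref T F v & x <: v & y <: v & z <: v" if h: "In x" "In y" "In z" for x y z
 proof -
  obtain n1 v1 n2 v2 n3 v3 where *: "Nat n1" "Stg n1 v1" "x <: v1" "Nat n2" "Stg n2 v2" "y <: v2" "Nat n3" "Stg n3 v3" "z <: v3"
   using h unfolding In_def by blast
  obtain k where k: "Nat k" "!!l. l <: suc n1 | l <: suc n2 ==> l <: k" using Nat_max[OF Nat_suc[OF *(1)] Nat_suc[OF *(4)]] by blast
  obtain m where m: "Nat m" "!!l. l <: k | l <: suc n3 ==> l <: m" using Nat_max[OF k(1) Nat_suc[OF *(7)]] by blast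
  obtain v where v: "Stg m v" using Sex[OF m(1)] by blast
  have "n1 <: m" "n2 <: m" "n3 <: m" using k m by auto
  hence "x <: v" "y <: v" "z <: v" using Smono[OF m(1) _ _ v] * by blast+
  thus ?thesis using G[OF v] unfolding R_def by blast
 qed
 have InF: "F p & HF A" if "In (pos p A) | In (neg p A)" for p A
  using that G IV_mem unfolding In_def by blast
 have decided: "In (pos p A) | (In (neg p A) & (ALL i q. p = cAll i q --> (EX c. Nat c & In (neg q (upd A i c)))))" if p: "F p" "HF A" for p A
 proof -
  obtain n where n: "Nat n" "Enum n (opair p A)" using Enum_onto[of "opair p A"] p FForm by auto
  obtain v where v: "Stg n v" using Sex n by blast
  obtain w where w: "GR n v w" using GRt(1)[OF v] by blast
  have "Dec v p A w" using w n Enum_fun[OF n(1) n(2)] p unfolding GR_def by (metis opair_inj)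
  moreover have "Stg (suc n) w" by (rule SS[OF v w])
  ultimately show ?thesis using good(2)[of v p A w] G[OF v] p n(1) Nat_suc unfolding In_def by metis
 qed
 have viol: False if "In x" "In y" "In z" "!!v. x <: v ==> y <: v ==> z <: v ==> Vio T v" for x y z
  using joint[OF that(1-3)] that(4) Ref_base by blast
 define V where "V = (%p A. In (pos p A))"
 have w1: "In (pos p A) ==> In (neg p A) ==> False" for p q A i j c d k
  by (rule viol[of "pos p A" "neg p A" "neg p A"], assumption+, rule VioI(1), assumption+)
 have w2: "In (pos (cNeg p) A) ==> In (pos p A) ==> False" for p q A i j c d k
  by (rule viol[of "pos (cNeg p) A" "pos p A" "pos p A"], assumption+, rule VioI(2), assumption+)
 have w3: "In (neg (cNeg p) A) ==> In (neg p A) ==> False" for p q A i j c d k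
  by (rule viol[of "neg (cNeg p) A" "neg p A" "neg p A"], assumption+, rule VioI(3), assumption+)
 have w4: "In (pos (cImp p q) A) ==> In (pos p A) ==> In (neg q A) ==> False" for p q A i j c d k
  by (rule viol[of "pos (cImp p q) A" "pos p A" "neg q A"], assumption+, rule VioI(4), assumption+)
 have w5: "In (neg (cImp p q) A) ==> In (neg p A) ==> False" for p q A i j c d k
  by (rule viol[of "neg (cImp p q) A" "neg p A" "neg p A"], assumption+, rule VioI(5), assumption+)
 have w6: "In (neg (cImp p q) A) ==> In (pos q A) ==> False" for p q A i j c d k
  by (rule viol[of "neg (cImp p q) A" "pos q A" "pos q A"], assumption+, rule VioI(6), assumption+)
 have w7: "Nat c ==> In (pos (cAll i p) A) ==> In (neg p (upd A i c)) ==> False" for p q A i j c d k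
  by (rule viol[of "pos (cAll i p) A" "neg p (upd A i c)" "neg p (upd A i c)"], assumption+, rule VioI(7), assumption+)
 have w8: "In (pos (cMem i j) A) ==> In (neg mem01 (pr (nv A i) (nv A j))) ==> False" for p q A i j c d k
  by (rule viol[of "pos (cMem i j) A" "neg mem01 (pr (nv A i) (nv A j))" "neg mem01 (pr (nv A i) (nv A j))"], assumption+, rule VioI(8), assumption+)
 have w9: "In (neg (cMem i j) A) ==> In (pos mem01 (pr (nv A i) (nv A j))) ==> False" for p q A i j c d k
  by (rule viol[of "neg (cMem i j) A" "pos mem01 (pr (nv A i) (nv A j))" "pos mem01 (pr (nv A i) (nv A j))"], assumption+, rule VioI(9), assumption+)
 have w10: "In (pos (cEql i j) A) ==> In (neg eq01 (pr (nv A i) (nv A j))) ==> False" for p q A i j c d k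
  by (rule viol[of "pos (cEql i j) A" "neg eq01 (pr (nv A i) (nv A j))" "neg eq01 (pr (nv A i) (nv A j))"], assumption+, rule VioI(10), assumption+)
 have w11: "In (neg (cEql i j) A) ==> In (pos eq01 (pr (nv A i) (nv A j))) ==> False" for p q A i j c d k
  by (rule viol[of "neg (cEql i j) A" "pos eq01 (pr (nv A i) (nv A j))" "pos eq01 (pr (nv A i) (nv A j))"], assumption+, rule VioI(11), assumption+)
 have w12: "Nat c ==> In (neg eq01 (pr c c)) ==> False" for p q A i j c d k
  by (rule viol[of "neg eq01 (pr c c)" "neg eq01 (pr c c)" "neg eq01 (pr c c)"], assumption+, rule VioI(12), assumption+)
 have w13: "Nat c ==> Nat d ==> Nat k ==> In (pos eq01 (pr c d)) ==> In (pos eq01 (pr c k)) ==> In (neg eq01 (pr d k)) ==> False" for p q A i j c d k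
  by (rule viol[of "pos eq01 (pr c d)" "pos eq01 (pr c k)" "neg eq01 (pr d k)"], assumption+, rule VioI(13), assumption+)
 have w14: "Nat c ==> Nat d ==> Nat k ==> In (pos eq01 (pr c d)) ==> In (pos mem01 (pr c k)) ==> In (neg mem01 (pr d k)) ==> False" for p q A i j c d k
  by (rule viol[of "pos eq01 (pr c d)" "pos mem01 (pr c k)" "neg mem01 (pr d k)"], assumption+, rule VioI(14), assumption+)
 have w15: "Nat c ==> Nat d ==> Nat k ==> In (pos eq01 (pr c d)) ==> In (pos mem01 (pr k c)) ==> In (neg mem01 (pr k d)) ==> False" for p q A i j c d k
  by (rule viol[of "pos eq01 (pr c d)" "pos mem01 (pr k c)" "neg mem01 (pr k d)"], assumption+, rule VioI(15), assumption+)
 have w16: "T p ==> In (neg p A) ==> False" for p q A i j c d k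
  by (rule viol[of "neg p A" "neg p A" "neg p A"], assumption+, rule VioI(16), assumption+)
 have NV: "~ V p A <-> In (neg p A)" if "F p" "HF A" for p A
  using decided[OF that] w1 unfolding V_def by blast
 define Mr where "Mr = (%c d. V mem01 (pr c d))"
 define Er where "Er = (%c d. V eq01 (pr c d))"
 have dV: "dfn (%e. V (e i) (e j))" for i j unfolding V_def by (rule dfn_app1[OF dIn]) (intro dfnI)
 have hp: "HF (pr c d)" if "Nat c" "Nat d" for c d using that by simp
 have InV: "In (pos p A) <-> V p A" for p A unfolding V_def ..
 have M: "~ Mr c d <-> In (neg mem01 (pr c d))" "~ Er c d <-> In (neg eq01 (pr c d))" if "Nat c" "Nat d" for c d
  unfolding Mr_def Er_def by (rule NV[OF F01(1) hp[OF that]] NV[OF F01(2) hp[OF that]])+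
 have MI: "In (pos mem01 (pr c d)) <-> Mr c d" "In (pos eq01 (pr c d)) <-> Er c d" for c d unfolding Mr_def Er_def V_def by simp_all
 have "tarski E dfn F Nat emp Mr Er V"
 proof
  show "dfn (%e. Mr (e 0) (e 1))" "dfn (%e. Er (e 0) (e 1))" unfolding Mr_def Er_def V_def by (rule dfn_app1[OF dIn], intro dfnI)+
  show "Er c c" if "Nat c" for c using w12[OF that] M(2)[OF that that] by blast
  show "Er d k" if "Nat c" "Nat d" "Nat k" "Er c d" "Er c k" for c d k
   using w13[OF that(1-3)] that M(2)[OF that(2,3)] MI by blast
  show "Mr d k" if "Nat c" "Nat d" "Nat k" "Er c d" "Mr c k" for c d k
   using w14[OF that(1-3)] that M(1)[OF that(2,3)] MI by blast
  show "Mr k d" if "Nat c" "Nat d" "Nat k" "Er c d" "Mr k c" for c d k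
   using w15[OF that(1-3)] that M(1)[OF that(3,2)] MI by blast
  have l: "(if Nat (lk B i emp) then lk B i emp else emp) = nv B i" for B i by (simp add: nv_def)
  show "V (cMem i j) B <-> Mr (if Nat (lk B i emp) then lk B i emp else emp) (if Nat (lk B j emp) then lk B j emp else emp)"
   if f: "F (cMem i j)" "HF B" for i j B unfolding l
   using w8[of i j B] w9[of i j B] NV[OF f] M(1)[of "nv B i" "nv B j"] MI(1)[of "nv B i" "nv B j"] InV[of "cMem i j" B] Nat_nv by blast
  show "V (cEql i j) B <-> Er (if Nat (lk B i emp) then lk B i emp else emp) (if Nat (lk B j emp) then lk B j emp else emp)"
   if f: "F (cEql i j)" "HF B" for i j B unfolding l
   using w10[of i j B] w11[of i j B] NV[OF f] M(2)[of "nv B i" "nv B j"] MI(2)[of "nv B i" "nv B j"] InV[of "cEql i j" B] Nat_nv by blast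
  show "V (cNeg p) B <-> ~ V p B" if f: "F (cNeg p)" "HF B" for p B
  proof -
   have p: "F p" using FImm[OF f(1)] by simp
   show ?thesis using w2[of p B] w3[of p B] NV[OF f] NV[OF p f(2)] InV by blast
  qed
  show "V (cImp p q) B <-> (V p B --> V q B)" if f: "F (cImp p q)" "HF B" for p q B
  proof -
   have p: "F p" "F q" using FImm[OF f(1)] by simp_all
   show ?thesis using w4[of p q B] w5[of p q B] w6[of p q B] NV[OF f] NV[OF p(1) f(2)] NV[OF p(2) f(2)] InV by blast
  qed
  show "V (cAll i p) B <-> (ALL c. Nat c --> V p (upd B i c))" if f: "F (cAll i p)" "HF B" for i p B
  proof -
   have p: "F p" "Nat i" using FImm[OF f(1)] FForm[OF f(1)] by simp_all
   have h: "HF (upd B i c)" if "Nat c" for c using f p that by simp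
   have "V p (upd B i c)" if "V (cAll i p) B" "Nat c" for c
    using w7[OF that(2), of i p B] that(1) NV[OF p(1) h[OF that(2)]] InV by blast
   moreover have "V (cAll i p) B" if "ALL c. Nat c --> V p (upd B i c)"
   proof (rule ccontr)
    assume "~ V (cAll i p) B"
    then obtain c where "Nat c" "In (neg p (upd B i c))" using decided[OF f] unfolding V_def by blast
    thus False using NV[OF p(1) h] that by blast
   qed
   ultimately show ?thesis by blast
  qed
 qed (use dF dV FForm FImm in \<open>auto intro: dfnI\<close>)
 moreover have "V p A" if "T p" "F p" "HF A" for p A
  using w16[OF that(1)] NV[OF that(2,3)] by blast
 moreover have "In x" if "x <: v0" for x using S0 that Nat_emp unfolding In_def by blast
 ultimately show ?thesis using NV InF unfolding V_def by blast
qed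

end

section \<open>Finitely axiomatized theories with a definable model\<close>

context smodel
begin

lemma dfn_Bex_set: "(!!p. p : set U ==> dfn (%e. P p e)) ==> dfn (%e. EX p:set U. P p e)"
 by (induction U) (simp_all add: dfn_const dfn_or)

lemma dfn_sat_in:
 assumes D: "dfn (%e. D (e 0))" and M: "dfn (%e. Mr (e 0) (e 1))" and R: "dfn (%e. Er (e 0) (e 1))"
 shows "(!!i. dt (t i)) ==> dfn (%e. sat {c. D c} Mr Er (%i. t i e) p)"
proof (induction p arbitrary: t)
 case (Forall i p)
 have "dt (%e. if j = i then e 0 else t j (%k. e (Suc k)))" for j
  using Forall.prems[of j] by (cases "j = i") (simp_all add: dt_var dt_shift)
 from Forall.IH[of "%j e. if j = i then e 0 else t j (%k. e (Suc k))", OF this]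
 have "dfn (%e. D (e 0) --> sat {c. D c} Mr Er ((%j. t j (%k. e (Suc k)))(i := e 0)) p)"
  by (intro dfnI D) (simp add: fun_upd_def)
 from dfn_all[of "%e c. D c --> sat {c. D c} Mr Er ((%j. t j e)(i := c)) p", OF this] show ?case by simp
qed (auto intro!: dfn_app2[OF M] dfn_app2[OF R] dfn_not dfn_imp)

text \<open>For a list of standard formulas truth is a finite disjunction of cases, in each of which
  the formula itself is evaluated in the structure; it is therefore definable.\<close>

lemma tarski_codes:
 fixes U :: "fm list"
 assumes D: "dfn (%e. D (e 0))" and M: "dfn (%e. Mr (e 0) (e 1))" and R: "dfn (%e. Er (e 0) (e 1))"
  and HFD: "!!c. D c ==> HF c" and Dd0: "D d0"
  and eq: "!!c. D c ==> Er c c" "!!c d k. D c ==> D d ==> D k ==> Er c d ==> Er c k ==> Er d k"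
   "!!c d k. D c ==> D d ==> D k ==> Er c d ==> Mr c k ==> Mr d k"
   "!!c d k. D c ==> D d ==> D k ==> Er c d ==> Mr k c ==> Mr k d"
  and U: "!!p. Neg p : set U ==> p : set U" "!!p q. Imp p q : set U ==> p : set U & q : set U"
   "!!i p. Forall i p : set U ==> p : set U"
 shows "tarski E dfn (%x. EX p:set U. x = code p) D d0 Mr Er
  (%x B. EX p:set U. x = code p & sat {c. D c} Mr Er (%i. if D (lk B (nn i) d0) then lk B (nn i) d0 else d0) p)"
proof -
 define v where "v = (%B i. if D (lk B (nn i) d0) then lk B (nn i) d0 else d0)"
 define W where "W = (%x B. EX p:set U. x = code p & sat {c. D c} Mr Er (v B) p)"
 have V: "p : set U ==> W (code p) B <-> sat {c. D c} Mr Er (v B) p" for p B unfolding W_def by (auto simp: code_inj)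
 have vu: "D c ==> v (upd B (nn i) c) = (v B)(i := c)" for B i c unfolding v_def by (auto simp: lk_upd fun_eq_iff)
 have dl: "dt (%e. v (e j) i)" for i j
 proof (rule dt_app1[of "%B. v B i"])
  have "z = v B i <-> (D (lk B (nn i) d0) & z = lk B (nn i) d0) | (~ D (lk B (nn i) d0) & z = d0)" for z B unfolding v_def by auto
  thus "dfn (%e. e 0 = v (e 1) i)" by (simp only:) (intro dfnI dfn_app1[OF D])
 qed (rule dt_var)
 have "tarski E dfn (%x. EX p:set U. x = code p) D d0 Mr Er W"
 proof
  show "dfn (%e. EX p:set U. e 0 = code p)" by (intro dfn_Bex_set dfnI)
  show "dfn (%e. W (e 0) (e 1))" unfolding W_def by (intro dfn_Bex_set dfnI dfn_sat_in[OF D M R] dl)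
  show "Form x" if "EX p:set U. x = code p" for x using that by auto
  show "EX p:set U. y = code p" if h: "EX p:set U. x = code p" "Imm y x" for x y
  proof -
   obtain p where p: "p : set U" "x = code p" using h(1) by blast
   hence y: "Imm y (code p)" using h(2) by simp
   show ?thesis
   proof (cases p)
    case (Neg q) thus ?thesis using y p(1) U(1)[of q] by auto
   next
    case (Imp q r) thus ?thesis using y p(1) U(2)[of q r] by auto
   next
    case (Forall i q) thus ?thesis using y p(1) U(3)[of i q] by auto
   qed (use y in simp_all)
  qed
  fix B assume "HF B"
  show "W (cMem i j) B <-> Mr (if D (lk B i d0) then lk B i d0 else d0) (if D (lk B j d0) then lk B j d0 else d0)"
   if F: "EX p:set U. cMem i j = code p" for i j
  proof -
   obtain p where p: "p : set U" "cMem i j = code p" using F by blast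
   thus ?thesis using V[OF p(1), of B] by (cases p rule: fm.exhaust) (simp_all add: v_def)
  qed
  show "W (cEql i j) B <-> Er (if D (lk B i d0) then lk B i d0 else d0) (if D (lk B j d0) then lk B j d0 else d0)"
   if F: "EX p:set U. cEql i j = code p" for i j
  proof -
   obtain p where p: "p : set U" "cEql i j = code p" using F by blast
   thus ?thesis using V[OF p(1), of B] by (cases p rule: fm.exhaust) (simp_all add: v_def)
  qed
  show "W (cNeg x) B <-> ~ W x B" if F: "EX p:set U. cNeg x = code p" for x
  proof -
   obtain p where p: "p : set U" "cNeg x = code p" using F by blast
   then obtain q where q: "p = Neg q" "x = code q" by (cases p rule: fm.exhaust) simp_all
   thus ?thesis using V[OF p(1), of B] V[of q B] U(1)[of q] p by simp
  qed
  show "W (cImp x y) B <-> (W x B --> W y B)" if F: "EX p:set U. cImp x y = code p" for x y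
  proof -
   obtain p where p: "p : set U" "cImp x y = code p" using F by blast
   then obtain q r where q: "p = Imp q r" "x = code q" "y = code r" by (cases p rule: fm.exhaust) simp_all
   thus ?thesis using V[OF p(1), of B] V[of q B] V[of r B] U(2)[of q r] p by simp
  qed
  show "W (cAll i x) B <-> (ALL c. D c --> W x (upd B i c))" if F: "EX p:set U. cAll i x = code p" for i x
  proof -
   obtain p where p: "p : set U" "cAll i x = code p" using F by blast
   then obtain j q where q: "p = Forall j q" "i = nn j" "x = code q" by (cases p rule: fm.exhaust) simp_all
   have qU: "q : set U" using U(3)[of j q] p q by simp
   show ?thesis using V[OF p(1), of B] unfolding p(2) q(1,2,3) V[OF qU] sat.simps(5) using vu by simp
  qed
 qed (fact D M R HFD Dd0 eq)+
 thus ?thesis unfolding W_def v_def .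
qed

end

lemma (in tarski) V_code:
 assumes F: "!!q. F (code q)"
 shows "HF B ==> V (code p) B <-> sat {c. D c} Mr Er (%i. vl B (nn i)) p"
proof (induction p arbitrary: B)
 case (Mem i j) thus ?case using V_Mem[of "nn i" "nn j" B] F[of "Mem i j"] by simp
next
 case (Eql i j) thus ?case using V_Eql[of "nn i" "nn j" B] F[of "Eql i j"] by simp
next
 case (Neg p) thus ?case using V_Neg[of "code p" B] F[of "Neg p"] by simp
next
 case (Imp p q) thus ?case using V_Imp[of "code p" "code q" B] F[of "Imp p q"] by simp
next
 case (Forall i p)
 have "(%j. vl (upd B (nn i) c) (nn j)) = (%j. vl B (nn j))(i := c)" if "D c" for c
  using vl_upd[OF that] by (auto simp: fun_eq_iff)
 thus ?case using V_All[of "nn i" "code p" B] F[of "Forall i p"] Forall HFD by simp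
qed

lemma (in tarski) V_Ex: "F (cEx i p) ==> HF B ==> V (cEx i p) B <-> (EX c. D c & V p (upd B i c))"
proof -
 assume F: "F (cEx i p)" and B: "HF B"
 have F1: "F (cAll i (cNeg p))" by (rule FImm[OF F]) simp
 have F2: "F (cNeg p)" by (rule FImm[OF F1]) simp
 note F' = F1 F2
 have "HF (upd B i c)" if "D c" for c using that B HFD FForm[OF F] by simp
 thus ?thesis using V_Neg[OF F B] V_All[OF F'(1) B] V_Neg[OF F'(2)] by simp
qed

lemma (in tarski) V_Conj: "F (cConj p q) ==> HF B ==> V (cConj p q) B <-> V p B & V q B"
proof -
 assume F: "F (cConj p q)" and B: "HF B"
 have F1: "F (cImp p (cNeg q))" by (rule FImm[OF F]) simp
 have F2: "F (cNeg q)" by (rule FImm[OF F1]) simp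
 note F' = F1 F2
 show ?thesis using V_Neg[OF F B] V_Imp[OF F'(1) B] V_Neg[OF F'(2) B] by simp
qed

text \<open>When the immediate subformulas of \<open>p\<close> are covered, the Tarski clause for
  \<open>p\<close> can be read as the definition of its truth; the structure does not
  change.\<close>

lemma (in tarski) extend:
 assumes p: "Form p" "!!q. Imm q p ==> F q"
 shows "EX V'. tarski E dfn (%x. F x | x = p) D d0 Mr Er V' & (ALL x B. F x --> V' x B = V x B)"
proof -
 define V1 where "V1 = (%x B. (EX i j. x = cMem i j & Mr (vl B i) (vl B j)) | (EX i j. x = cEql i j & Er (vl B i) (vl B j)) |
  (EX q. x = cNeg q & ~ V q B) | (EX q r. x = cImp q r & (V q B --> V r B)) | (EX i q. x = cAll i q & (ALL c. D c --> V q (upd B i c))))"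
 have V1: "V1 (cMem i j) B <-> Mr (vl B i) (vl B j)" "V1 (cEql i j) B <-> Er (vl B i) (vl B j)" "V1 (cNeg q) B <-> ~ V q B"
  "V1 (cImp q r) B <-> (V q B --> V r B)" "V1 (cAll i q) B <-> (ALL c. D c --> V q (upd B i c))" for i j q r B
  unfolding V1_def by simp_all
 define V' where "V' = (%x B. (F x & V x B) | (~ F x & x = p & V1 x B))"
 have d: "dfn (%e. V' (e 0) (e 1))" unfolding V'_def V1_def by (intro dfnI)
 have old: "F x ==> V' x B = V x B" for x B unfolding V'_def by simp
 have new: "V' x B = V1 x B" if "F x | x = p" "HF B" for x B
 proof (cases "F x")
  case True
  have f: "Form x" by (rule FForm[OF True])
  from f have "V x B = V1 x B"
   by (cases rule: Form_cases) (use True that(2) in \<open>simp_all add: V1 V_Mem V_Eql V_Neg V_Imp V_All\<close>)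
  thus ?thesis using old True by simp
 qed (use that in \<open>simp add: V'_def\<close>)
 have sub: "F q" if "Imm q x" "F x | x = p" for q x using that FImm p(2) by blast
 have "tarski E dfn (%x. F x | x = p) D d0 Mr Er V'"
 proof
  fix B assume B: "HF B"
  show "V' (cMem i j) B <-> Mr (if D (lk B i d0) then lk B i d0 else d0) (if D (lk B j d0) then lk B j d0 else d0)"
   if "F (cMem i j) | cMem i j = p" for i j using new[OF that B] V1 unfolding vl_def by simp
  show "V' (cEql i j) B <-> Er (if D (lk B i d0) then lk B i d0 else d0) (if D (lk B j d0) then lk B j d0 else d0)"
   if "F (cEql i j) | cEql i j = p" for i j using new[OF that B] V1 unfolding vl_def by simp
  show "V' (cNeg q) B <-> ~ V' q B" if "F (cNeg q) | cNeg q = p" for q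
   using new[OF that B] old[OF sub[of q, OF _ that]] V1 by simp
  show "V' (cImp q r) B <-> (V' q B --> V' r B)" if "F (cImp q r) | cImp q r = p" for q r
   using new[OF that B] old[OF sub[of q, OF _ that]] old[OF sub[of r, OF _ that]] V1 by simp
  show "V' (cAll i q) B <-> (ALL c. D c --> V' q (upd B i c))" if "F (cAll i q) | cAll i q = p" for i q
   using new[OF that B] old[OF sub[of q, OF _ that]] V1 by simp
 next
  show "dfn (%e. F (e 0) | e 0 = p)" by (intro dfnI)
  show "Form x" if "F x | x = p" for x using that p FForm by blast
  show "F q | q = p" if "F x | x = p" "Imm q x" for x q using sub that by blast
 qed (fact dD dMr dEr d HFD Dd0 Er_refl Er_E Mr_l Mr_r)+
 thus ?thesis using old by blast
qed

section \<open>Finite sets of formulas built up from subformulas\<close>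

context smodel
begin

text \<open>Formulas are added one at a time, each after its immediate subformulas. Induction along
  this growth is internal, so the sets obtained may be of nonstandard finite size.\<close>

definition Us :: "'a => 'a => bool" where
 "Us b = gen (%U. U = b) (%U W. EX p. Form p & (ALL q. Imm q p --> q <: U) & W = adj U p) (%_ _ _. False)"

lemma dfn_Us [dfnI]: "dt x ==> dfn (%e. Us b (x e))" unfolding Us_def by (intro dfn_gen0 dfnI)
lemma Us_base: "Us b b" unfolding Us_def by (rule gen_base) simp
lemma Us_step: "Us b U ==> Form p ==> (!!q. Imm q p ==> q <: U) ==> Us b (adj U p)" unfolding Us_def by (erule gen_1) blast
lemma Us_induct:
 assumes "Us b U" "dfn (%e. P (e 0))" "P b"
  "!!U p. Us b U ==> P U ==> Form p ==> (!!q. Imm q p ==> q <: U) ==> P (adj U p)"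
 shows "P U"
 by (rule gen_induct[OF assms(1)[unfolded Us_def], of P, OF assms(2)]) (use assms(3,4) in \<open>auto simp: Us_def\<close>)

lemma Us_props:
 assumes "Us b U" "!!x. x <: b ==> Form x" "!!x y. x <: b ==> Imm y x ==> y <: b"
 shows "(ALL x. x <: b --> x <: U) & (ALL x. x <: U --> Form x & (ALL y. Imm y x --> y <: U))"
 by (rule Us_induct[OF assms(1)]) (intro dfnI, use assms(2,3) in auto)

lemma Us_union: assumes "Us b U" "Us b W" shows "EX X. Us b X & (ALL x. x <: U | x <: W --> x <: X)"
proof (rule Us_induct[OF assms(2), of "%W. EX X. Us b X & (ALL x. x <: U | x <: W --> x <: X)"])
 show "dfn (%e. EX X. Us b X & (ALL x. x <: U | x <: e 0 --> x <: X))" by (intro dfnI)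
 have "ALL x. x <: b --> x <: U" by (rule Us_induct[OF assms(1)]) (intro dfnI, auto)
 thus "EX X. Us b X & (ALL x. x <: U | x <: b --> x <: X)" using assms(1) by blast
 fix W p assume IH: "EX X. Us b X & (ALL x. x <: U | x <: W --> x <: X)" and p: "Form p" "!!q. Imm q p ==> q <: W"
 from IH obtain X where X: "Us b X" "!!x. x <: U | x <: W ==> x <: X" by blast
 have "Us b (adj X p)" by (rule Us_step[OF X(1) p(1)]) (use p X in blast)
 thus "EX X. Us b X & (ALL x. x <: U | x <: adj W p --> x <: X)" using X(2) by (intro exI[of _ "adj X p"]) auto
qed

lemma Us_Form: assumes "Form p" shows "EX X. Us b X & p <: X"
proof (rule Form_induct[OF assms, of "%p. EX X. Us b X & p <: X"])
 show "dfn (%e. EX X. Us b X & e 0 <: X)" by (intro dfnI)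
 have s: "EX X. Us b X & p <: X" if "Us b Y" "Form p" "!!q. Imm q p ==> q <: Y" for p Y
  using Us_step[OF that] by (intro exI[of _ "adj Y p"]) simp
 show "EX X. Us b X & cMem i j <: X" "EX X. Us b X & cEql i j <: X" if "Nat i" "Nat j" for i j
  by (rule s[OF Us_base]; use that in simp)+
 show "EX X. Us b X & cNeg p <: X" if h: "Form p" "EX X. Us b X & p <: X" for p
 proof -
  obtain X where "Us b X" "p <: X" using h(2) by blast
  thus ?thesis by (intro s[of X]) (use h in simp_all)
 qed
 show "EX X. Us b X & cAll i p <: X" if h: "Nat i" "Form p" "EX X. Us b X & p <: X" for i p
 proof -
  obtain X where "Us b X" "p <: X" using h(3) by blast
  thus ?thesis by (intro s[of X]) (use h in simp_all)
 qed
 show "EX X. Us b X & cImp p q <: X" if h: "Form p" "EX X. Us b X & p <: X" "Form q" "EX X. Us b X & q <: X" for p q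
 proof -
  obtain X Y where *: "Us b X" "p <: X" "Us b Y" "q <: Y" using h(2,4) by blast
  obtain Z where "Us b Z" "p <: Z" "q <: Z" using Us_union[OF *(1,3)] *(2,4) by blast
  thus ?thesis by (intro s[of Z]) (use h in auto)
 qed
qed

lemma IV_mono: "IV F v ==> (!!x. F x ==> F' x) ==> IV F' v" unfolding IV_def by blast

lemma Ref_mono:
 assumes T: "dfn (%e. T (e 0))" and F': "dfn (%e. F' (e 0))" and FF: "!!x. F x ==> F' x" and R: "Ref T F v"
 shows "Ref T F' v"
proof (rule gen_induct[OF R[unfolded Ref_def], of "Ref T F'"])
 show "dfn (%e. Ref T F' (e 0))" by (rule dfn_Ref[OF T F']) (rule dt_var)
 show "Ref T F' v" if "IV F v & Vio T v" for v using that IV_mono[of F v F', OF _ FF] Ref_base by blast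
 show "Ref T F' v" if h: "Ref T F' w" "Ref1 F w v" for v w
 proof -
  obtain i p A c where *: "IV F v" "w = adj v (neg p (upd A i c))" "neg (cAll i p) A <: v" "fresh c v" using h(2) unfolding Ref1_def by blast
  show ?thesis using Ref_eigen[OF IV_mono[of F v F', OF *(1) FF] *(3,4)] h(1) *(2) by blast
 qed
 show "Ref T F' v" if h: "Ref T F' w" "Ref T F' w'" "Ref2 F w w' v" for v w w'
 proof -
  obtain p A where *: "IV F v" "F p" "HF A" "w = adj v (pos p A)" "w' = adj v (neg p A)" using h(3) unfolding Ref2_def by blast
  show ?thesis using Ref_cut[OF T F' IV_mono[of F v F', OF *(1) FF] FF[OF *(2)] *(3)] h(1,2) *(4,5) by blast
 qed
qed

lemma IV_Us: assumes v: "IV Form v" shows "EX U. Us b U & IV (%x. x <: U) v"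
proof -
 let ?P = "%v. (ALL x. x <: v --> (EX p A. Form p & HF A & (x = pos p A | x = neg p A))) -->
  (EX U. Us b U & (ALL x. x <: v --> (EX p A. p <: U & HF A & (x = pos p A | x = neg p A))))"
 have h: "HF v" using v unfolding IV_def by blast
 have "?P v"
 proof (rule HF_induct[OF h, of ?P])
  show "dfn (%e. ?P (e 0))" by (intro dfnI)
  show "?P emp" using Us_base by auto
  fix x y assume IH: "?P x"
  show "?P (adj x y)"
  proof
   assume a: "ALL z. z <: adj x y --> (EX p A. Form p & HF A & (z = pos p A | z = neg p A))"
   then obtain U where U: "Us b U" "ALL z. z <: x --> (EX p A. p <: U & HF A & (z = pos p A | z = neg p A))" using IH by auto
   have "EX p A. Form p & HF A & (y = pos p A | y = neg p A)" using a[rule_format, of y] by simp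
   then obtain p A where p: "Form p" "HF A" "y = pos p A | y = neg p A" by blast
   obtain W where W: "Us b W" "p <: W" using Us_Form[OF p(1)] by blast
   obtain X where X: "Us b X" "!!x. x <: U | x <: W ==> x <: X" using Us_union[OF U(1) W(1)] by blast
   have "EX p A. p <: X & HF A & (z = pos p A | z = neg p A)" if "z <: adj x y" for z
   proof (cases "z = y")
    case True thus ?thesis using p W X(2) by blast
   next
    case False
    hence "z <: x" using that by simp
    thus ?thesis using U(2) X(2) by blast
   qed
   thus "EX U. Us b U & (ALL z. z <: adj x y --> (EX p A. p <: U & HF A & (z = pos p A | z = neg p A)))" using X(1) by blast
  qed
 qed
 thus ?thesis using v unfolding IV_def by blast
qed

lemma dfn_mem_in: "dfn (%e. e 0 <: U)" by (intro dfnI)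

text \<open>A refutation mentions only finitely many formulas in the sense of the model; the sets
  belonging to its premises are united by \<open>Us_union\<close>.\<close>

lemma Ref_Us: assumes T: "dfn (%e. T (e 0))" and R: "Ref T Form v" shows "EX U. Us b U & Ref T (%x. x <: U) v"
proof (rule gen_induct[OF R[unfolded Ref_def], of "%v. EX U. Us b U & Ref T (%x. x <: U) v"])
 show "dfn (%e. EX U. Us b U & Ref T (%x. x <: U) (e 0))"
  by (intro dfn_ex dfn_and dfn_Us dt_var dfn_RefU[OF T, of "%e x. x <: e 0"] dfnI)
 have mono: "Ref T (%x. x <: X) v" if "Ref T (%x. x <: U) v" "!!x. x <: U ==> x <: X" for U X v
  by (rule Ref_mono[OF T dfn_mem_in that(2) that(1)])
 show "EX U. Us b U & Ref T (%x. x <: U) v" if h: "IV Form v & Vio T v" for v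
 proof -
  obtain U where "Us b U" "IV (%x. x <: U) v" using IV_Us h by blast
  thus ?thesis using Ref_base h by blast
 qed
 show "EX U. Us b U & Ref T (%x. x <: U) v" if h: "EX U. Us b U & Ref T (%x. x <: U) w" "Ref1 Form w v" for v w
 proof -
  obtain i p A c where *: "IV Form v" "w = adj v (neg p (upd A i c))" "neg (cAll i p) A <: v" "fresh c v" using h(2) unfolding Ref1_def by blast
  obtain U where U: "Us b U" "Ref T (%x. x <: U) w" using h(1) by blast
  obtain W where W: "Us b W" "IV (%x. x <: W) v" using IV_Us *(1) by blast
  obtain X where X: "Us b X" "!!x. x <: U | x <: W ==> x <: X" using Us_union[OF U(1) W(1)] by blast
  have i: "IV (%x. x <: X) v" by (rule IV_mono[OF W(2)]) (use X(2) in blast)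
  have r: "Ref T (%x. x <: X) w" by (rule mono[OF U(2)]) (use X(2) in blast)
  show ?thesis using X(1) Ref_eigen[OF i *(3,4) r[unfolded *(2)]] by blast
 qed
 show "EX U. Us b U & Ref T (%x. x <: U) v"
  if h: "EX U. Us b U & Ref T (%x. x <: U) w" "EX U. Us b U & Ref T (%x. x <: U) w'" "Ref2 Form w w' v" for v w w'
 proof -
  obtain p A where *: "IV Form v" "Form p" "HF A" "w = adj v (pos p A)" "w' = adj v (neg p A)" using h(3) unfolding Ref2_def by blast
  obtain U where U: "Us b U" "Ref T (%x. x <: U) w" using h(1) by blast
  obtain U' where U': "Us b U'" "Ref T (%x. x <: U') w'" using h(2) by blast
  obtain W where W: "Us b W" "IV (%x. x <: W) v" using IV_Us *(1) by blast
  obtain W' where W': "Us b W'" "p <: W'" using Us_Form *(2) by blast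
  obtain X where X: "Us b X" "!!x. x <: U | x <: W ==> x <: X" using Us_union[OF U(1) W(1)] by blast
  obtain Y where Y: "Us b Y" "!!x. x <: U' | x <: W' ==> x <: Y" using Us_union[OF U'(1) W'(1)] by blast
  obtain Z where Z: "Us b Z" "!!x. x <: X | x <: Y ==> x <: Z" using Us_union[OF X(1) Y(1)] by blast
  have i: "IV (%x. x <: Z) v" by (rule IV_mono[OF W(2)]) (use X(2) Z(2) in blast)
  have r: "Ref T (%x. x <: Z) w" by (rule mono[OF U(2)]) (use X(2) Z(2) in blast)
  have r': "Ref T (%x. x <: Z) w'" by (rule mono[OF U'(2)]) (use Y(2) Z(2) in blast)
  have "p <: Z" using W'(2) Y(2) Z(2) by blast
  thus ?thesis using Z(1) Ref_cut[OF T dfn_mem_in i _ *(3) r[unfolded *(4)] r'[unfolded *(5)]] by blast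
 qed
qed

text \<open>A single definable structure satisfies \<open>T\<close> but has no definable truth predicate; hence the
 induction along growing finite sets of formulas, with a new model at each stage.\<close>

lemma not_Ref_Form:
 fixes V :: "'a => 'a => bool"
 assumes T: "dfn (%e. T (e 0))" and Tb: "!!x. T x ==> x <: b" and b01: "mem01 <: b" "eq01 <: b"
  and V: "tarski E dfn (%x. x <: b) D d0 Mr Er V" and TV: "!!p B. T p ==> HF B ==> V p B"
 shows "~ Ref T Form emp"
proof
 assume "Ref T Form emp"
 from Ref_Us[OF T this, of b] obtain U where U: "Us b U" "Ref T (%x. x <: U) emp" by blast
 interpret b: tarski E dfn "%x. x <: b" D d0 Mr Er V by (rule V)
 have "~ Ref T (%x. x <: U) emp"
 proof (rule Us_induct[OF U(1), of "%U. ~ Ref T (%x. x <: U) emp"])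
  show "dfn (%e. ~ Ref T (%x. x <: e 0) emp)"
   by (intro dfn_not dfn_RefU[OF T, of "%e x. x <: e 0"] dfnI)
  show "~ Ref T (%x. x <: b) emp" by (rule b.not_Ref) (rule TV)
  fix U p assume U: "Us b U" "~ Ref T (%x. x <: U) emp" and p: "Form p" "!!q. Imm q p ==> q <: U"
  have up: "(ALL x. x <: b --> x <: U) & (ALL x. x <: U --> Form x & (ALL y. Imm y x --> y <: U))"
   by (rule Us_props[OF U(1) b.FForm b.FImm])
  \<comment> \<open>Irrefutability over \<open>U\<close> gives a model with truth on
    \<open>U\<close>; one clause extends its truth to \<open>p\<close>, and soundness in this model
    gives irrefutability over \<open>adj U p\<close>.\<close>
  have "EX V Mr Er. tarski E dfn (%x. x <: U) Nat emp Mr Er V & (ALL p A. T p --> p <: U --> HF A --> V p A) &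
   (ALL p A. (pos p A <: emp --> V p A) & (neg p A <: emp --> ~ V p A))"
   by (rule model_existence[OF T dfn_mem_in _ _ _ _ IV_emp U(2)]) (use up b01 in blast)+
  then obtain V Mr Er where W: "tarski E dfn (%x. x <: U) Nat emp Mr Er V" "!!p A. T p ==> p <: U ==> HF A ==> V p A" by blast
  interpret w: tarski E dfn "%x. x <: U" Nat emp Mr Er V by (rule W(1))
  obtain V' where V': "tarski E dfn (%x. x <: U | x = p) Nat emp Mr Er V'" "!!x B. x <: U ==> V' x B = V x B"
   using w.extend[OF p] by blast
  interpret v: tarski E dfn "%x. x <: U | x = p" Nat emp Mr Er V' by (rule V'(1))
  have "~ Ref T (%x. x <: U | x = p) emp"
  proof (rule v.not_Ref)
   fix q B assume "T q" "HF B"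
   thus "V' q B" using V'(2) W(2) up Tb by blast
  qed
  thus "~ Ref T (%x. x <: adj U p) emp" by simp
 qed
 thus False using U(2) by blast
qed

end

primrec subfms :: "fm => fm list" where
 "subfms (Mem i j) = [Mem i j]"
| "subfms (Eql i j) = [Eql i j]"
| "subfms (Neg p) = Neg p # subfms p"
| "subfms (Imp p q) = Imp p q # subfms p @ subfms q"
| "subfms (Forall i p) = Forall i p # subfms p"

lemma subfms_refl: "p : set (subfms p)" by (cases p) auto
lemma subfms_closed:
 "Neg q : set (subfms p) ==> q : set (subfms p)" "Imp q r : set (subfms p) ==> q : set (subfms p) & r : set (subfms p)"
 "Forall i q : set (subfms p) ==> q : set (subfms p)"
 by (induction p) (auto simp: subfms_refl)

context smodel
begin

lemma finite_set_ex: "EX b. ALL x. x <: b <-> x : set xs"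
proof (induction xs)
 case (Cons a xs)
 then obtain b where "ALL x. x <: b <-> x : set xs" by blast
 thus ?case by (intro exI[of _ "adj b a"]) auto
qed (auto intro: exI[of _ emp])

text \<open>For the given structure there are truth predicates for finite lists of standard
  formulas. That much already excludes refutations from \<open>L\<close> by arbitrary internal
  formulas, and the Henkin model then obtained has truth for all of them.\<close>

theorem finite_theory_model:
 fixes L :: "fm list"
 assumes D: "dfn (%e. D (e 0))" and M: "dfn (%e. Mr (e 0) (e 1))" and R: "dfn (%e. Er (e 0) (e 1))"
  and HFD: "!!c. D c ==> HF c" and Dd0: "D d0"
  and eq: "!!c. D c ==> Er c c" "!!c d k. D c ==> D d ==> D k ==> Er c d ==> Er c k ==> Er d k"
   "!!c d k. D c ==> D d ==> D k ==> Er c d ==> Mr c k ==> Mr d k"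
   "!!c d k. D c ==> D d ==> D k ==> Er c d ==> Mr k c ==> Mr k d"
  and L: "!!p e. p : set L ==> (!!i. D (e i)) ==> sat {c. D c} Mr Er e p"
 shows "EX V Mr Er. tarski E dfn Form Nat emp Mr Er V & (ALL p:set L. ALL B. HF B --> V (code p) B)"
proof -
 define U where "U = Mem 0 1 # Eql 0 1 # concat (map subfms L)"
 let ?V = "%x B. EX p:set U. x = code p & sat {c. D c} Mr Er (%i. if D (lk B (nn i) d0) then lk B (nn i) d0 else d0) p"
 have t: "tarski E dfn (%x. EX p:set U. x = code p) D d0 Mr Er ?V"
  by (rule tarski_codes[OF D M R HFD Dd0 eq]) (auto simp: U_def dest: subfms_closed)
 obtain b where b: "!!x. x <: b <-> x : set (map code U)" using finite_set_ex by blast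
 hence b': "x <: b <-> (EX p:set U. x = code p)" for x by auto
 define T where "T = (%x. EX p:set L. x = code p)"
 have LU: "p : set U" if "p : set L" for p using that subfms_refl unfolding U_def by auto
 have T: "dfn (%e. T (e 0))" unfolding T_def by (intro dfn_Bex_set dfnI)
 have nr: "~ Ref T Form emp"
 proof (rule not_Ref_Form[OF T, of b D d0 Mr Er ?V])
  show "tarski E dfn (%x. x <: b) D d0 Mr Er ?V" using t unfolding b' .
  show "x <: b" if "T x" for x using that LU unfolding b' T_def by blast
  show "mem01 <: b" "eq01 <: b" unfolding b' mem01_def eq01_def by (simp_all add: U_def)
  show "?V p B" if h: "T p" for p B
  proof -
   obtain q where q: "q : set L" "p = code q" using h unfolding T_def by blast
   have "sat {c. D c} Mr Er (%i. if D (lk B (nn i) d0) then lk B (nn i) d0 else d0) q" by (rule L[OF q(1)]) (simp add: Dd0)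
   thus ?thesis using q LU by blast
  qed
 qed
 have "EX V Mr Er. tarski E dfn Form Nat emp Mr Er V & (ALL p A. T p --> Form p --> HF A --> V p A) &
   (ALL p A. (pos p A <: emp --> V p A) & (neg p A <: emp --> ~ V p A))"
 proof (rule model_existence[OF T _ _ _ _ _ IV_emp nr])
  show "Form q" if "Form p" "Imm q p" for p q using that(1) by (cases rule: Form_cases) (use that(2) in auto)
  show "dfn (%e. Form (e 0))" by (intro dfnI)
 qed (simp_all add: mem01_def eq01_def)
 thus ?thesis unfolding T_def by (metis Form_code)
qed

end

section \<open>Transport of definable structures to the type of natural numbers\<close>

text \<open>The structures produced by the Henkin construction live on a subset of
  \<open>nat\<close> with a congruence for equality. Returning to all of \<open>nat\<close> with
  true equality lets the development for models of S be applied to them again.\<close>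

locale quot0 =
 fixes W :: "nat set" and Mr Er :: "nat => nat => bool"
 assumes Qr: "c : W ==> Er c c" and QE: "c : W ==> d : W ==> k : W ==> Er c d ==> Er c k ==> Er d k"
  and Ql: "c : W ==> d : W ==> k : W ==> Er c d ==> Mr c k ==> Mr d k"
  and Qm: "c : W ==> d : W ==> k : W ==> Er c d ==> Mr k c ==> Mr k d"
begin

lemma Qs: "c : W ==> d : W ==> Er c d ==> Er d c" using QE[of c d c] Qr by blast

definition rep :: "nat set => nat => nat" where "rep A c = (LEAST d. d : A & Er c d)"

lemma rep: assumes "A \<subseteq> W" "c : A" shows "rep A c : A" "Er c (rep A c)"
 using LeastI[of "%d. d : A & Er c d" c] assms Qr unfolding rep_def by blast+

lemma rep_eq: assumes "A \<subseteq> W" "c : A" "d : A" shows "rep A c = rep A d <-> Er c d"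
proof
 assume "rep A c = rep A d"
 hence r: "Er c (rep A c)" "Er d (rep A c)" "rep A c : W" using rep[OF assms(1,2)] rep[OF assms(1,3)] assms(1) by auto
 have w: "c : W" "d : W" using assms by blast+
 have "Er (rep A c) c" "Er (rep A c) d" using Qs[OF w(1) r(3,1)] Qs[OF w(2) r(3,2)] .
 thus "Er c d" by (rule QE[OF r(3) w])
next
 assume e: "Er c d"
 have w: "c : W" "d : W" using assms by blast+
 have "(k : A & Er c k) = (k : A & Er d k)" for k
  using QE[OF w(1,2) _ e, of k] QE[OF w(2,1) _ Qs[OF w e], of k] assms(1) by blast
 thus "rep A c = rep A d" unfolding rep_def by simp
qed

lemma rep_in: "c : W ==> rep W c : W" by (rule rep(1)) simp
lemma rep_iff: "c : W ==> d : W ==> rep W c = rep W d <-> Er c d" by (rule rep_eq) simp_all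
lemma Mr_rep: assumes "c : W" "d : W" shows "Mr (rep W c) (rep W d) <-> Mr c d"
proof -
 have e: "Er c (rep W c)" "Er d (rep W d)" using rep(2)[OF subset_refl] assms by blast+
 note i = rep_in[OF assms(1)] rep_in[OF assms(2)]
 have "Mr c d <-> Mr (rep W c) d"
  using Ql[OF assms(1) i(1) assms(2) e(1)] Ql[OF i(1) assms(1) assms(2) Qs[OF assms(1) i(1) e(1)]] by blast
 also have "\<dots> <-> Mr (rep W c) (rep W d)"
  using Qm[OF assms(2) i(2) i(1) e(2)] Qm[OF i(2) assms(2) i(1) Qs[OF assms(2) i(2) e(2)]] by blast
 finally show ?thesis by blast
qed

lemma sat_rep: "(!!i. i : FV p ==> e i : W & e' i = rep W (e i)) ==> sat W Mr Er e p <-> sat (rep W ` W) Mr (=) e' p"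
 by (rule sat_iso[where W = W and h = "rep W"]) (use Mr_rep rep_iff in auto)

end

text \<open>For a bijection with \<open>nat\<close> the quotient has to be infinite.
  \<open>Qinf\<close> ensures this by a map that is injective modulo \<open>Er\<close> and misses
  \<open>z\<close>; in models of S these are the singleton map and the empty set.\<close>

locale quot = quot0 +
 assumes Qinf: "EX W0 z s. W0 \<subseteq> W & z : W0 & (ALL c:W0. s c : W0 & ~ Er (s c) z) & (ALL c:W0. ALL d:W0. Er (s c) (s d) --> Er c d)"
begin

lemma ex_proj: "EX h. h ` W = (UNIV :: nat set) & (ALL c:W. ALL d:W. h c = (h d :: nat) <-> Er c d)"
proof -
 obtain W0 z s where W0: "W0 \<subseteq> W" "z : W0" and s: "!!c. c : W0 ==> s c : W0" "!!c. c : W0 ==> ~ Er (s c) z"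
  "!!c d. c : W0 ==> d : W0 ==> Er (s c) (s d) ==> Er c d" using Qinf by blast
 let ?r = "rep W0" let ?R = "?r ` W0" let ?f = "%c. ?r (s c)"
 have id: "?r c = c" if "c : ?R" for c
 proof -
  obtain d where d: "d : W0" "c = ?r d" using \<open>c : ?R\<close> by blast
  thus ?thesis using rep_eq[OF W0(1) d(1) rep(1)[OF W0(1) d(1)]] rep(2)[OF W0(1) d(1)] by simp
 qed
 have sub: "?R \<subseteq> W0" using rep(1)[OF W0(1)] by blast
 have "infinite ?R"
 proof
  assume fin: "finite ?R"
  have inj: "inj_on ?f ?R"
  proof (rule inj_onI)
   fix c d assume *: "c : ?R" "d : ?R" "?f c = ?f d"
   have w: "c : W0" "d : W0" using * sub by blast+
   have "Er (s c) (s d)" using rep_eq[OF W0(1) s(1)[OF w(1)] s(1)[OF w(2)]] *(3) by blast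
   hence "?r c = ?r d" using rep_eq[OF W0(1) w] s(3)[OF w] by blast
   thus "c = d" using id[OF *(1)] id[OF *(2)] by simp
  qed
  have im: "?f ` ?R \<subseteq> ?R" using s(1) sub by blast
  have "?r z : ?f ` ?R" using endo_inj_surj[OF fin im inj] W0(2) by blast
  then obtain c where c: "c : W0" "?r z = ?r (s c)" using sub by blast
  hence "?r (s c) = ?r z" by simp
  hence "Er (s c) z" using rep_eq[OF W0(1) s(1)[OF c(1)] W0(2)] by blast
  thus False using s(2)[OF c(1)] by blast
 qed
 moreover have "inj_on (rep W) ?R"
 proof (rule inj_onI)
  fix c d assume *: "c : ?R" "d : ?R" "rep W c = rep W d"
  have w: "c : W0" "d : W0" using * sub by blast+
  hence "Er c d" using rep_eq[of W c d] * W0(1) by blast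
  hence "?r c = ?r d" using rep_eq[OF W0(1) w] by blast
  thus "c = d" using id[OF *(1)] id[OF *(2)] by simp
 qed
 ultimately have "infinite (rep W ` ?R)" using finite_imageD by blast
 moreover have "rep W ` ?R \<subseteq> rep W ` W" using sub W0(1) by blast
 ultimately have "infinite (rep W ` W)" using finite_subset by blast
 hence b: "bij_betw (to_nat_on (rep W ` W)) (rep W ` W) UNIV" by (intro to_nat_on_infinite) simp
 have "(to_nat_on (rep W ` W) \<circ> rep W) ` W = UNIV" using bij_betw_imp_surj_on[OF b] by (simp add: image_comp)
 moreover have "(to_nat_on (rep W ` W) \<circ> rep W) c = (to_nat_on (rep W ` W) \<circ> rep W) d <-> Er c d" if "c : W" "d : W" for c d
  using inj_on_eq_iff[OF bij_betw_imp_inj_on[OF b], of "rep W c" "rep W d"] rep_eq[OF subset_refl that] that by simp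
 ultimately show ?thesis by blast
qed

definition proj :: "nat => nat" where
 "proj = (SOME h. h ` W = (UNIV :: nat set) & (ALL c:W. ALL d:W. h c = (h d :: nat) <-> Er c d))"
lemma proj: "proj ` W = UNIV" "c : W ==> d : W ==> proj c = proj d <-> Er c d"
 using someI_ex[OF ex_proj] unfolding proj_def by blast+
lemma proj_ex: "EX c:W. proj c = a" using proj(1) by (metis UNIV_I imageE)

definition EN :: "nat => nat => bool" where "EN a b <-> (EX c:W. EX d:W. proj c = a & proj d = b & Mr c d)"
lemma EN_proj: assumes "c : W" "d : W" shows "EN (proj c) (proj d) <-> Mr c d"
proof
 assume "EN (proj c) (proj d)"
 then obtain c' d' where *: "c' : W" "d' : W" "proj c' = proj c" "proj d' = proj d" "Mr c' d'" unfolding EN_def by blast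
 hence "Er c' c" "Er d' d" using proj(2) assms by blast+
 thus "Mr c d" using Ql[OF *(1) assms(1) *(2) _ *(5)] Qm[OF *(2) assms(2,1)] by blast
qed (use assms in \<open>auto simp: EN_def\<close>)

lemma sat_proj: "(!!i. i : FV p ==> e i : W & e' i = proj (e i)) ==> sat W Mr Er e p <-> sat UNIV EN (=) e' p"
 by (rule sat_iso[where W = W and h = proj]) (use proj EN_proj in auto)

end

section \<open>The model given by the consistency of S\<close>

lemma (in smodel) con_model:
 assumes "Con SAx"
 shows "EX V Mr Er. tarski E dfn Form Nat emp Mr Er V & (ALL p A. SAx p --> HF A --> V p A)"
proof -
 interpret h: hilb E dfn SAx by unfold_locales (intro dfnI, rule SAx_Form)
 have nr: "~ Ref SAx Form emp" by (rule h.Con_not_Ref[OF assms])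
 have "EX V Mr Er. tarski E dfn Form Nat emp Mr Er V & (ALL p A. SAx p --> Form p --> HF A --> V p A) &
   (ALL p A. (pos p A <: emp --> V p A) & (neg p A <: emp --> ~ V p A))"
 proof (rule model_existence[OF h.dT _ _ _ _ _ IV_emp nr])
  show "Form q" if "Form p" "Imm q p" for p q using that(1) by (cases rule: Form_cases) (use that(2) in auto)
  show "dfn (%e. Form (e 0))" by (intro dfnI)
 qed (simp_all add: mem01_def eq01_def)
 thus ?thesis using SAx_Form by metis
qed

locale nmod = tarski E dfn "smodel.Form E" "smodel.Nat E" "smodel.emp E" Mr Er V for E :: "nat => nat => bool" (infix "<:" 50) and dfn Mr Er V +
 assumes SV: "SAx x ==> HF B ==> V x B"
begin

lemma V_SAx: assumes "p : set S_single" "!!i. Nat (e i)" shows "sat {c. Nat c} Mr Er e p"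
proof -
 have fv: "FV p = {}" using assms(1) unfolding S_single_def
  by (auto simp: ax_ext_def ax_found_def ax_pair_def ax_union_def ax_power_def hall_def hex_def hmem_def heq_def hnot_def hand_def hor_def himp_def hiff_def)
 have "SAx (code p)" unfolding SAx_def using assms(1) by blast
 hence "V (code p) emp" using SV by simp
 hence "sat {c. Nat c} Mr Er (%i. vl emp (nn i)) p" by (simp add: V_code)
 thus ?thesis using sat_cong[of p e "%i. vl emp (nn i)" "{c. Nat c}" Mr Er] fv by simp
qed

sublocale q: quot "{c. Nat c}" Mr Er
proof
 define z where "z = (SOME z. Nat z & (ALL c. Nat c --> ~ Mr c z))"
 define s where "s = (%c. SOME d. Nat d & (ALL x. Nat x --> (Mr x d <-> Er x c)))"
 have e: "Nat ((%_. emp) i)" for i by simp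
 have pair: "ALL x. Nat x --> (ALL y. Nat y --> (EX z. Nat z & (ALL w. Nat w --> (Mr w z <-> Er w x | Er w y))))"
  using V_SAx[of "ax_pair 0" "%_. emp"] by (simp add: S_single_def ax_pair_def sat_h)
 have s: "Nat (s c)" "Nat x ==> Mr x (s c) <-> Er x c" if "Nat c" for c x
 proof -
  have "EX d. Nat d & (ALL x. Nat x --> (Mr x d <-> Er x c))" using pair[rule_format, OF that that] by simp
  from someI_ex[OF this] show "Nat (s c)" "Nat x ==> Mr x (s c) <-> Er x c" unfolding s_def by blast+
 qed
 have found: "ALL x. Nat x --> (EX y. Nat y & Mr y x) --> (EX y. Nat y & Mr y x & ~ (EX z. Nat z & Mr z x & Mr z y))"
  using V_SAx[of "ax_found 0" "%_. emp"] by (simp add: S_single_def ax_found_def sat_h)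
 have ext: "ALL x. Nat x --> (ALL y. Nat y --> (ALL z. Nat z --> (Mr z x <-> Mr z y)) --> Er x y)"
  using V_SAx[of "ax_ext 0" "%_. emp"] by (simp add: S_single_def ax_ext_def sat_h)
 have "EX z. Nat z & (ALL c. Nat c --> ~ Mr c z)"
 proof -
  let ?x = "nn 0" and ?y = "nn 1" and ?z = "nn 2"
  let ?p = "cNeg (cEql ?z ?z)"
  have "SAx (cEx ?y (cAll ?z (cIff (cMem ?z ?y) (cConj (cMem ?z ?x) ?p))))"
   unfolding SAx_def
   by (rule disjI2, rule disjI1, rule exI[of _ ?x], rule exI[of _ ?y], rule exI[of _ ?z], rule exI[of _ ?p])
    (simp del: nn.simps)
  hence "V (cEx ?y (cAll ?z (cIff (cMem ?z ?y) (cConj (cMem ?z ?x) ?p)))) emp" using SV by simp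
  thus ?thesis by (simp add: V_Neg V_All V_Imp V_Mem V_Eql vl_upd Er_refl del: nn.simps)
 qed
 from someI_ex[OF this] have z: "Nat z" "!!c. Nat c ==> ~ Mr c z" unfolding z_def by blast+
 have "~ Er (s c) z" if c: "Nat c" for c
 proof
  assume "Er (s c) z"
  hence "Mr c z" using Mr_r[OF s(1)[OF c] z(1) c] s(2)[OF c c] Er_refl[OF c] by blast
  thus False using z c by blast
 qed
 moreover have "Er c d" if c: "Nat c" "Nat d" "Er (s c) (s d)" for c d
 proof -
  have "Mr c (s d)" using Mr_r[OF s(1)[OF c(1)] s(1)[OF c(2)] c(1) c(3)] s(2)[OF c(1,1)] Er_refl[OF c(1)] by blast
  thus ?thesis using s(2)[OF c(2,1)] by blast
 qed
 ultimately show "EX W0 z s. W0 \<subseteq> {c. Nat c} & z : W0 & (ALL c:W0. s c : W0 & ~ Er (s c) z) & (ALL c:W0. ALL d:W0. Er (s c) (s d) --> Er c d)"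
  using z(1) s(1) by (intro exI[of _ "{c. Nat c}"] exI[of _ z] exI[of _ s]) auto
qed (use Er_refl Er_E Mr_l Mr_r in blast)+

lemmas prj = q.proj(2)[unfolded mem_Collect_eq] and prj_EN = q.EN_proj[unfolded mem_Collect_eq]
lemma prj_ex: "EX c. Nat c & q.proj c = a" using q.proj_ex[of a] by blast

definition val :: "nat => nat => nat" where "val B k = q.proj (vl B (nn k))"

lemma val_upd: "Nat c ==> val (upd B (nn i) c) k = (if k = i then q.proj c else val B k)"
 unfolding val_def by (simp add: vl_upd)

lemma ex_val: "EX B. HF B & (ALL k<m. val B k = e k)"
proof (induction m)
 case (Suc m)
 then obtain B where B: "HF B" "!!k. k < m ==> val B k = e k" by blast
 obtain c where c: "Nat c" "q.proj c = e m" using prj_ex by blast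
 show ?case by (rule exI[of _ "upd B (nn m) c"]) (use B c in \<open>auto simp: val_upd less_Suc_eq\<close>)
qed (auto intro: exI[of _ emp])

text \<open>The predicates on the model that are given by a formula in the sense of the ground model,
 possibly of nonstandard length, with standardly many standard variables.\<close>

definition idfn :: "((nat => nat) => bool) => bool" where
 "idfn P <-> (EX q m. (Form q & (ALL i. FreeV i q --> (EX k<m. i = nn k))) & (ALL e B. HF B --> (ALL k<m. val B k = e k) --> (P e <-> V q B)))"

sublocale i: dfn0 q.EN idfn
proof
 show "idfn (%e. q.EN (e i) (e j))" for i j unfolding idfn_def
  by (rule exI[of _ "cMem (nn i) (nn j)"], rule exI[of _ "Suc (max i j)"], intro conjI allI impI)
   (auto simp: V_Mem val_def prj_EN[symmetric])
 show "idfn (%e. e i = e j)" for i j unfolding idfn_def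
  by (rule exI[of _ "cEql (nn i) (nn j)"], rule exI[of _ "Suc (max i j)"], intro conjI allI impI)
   (auto simp: V_Eql val_def prj[symmetric])
 show "idfn (%e. ~ P e)" if h: "idfn P" for P
 proof -
  obtain q m where q: "Form q" "!!i. FreeV i q ==> EX k<m. i = nn k" "!!e B. HF B ==> ALL k<m. val B k = e k ==> P e <-> V q B" using h unfolding idfn_def by blast
  show ?thesis unfolding idfn_def by (rule exI[of _ "cNeg q"], rule exI[of _ m]) (simp add: q V_Neg)
 qed
 show "idfn (%e. P e --> Q e)" if h: "idfn P" "idfn Q" for P Q
 proof -
  obtain q m where q: "Form q" "!!i. FreeV i q ==> EX k<m. i = nn k" "!!e B. HF B ==> ALL k<m. val B k = e k ==> P e <-> V q B" using h(1) unfolding idfn_def by blast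
  obtain r n where r: "Form r" "!!i. FreeV i r ==> EX k<n. i = nn k" "!!e B. HF B ==> ALL k<n. val B k = e k ==> Q e <-> V r B" using h(2) unfolding idfn_def by blast
  show ?thesis unfolding idfn_def
  proof (rule exI[of _ "cImp q r"], rule exI[of _ "max m n"], intro conjI allI impI)
   fix e B assume B: "HF B" "ALL k<max m n. val B k = e k"
   thus "(P e --> Q e) <-> V (cImp q r) B" using q(3)[OF B(1), of e] r(3)[OF B(1), of e] q(1) r(1) by (simp add: V_Imp)
  next
   fix i assume "FreeV i (cImp q r)"
   thus "EX k<max m n. i = nn k" using q(2)[of i] r(2)[of i] by (auto simp: less_max_iff_disj)
  qed (use q r in simp)
 qed
 show "idfn (%e. ALL a. P (e(k := a)))" if h: "idfn P" for P k
 proof -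
  obtain q m where q: "Form q" "!!i. FreeV i q ==> EX k<m. i = nn k" "!!e B. HF B ==> ALL k<m. val B k = e k ==> P e <-> V q B" using h unfolding idfn_def by blast
  show ?thesis unfolding idfn_def
  proof (rule exI[of _ "cAll (nn k) q"], rule exI[of _ m], intro conjI allI impI)
   fix e B assume B: "HF B" "ALL k<m. val B k = e k"
   have u: "P (e(k := q.proj c)) <-> V q (upd B (nn k) c)" if c: "Nat c" for c
    by (rule q(3)) (use B c in \<open>auto simp: val_upd\<close>)
   have "(ALL a. P (e(k := a))) <-> (ALL c. Nat c --> P (e(k := q.proj c)))" using prj_ex by metis
   thus "(ALL a. P (e(k := a))) <-> V (cAll (nn k) q) B" using u B(1) q(1) by (simp add: V_All)
  qed (use q in auto)
 qed
 show "EX m. ALL e e'. (ALL i<m. e i = e' i) --> P e = P e'" if h: "idfn P" for P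
 proof -
  obtain q m where q: "Form q" "!!i. FreeV i q ==> EX k<m. i = nn k" "!!e B. HF B ==> ALL k<m. val B k = e k ==> P e <-> V q B" using h unfolding idfn_def by blast
  have "P e = P e'" if e: "ALL i<m. e i = e' i" for e e'
  proof -
   obtain B where B: "HF B" "ALL k<m. val B k = e k" using ex_val[of m e] by blast
   thus ?thesis using q(3)[OF B(1), of e] q(3)[OF B(1), of e'] e by simp
  qed
  thus ?thesis by blast
 qed
qed

lemma fresh_var: assumes "Form q" shows "EX X. Nat X & ~ FreeV X q & (ALL k<m. X ~= nn k) & ~ FreeV (suc X) q & (ALL k<m. suc X ~= nn k) &
  ~ FreeV (suc (suc X)) q & (ALL k<m. suc (suc X) ~= nn k)"
proof -
 obtain m0 where m0: "Nat m0" "!!i. FreeV i q ==> i <: m0" using FreeV_bound[OF assms] by blast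
 obtain X where X: "Nat X" "!!l. l <: m0 | l <: nn m ==> l <: X" using Nat_max[OF m0(1) Nat_nn[of m]] by blast
 have "nn k <: X" if "k < m" for k using X(2)[of "nn k"] that by (simp add: mem_nn)
 moreover have "~ X <: X" "~ suc X <: X" "~ suc (suc X) <: X"
  using irrefl[of X] asym[of X "suc X"] asym[of X "suc (suc X)"] by auto
 ultimately show ?thesis using X m0(2) by metis
qed

lemma sat_N: "p : set S_single ==> sat UNIV q.EN (=) e p"
proof -
 assume p: "p : set S_single"
 have fv: "FV p = {}" using p unfolding S_single_def
  by (auto simp: ax_ext_def ax_found_def ax_pair_def ax_union_def ax_power_def hall_def hex_def hmem_def heq_def hnot_def hand_def hor_def himp_def hiff_def)
 show ?thesis using q.sat_proj[of p "%_. emp" e] V_SAx[OF p, of "%_. emp"] fv by simp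
qed

text \<open>\<open>V\<close> verifies every instance of the schemata that the ground model regards
  as an axiom, nonstandard ones included. Therefore all of \<open>idfn\<close>, and not just the
  standard formulas, is admissible as the family of definable predicates.\<close>

sublocale n: smodel q.EN "pdfn idfn"
proof (rule smodel.intro[OF i.dfn0_pdfn], unfold_locales)
 show "pdfn idfn P ==> pdfn idfn (%e. P (e(k := c)))" for P k c by (rule i.pdfn_param)
 show "x = y" if "!!z. q.EN z x <-> q.EN z y" for x y
  using sat_N[of "ax_ext 0"] that by (simp add: S_single_def ax_ext_def sat_h)
 show "EX y. q.EN y x & ~ (EX z. q.EN z x & q.EN z y)" if "q.EN y x" for x y
  using sat_N[of "ax_found 0"] that by (auto simp add: S_single_def ax_found_def sat_h)
 show "EX z. ALL w. q.EN w z <-> w = x | w = y" for x y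
  using sat_N[of "ax_pair 0"] by (simp add: S_single_def ax_pair_def sat_h)
 show "EX u. ALL w. q.EN w u <-> (EX y. q.EN y x & q.EN w y)" for x
  using sat_N[of "ax_union 0"] by (simp add: S_single_def ax_union_def sat_h)
 show "EX p. ALL w. q.EN w p <-> (ALL z. q.EN z w --> q.EN z x)" for x
  using sat_N[of "ax_power 0"] by (simp add: S_single_def ax_power_def sat_h)
 show "EX y. ALL z. q.EN z y <-> q.EN z x & G z" if G: "pdfn idfn (%e. G (e 0))" for G x
 proof -
  obtain P0 c where P0: "idfn P0" "!!e. G (e 0) = P0 (%i. if even i then e (i div 2) else c i)" using G unfolding pdfn_def by blast
  obtain q m where q: "Form q" "!!i. FreeV i q ==> EX k<m. i = nn k" "!!e B. HF B ==> ALL k<m. val B k = e k ==> P0 e <-> V q B" using P0(1) unfolding idfn_def by blast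
  define e0 where "e0 = (%i::nat. if even i then x else c i)"
  obtain B where B: "HF B" "!!k. k < Suc m ==> val B k = e0 k" using ex_val[of "Suc m" e0] by blast
  \<comment> \<open>\<open>X\<close> and \<open>suc X\<close> lie beyond the standard variables in
    use and the free variables of \<open>q\<close>, so placing the two sets there leaves the
    evaluation of \<open>q\<close> intact.\<close>
  obtain X where X: "Nat X" "~ FreeV (suc X) q" "ALL k<Suc m. X ~= nn k" "ALL k<Suc m. suc X ~= nn k" using fresh_var[OF q(1), of "Suc m"] by blast
  let ?Y = "suc X" and ?z = "nn 0"
  have ne: "X ~= ?z" "?z ~= X" "?Y ~= ?z" "?z ~= ?Y" "X ~= ?Y" "?Y ~= X" using X(3,4) irrefl[of X] mem_suc[of X X] by fastforce+
  obtain cx where cx: "Nat cx" "q.proj cx = x" using prj_ex by blast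
  have "SAx (cEx ?Y (cAll ?z (cIff (cMem ?z ?Y) (cConj (cMem ?z X) q))))" unfolding SAx_def
   by (rule disjI2, rule disjI1, rule exI[of _ X], rule exI[of _ ?Y], rule exI[of _ ?z], rule exI[of _ q])
    (use X ne q(1) in \<open>simp del: nn.simps\<close>)
  hence "V (cEx ?Y (cAll ?z (cIff (cMem ?z ?Y) (cConj (cMem ?z X) q)))) (upd B X cx)" using SV B X cx by simp
  then obtain cy where cy: "Nat cy" "!!cz. Nat cz ==> Mr cz cy <-> Mr cz cx & V q (upd (upd (upd B X cx) ?Y cy) ?z cz)"
   using B X cx q(1) ne by (simp add: V_Neg V_All V_Imp V_Mem vl_upd del: nn.simps) blast
  have vq: "V q (upd (upd (upd B X cx) ?Y cy) ?z cz) <-> G (q.proj cz)" if cz: "Nat cz" for cz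
  proof -
   let ?e = "%i. if even i then ((%_. x)(0 := q.proj cz)) (i div 2) else c i"
   have "ALL k<m. val (upd (upd (upd B X cx) ?Y cy) ?z cz) k = ?e k"
   proof (intro allI impI)
    fix k assume k: "k < m"
    have "val B k = e0 k" "X ~= nn k" "?Y ~= nn k" using B X k by simp_all
    thus "val (upd (upd (upd B X cx) ?Y cy) ?z cz) k = ?e k" using cx cy cz unfolding val_def e0_def
     by (auto simp: vl_upd elim!: evenE simp del: nn.simps)
   qed
   from q(3)[OF _ this] show ?thesis using P0(2)[of "(%_. x)(0 := q.proj cz)"] B X cx cy cz by simp
  qed
  have "q.EN z (q.proj cy) <-> q.EN z x & G z" for z
  proof -
   obtain cz where "Nat cz" "q.proj cz = z" using prj_ex by blast
   thus ?thesis using cy vq prj_EN cx by metis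
  qed
  thus ?thesis by blast
 qed
 show "EX y. ALL w. q.EN w y <-> (EX z. q.EN z x & F z w)"
  if F: "pdfn idfn (%e. F (e 0) (e 1))" and fn: "!!z. q.EN z x ==> EX u. ALL w. F z w --> w = u" for F x
 proof -
  obtain P0 c where P0: "idfn P0" "!!e. F (e 0) (e 1) = P0 (%i. if even i then e (i div 2) else c i)" using F unfolding pdfn_def by blast
  obtain q m where q: "Form q" "!!i. FreeV i q ==> EX k<m. i = nn k" "!!e B. HF B ==> ALL k<m. val B k = e k ==> P0 e <-> V q B" using P0(1) unfolding idfn_def by blast
  define e0 where "e0 = (%i::nat. if even i then x else c i)"
  obtain B where B: "HF B" "!!k. k < m+3 ==> val B k = e0 k" using ex_val[of "m+3" e0] by blast
  obtain X where X: "Nat X" "~ FreeV (suc X) q" "~ FreeV (suc (suc X)) q" "ALL k<m+3. X ~= nn k" "ALL k<m+3. suc X ~= nn k" "ALL k<m+3. suc (suc X) ~= nn k"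
   using fresh_var[OF q(1), of "m+3"] by blast
  let ?Y = "suc X" and ?U = "suc (suc X)" and ?z = "nn 0" and ?w = "nn 2"
  have ne: "X ~= ?z" "?z ~= X" "?Y ~= ?z" "?z ~= ?Y" "?U ~= ?z" "?z ~= ?U" "X ~= ?w" "?w ~= X" "?Y ~= ?w" "?w ~= ?Y" "?U ~= ?w" "?w ~= ?U"
   using X(4-6) by (simp_all only: add_gr_0 zero_less_numeral one_less_numeral_iff) (metis add_gr_0 zero_less_numeral trans_less_add2 lessI numeral_2_eq_2 numeral_3_eq_3)+
  have ne': "X ~= ?Y" "?Y ~= X" "X ~= ?U" "?U ~= X" "?Y ~= ?U" "?U ~= ?Y" by (metis mem_suc irrefl)+
  have nzw: "?z ~= ?w" "?w ~= ?z" by (simp_all del: nn.simps)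
  obtain cx where cx: "Nat cx" "q.proj cx = x" using prj_ex by blast
  let ?A = "upd B X cx"
  have vq: "V q C <-> F (q.proj cz) (q.proj cw)"
   if C: "HF C" "Nat cz" "Nat cw" "vl C ?z = cz" "vl C ?w = cw" "!!k. k < m+3 ==> k ~= 0 ==> k ~= 2 ==> vl C (nn k) = vl B (nn k)" for C cz cw
  proof -
   let ?e = "%i. if even i then ((%_. x)(0 := q.proj cz, 1 := q.proj cw)) (i div 2) else c i"
   have "ALL k<m. val C k = ?e k"
   proof (intro allI impI)
    fix k assume k: "k < m"
    consider "k = 0" | "k = 2" | "k ~= 0" "k ~= 2" by blast
    thus "val C k = ?e k"
    proof cases
     case 3
     hence "val C k = e0 k" using C(6)[of k] B(2)[of k] k unfolding val_def by simp
     thus ?thesis using 3 unfolding e0_def by (auto elim!: evenE)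
    qed (use C in \<open>simp_all add: val_def del: nn.simps\<close>)
   qed
   from q(3)[OF C(1) this] show ?thesis using P0(2)[of "(%_. x)(0 := q.proj cz, 1 := q.proj cw)"] by simp
  qed
  have keep: "k < m+3 ==> nn k ~= X & nn k ~= ?Y & nn k ~= ?U" for k using X(4-6) by metis
  have F1: "V q (upd (upd (upd ?A ?z cz) ?U cu) ?w cw) <-> F (q.proj cz) (q.proj cw)" if "Nat cz" "Nat cu" "Nat cw" for cz cu cw
   by (rule vq) (use that B X cx keep ne nzw in \<open>auto simp: vl_upd simp del: nn.simps\<close>)
  have F2: "V q (upd (upd (upd ?A ?Y cy) ?w cw) ?z cz) <-> F (q.proj cz) (q.proj cw)" if "Nat cz" "Nat cy" "Nat cw" for cz cy cw
   by (rule vq) (use that B X cx keep ne nzw in \<open>auto simp: vl_upd simp del: nn.simps\<close>)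
  let ?hyp = "cAll ?z (cImp (cMem ?z X) (cEx ?U (cAll ?w (cImp q (cEql ?w ?U)))))"
  let ?con = "cEx ?Y (cAll ?w (cIff (cMem ?w ?Y) (cEx ?z (cConj (cMem ?z X) q))))"
  have "SAx (cImp ?hyp ?con)" unfolding SAx_def
   by (rule disjI2, rule disjI2, rule exI[of _ X], rule exI[of _ ?Y], rule exI[of _ ?z], rule exI[of _ ?w], rule exI[of _ ?U], rule exI[of _ q])
    (use X ne ne' q(1) in \<open>simp del: nn.simps\<close>)
  hence imp: "V ?hyp ?A --> V ?con ?A" using SV[of "cImp ?hyp ?con" ?A] B X cx q(1) by (simp add: V_Imp del: nn.simps)
  have "V ?hyp ?A"
  proof -
   have "EX cu. Nat cu & (ALL cw. Nat cw --> F (q.proj cz) (q.proj cw) --> Er cw cu)" if cz: "Nat cz" "Mr cz cx" for cz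
   proof -
    have "q.EN (q.proj cz) x" using cz cx prj_EN by metis
    then obtain u where u: "!!w. F (q.proj cz) w ==> w = u" using fn by blast
    obtain cu where "Nat cu" "q.proj cu = u" using prj_ex by blast
    thus ?thesis using u prj by metis
   qed
   thus ?thesis using B X cx q(1) ne ne' nzw by (simp add: V_Neg V_All V_Imp V_Mem V_Eql vl_upd F1 del: nn.simps) blast
  qed
  hence con: "V ?con ?A" using imp by blast
  let ?bod = "cIff (cMem ?w ?Y) (cEx ?z (cConj (cMem ?z X) q))"
  have HA: "HF ?A" using B X cx by simp
  have Fm: "Form ?con" "Form (cAll ?w ?bod)" using X q(1) by (simp_all del: nn.simps)
  obtain cy where cy0: "Nat cy" "V (cAll ?w ?bod) (upd ?A ?Y cy)" using con unfolding V_Ex[OF Fm(1) HA] by blast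
  have HY: "HF (upd ?A ?Y cy)" using HA X cy0 by simp
  have cy: "Nat cy" "Mr cw cy <-> (EX cz. Nat cz & Mr cz cx & F (q.proj cz) (q.proj cw))" if "Nat cw" for cw
  proof -
   have "V ?bod (upd (upd ?A ?Y cy) ?w cw)" using cy0(2) that unfolding V_All[OF Fm(2) HY] by blast
   hence "(Mr cw cy --> (EX cz. Nat cz & Mr cz cx & F (q.proj cz) (q.proj cw))) & ((EX cz. Nat cz & Mr cz cx & F (q.proj cz) (q.proj cw)) --> Mr cw cy)"
    using cy0(1) that B(1) X(1) cx(1) q(1) ne ne' nzw by (simp add: V_Neg V_All V_Imp V_Mem vl_upd F2 del: nn.simps) blast
   thus "Mr cw cy <-> (EX cz. Nat cz & Mr cz cx & F (q.proj cz) (q.proj cw))" by blast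
  qed (rule cy0)
  have "q.EN w (q.proj cy) <-> (EX z. q.EN z x & F z w)" for w
  proof -
   obtain cw where cw: "Nat cw" "q.proj cw = w" using prj_ex by blast
   have "(EX cz. Nat cz & Mr cz cx & F (q.proj cz) w) <-> (EX z. q.EN z x & F z w)"
    using prj_EN cx prj_ex by metis
   thus ?thesis using cy(2)[OF cw(1)] cy0(1) cw prj_EN by metis
  qed
  thus ?thesis by blast
 qed
qed

end

section \<open>A finite part of class comprehension\<close>

definition hPR :: "nat => nat => nat => hfm" where
 "hPR x y p = (hset x \<^bold>\<and> hset y \<^bold>\<and> hset p \<^bold>\<and> rel (hpair x y p))"

definition HPs :: "'a set => ('a => 'a => bool) => ('a => 'a => bool) => 'a => 'a => 'a => bool" where
 "HPs D R Q x y p <-> (EX a:D. EX b:D. (ALL w:D. R w a <-> Q w x) & (ALL w:D. R w b <-> Q w x | Q w y) &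
   (ALL w:D. R w p <-> Q w a | Q w b))"
definition PRs :: "'a set => ('a => 'a => bool) => ('a => 'a => bool) => 'a => 'a => 'a => bool" where
 "PRs D R Q x y p <-> (EX b:D. R x b) & (EX b:D. R y b) & (EX b:D. R p b) & HPs {a:D. EX b:D. R a b} R Q x y p"

lemma sat_hpair: "x < n ==> y < n ==> p < n ==> sat D R Q e (hpair x y p n) <-> HPs D R Q (e x) (e y) (e p)"
 by (simp add: hpair_def sat_h HPs_def)
lemma sat_hset: "x < n ==> sat D R Q e (hset x n) <-> (EX b:D. R (e x) b)"
 by (simp add: hset_def sat_h)
lemma sat_hPR: "x < n ==> y < n ==> p < n ==> sat D R Q e (hPR x y p n) <-> PRs D R Q (e x) (e y) (e p)"
 by (simp add: hPR_def sat_h PRs_def sat_hpair sat_hset)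

lemma HPs_inj:
 assumes p: "HPs D R (=) x y p" "HPs D R (=) x' y' p" and D: "x : D" "y : D" "x' : D" "y' : D"
 shows "x = x' & y = y'"
proof -
 let ?S = "%u. {w:D. R w u}"
 obtain a b where ab0: "a : D" "b : D" "ALL w:D. R w a <-> w = x" "ALL w:D. R w b <-> w = x | w = y" "ALL w:D. R w p <-> w = a | w = b"
  using p(1) unfolding HPs_def by blast
 have ab: "a : D" "b : D" "?S a = {x}" "?S b = {x, y}" "!!w. w : D ==> R w p <-> w = a | w = b" using ab0 D by auto
 obtain a' b' where ab1: "a' : D" "b' : D" "ALL w:D. R w a' <-> w = x'" "ALL w:D. R w b' <-> w = x' | w = y'" "ALL w:D. R w p <-> w = a' | w = b'"
  using p(2) unfolding HPs_def by blast
 have ab': "a' : D" "b' : D" "?S a' = {x'}" "?S b' = {x', y'}" "!!w. w : D ==> R w p <-> w = a' | w = b'" using ab1 D by auto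
 have "{a, b} = {a', b'}" using ab(1,2,5) ab'(1,2,5) by blast
 hence "?S ` {a, b} = ?S ` {a', b'}" by (rule arg_cong)
 hence "{{x}, {x, y}} = {{x'}, {x', y'}}" unfolding image_insert image_empty ab(3,4) ab'(3,4) .
 thus ?thesis by (auto simp: doubleton_eq_iff)
qed

text \<open>A finite basis of class operations in the manner of Goedel, for stacks coded by nested
  pairs. The first four sentences secure pairs and an empty set; the next three give access to the
  members of a variable's value on a stack; then come membership and equality of two values,
  complement, implication, quantification over the top entry, and the section at the empty
  stack.\<close>

definition L_ops :: "fm list" where
 "L_ops = [
  (\<^bold>\<forall>x. \<^bold>\<forall>y. hset x \<^bold>\<and> hset y \<^bold>\<longrightarrow> (\<^bold>\<exists>p. hPR x y p)) 0,
  (\<^bold>\<forall>x. \<^bold>\<forall>y. \<^bold>\<forall>p. \<^bold>\<forall>q. hPR x y p \<^bold>\<and> hPR x y q \<^bold>\<longrightarrow> p \<^bold>= q) 0,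
  (\<^bold>\<forall>x. \<^bold>\<forall>y. \<^bold>\<forall>z. \<^bold>\<forall>w. \<^bold>\<forall>p. hPR x y p \<^bold>\<and> hPR z w p \<^bold>\<longrightarrow> x \<^bold>= z \<^bold>\<and> y \<^bold>= w) 0,
  (\<^bold>\<exists>z. hset z \<^bold>\<and> hempty z) 0,
  (\<^bold>\<forall>W. \<^bold>\<exists>Y. \<^bold>\<forall>p. hset p \<^bold>\<longrightarrow> (p \<^bold>\<in> Y \<^bold>\<longleftrightarrow> (\<^bold>\<exists>s. \<^bold>\<exists>a. hPR s a p \<^bold>\<and> s \<^bold>\<in> W))) 0,
  (\<^bold>\<exists>Y. \<^bold>\<forall>p. hset p \<^bold>\<longrightarrow> (p \<^bold>\<in> Y \<^bold>\<longleftrightarrow> (\<^bold>\<exists>b. \<^bold>\<exists>s. hPR s b p \<^bold>\<and> (\<^bold>\<exists>t. \<^bold>\<exists>a. hPR t a b \<^bold>\<and> s \<^bold>\<in> t)))) 0,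
  (\<^bold>\<forall>Q. \<^bold>\<exists>Y. \<^bold>\<forall>p. hset p \<^bold>\<longrightarrow> (p \<^bold>\<in> Y \<^bold>\<longleftrightarrow>
   (\<^bold>\<exists>b. \<^bold>\<exists>s. hPR s b p \<^bold>\<and> (\<^bold>\<exists>t. \<^bold>\<exists>a. hPR t a b \<^bold>\<and> (\<^bold>\<exists>c. hPR s a c \<^bold>\<and> c \<^bold>\<in> Q))))) 0,
  (\<^bold>\<forall>Q. \<^bold>\<forall>R. \<^bold>\<exists>Y. \<^bold>\<forall>a. hset a \<^bold>\<longrightarrow> (a \<^bold>\<in> Y \<^bold>\<longleftrightarrow> (\<^bold>\<exists>s. hset s \<^bold>\<and> (\<^bold>\<exists>p. hPR s a p \<^bold>\<and> p \<^bold>\<in> R) \<^bold>\<and>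
   (\<^bold>\<forall>t. hset t \<^bold>\<longrightarrow> (t \<^bold>\<in> s \<^bold>\<longleftrightarrow> (\<^bold>\<exists>p. hPR t a p \<^bold>\<and> p \<^bold>\<in> Q)))))) 0,
  (\<^bold>\<forall>Q. \<^bold>\<forall>R. \<^bold>\<exists>Y. \<^bold>\<forall>a. hset a \<^bold>\<longrightarrow> (a \<^bold>\<in> Y \<^bold>\<longleftrightarrow> (\<^bold>\<forall>s. \<^bold>\<forall>p. hPR s a p \<^bold>\<longrightarrow> (p \<^bold>\<in> Q \<^bold>\<longleftrightarrow> p \<^bold>\<in> R)))) 0,
  (\<^bold>\<forall>X. \<^bold>\<exists>Y. \<^bold>\<forall>a. hset a \<^bold>\<longrightarrow> (a \<^bold>\<in> Y \<^bold>\<longleftrightarrow> \<^bold>\<not> a \<^bold>\<in> X)) 0,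
  (\<^bold>\<forall>X. \<^bold>\<forall>Z. \<^bold>\<exists>Y. \<^bold>\<forall>a. hset a \<^bold>\<longrightarrow> (a \<^bold>\<in> Y \<^bold>\<longleftrightarrow> (a \<^bold>\<in> X \<^bold>\<longrightarrow> a \<^bold>\<in> Z))) 0,
  (\<^bold>\<forall>X. \<^bold>\<exists>Y. \<^bold>\<forall>a. hset a \<^bold>\<longrightarrow> (a \<^bold>\<in> Y \<^bold>\<longleftrightarrow> (\<^bold>\<forall>s. \<^bold>\<forall>p. hPR s a p \<^bold>\<longrightarrow> p \<^bold>\<in> X))) 0,
  (\<^bold>\<forall>X. \<^bold>\<exists>Y. \<^bold>\<forall>s. hset s \<^bold>\<longrightarrow> (s \<^bold>\<in> Y \<^bold>\<longleftrightarrow> (\<^bold>\<exists>z. \<^bold>\<exists>p. hempty z \<^bold>\<and> hPR s z p \<^bold>\<and> p \<^bold>\<in> X))) 0]"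

section \<open>The definable classes over a model of S\<close>

context smodel
begin

definition els :: "'a => 'a set" where "els a = {x. x <: a}"
definition Cls :: "'a set set" where "Cls = {X. dfn (%e. e 0 : X)}"
definition Rm :: "'a set => 'a set => bool" where "Rm X Y <-> (EX a. X = els a & a : Y)"

lemma els_inj [simp]: "els a = els b <-> a = b" using ext[of a b] unfolding els_def by auto
lemma mem_els [simp]: "x : els a <-> x <: a" by (simp add: els_def)
lemma Rm_els [simp]: "Rm (els a) Y <-> a : Y" unfolding Rm_def by auto
lemma els_Cls [simp]: "els a : Cls" unfolding Cls_def by (simp, intro dfnI)
lemma UNIV_Cls: "UNIV : Cls" unfolding Cls_def by (simp, intro dfnI)
lemma Cls_set: "(EX b:Cls. Rm X b) <-> (EX a. X = els a)"
 using UNIV_Cls unfolding Rm_def by blast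
lemma Cls_sets: "{a:Cls. EX b:Cls. Rm a b} = range els" unfolding Cls_set by auto

lemma dfn_Cls: "X : Cls ==> dt x ==> dfn (%e. x e : X)" unfolding Cls_def by (rule dfn_app1) simp_all

lemma HPs_els [simp]: "HPs (range els) Rm (=) (els x) (els y) (els p) <-> p = opair x y"
 unfolding HPs_def opair_iff by (simp add: image_iff)

lemma PRs_els: "PRs Cls Rm (=) X Y P <-> (EX x y. X = els x & Y = els y & P = els (opair x y))"
 unfolding PRs_def Cls_sets by (simp add: Cls_set) auto

lemma Cls_comp:
 assumes "dfn (%e. P (e 0))" "!!a. \<phi> (els a) <-> P a"
 shows "EX Y:Cls. ALL p:Cls. (EX a. p = els a) --> (Rm p Y <-> \<phi> p)"
proof (rule bexI[of _ "Collect P"])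
 show "Collect P : Cls" using assms(1) by (simp add: Cls_def)
qed (use assms(2) in \<open>force\<close>)

lemma bex_els: "(EX s:Cls. (EX a. s = els a) & P s) <-> (EX a. P (els a))" "(ALL s:Cls. (EX a. s = els a) --> P s) <-> (ALL a. P (els a))"
 by auto

lemma all_PR: "(ALL s:Cls. ALL p:Cls. (EX x y. s = els x & els a = els y & p = els (opair x y)) --> P p) <-> (ALL s. P (els (opair s a)))"
proof (intro iffI allI)
 fix s assume h: "ALL s:Cls. ALL p:Cls. (EX x y. s = els x & els a = els y & p = els (opair x y)) --> P p"
 show "P (els (opair s a))" using bspec[OF bspec[OF h els_Cls[of s]] els_Cls[of "opair s a"]] by blast
qed auto

lemma Cls_ops: "p : set L_ops ==> sat Cls Rm (=) e p"
proof -
 note sp = sat_h sat_hPR sat_hset hempty_def Cls_set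
 have 1: "ALL W:Cls. EX Y:Cls. ALL p:Cls. (EX a. p = els a) --> (Rm p Y <-> (EX s:Cls. EX a:Cls. PRs Cls Rm (=) s a p & Rm s W))"
 proof (intro ballI)
  fix W assume W: "W : Cls"
  show "EX Y:Cls. ALL p:Cls. (EX a. p = els a) --> (Rm p Y <-> (EX s:Cls. EX a:Cls. PRs Cls Rm (=) s a p & Rm s W))"
  by (rule Cls_comp[of "%p. EX x y. p = opair x y & x : W"]) (intro dfnI dfn_Cls[OF W], auto simp: PRs_els)
 qed
 have 2: "EX Y:Cls. ALL p:Cls. (EX a. p = els a) --> (Rm p Y <-> (EX b:Cls. EX s:Cls. PRs Cls Rm (=) s b p & (EX t:Cls. EX a:Cls. PRs Cls Rm (=) t a b & Rm s t)))"
  by (rule Cls_comp[of "%p. EX s t a. p = opair s (opair t a) & s <: t"]) (intro dfnI, auto simp: PRs_els)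
 have 3: "ALL Q:Cls. EX Y:Cls. ALL p:Cls. (EX a. p = els a) --> (Rm p Y <-> (EX b:Cls. EX s:Cls. PRs Cls Rm (=) s b p & (EX t:Cls. EX a:Cls. PRs Cls Rm (=) t a b & (EX c:Cls. PRs Cls Rm (=) s a c & Rm c Q))))"
 proof (intro ballI)
  fix Q assume W: "Q : Cls"
  show "EX Y:Cls. ALL p:Cls. (EX a. p = els a) --> (Rm p Y <-> (EX b:Cls. EX s:Cls. PRs Cls Rm (=) s b p & (EX t:Cls. EX a:Cls. PRs Cls Rm (=) t a b & (EX c:Cls. PRs Cls Rm (=) s a c & Rm c Q))))"
  by (rule Cls_comp[of "%p. EX s t a. p = opair s (opair t a) & opair s a : Q"]) (intro dfnI dfn_Cls[OF W], auto simp: PRs_els)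
 qed
 have 4: "ALL Q:Cls. ALL R:Cls. EX Y:Cls. ALL a:Cls. (EX b. a = els b) --> (Rm a Y <-> (EX s:Cls. (EX b. s = els b) & (EX p:Cls. PRs Cls Rm (=) s a p & Rm p R) & (ALL t:Cls. (EX b. t = els b) --> (Rm t s <-> (EX p:Cls. PRs Cls Rm (=) t a p & Rm p Q)))))"
 proof (intro ballI)
  fix Q R assume W: "Q : Cls" "R : Cls"
  show "EX Y:Cls. ALL a:Cls. (EX b. a = els b) --> (Rm a Y <-> (EX s:Cls. (EX b. s = els b) & (EX p:Cls. PRs Cls Rm (=) s a p & Rm p R) & (ALL t:Cls. (EX b. t = els b) --> (Rm t s <-> (EX p:Cls. PRs Cls Rm (=) t a p & Rm p Q)))))"
  by (rule Cls_comp[of "%a. EX s. opair s a : R & (ALL t. t <: s <-> opair t a : Q)"]) (intro dfnI dfn_Cls[OF W(1)] dfn_Cls[OF W(2)], auto simp: bex_els PRs_els)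
 qed
 have 5: "ALL Q:Cls. ALL R:Cls. EX Y:Cls. ALL a:Cls. (EX b. a = els b) --> (Rm a Y <-> (ALL s:Cls. ALL p:Cls. PRs Cls Rm (=) s a p --> (Rm p Q <-> Rm p R)))"
 proof (intro ballI)
  fix Q R assume W: "Q : Cls" "R : Cls"
  show "EX Y:Cls. ALL a:Cls. (EX b. a = els b) --> (Rm a Y <-> (ALL s:Cls. ALL p:Cls. PRs Cls Rm (=) s a p --> (Rm p Q <-> Rm p R)))"
  by (rule Cls_comp[of "%a. ALL s. opair s a : Q <-> opair s a : R"]) (intro dfnI dfn_Cls[OF W(1)] dfn_Cls[OF W(2)], unfold PRs_els all_PR, simp)
 qed
 have 6: "ALL X:Cls. EX Y:Cls. ALL a:Cls. (EX b. a = els b) --> (Rm a Y <-> ~ Rm a X)"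
 proof (intro ballI)
  fix X assume W: "X : Cls"
  show "EX Y:Cls. ALL a:Cls. (EX b. a = els b) --> (Rm a Y <-> ~ Rm a X)"
  by (rule Cls_comp[of "%a. ~ a : X"]) (intro dfnI dfn_Cls[OF W], auto simp: PRs_els)
 qed
 have 7: "ALL X:Cls. ALL Z:Cls. EX Y:Cls. ALL a:Cls. (EX b. a = els b) --> (Rm a Y <-> (Rm a X --> Rm a Z))"
 proof (intro ballI)
  fix X Z assume W: "X : Cls" "Z : Cls"
  show "EX Y:Cls. ALL a:Cls. (EX b. a = els b) --> (Rm a Y <-> (Rm a X --> Rm a Z))"
  by (rule Cls_comp[of "%a. a : X --> a : Z"]) (intro dfnI dfn_Cls[OF W(1)] dfn_Cls[OF W(2)], auto)
 qed
 have 8: "ALL X:Cls. EX Y:Cls. ALL a:Cls. (EX b. a = els b) --> (Rm a Y <-> (ALL s:Cls. ALL p:Cls. PRs Cls Rm (=) s a p --> Rm p X))"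
 proof (intro ballI)
  fix X assume W: "X : Cls"
  show "EX Y:Cls. ALL a:Cls. (EX b. a = els b) --> (Rm a Y <-> (ALL s:Cls. ALL p:Cls. PRs Cls Rm (=) s a p --> Rm p X))"
  by (rule Cls_comp[of "%a. ALL s. opair s a : X"]) (intro dfnI dfn_Cls[OF W], unfold PRs_els all_PR, simp)
 qed
 have 9: "ALL X:Cls. EX Y:Cls. ALL s:Cls. (EX b. s = els b) --> (Rm s Y <-> (EX z:Cls. EX p:Cls. (ALL w:Cls. ~ Rm w z) & PRs Cls Rm (=) s z p & Rm p X))"
 proof (intro ballI)
  fix X assume W: "X : Cls"
  show "EX Y:Cls. ALL s:Cls. (EX b. s = els b) --> (Rm s Y <-> (EX z:Cls. EX p:Cls. (ALL w:Cls. ~ Rm w z) & PRs Cls Rm (=) s z p & Rm p X))"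
 proof (rule Cls_comp[of "%s. opair s emp : X"])
  show "dfn (%e. opair (e 0) emp : X)" by (intro dfnI dfn_Cls[OF W])
  have z: "(ALL w:Cls. ~ Rm w (els y)) <-> y = emp" for y unfolding Rm_def emp_iff by auto
  show "(EX z:Cls. EX p:Cls. (ALL w:Cls. ~ Rm w z) & PRs Cls Rm (=) (els a) z p & Rm p X) <-> opair a emp : X" for a
  proof
   assume "EX z:Cls. EX p:Cls. (ALL w:Cls. ~ Rm w z) & PRs Cls Rm (=) (els a) z p & Rm p X"
   thus "opair a emp : X" using z by (auto simp: PRs_els)
  next
   assume "opair a emp : X"
   thus "EX z:Cls. EX p:Cls. (ALL w:Cls. ~ Rm w z) & PRs Cls Rm (=) (els a) z p & Rm p X"
    using z[of emp] by (intro bexI[of _ "els emp"] bexI[of _ "els (opair a emp)"]) (auto simp: PRs_els)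
  qed
 qed
 qed
 have 0: "EX z:Cls. (EX b. z = els b) & (ALL w:Cls. ~ Rm w z)" by (rule bexI[of _ "els emp"]) (auto simp: Rm_def)
 have p1: "ALL x:Cls. ALL y:Cls. (EX a. x = els a) & (EX a. y = els a) --> (EX p:Cls. PRs Cls Rm (=) x y p)"
  unfolding PRs_els by auto
 have p2: "ALL x:Cls. ALL y:Cls. ALL p:Cls. ALL q:Cls. PRs Cls Rm (=) x y p & PRs Cls Rm (=) x y q --> p = q"
  unfolding PRs_els by auto
 have p3: "ALL x:Cls. ALL y:Cls. ALL z:Cls. ALL w:Cls. ALL p:Cls. PRs Cls Rm (=) x y p & PRs Cls Rm (=) z w p --> x = z & y = w"
  unfolding PRs_els by auto
 assume "p : set L_ops"
 thus ?thesis unfolding L_ops_def set_simps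
  apply (elim insertE emptyE)
  subgoal using p1 by (simp add: sp)
  subgoal using p2 by (simp add: sp)
  subgoal using p3 by (simp add: sp)
  subgoal using 0 by (simp add: sp)
  subgoal using 1 by (simp add: sp)
  subgoal using 2 by (simp add: sp)
  subgoal using 3 by (simp add: sp)
  subgoal using 4 by (simp add: sp)
  subgoal using 5 by (simp add: sp)
  subgoal using 6 by (simp add: sp)
  subgoal using 7 by (simp add: sp)
  subgoal using 8 by (simp add: sp)
  subgoal using 9 by (simp add: sp)
  done
qed

lemma tru_S_single: "p : set S_single ==> sat UNIV (<:) (=) e p"
proof -
 have "(EX u. u <: x) ==> EX y. y <: x & (ALL z. z <: x --> ~ z <: y)" for x using found by blast
 moreover assume "p : set S_single"
 ultimately show ?thesis unfolding S_single_def set_simps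
  by (elim insertE emptyE) (simp_all add: sat_h ax_ext_def ax_found_def ax_pair_def ax_union_def ax_power_def pairing union power ext)
qed

lemma Cls_C_single: "p : set C_single ==> sat Cls Rm (=) e p"
proof -
 have r: "sat Cls Rm (=) e (rel A 0)" if A: "A 0 : set S_single" for A
 proof -
  have fv: "FV (A 0) = {}" using A unfolding S_single_def
   by (auto simp: ax_ext_def ax_found_def ax_pair_def ax_union_def ax_power_def hall_def hex_def hmem_def heq_def hnot_def hand_def hor_def himp_def hiff_def)
  have "sat UNIV (<:) (=) (%_. emp) (A 0) = sat (range els) Rm (=) e (A 0)"
   by (rule sat_iso[where W = UNIV and h = els]) (auto simp: fv)
  thus ?thesis using tru_S_single[OF A] unfolding sat_rel Cls_sets by simp
 qed
 have e: "sat Cls Rm (=) e (ax_ext 0)"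
 proof -
  have "X = Y" if "ALL z:Cls. Rm z X = Rm z Y" for X Y
   using that els_Cls Rm_els by blast
  thus ?thesis by (simp add: sat_h ax_ext_def)
 qed
 have s: "sat Cls Rm (=) e (ax_set_exists 0)"
  by (simp add: sat_h ax_set_exists_def sat_hset Cls_set) (use els_Cls in blast)
 have c: "sat Cls Rm (=) e (ax_class_replacement 0)"
 proof -
  have "EX y. ALL w. w <: y <-> (EX z. z <: x & opair z w : F)"
   if F: "F : Cls" and fn: "ALL x y z. opair x y : F & opair x z : F --> y = z" for F x
  proof (rule repl[of "%z w. opair z w : F"])
   show "dfn (%e. opair (e 0) (e 1) : F)" by (intro dfnI dfn_Cls[OF F])
  qed (use fn in blast)
  thus ?thesis
   by (simp add: ax_class_replacement_def sat_h hsingle_valued_def hpairin_def sat_hpair Cls_sets)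
 qed
 assume "p : set C_single"
 thus ?thesis unfolding C_single_def set_simps
  by (elim insertE emptyE) (use e s c r in \<open>simp_all add: S_single_def\<close>)
qed

end

section \<open>Codes in the ground model for the definable classes\<close>

context nmod
begin

lemma idfn_opair: "idfn (%e. e k = n.opair (e i) (e j))"
proof -
 have "(%e. e k = n.opair (e i) (e j)) = (%e. sat UNIV q.EN (=) e (hpair i j k (Suc (i + j + k))))"
  by (simp add: n.tru_hpair)
 thus ?thesis using i.dfn_sat by simp
qed

lemma idfn_emp: "idfn (%e. e k = n.emp)"
proof -
 have "(%e. e k = n.emp) = (%e. sat UNIV q.EN (=) e (hempty k (Suc k)))"
  by (simp add: n.tru_hempty)
 thus ?thesis using i.dfn_sat by simp
qed

text \<open>A definable class may involve any standard number of parameters, while a code holds a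
  single one; they are packed into it by repeated pairing, and the formula unpacks them.\<close>

lemma collapse:
 assumes "idfn R"
 shows "EX R' b. idfn R' & (ALL e. R (%i. if i = 0 then e 0 else if i \<le> Suc n then c i else e i) = R' (%i. if i = 0 then e 0 else if i = 1 then b else e i))"
proof (induction n)
 case 0
 have "(%i::nat. if i = 0 then e 0 else if i \<le> Suc 0 then c i else e i) = (%i. if i = 0 then e 0 else if i = 1 then c 1 else e i)" for e :: "nat => nat"
  by (auto simp: fun_eq_iff le_Suc_eq)
 thus ?case using assms by (intro exI[of _ R] exI[of _ "c 1"]) simp
next
 case (Suc n)
 then obtain R' b where R': "idfn R'" "!!e. R (%i. if i = 0 then e 0 else if i \<le> Suc n then c i else e i) = R' (%i. if i = 0 then e 0 else if i = 1 then b else e i)" by blast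
 define R2 where "R2 = (%e. EX v u. e 1 = n.opair u v & R' (e(1 := u, n + 2 := v)))"
 have eq: "(%k. e (if k = n + 2 then 1 else if k = 1 then 0 else k + 2)) = (%k. e (Suc (Suc k)))(1 := e 0, n + 2 := e 1)" for e :: "nat => nat"
  by (auto simp: fun_eq_iff)
 have "idfn (%e. R' (%k. e (if k = n + 2 then 1 else if k = 1 then 0 else k + 2)))" by (rule i.dfn_ren[OF R'(1)])
 hence "idfn (%e. R' ((%k. e (Suc (Suc k)))(1 := e 0, n + 2 := e 1)))" unfolding eq .
 from i.dfn_and[OF idfn_opair[of 3 0 1] this]
 have "idfn (%e. EX u. e 2 = n.opair u (e 0) & R' ((%k. e (Suc k))(1 := u, n + 2 := e 0)))"
  by - (rule i.dfn_ex, simp add: numeral_2_eq_2 numeral_3_eq_3)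
 hence R2: "idfn R2" unfolding R2_def by - (rule i.dfn_ex, simp add: numeral_2_eq_2)
 have "R (%i. if i = 0 then e 0 else if i \<le> Suc (Suc n) then c i else e i) = R2 (%i. if i = 0 then e 0 else if i = 1 then n.opair b (c (n + 2)) else e i)" for e
 proof -
  have 1: "(%i. if i = 0 then e 0 else if i \<le> Suc (Suc n) then c i else e i) =
   (%i. if i = 0 then (e(n + 2 := c (n + 2))) 0 else if i \<le> Suc n then c i else (e(n + 2 := c (n + 2))) i)"
   by (auto simp: fun_eq_iff le_Suc_eq)
  have 2: "(%i. if i = 0 then (e(n + 2 := c (n + 2))) 0 else if i = 1 then b else (e(n + 2 := c (n + 2))) i) =
   (%i. if i = 0 then e 0 else if i = 1 then n.opair b (c (n + 2)) else e i)(1 := b, n + 2 := c (n + 2))"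
   by (auto simp: fun_eq_iff)
  show ?thesis unfolding 1 R'(2) 2 R2_def by auto
 qed
 thus ?case using R2 by blast
qed

text \<open>A universal quantifier over a variable that the predicate ignores does not change its
  truth; in this way all variables but 0 and 1 are removed from the formula.\<close>

lemma reduce_vars:
 assumes "!!e e'. e 0 = e' 0 ==> e 1 = e' 1 ==> P e = P e'"
 shows "Form q ==> (!!i. FreeV i q ==> EX k<m. i = nn k) ==> (!!e B. HF B ==> ALL k<m. val B k = e k ==> P e <-> V q B) ==>
  EX q. Form q & (ALL i. FreeV i q --> i = nn 0 | i = nn 1) & (ALL e B. HF B --> val B 0 = e 0 --> val B 1 = e 1 --> (P e <-> V q B))"
proof (induction m arbitrary: q)
 case 0 thus ?case by (intro exI[of _ q]) auto
next
 case (Suc m)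
 show ?case
 proof (cases "m < 2")
  case True
  have "i = nn 0 | i = nn 1" if "FreeV i q" for i
   using Suc.prems(2)[OF that] True by (auto simp: less_Suc_eq numeral_2_eq_2)
  moreover have "P e <-> V q B" if "HF B" "val B 0 = e 0" "val B 1 = e 1" for e B
   by (rule Suc.prems(3)[OF that(1)]) (use that True in \<open>auto simp: less_Suc_eq numeral_2_eq_2\<close>)
  ultimately show ?thesis using Suc.prems(1) by blast
 next
  case False
  show ?thesis
  proof (rule Suc.IH[of "cAll (nn m) q"])
   show "Form (cAll (nn m) q)" using Suc.prems(1) by simp
   show "EX k<m. i = nn k" if "FreeV i (cAll (nn m) q)" for i using that Suc.prems(2)[of i] by (auto simp: less_Suc_eq)
   fix e B assume B: "HF B" "ALL k<m. val B k = e k"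
   have "P e <-> V q (upd B (nn m) c)" if c: "Nat c" for c
   proof -
    have "P (e(m := q.proj c)) <-> V q (upd B (nn m) c)"
     by (rule Suc.prems(3)) (use B c in \<open>auto simp: val_upd\<close>)
    moreover have "P (e(m := q.proj c)) = P e" by (rule assms) (use False in auto)
    ultimately show ?thesis by simp
   qed
   moreover have "V (cAll (nn m) q) B <-> (ALL c. Nat c --> V q (upd B (nn m) c))" using B(1) Suc.prems(1) by (simp add: V_All)
   ultimately show "P e <-> V (cAll (nn m) q) B" using Nat_emp by blast
  qed
 qed
qed

text \<open>A class is coded by a formula in the variables 0 and 1 and a value \<open>b\<close> for
  the second. The formula may be nonstandard; since \<open>V\<close> evaluates it, the structure of
  coded classes is definable in the ground model.\<close>

definition In :: "nat => nat => bool" where "In x c <-> (EX q b. c = opair q b & V q (pr x b))"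
definition Dk :: "nat => bool" where
 "Dk c <-> (EX q b. c = opair q b & Form q & (ALL i. FreeV i q --> i = nn 0 | i = nn 1) & Nat b)"
definition Mk :: "nat => nat => bool" where
 "Mk c d <-> (EX a. Nat a & (ALL x. Nat x --> (In x c <-> Mr x a)) & In a d)"
definition Ek :: "nat => nat => bool" where "Ek c d <-> (ALL x. Nat x --> (In x c <-> In x d))"
definition cls :: "nat => nat set" where "cls c = {q.proj x |x. Nat x & In x c}"

lemma val_pr: "Nat x ==> Nat b ==> val (pr x b) 0 = q.proj x" "Nat x ==> Nat b ==> val (pr x b) 1 = q.proj b"
 unfolding val_def vl_def lk_pr by simp_all

lemma V_two:
 assumes "Form q" "ALL i. FreeV i q --> i = nn 0 | i = nn 1" "HF B" "HF B'" "val B 0 = val B' 0" "val B 1 = val B' 1"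
 shows "V q B <-> V q B'"
proof (rule V_cong[OF assms(1,3,4)])
 fix i assume "FreeV i q"
 hence "i = nn 0 | i = nn 1" using assms(2) by blast
 thus "Er (vl B i) (vl B' i)" using assms(5,6) prj unfolding val_def by auto
qed

lemma In_cls: assumes "Dk c" "Nat x" shows "q.proj x : cls c <-> In x c"
proof
 assume "q.proj x : cls c"
 then obtain y where y: "Nat y" "q.proj x = q.proj y" "In y c" unfolding cls_def by blast
 obtain q b where q: "c = opair q b" "Form q" "ALL i. FreeV i q --> i = nn 0 | i = nn 1" "Nat b" using assms(1) unfolding Dk_def by blast
 have "V q (pr x b) <-> V q (pr y b)"
  by (rule V_two[OF q(2,3)]) (use assms(2) y(1,2) q(4) in \<open>simp_all only: val_pr HF_pr HF_Nat\<close>)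
 thus "In x c" using y(3) q(1) unfolding In_def by simp
qed (use assms(2) in \<open>auto simp: cls_def\<close>)

lemma Ek_cls: assumes "Dk c" "Dk d" shows "Ek c d <-> cls c = cls d"
proof
 assume "Ek c d" thus "cls c = cls d" unfolding Ek_def cls_def by blast
next
 assume "cls c = cls d" thus "Ek c d" unfolding Ek_def using In_cls[OF assms(1)] In_cls[OF assms(2)] by simp
qed

lemma Mk_cls: assumes "Dk c" "Dk d" shows "Mk c d <-> n.Rm (cls c) (cls d)"
proof -
 have s: "(ALL x. Nat x --> (In x c <-> Mr x a)) <-> cls c = n.els (q.proj a)" if a: "Nat a" for a
 proof -
  have "cls c = n.els (q.proj a) <-> (ALL x. Nat x --> (q.proj x : cls c <-> q.proj x : n.els (q.proj a)))"
   using prj_ex by (metis set_eqI)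
  thus ?thesis using In_cls[OF assms(1)] prj_EN a by simp
 qed
 show ?thesis
 proof
  assume "Mk c d"
  then obtain a where "Nat a" "ALL x. Nat x --> (In x c <-> Mr x a)" "In a d" unfolding Mk_def by blast
  thus "n.Rm (cls c) (cls d)" unfolding n.Rm_def using s In_cls[OF assms(2)] by blast
 next
  assume "n.Rm (cls c) (cls d)"
  then obtain a where a: "cls c = n.els a" "a : cls d" unfolding n.Rm_def by blast
  obtain y where y: "Nat y" "q.proj y = a" using prj_ex by blast
  thus "Mk c d" unfolding Mk_def using s[OF y(1)] In_cls[OF assms(2) y(1)] a by blast
 qed
qed

lemma cls_Cls: assumes "Dk c" shows "cls c : n.Cls"
proof -
 obtain q b where q: "c = opair q b" "Form q" "ALL i. FreeV i q --> i = nn 0 | i = nn 1" "Nat b" using assms unfolding Dk_def by blast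
 define P where "P = (%e :: nat => nat. EX B. HF B & val B 0 = e 0 & val B 1 = e 1 & V q B)"
 have P: "P e <-> V q B" if "HF B" "val B 0 = e 0" "val B 1 = e 1" for e B
  unfolding P_def using V_two[OF q(2,3) that(1)] that by metis
 have "EX k<2. i = nn k" if "FreeV i q" for i
 proof -
  have "i = nn 0 | i = nn 1" using q(3) that by blast
  thus ?thesis by (elim disjE) (rule exI[of _ 0], simp, rule exI[of _ 1], simp)
 qed
 moreover have "P e <-> V q B" if "HF B" "ALL k<2. val B k = e k" for e B by (rule P) (use that in auto)
 ultimately have "idfn P" unfolding idfn_def using q(2) by blast
 hence "pdfn idfn (%e. P (e(1 := q.proj b)))" by (intro n.dfn_param i.pdfn_I)
 moreover have "P (e(1 := q.proj b)) <-> e 0 : cls c" for e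
 proof -
  obtain x where x: "Nat x" "q.proj x = e 0" using prj_ex by blast
  have "P (e(1 := q.proj b)) <-> V q (pr x b)"
   by (rule P) (use x q(4) in \<open>simp_all only: val_pr HF_pr HF_Nat fun_upd_apply, simp_all\<close>)
  thus ?thesis using In_cls[OF assms x(1)] x(2) q(1) unfolding In_def by simp
 qed
 ultimately show ?thesis unfolding n.Cls_def by simp
qed

lemma Cls_cls: assumes "X : n.Cls" shows "EX c. Dk c & cls c = X"
proof -
 obtain P0 c where P0: "idfn P0" "!!e. e 0 : X <-> P0 (%i. if even i then e (i div 2) else c i)"
  using assms unfolding n.Cls_def pdfn_def by blast
 obtain m where m: "!!e e'. (ALL i<m. e i = e' i) ==> P0 e = P0 e'" using i.dfn_fin[OF P0(1)] by blast
 \<comment> \<open>The even positions other than 0 hold variables on which membership in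
   \<open>X\<close> does not depend; they are filled with 0 and treated as further
   parameters.\<close>
 define c' where "c' = (%i. if even i then 0 else c i)"
 obtain R b where R: "idfn R" "!!e. P0 (%i. if i = 0 then e 0 else if i \<le> Suc m then c' i else e i) = R (%i. if i = 0 then e 0 else if i = 1 then b else e i)"
  using collapse[OF P0(1), of m c'] by blast
 \<comment> \<open>All variables from 2 on are set to the empty set, so that the predicate depends
   on the first two only, as \<open>reduce_vars\<close> demands.\<close>
 define R2 where "R2 = (%e :: nat => nat. EX z. z = n.emp & R (%i. if i = 0 then e 0 else if i = 1 then e 1 else z))"
 have "idfn (%e. R (%i. e (if i = 0 then 1 else if i = 1 then 2 else 0)))" by (rule i.dfn_ren[OF R(1)])
 moreover have "(%i. e (if i = 0 then 1 else if i = 1 then 2 else 0)) = (%i::nat. if i = 0 then e (Suc 0) else if i = 1 then e (Suc 1) else e 0)" for e :: "nat => nat"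
  by (auto simp: fun_eq_iff numeral_2_eq_2)
 ultimately have "idfn R2" unfolding R2_def by (intro i.dfn_ex i.dfn_and idfn_emp) simp
 then obtain q k where "Form q" "!!i. FreeV i q ==> EX j<k. i = nn j" "!!e B. HF B ==> ALL j<k. val B j = e j ==> R2 e <-> V q B"
  unfolding idfn_def by blast
 moreover have "R2 e = R2 e'" if "e 0 = e' 0" "e 1 = e' 1" for e e' unfolding R2_def by (simp only: that)
 ultimately obtain q where q: "Form q" "ALL i. FreeV i q --> i = nn 0 | i = nn 1"
   "!!e B. HF B ==> val B 0 = e 0 ==> val B 1 = e 1 ==> R2 e <-> V q B"
  using reduce_vars[of R2 q k] by blast
 obtain y where y: "Nat y" "q.proj y = b" using prj_ex by blast
 have d: "Dk (opair q y)" using q(1,2) y(1) unfolding Dk_def by blast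
 have "a : X <-> a : cls (opair q y)" for a
 proof -
  obtain x where x: "Nat x" "q.proj x = a" using prj_ex by blast
  let ?e = "%i::nat. if i = 0 then a else n.emp"
  have "a : X <-> P0 (%i. if even i then (%i. if i = 0 then a else 0) (i div 2) else c i)" using P0(2)[of "%i. if i = 0 then a else 0"] by simp
  also have "\<dots> <-> P0 (%i. if i = 0 then ?e 0 else if i \<le> Suc m then c' i else ?e i)"
   by (rule m) (auto simp: c'_def)
  also have "\<dots> <-> R (%i. if i = 0 then ?e 0 else if i = 1 then b else ?e i)" by (rule R(2))
  also have "\<dots> <-> R2 (%i. if i = 0 then a else b)"
  proof -
   have "(%i. if i = 0 then ?e 0 else if i = 1 then b else ?e i) = (%i. if i = 0 then a else if i = 1 then b else n.emp)" by auto
   thus ?thesis unfolding R2_def by simp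
  qed
  also have "\<dots> <-> V q (pr x y)" by (rule q(3)) (use x y in \<open>simp_all only: val_pr HF_pr HF_Nat, simp_all\<close>)
  also have "\<dots> <-> a : cls (opair q y)" using In_cls[OF d x(1)] x(2) unfolding In_def by simp
  finally show ?thesis .
 qed
 thus ?thesis using d by blast
qed

text \<open>The codes satisfy the finitely many sentences because their structure is isomorphic,
  modulo equality of extensions, to \<open>n.Cls\<close>; \<open>finite_theory_model\<close>
  exchanges it for a structure with full truth. The default element codes the empty class.\<close>

theorem class_model: "EX V Mr Er. tarski E dfn Form Nat emp Mr Er V & (ALL p:set (C_single @ L_ops). ALL B. HF B --> V (code p) B)"
proof (rule finite_theory_model[of Dk Mk Ek "opair (cNeg (cEql (nn 0) (nn 0))) emp"])
 have dIn: "dt x ==> dt y ==> dfn (%e. In (x e) (y e))" for x y by (rule dfn_app2) (unfold In_def, intro dfnI)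
 show "dfn (%e. Dk (e 0))" unfolding Dk_def by (intro dfnI)
 show "dfn (%e. Mk (e 0) (e 1))" unfolding Mk_def by (intro dfnI dIn)
 show "dfn (%e. Ek (e 0) (e 1))" unfolding Ek_def by (intro dfnI dIn)
 show "HF c" if "Dk c" for c using that unfolding Dk_def by auto
 show "Dk (opair (cNeg (cEql (nn 0) (nn 0))) emp)" unfolding Dk_def
  by (rule exI[of _ "cNeg (cEql (nn 0) (nn 0))"], rule exI[of _ emp]) simp
 show "sat {c. Dk c} Mk Ek e p" if p: "p : set (C_single @ L_ops)" and e: "!!i. Dk (e i)" for p e
 proof -
  have "sat {c. Dk c} Mk Ek e p = sat n.Cls n.Rm (=) (%i. cls (e i)) p"
  proof (rule sat_iso[where W = "{c. Dk c}" and h = cls])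
   show "cls ` {c. Dk c} = n.Cls" using cls_Cls Cls_cls by blast
  qed (use Mk_cls Ek_cls e in auto)
  thus ?thesis using p n.Cls_ops n.Cls_C_single by auto
 qed
qed (auto simp: Ek_cls Mk_cls)

end

section \<open>Class comprehension for nonstandard formulas\<close>

locale ftarski = tarski E dfn "smodel.Form E" "smodel.Nat E" "smodel.emp E" Mr Er V
 for E :: "nat => nat => bool" (infix "<:" 50) and dfn Mr Er V
begin

lemma V_fresh: assumes "Form p" "~ FreeV i p" "HF B" "Nat i" "Nat c" shows "V p (upd B i c) <-> V p B"
proof (rule V_cong[OF assms(1)])
 fix k assume "FreeV k p"
 hence "k ~= i" using assms(2) by blast
 thus "Er (vl (upd B i c) k) (vl B k)" using assms(5) Er_refl by (simp add: vl_upd)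
qed (use assms in simp_all)

lemma LogAx_V: assumes "LogAx x" "HF B" shows "V x B"
 using assms(1) unfolding LogAx_def
proof (elim disjE exE conjE)
 fix i p assume "Nat i" "Form p" "x = cImp (cAll i p) p"
 moreover have "V p B" if p: "Form p" "Nat i" "ALL c. Nat c --> V p (upd B i c)"
 proof -
  have "V p (upd B i (vl B i)) <-> V p B" by (rule V_cong) (use p assms(2) Er_refl in \<open>auto simp: vl_upd\<close>)
  thus ?thesis using p(3) by simp
 qed
 ultimately show ?thesis using assms(2) by (simp add: V_Imp V_All)
next
 fix i p assume "Nat i" "Form p" "~ FreeV i p" "x = cImp p (cAll i p)"
 thus ?thesis using assms(2) V_fresh by (simp add: V_Imp V_All)
next
 fix i j assume "Nat i" "Nat j" "x = cEx i (cEql i j)"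
 moreover have "EX c. Nat c & Er c (if j = i then c else vl B j)" by (rule exI[of _ "vl B j"]) (simp add: Er_refl)
 ultimately show ?thesis using assms(2) by (simp add: V_Neg V_All V_Eql vl_upd)
next
 fix i j k assume n: "Nat i" "Nat j" "Nat k" and x: "x = cImp (cEql i j) (cImp (cEql i k) (cEql j k))"
 show ?thesis using n assms(2) Er_E[of "vl B i" "vl B j" "vl B k"] unfolding x by (simp add: V_Imp V_Eql)
next
 fix i j k assume n: "Nat i" "Nat j" "Nat k" and x: "x = cImp (cEql i j) (cImp (cMem i k) (cMem j k))"
 show ?thesis using n assms(2) Mr_l[of "vl B i" "vl B j" "vl B k"] unfolding x by (simp add: V_Imp V_Eql V_Mem)
next
 fix i j k assume n: "Nat i" "Nat j" "Nat k" and x: "x = cImp (cEql i j) (cImp (cMem k i) (cMem k j))"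
 show ?thesis using n assms(2) Mr_r[of "vl B i" "vl B j" "vl B k"] unfolding x by (simp add: V_Imp V_Eql V_Mem)
qed (use assms(2) in \<open>auto simp: V_Imp V_Neg V_All\<close>)

text \<open>A proof of the ground model may have nonstandard length, so soundness is an induction
  inside that model; it is available because \<open>V\<close> is definable and covers all internal
  formulas.\<close>

lemma Pv_V:
 assumes T: "!!x. T x ==> Form x" "!!x B. T x ==> HF B ==> V x B" and P: "Pv T x" and B: "HF B" shows "V x B"
proof -
 have "Form x & (ALL B. HF B --> V x B)"
 proof (rule Pv_induct[OF P, of "%x. Form x & (ALL B. HF B --> V x B)"])
  show "dfn (%e. Form (e 0) & (ALL B. HF B --> V (e 0) B))" by (intro dfnI)
  show "Form y & (ALL B. HF B --> V y B)" if "LogAx y" for y using that LogAx_Form LogAx_V by blast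
  show "Form y & (ALL B. HF B --> V y B)" if "T y" for y using that T by blast
  show "Form y & (ALL B. HF B --> V y B)" if "Form (cImp p y) & (ALL B. HF B --> V (cImp p y) B)" "Form p & (ALL B. HF B --> V p B)" for p y
   using that by (auto simp: V_Imp)
  show "Form (cAll i p) & (ALL B. HF B --> V (cAll i p) B)" if "Nat i" "Form p & (ALL B. HF B --> V p B)" for i p
   using that by (auto simp: V_All)
 qed
 thus ?thesis using B by blast
qed

lemma ex_vl: assumes "!!i. Nat (e i)" shows "EX B. HF B & (ALL k<m. vl B (nn k) = e k)"
proof (induction m)
 case (Suc m)
 then obtain B where "HF B" "!!k. k < m ==> vl B (nn k) = e k" by blast
 thus ?case using assms by (intro exI[of _ "upd B (nn m) (e m)"]) (auto simp: vl_upd less_Suc_eq)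
qed (auto intro: exI[of _ emp])

lemma sat_ex:
 assumes "!!i. Nat (e i)"
 shows "EX B. HF B & (ALL k<m. vl B (nn k) = e k) & (V (code p) B <-> sat {c. Nat c} Mr Er e p)"
proof -
 obtain B where B: "HF B" "ALL k<max m (Suc (Max (insert 0 (FV p)))). vl B (nn k) = e k" using ex_vl[of e, OF assms] by blast
 have "sat {c. Nat c} Mr Er (%i. vl B (nn i)) p = sat {c. Nat c} Mr Er e p"
 proof (rule sat_cong)
  fix i assume "i : FV p"
  hence "i \<le> Max (insert 0 (FV p))" using finite_FV[of p] by (intro Max_ge) auto
  thus "vl B (nn i) = e i" using B(2) by (simp add: less_max_iff_disj)
 qed
 thus ?thesis using B by (intro exI[of _ B]) (simp add: V_code)
qed

lemma sat_all: "(!!B. HF B ==> V (code p) B) ==> (!!i. Nat (e i)) ==> sat {c. Nat c} Mr Er e p"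
 using sat_ex[of e 0 p] by blast

sublocale q: quot0 "{c. Nat c}" Mr Er by unfold_locales (use Er_refl Er_E Mr_l Mr_r in blast)+

end

locale kmod = ftarski E dfn Mr Er V for E :: "nat => nat => bool" (infix "<:" 50) and dfn Mr Er V +
 assumes KL: "p : set (C_single @ L_ops) ==> smodel.HF E B ==> V (smodel.code E p) B"
begin

definition ks :: "nat => bool" where "ks c <-> (EX b. Nat b & Mr c b)"
definition PR :: "nat => nat => nat => bool" where "PR x y p <-> Nat x & Nat y & Nat p & PRs {c. Nat c} Mr Er x y p"

lemma dfn_ks [dfnI]: "dt x ==> dfn (%e. ks (x e))" by (rule dfn_app1) (unfold ks_def, intro dfnI)
lemma dfn_PR [dfnI]: "dt x ==> dt y ==> dt z ==> dfn (%e. PR (x e) (y e) (z e))"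
 by (rule dfn_app3) (unfold PR_def PRs_def HPs_def Bex_def Ball_def mem_Collect_eq, intro dfnI)

lemma L: "p : set (C_single @ L_ops) ==> sat {c. Nat c} Mr Er (%_. emp) p"
 by (rule sat_all) (use KL in simp_all)

lemma PR_ks: "PR x y p ==> ks x & ks y & ks p & Nat x & Nat y & Nat p" unfolding PR_def PRs_def ks_def by auto

lemma ks_ext: assumes "Nat x" "Nat y" "!!z. Nat z ==> ks z ==> Mr z x <-> Mr z y" shows "Er x y"
proof -
 have "ALL x. Nat x --> (ALL y. Nat y --> (ALL z. Nat z --> (Mr z x <-> Mr z y)) --> Er x y)"
  using L[of "ax_ext 0"] by (simp add: C_single_def ax_ext_def sat_h)
 moreover have "Mr z x <-> Mr z y" if "Nat z" for z using assms that unfolding ks_def by blast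
 ultimately show ?thesis using assms(1,2) by blast
qed

lemma Mr_cong: assumes "Nat x" "Nat y" "Nat x'" "Nat y'" "Er x x'" "Er y y'" shows "Mr x y <-> Mr x' y'"
proof -
 note s = Er_sym[OF assms(1,3,5)] Er_sym[OF assms(2,4,6)]
 show ?thesis using Mr_l[OF assms(1,3,2,5)] Mr_l[OF assms(3,1,2) s(1)] Mr_r[OF assms(2,4,3,6)] Mr_r[OF assms(4,2,3) s(2)] by blast
qed

lemma Er_cong: assumes "Nat x" "Nat y" "Nat w" "Er x y" shows "Er w x <-> Er w y"
 using Er_trans[OF assms(3,1,2) _ assms(4)] Er_trans[OF assms(3,2,1) _ Er_sym[OF assms(1,2,4)]] by blast

lemma ks_cong: "Nat x ==> Nat y ==> Er x y ==> ks x ==> ks y" unfolding ks_def using Mr_l by blast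

lemma PR_cong:
 assumes "PR x y p" "Nat x'" "Nat y'" "Nat p'" "Er x x'" "Er y y'" "Er p p'" shows "PR x' y' p'"
proof -
 have n: "Nat x" "Nat y" "Nat p" and k: "ks x" "ks y" "ks p" using PR_ks[OF assms(1)] by blast+
 have k': "ks x'" "ks y'" "ks p'" using ks_cong assms n k by blast+
 have e: "Er w x <-> Er w x'" "Er w y <-> Er w y'" "Mr w p <-> Mr w p'" if "Nat w" for w
  using Er_cong[OF n(1) assms(2) that assms(5)] Er_cong[OF n(2) assms(3) that assms(6)]
   Mr_cong[OF that n(3) that assms(4) Er_refl[OF that] assms(7)] by blast+
 have "HPs {a : {c. Nat c}. EX b:{c. Nat c}. Mr a b} Mr Er x y p = HPs {a : {c. Nat c}. EX b:{c. Nat c}. Mr a b} Mr Er x' y' p'"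
  unfolding HPs_def using e by (simp cong: conj_cong)
 thus ?thesis using assms(1-4) k' unfolding PR_def PRs_def ks_def by auto
qed

lemmas Lsimps = sat_h sat_hPR sat_hset hempty_def L_ops_def C_single_def

lemma PR_ex: assumes "Nat x" "Nat y" "ks x" "ks y" shows "EX p. PR x y p"
proof -
 have "sat {c. Nat c} Mr Er (%_. emp) (L_ops ! 0)" by (rule L) (simp add: L_ops_def)
 hence "ALL x. Nat x --> (ALL y. Nat y --> (EX b. Nat b & Mr x b) & (EX b. Nat b & Mr y b) --> (EX p. Nat p & PRs {c. Nat c} Mr Er x y p))"
  by (simp add: Lsimps)
 thus ?thesis using assms unfolding PR_def ks_def by blast
qed

lemma PR_fun: assumes "PR x y p" "PR x y q" shows "Er p q"
proof -
 have "sat {c. Nat c} Mr Er (%_. emp) (L_ops ! 1)" by (rule L) (simp add: L_ops_def)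
 hence "ALL x. Nat x --> (ALL y. Nat y --> (ALL p. Nat p --> (ALL q. Nat q --> PRs {c. Nat c} Mr Er x y p & PRs {c. Nat c} Mr Er x y q --> Er p q)))"
  by (simp add: Lsimps)
 thus ?thesis using assms unfolding PR_def by blast
qed

lemma PR_inj: assumes "PR x y p" "PR z w p" shows "Er x z" "Er y w"
proof -
 have "sat {c. Nat c} Mr Er (%_. emp) (L_ops ! 2)" by (rule L) (simp add: L_ops_def)
 hence "ALL x. Nat x --> (ALL y. Nat y --> (ALL z. Nat z --> (ALL w. Nat w --> (ALL p. Nat p --> PRs {c. Nat c} Mr Er x y p & PRs {c. Nat c} Mr Er z w p --> Er x z & Er y w))))"
  by (simp add: Lsimps numeral_2_eq_2) blast
 thus "Er x z" "Er y w" using assms unfolding PR_def by blast+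
qed

lemma PR_inj': assumes "PR x y p" "PR z w q" "Er p q" shows "Er x z" "Er y w" "PR x y q"
proof -
 have n: "Nat x" "Nat y" "Nat q" using PR_ks assms by blast+
 show p: "PR x y q" by (rule PR_cong[OF assms(1) n(1,2,3) Er_refl[OF n(1)] Er_refl[OF n(2)] assms(3)])
 show "Er x z" "Er y w" using PR_inj[OF p assms(2)] .
qed

lemma op_empty: "EX z. Nat z & ks z & (ALL w. Nat w --> ~ Mr w z)"
proof -
 have "sat {c. Nat c} Mr Er (%_. emp) (L_ops ! 3)" by (rule L) (simp add: L_ops_def)
 thus ?thesis by (simp add: Lsimps ks_def numeral_3_eq_3)
qed

definition empt :: "nat => bool" where "empt z <-> (ALL w. Nat w --> ~ Mr w z)"

text \<open>The closure properties of \<open>L_ops\<close> read off in the structure. Pairing is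
  kept as the relation \<open>PR\<close>, since pairs are unique only up to
  \<open>Er\<close>.\<close>

lemma ops:
 "Nat W ==> EX Y. Nat Y & (ALL p. Nat p --> ks p --> (Mr p Y <-> (EX s a. PR s a p & Mr s W)))"
 "EX Y. Nat Y & (ALL p. Nat p --> ks p --> (Mr p Y <-> (EX b s. PR s b p & (EX t a. PR t a b & Mr s t))))"
 "Nat Q ==> EX Y. Nat Y & (ALL p. Nat p --> ks p --> (Mr p Y <-> (EX b s. PR s b p & (EX t a. PR t a b & (EX c. PR s a c & Mr c Q)))))"
 "Nat Q ==> Nat R ==> EX Y. Nat Y & (ALL a. Nat a --> ks a --> (Mr a Y <-> (EX s. Nat s & ks s & (EX p. PR s a p & Mr p R) &
   (ALL t. Nat t --> ks t --> (Mr t s <-> (EX p. PR t a p & Mr p Q))))))"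
 "Nat Q ==> Nat R ==> EX Y. Nat Y & (ALL a. Nat a --> ks a --> (Mr a Y <-> (ALL s p. PR s a p --> (Mr p Q <-> Mr p R))))"
 "Nat Q ==> EX Y. Nat Y & (ALL a. Nat a --> ks a --> (Mr a Y <-> ~ Mr a Q))"
 "Nat Q ==> Nat R ==> EX Y. Nat Y & (ALL a. Nat a --> ks a --> (Mr a Y <-> (Mr a Q --> Mr a R)))"
 "Nat Q ==> EX Y. Nat Y & (ALL a. Nat a --> ks a --> (Mr a Y <-> (ALL s p. PR s a p --> Mr p Q)))"
 "Nat Q ==> EX Y. Nat Y & (ALL s. Nat s --> ks s --> (Mr s Y <-> (EX z p. empt z & PR s z p & Mr p Q)))"
proof -
 have N: "sat {c. Nat c} Mr Er (%_. emp) (L_ops ! k)" if "k < length L_ops" for k by (rule L) (use nth_mem[OF that] in simp)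
 note u = ks_def PR_def empt_def
 have 1: "Nat c & P c <-> P c" if "!!c. P c ==> Nat c" for P :: "nat => bool" and c using that by blast
 note sm = Lsimps u Bex_def Ball_def
 show "Nat W ==> EX Y. Nat Y & (ALL p. Nat p --> ks p --> (Mr p Y <-> (EX s a. PR s a p & Mr s W)))"
  using N[of 4] by (simp add: sm) (drule spec, drule (1) mp, erule exE, rule_tac x = x in exI, simp, metis)
 show "EX Y. Nat Y & (ALL p. Nat p --> ks p --> (Mr p Y <-> (EX b s. PR s b p & (EX t a. PR t a b & Mr s t))))"
 proof -
  have e: "(EX b. Nat b & (EX s. Nat s & PRs {c. Nat c} Mr Er s b p & (EX t. Nat t & (EX a. Nat a & PRs {c. Nat c} Mr Er t a b) & Mr s t))) <->
   (EX b s. PR s b p & (EX t a. PR t a b & Mr s t))" if "Nat p" for p unfolding PR_def using that by blast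
  have "EX Y. Nat Y & (ALL p. Nat p --> (EX b. Nat b & Mr p b) --> (Mr p Y <->
   (EX b. Nat b & (EX s. Nat s & PRs {c. Nat c} Mr Er s b p & (EX t. Nat t & (EX a. Nat a & PRs {c. Nat c} Mr Er t a b) & Mr s t)))))"
   using N[of 5] by (simp add: Lsimps)
  thus ?thesis unfolding ks_def by (simp add: e cong: conj_cong)
 qed
 show "Nat Q ==> EX Y. Nat Y & (ALL p. Nat p --> ks p --> (Mr p Y <-> (EX b s. PR s b p & (EX t a. PR t a b & (EX c. PR s a c & Mr c Q)))))"
 proof -
  assume Q: "Nat Q"
  have e: "(EX b. Nat b & (EX s. Nat s & PRs {c. Nat c} Mr Er s b p & (EX t. Nat t & (EX a. Nat a & PRs {c. Nat c} Mr Er t a b & (EX c. Nat c & PRs {c. Nat c} Mr Er s a c & Mr c Q))))) <->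
   (EX b s. PR s b p & (EX t a. PR t a b & (EX c. PR s a c & Mr c Q)))" if "Nat p" for p unfolding PR_def using that by blast
  have "ALL Q. Nat Q --> (EX Y. Nat Y & (ALL p. Nat p --> (EX b. Nat b & Mr p b) --> (Mr p Y <->
   (EX b. Nat b & (EX s. Nat s & PRs {c. Nat c} Mr Er s b p & (EX t. Nat t & (EX a. Nat a & PRs {c. Nat c} Mr Er t a b & (EX c. Nat c & PRs {c. Nat c} Mr Er s a c & Mr c Q))))))))"
   using N[of 6] by (simp add: Lsimps)
  from this[rule_format, OF Q] show ?thesis unfolding ks_def by (simp add: e cong: conj_cong)
 qed
 show "Nat Q ==> Nat R ==> EX Y. Nat Y & (ALL a. Nat a --> ks a --> (Mr a Y <-> (EX s. Nat s & ks s & (EX p. PR s a p & Mr p R) &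
   (ALL t. Nat t --> ks t --> (Mr t s <-> (EX p. PR t a p & Mr p Q))))))"
 proof -
  assume Q: "Nat Q"
  assume R: "Nat R"
  have e: "(EX p. Nat p & PRs {c. Nat c} Mr Er s a p & Mr p R) <-> (EX p. PR s a p & Mr p R)" if "Nat a" "Nat s" for a s R unfolding PR_def using that by blast
  have "ALL Q. Nat Q --> (ALL R. Nat R --> (EX Y. Nat Y & (ALL a. Nat a --> (EX b. Nat b & Mr a b) --> (Mr a Y <-> (EX s. Nat s & (EX b. Nat b & Mr s b) & (EX p. Nat p & PRs {c. Nat c} Mr Er s a p & Mr p R) & (ALL t. Nat t --> (EX b. Nat b & Mr t b) --> (Mr t s <-> (EX p. Nat p & PRs {c. Nat c} Mr Er t a p & Mr p Q))))))))"
   using N[of 7] by (simp add: Lsimps)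
  from this[rule_format, OF Q R] show ?thesis unfolding ks_def by (simp add: e empt_def cong: conj_cong)
 qed
 show "Nat Q ==> Nat R ==> EX Y. Nat Y & (ALL a. Nat a --> ks a --> (Mr a Y <-> (ALL s p. PR s a p --> (Mr p Q <-> Mr p R))))"
 proof -
  assume Q: "Nat Q"
  assume R: "Nat R"
  have e: "(ALL s. Nat s --> (ALL p. Nat p --> PRs {c. Nat c} Mr Er s a p --> (Mr p Q <-> Mr p R))) <-> (ALL s p. PR s a p --> (Mr p Q <-> Mr p R))" if "Nat a" for a unfolding PR_def using that by blast
  have "ALL Q. Nat Q --> (ALL R. Nat R --> (EX Y. Nat Y & (ALL a. Nat a --> (EX b. Nat b & Mr a b) --> (Mr a Y <-> (ALL s. Nat s --> (ALL p. Nat p --> PRs {c. Nat c} Mr Er s a p --> (Mr p Q <-> Mr p R)))))))"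
   using N[of 8] by (simp add: Lsimps)
  from this[rule_format, OF Q R] show ?thesis unfolding ks_def by (simp add: e empt_def cong: conj_cong)
 qed
 show "Nat Q ==> EX Y. Nat Y & (ALL a. Nat a --> ks a --> (Mr a Y <-> ~ Mr a Q))"
  using N[of 9] by (simp add: sm)
 show "Nat Q ==> Nat R ==> EX Y. Nat Y & (ALL a. Nat a --> ks a --> (Mr a Y <-> (Mr a Q --> Mr a R)))"
  using N[of 10] by (simp add: sm)
 show "Nat Q ==> EX Y. Nat Y & (ALL a. Nat a --> ks a --> (Mr a Y <-> (ALL s p. PR s a p --> Mr p Q)))"
 proof -
  assume Q: "Nat Q"
  have e: "(ALL s. Nat s --> (ALL p. Nat p --> PRs {c. Nat c} Mr Er s a p --> Mr p Q)) <-> (ALL s p. PR s a p --> Mr p Q)" if "Nat a" for a unfolding PR_def using that by blast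
  have "ALL Q. Nat Q --> (EX Y. Nat Y & (ALL a. Nat a --> (EX b. Nat b & Mr a b) --> (Mr a Y <-> (ALL s. Nat s --> (ALL p. Nat p --> PRs {c. Nat c} Mr Er s a p --> Mr p Q)))))"
   using N[of 11] by (simp add: Lsimps)
  from this[rule_format, OF Q] show ?thesis unfolding ks_def by (simp add: e empt_def cong: conj_cong)
 qed
 show "Nat Q ==> EX Y. Nat Y & (ALL s. Nat s --> ks s --> (Mr s Y <-> (EX z p. empt z & PR s z p & Mr p Q)))"
 proof -
  assume Q: "Nat Q"
  have e: "(EX z. Nat z & (ALL w. Nat w --> ~ Mr w z) & (EX p. Nat p & PRs {c. Nat c} Mr Er a z p & Mr p Q)) <-> (EX z. (ALL w. Nat w --> ~ Mr w z) & (EX p. PR a z p & Mr p Q))" if "Nat a" for a unfolding PR_def using that by blast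
  have "ALL Q. Nat Q --> (EX Y. Nat Y & (ALL a. Nat a --> (EX b. Nat b & Mr a b) --> (Mr a Y <-> (EX z. Nat z & (ALL w. Nat w --> ~ Mr w z) & (EX p. Nat p & PRs {c. Nat c} Mr Er a z p & Mr p Q)))))"
   using N[of 12] by (simp add: Lsimps)
  from this[rule_format, OF Q] show ?thesis unfolding ks_def by (simp add: e empt_def cong: conj_cong)
 qed
qed

text \<open>\<open>Env B0 a0 G a B\<close>: the stack \<open>a\<close> of the values, pushed on the empty set \<open>a0\<close>, of the variables
 listed in \<open>G\<close> turns the assignment \<open>B0\<close> into \<open>B\<close>.\<close>

definition Env :: "nat => nat => nat => nat => nat => bool" where
 "Env B0 a0 G a B <-> gen (%y. y = t3 emp a0 B0)
   (%x y. EX G a B i t c. x = t3 G a B & Nat i & PR t a c & y = t3 (opair i G) c (upd B i t)) (%_ _ _. False) (t3 G a B)"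
definition Stk :: "nat => bool" where
 "Stk = gen (%y. y = emp) (%x y. EX i. Nat i & y = opair i x) (%_ _ _. False)"

lemma dfn_Env [dfnI]: "dt x ==> dt y ==> dt z ==> dfn (%e. Env B0 a0 (x e) (y e) (z e))"
 by (rule dfn_app3) (unfold Env_def, intro dfn_gen0 dfnI)
lemma dfn_Stk [dfnI]: "dt x ==> dfn (%e. Stk (x e))" unfolding Stk_def by (intro dfn_gen0 dfnI)

lemma Stk_emp: "Stk emp" unfolding Stk_def by (rule gen_base) simp
lemma Stk_push: "Stk G ==> Nat i ==> Stk (opair i G)" unfolding Stk_def by (erule gen_1) blast

lemma Env_emp: "Env B0 a0 emp a0 B0" unfolding Env_def by (rule gen_base) simp
lemma Env_push: "Env B0 a0 G a B ==> Nat i ==> PR t a c ==> Env B0 a0 (opair i G) c (upd B i t)"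
 unfolding Env_def by (erule gen_1) blast
lemma Env_cases:
 assumes "Env B0 a0 G a B"
 shows "(G = emp & a = a0 & B = B0) | (EX G' a' B' i t. Env B0 a0 G' a' B' & Nat i & PR t a' a & G = opair i G' & B = upd B' i t)"
 using gen_cases[OF assms[unfolded Env_def]]
proof (elim disjE exE conjE)
 assume "t3 G a B = t3 emp a0 B0" thus ?thesis by simp
next
 fix p G' a' B' i t c
 assume "gen (%y. y = t3 emp a0 B0) (%x y. EX G a B i t c. x = t3 G a B & Nat i & PR t a c & y = t3 (opair i G) c (upd B i t)) (%_ _ _. False) p"
  "p = t3 G' a' B'" "Nat i" "PR t a' c" "t3 G a B = t3 (opair i G') c (upd B' i t)"
 hence "Env B0 a0 G' a' B' & Nat i & PR t a' a & G = opair i G' & B = upd B' i t" unfolding Env_def by simp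
 thus ?thesis by blast
qed simp

lemma Env_props:
 assumes "Env B0 a0 G a B" "HF B0" "Nat a0" "ks a0" shows "HF B & Nat a & ks a"
proof -
 have "ALL G a B. t3 G0 a1 B1 = t3 G a B --> HF B & Nat a & ks a" if "Env B0 a0 G0 a1 B1" for G0 a1 B1
  using that unfolding Env_def
 proof (rule gen_induct)
  show "dfn (%e. ALL G a B. e 0 = t3 G a B --> HF B & Nat a & ks a)" by (intro dfnI)
  show "ALL G a B. y = t3 G a B --> HF B & Nat a & ks a" if "y = t3 emp a0 B0" for y using that assms by auto
  show "ALL G a B. y = t3 G a B --> HF B & Nat a & ks a"
   if h: "ALL G a B. x = t3 G a B --> HF B & Nat a & ks a" "EX G a B i t c. x = t3 G a B & Nat i & PR t a c & y = t3 (opair i G) c (upd B i t)" for x y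
  proof -
   obtain G a B i t c where *: "x = t3 G a B" "Nat i" "PR t a c" "y = t3 (opair i G) c (upd B i t)" using h(2) by blast
   have "HF B" using h(1) *(1) by blast
   thus ?thesis using * PR_ks[OF *(3)] by auto
  qed
 qed simp
 thus ?thesis using assms(1) by blast
qed

context
 fixes B0 a0 assumes B0: "HF B0" and a0: "Nat a0" "ks a0"
begin

text \<open>The value of a variable that is not on the stack may be a proper class, which no pair
  can hold. Values are therefore represented through their members, by a class of pairs of a member
  \<open>s\<close> and a stack \<open>a\<close>. The last variable pushed is read from the top of
  the stack; for another one the top is skipped, down to the empty stack, where \<open>B0\<close>
  decides.\<close>

lemma val_class:
 assumes G: "Stk G"
 shows "ALL i. EX Q. Nat Q & (ALL a B. Env B0 a0 G a B --> (ALL s p. PR s a p --> (Mr p Q <-> Mr s (vl B i))))" (is "?P G")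
proof (rule gen_induct[OF G[unfolded Stk_def], of ?P])
 show "dfn (%e. ?P (e 0))" by (intro dfnI)
 show "?P G" if G: "G = emp" for G
 proof
  fix i
  obtain Q where Q: "Nat Q" "!!p. Nat p ==> ks p ==> Mr p Q <-> (EX s a. PR s a p & Mr s (vl B0 i))" using ops(1)[of "vl B0 i"] by auto
  have "Mr p Q <-> Mr s (vl B i)" if h: "Env B0 a0 G a B" "PR s a p" for a B s p
  proof -
   have B: "B = B0" using Env_cases[OF h(1)] G by auto
   have n: "Nat p" "ks p" "Nat s" using PR_ks[OF h(2)] by blast+
   have "Mr s' (vl B0 i) <-> Mr s (vl B0 i)" if "PR s' a' p" for s' a'
    using Mr_cong[OF _ _ n(3) _ PR_inj(1)[OF that h(2)] Er_refl, of "vl B0 i"] PR_ks[OF that] by simp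
   thus ?thesis using Q(2)[OF n(1,2)] h(2) B by blast
  qed
  thus "EX Q. Nat Q & (ALL a B. Env B0 a0 G a B --> (ALL s p. PR s a p --> (Mr p Q <-> Mr s (vl B i))))" using Q(1) by blast
 qed
 show "?P G" if h: "?P G'" "EX j. Nat j & G = opair j G'" for G' G
 proof
  fix i
  obtain j where j: "Nat j" "G = opair j G'" using h(2) by blast
  have inv: "EX a' B' t. Env B0 a0 G' a' B' & PR t a' a & B = upd B' j t" if "Env B0 a0 G a B" for a B
   using Env_cases[OF that] j(2) by auto
  show "EX Q. Nat Q & (ALL a B. Env B0 a0 G a B --> (ALL s p. PR s a p --> (Mr p Q <-> Mr s (vl B i))))"
  proof (cases "i = j")
   case True
   obtain Q where Q: "Nat Q" "!!p. Nat p ==> ks p ==> Mr p Q <-> (EX b s. PR s b p & (EX t a. PR t a b & Mr s t))" using ops(2) by blast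
   have "Mr p Q <-> Mr s (vl B i)" if e: "Env B0 a0 G a B" and pr: "PR s a p" for a B s p
   proof -
    obtain a' B' t where *: "Env B0 a0 G' a' B'" "PR t a' a" "B = upd B' j t" using inv[OF e] by blast
    have n: "Nat p" "ks p" "Nat s" "Nat t" using PR_ks[OF pr] PR_ks[OF *(2)] by blast+
    have v: "vl B i = t" using *(3) n True by (simp add: vl_upd)
    have "Mr s t" if "PR s' b p" "PR t' a'' b" "Mr s' t'" for s' b t' a''
    proof -
     have "Er s' s" "Er b a" using PR_inj[OF that(1) pr] .
     moreover have "Er t' t" using PR_inj'(1)[OF that(2) *(2)] calculation(2) by blast
     ultimately show ?thesis using Mr_cong[of s' t' s t] that PR_ks[OF that(1)] PR_ks[OF that(2)] n by blast
    qed
    thus ?thesis unfolding v using Q(2)[OF n(1,2)] pr *(2) by blast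
   qed
   thus ?thesis using Q(1) by blast
  next
   case False
   obtain Q' where Q': "Nat Q'" "!!a B s p. Env B0 a0 G' a B ==> PR s a p ==> Mr p Q' <-> Mr s (vl B i)" using h(1) by blast
   obtain Q where Q: "Nat Q" "!!p. Nat p ==> ks p ==> Mr p Q <-> (EX b s. PR s b p & (EX t a. PR t a b & (EX c. PR s a c & Mr c Q')))"
    using ops(3)[OF Q'(1)] by blast
   have "Mr p Q <-> Mr s (vl B i)" if e: "Env B0 a0 G a B" and pr: "PR s a p" for a B s p
   proof -
    obtain a' B' t where *: "Env B0 a0 G' a' B'" "PR t a' a" "B = upd B' j t" using inv[OF e] by blast
    have n: "Nat p" "ks p" "Nat s" "Nat t" "ks s" "Nat a'" "ks a'" using PR_ks[OF pr] PR_ks[OF *(2)] by blast+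
    have v: "vl B i = vl B' i" using *(3) n False by (simp add: vl_upd)
    have "Mr s (vl B' i)" if k: "PR s' b p" "PR t' a'' b" "PR s' a'' c" "Mr c Q'" for s' b t' a'' c
    proof -
     have "Er s' s" "Er b a" using PR_inj[OF k(1) pr] .
     moreover have "Er a'' a'" using PR_inj'(2)[OF k(2) *(2)] calculation(2) by blast
     ultimately have "PR s a' c" using PR_cong[OF k(3) n(3,6) _ _ _ Er_refl] PR_ks[OF k(3)] by blast
     thus ?thesis using Q'(2)[OF *(1)] k(4) by blast
    qed
    moreover have "Mr p Q" if m: "Mr s (vl B' i)"
    proof -
     obtain c where c: "PR s a' c" using PR_ex[OF n(3,6,5,7)] by blast
     hence "Mr c Q'" using Q'(2)[OF *(1) c] m by blast
     thus ?thesis using Q(2)[OF n(1,2)] pr *(2) c by blast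
    qed
    ultimately show ?thesis unfolding v using Q(2)[OF n(1,2)] by blast
   qed
   thus ?thesis using Q(1) by blast
  qed
 qed
qed simp

text \<open>Internal induction on predicative formulas, so that nonstandard ones are covered. The
  stack layout \<open>G\<close> is quantified inside because a quantifier extends it, and the
  classes assigned by \<open>B0\<close> stay fixed as parameters.\<close>

lemma class_ex:
 assumes p: "Pred p"
 shows "ALL G. Stk G --> (EX X. Nat X & (ALL a B. Env B0 a0 G a B --> (Mr a X <-> V p B)))"
proof -
 let ?Q = "%p. Form p & (ALL G. Stk G --> (EX X. Nat X & (ALL a B. Env B0 a0 G a B --> (Mr a X <-> V p B))))"
 have E: "HF B" "Nat a" "ks a" if "Env B0 a0 G a B" for G a B using Env_props[OF that B0 a0] by blast+
 have "?Q p"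
 proof (rule gen_induct[OF p[unfolded Pred_def], of ?Q])
  show "dfn (%e. ?Q (e 0))" by (intro dfnI)
  show "?Q y" if at: "Atom y" for y
  proof -
   obtain i j where ij: "Nat i" "Nat j" "y = cMem i j | y = cEql i j" using at unfolding Atom_def by blast
   have "EX X. Nat X & (ALL a B. Env B0 a0 G a B --> (Mr a X <-> V y B))" if G: "Stk G" for G
   proof -
    obtain Q where Q: "Nat Q" "!!a B s p. Env B0 a0 G a B ==> PR s a p ==> Mr p Q <-> Mr s (vl B i)" using val_class[OF G] by blast
    obtain R where R: "Nat R" "!!a B s p. Env B0 a0 G a B ==> PR s a p ==> Mr p R <-> Mr s (vl B j)" using val_class[OF G] by blast
    show ?thesis
    proof (cases "y = cMem i j")
     case True
     \<comment> \<open>The value of variable \<open>i\<close> may be a proper class. The witness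
       \<open>s\<close> is a set with the same members, which exists exactly when that value is a
       set, as it must be to belong to anything.\<close>
     obtain X where X: "Nat X" "!!a. Nat a ==> ks a ==> Mr a X <-> (EX s. Nat s & ks s & (EX p. PR s a p & Mr p R) &
      (ALL t. Nat t --> ks t --> (Mr t s <-> (EX p. PR t a p & Mr p Q))))" using ops(4)[OF Q(1) R(1)] by blast
     have "Mr a X <-> V y B" if e: "Env B0 a0 G a B" for a B
     proof -
      have r: "(EX p. PR t a p & Mr p Q) <-> Mr t (vl B i)" "(EX p. PR t a p & Mr p R) <-> Mr t (vl B j)" if "Nat t" "ks t" for t
       using PR_ex[OF that(1) E(2)[OF e] that(2) E(3)[OF e]] Q(2)[OF e] R(2)[OF e] by blast+
      have "Mr a X <-> (EX s. Nat s & ks s & Mr s (vl B j) & (ALL t. Nat t --> ks t --> (Mr t s <-> Mr t (vl B i))))"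
       using X(2)[OF E(2,3)[OF e]] r by (simp cong: conj_cong)
      also have "\<dots> <-> Mr (vl B i) (vl B j)"
      proof
       assume "EX s. Nat s & ks s & Mr s (vl B j) & (ALL t. Nat t --> ks t --> (Mr t s <-> Mr t (vl B i)))"
       then obtain s where s: "Nat s" "Mr s (vl B j)" "!!t. Nat t ==> ks t ==> Mr t s <-> Mr t (vl B i)" by blast
       have "Er s (vl B i)" by (rule ks_ext) (use s in auto)
       thus "Mr (vl B i) (vl B j)" using Mr_l[of s "vl B i" "vl B j"] s by simp
      next
       assume m: "Mr (vl B i) (vl B j)"
       hence "ks (vl B i)" unfolding ks_def using D_vl by blast
       thus "EX s. Nat s & ks s & Mr s (vl B j) & (ALL t. Nat t --> ks t --> (Mr t s <-> Mr t (vl B i)))" using m D_vl by blast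
      qed
      finally show ?thesis using True ij E(1)[OF e] by (simp add: V_Mem)
     qed
     thus ?thesis using X(1) by blast
    next
     case False
     obtain X where X: "Nat X" "!!a. Nat a ==> ks a ==> Mr a X <-> (ALL s p. PR s a p --> (Mr p Q <-> Mr p R))" using ops(5)[OF Q(1) R(1)] by blast
     have "Mr a X <-> V y B" if e: "Env B0 a0 G a B" for a B
     proof -
      have "Mr a X <-> (ALL s p. PR s a p --> (Mr s (vl B i) <-> Mr s (vl B j)))"
       using X(2)[OF E(2,3)[OF e]] Q(2)[OF e] R(2)[OF e] by blast
      also have "\<dots> <-> Er (vl B i) (vl B j)"
      proof
       assume h: "ALL s p. PR s a p --> (Mr s (vl B i) <-> Mr s (vl B j))"
       show "Er (vl B i) (vl B j)"
        by (rule ks_ext) (use h PR_ex E[OF e] D_vl in blast)+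
      next
       assume h: "Er (vl B i) (vl B j)"
       show "ALL s p. PR s a p --> (Mr s (vl B i) <-> Mr s (vl B j))"
        using Mr_cong[OF _ D_vl _ D_vl Er_refl h] PR_ks by blast
      qed
      finally show ?thesis using False ij E(1)[OF e] by (auto simp: V_Eql)
     qed
     thus ?thesis using X(1) by blast
    qed
   qed
   thus ?thesis using ij by auto
  qed
  show "?Q y" if h: "?Q p" "y = cNeg p | (EX i j. Nat i & Nat j & i ~= j & y = cAll i (cImp (cEx j (cMem i j)) p))" for p y
   using h(2)
  proof (elim disjE exE conjE)
   assume y: "y = cNeg p"
   have "EX X. Nat X & (ALL a B. Env B0 a0 G a B --> (Mr a X <-> V y B))" if G: "Stk G" for G
   proof -
    obtain Q where Q: "Nat Q" "!!a B. Env B0 a0 G a B ==> Mr a Q <-> V p B" using h(1) G by blast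
    obtain X where X: "Nat X" "!!a. Nat a ==> ks a ==> Mr a X <-> ~ Mr a Q" using ops(6)[OF Q(1)] by blast
    have "Mr a X <-> V y B" if e: "Env B0 a0 G a B" for a B
     using X(2)[OF E(2,3)[OF e]] Q(2)[OF e] E(1)[OF e] h(1) y by (simp add: V_Neg)
    thus ?thesis using X(1) by blast
   qed
   thus ?thesis using h(1) y by simp
  next
   fix i j assume ij: "Nat i" "Nat j" "i ~= j" and y: "y = cAll i (cImp (cEx j (cMem i j)) p)"
   have "EX X. Nat X & (ALL a B. Env B0 a0 G a B --> (Mr a X <-> V y B))" if G: "Stk G" for G
   proof -
    \<comment> \<open>The quantifier ranges over sets and so can push its variable on the stack; a
      quantifier over classes could not, since pairs hold sets only.\<close>
    obtain Q where Q: "Nat Q" "!!a B. Env B0 a0 (opair i G) a B ==> Mr a Q <-> V p B" using h(1) Stk_push[OF G ij(1)] by blast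
    obtain X where X: "Nat X" "!!a. Nat a ==> ks a ==> Mr a X <-> (ALL s p. PR s a p --> Mr p Q)" using ops(8)[OF Q(1)] by blast
    have "Mr a X <-> V y B" if e: "Env B0 a0 G a B" for a B
    proof -
     have "V y B <-> (ALL c. Nat c --> ks c --> V p (upd B i c))"
      using E(1)[OF e] ij h(1) y by (simp add: V_All V_Imp V_Neg V_Mem vl_upd ks_def)
     moreover have "(ALL s p. PR s a p --> Mr p Q) <-> (ALL c. Nat c --> ks c --> V p (upd B i c))"
     proof (intro iffI allI impI)
      fix c assume hh: "ALL s p. PR s a p --> Mr p Q" "Nat c" "ks c"
      obtain q where q: "PR c a q" using PR_ex[OF hh(2) E(2)[OF e] hh(3) E(3)[OF e]] by blast
      show "V p (upd B i c)" using Q(2)[OF Env_push[OF e ij(1) q]] hh(1) q by blast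
     next
      fix s q assume hh: "ALL c. Nat c --> ks c --> V p (upd B i c)" "PR s a q"
      thus "Mr q Q" using Q(2)[OF Env_push[OF e ij(1) hh(2)]] PR_ks[OF hh(2)] by blast
     qed
     ultimately show ?thesis using X(2)[OF E(2,3)[OF e]] by blast
    qed
    thus ?thesis using X(1) by blast
   qed
   thus ?thesis using h(1) y ij by simp
  qed
  show "?Q y" if h: "?Q p" "?Q q" "y = cImp p q" for p q y
  proof -
   have "EX X. Nat X & (ALL a B. Env B0 a0 G a B --> (Mr a X <-> V y B))" if G: "Stk G" for G
   proof -
    obtain Q where Q: "Nat Q" "!!a B. Env B0 a0 G a B ==> Mr a Q <-> V p B" using h(1) G by blast
    obtain R where R: "Nat R" "!!a B. Env B0 a0 G a B ==> Mr a R <-> V q B" using h(2) G by blast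
    obtain X where X: "Nat X" "!!a. Nat a ==> ks a ==> Mr a X <-> (Mr a Q --> Mr a R)" using ops(7)[OF Q(1) R(1)] by blast
    have "Mr a X <-> V y B" if e: "Env B0 a0 G a B" for a B
     using X(2)[OF E(2,3)[OF e]] Q(2)[OF e] R(2)[OF e] E(1)[OF e] h by (simp add: V_Imp)
    thus ?thesis using X(1) by blast
   qed
   thus ?thesis using h by simp
  qed
 qed
 thus ?thesis by blast
qed

end

lemma CAx_V: assumes x: "CAx x" and B: "HF B" shows "V x B"
 using x unfolding CAx_def
proof (elim disjE bexE exE conjE)
 fix p assume "p : set C_single" "x = code p" thus ?thesis using KL B by simp
next
 fix v y j p assume n: "Nat v" "Nat y" "Nat j" "v ~= y" "v ~= j" and p: "Pred p" "~ FreeV y p"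
  and x: "x = cEx y (cAll v (cImp (cEx j (cMem v j)) (cIff (cMem v y) p)))"
 have Fp: "Form p" by (rule Pred_Form[OF p(1)])
 obtain a0 where a0: "Nat a0" "ks a0" "!!w. Nat w ==> ~ Mr w a0" using op_empty by blast
 \<comment> \<open>The only entry of the stack is \<open>v\<close>, sitting on the empty set
   \<open>a0\<close>; the section operation then turns the class of stacks into the class of values
   of \<open>v\<close>.\<close>
 obtain X where X: "Nat X" "!!a C. Env B a0 (opair v emp) a C ==> Mr a X <-> V p C"
  using class_ex[OF B a0(1,2) p(1)] Stk_push[OF Stk_emp n(1)] by blast
 obtain Y where Y: "Nat Y" "!!s. Nat s ==> ks s ==> Mr s Y <-> (EX z p. empt z & PR s z p & Mr p X)" using ops(9)[OF X(1)] by blast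
 have YV: "Mr s Y <-> V p (upd B v s)" if s: "Nat s" "ks s" for s
 proof -
  obtain c where c: "PR s a0 c" using PR_ex[OF s(1) a0(1) s(2) a0(2)] by blast
  have m: "Mr c X <-> V p (upd B v s)" by (rule X(2)[OF Env_push[OF Env_emp n(1) c]])
  have "Mr d X <-> Mr c X" if d: "empt z" "PR s z d" for z d
  proof -
   have k: "Nat z" "Nat d" "Nat c" using PR_ks[OF d(2)] PR_ks[OF c] by blast+
   have "Er z a0" by (rule ks_ext) (use k a0 d(1) in \<open>auto simp: empt_def\<close>)
   hence "PR s a0 d" using PR_cong[OF d(2) s(1) a0(1) k(2) Er_refl[OF s(1)] _ Er_refl[OF k(2)]] by blast
   thus ?thesis using Mr_cong[OF k(2) X(1) k(3) X(1) PR_fun[OF _ c] Er_refl[OF X(1)]] by blast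
  qed
  moreover have "empt a0" unfolding empt_def using a0(3) by blast
  ultimately show ?thesis using Y(2)[OF s] m c by blast
 qed
 have f: "V p (upd (upd B y Y) v c) <-> V p (upd B v c)" if c: "Nat c" for c
 proof (rule V_cong[OF Fp])
  fix i assume "FreeV i p"
  hence "i ~= y" using p(2) by blast
  thus "Er (vl (upd (upd B y Y) v c) i) (vl (upd B v c) i)" using c Y(1) Er_refl by (simp add: vl_upd)
 qed (use B n Y c in simp_all)
 let ?bod = "cImp (cEx j (cMem v j)) (cIff (cMem v y) p)"
 have "V ?bod (upd (upd B y Y) v c)" if c: "Nat c" for c
 proof -
  have "V ?bod (upd (upd B y Y) v c) <-> (ks c --> (Mr c Y <-> V p (upd B v c)))"
   using B n Y(1) c Fp f[OF c] by (simp add: V_Imp V_Neg V_All V_Mem vl_upd ks_def) blast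
  thus ?thesis using YV c by blast
 qed
 hence "V (cAll v ?bod) (upd B y Y)" using B n Y(1) Fp by (simp add: V_All)
 thus ?thesis unfolding x using B n Y(1) Fp by (subst V_Ex) auto
qed

lemma Pv_CAx_V: "Pv CAx x ==> HF B ==> V x B" by (rule Pv_V[of CAx]) (rule CAx_Form, assumption, rule CAx_V)

end

section \<open>The sets of a model of C form a model of S\<close>

lemma FV_relV [simp]: "FV (relV p) = FV p" by (induction p) auto
lemma predicative_relV: "predicative (relV p)" by (induction p) (auto intro: predicative.intros)

text \<open>Equality is true equality here; the domain will consist of representatives modulo the
  congruence of the structure at hand.\<close>

locale cmodel =
 fixes Dm :: "nat set" and EK :: "nat => nat => bool"
 assumes C: "p : C_axioms ==> (!!i. e i : Dm) ==> sat Dm EK (=) e p" and Dm: "Dm ~= {}"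
begin

definition KS :: "nat set" where "KS = {x:Dm. EX y:Dm. EK x y}"

lemma sat_relK: "sat Dm EK (=) e (relV p) = sat KS EK (=) e p" by (simp add: sat_relV KS_def)
lemma C1: "p : set C_single ==> sat Dm EK (=) (%_. SOME d. d : Dm) p"
 by (rule C) (use Dm in \<open>auto intro: C_axioms.single simp: some_in_eq\<close>)

lemma KS_mem: "x : Dm ==> y : Dm ==> EK x y ==> x : KS" unfolding KS_def by blast
lemma KS_Dm: "x : KS ==> x : Dm" unfolding KS_def by blast
lemma C_ext: "x : Dm ==> y : Dm ==> (!!z. z : KS ==> EK z x <-> EK z y) ==> x = y"
 using C1[of "ax_ext 0"] KS_mem by (simp add: C_single_def ax_ext_def sat_h) blast
lemma C_found: "x : KS ==> y : KS ==> EK y x ==> EX y:KS. EK y x & ~ (EX z:KS. EK z x & EK z y)"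
 using C1[of "rel ax_found 0"] by (simp add: C_single_def ax_found_def sat_h KS_def[symmetric]) blast
lemma C_pair: "x : KS ==> y : KS ==> EX z:KS. ALL w:KS. EK w z <-> w = x | w = y"
 using C1[of "rel ax_pair 0"] by (simp add: C_single_def ax_pair_def sat_h KS_def[symmetric])
lemma C_union: "x : KS ==> EX u:KS. ALL w:KS. EK w u <-> (EX y:KS. EK y x & EK w y)"
 using C1[of "rel ax_union 0"] by (simp add: C_single_def ax_union_def sat_h KS_def[symmetric])
lemma C_power: "x : KS ==> EX p:KS. ALL w:KS. EK w p <-> (ALL z:KS. EK z w --> EK z x)"
 using C1[of "rel ax_power 0"] by (simp add: C_single_def ax_power_def sat_h KS_def[symmetric])
lemma KS_nonempty: "EX x. x : KS"
 using C1[of "ax_set_exists 0"] by (simp add: C_single_def ax_set_exists_def sat_h sat_hset KS_def[symmetric]) (auto simp: KS_def)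

abbreviation OP :: "nat => nat => nat => bool" where "OP \<equiv> HPs KS EK (=)"

lemma OP_ex: assumes "x : KS" "y : KS" shows "EX p:KS. OP x y p"
proof -
 obtain a where a: "a : KS" "ALL w:KS. EK w a <-> w = x" using C_pair[OF assms(1,1)] by auto
 obtain b where b: "b : KS" "ALL w:KS. EK w b <-> w = x | w = y" using C_pair[OF assms] by auto
 obtain p where p: "p : KS" "ALL w:KS. EK w p <-> w = a | w = b" using C_pair[OF a(1) b(1)] by auto
 thus ?thesis unfolding HPs_def using a b by blast
qed

lemma C_class_repl:
 assumes "x : KS" and F: "F : Dm" and fn: "!!x y z p q. x : KS ==> y : KS ==> z : KS ==> p : KS ==> q : KS ==> OP x y p ==> EK p F ==> OP x z q ==> EK q F ==> y = z"
 shows "EX y:KS. ALL w:KS. EK w y <-> (EX z:KS. EK z x & (EX p:KS. OP z w p & EK p F))"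
proof -
 have *: "ALL F:Dm. (ALL x:KS. ALL y:KS. ALL z:KS. (EX p:KS. OP x y p & EK p F) & (EX p:KS. OP x z p & EK p F) --> y = z) -->
  (ALL x:KS. EX y:KS. ALL w:KS. EK w y <-> (EX z:KS. EK z x & (EX p:KS. OP z w p & EK p F)))"
  using C1[of "ax_class_replacement 0"]
  by (simp add: C_single_def ax_class_replacement_def sat_h hsingle_valued_def hpairin_def sat_hpair KS_def[symmetric])
 have "ALL x:KS. ALL y:KS. ALL z:KS. (EX p:KS. OP x y p & EK p F) & (EX p:KS. OP x z p & EK p F) --> y = z" using fn by blast
 thus ?thesis using * F assms(1) by blast
qed

text \<open>Comprehension gives the class \<open>F\<close> of pairs described by \<open>p\<close>.
  Its first components are confined to \<open>x\<close>, because class replacement asks for a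
  function that is single-valued everywhere, while \<open>p\<close> is only assumed to be so on
  \<open>x\<close>.\<close>

lemma C_repl:
 assumes e: "!!i. e i : KS" and zw: "z ~= w" and x: "x : KS"
  and fn: "!!a. a : KS ==> EK a x ==> EX u:KS. ALL b:KS. sat KS EK (=) (e(z := a, w := b)) p --> b = u"
 shows "EX y:KS. ALL b:KS. EK b y <-> (EX a:KS. EK a x & sat KS EK (=) (e(z := a, w := b)) p)"
proof -
 \<comment> \<open>The auxiliary variables are numbered from \<open>N\<close> on, above
   \<open>z\<close>, \<open>w\<close> and everything in \<open>p\<close>, so that the instance of
   comprehension captures nothing.\<close>
 define N where "N = Suc (z + w + Max (insert 0 (FV p)))"
 have N: "i < N" if "i : FV p | i = z | i = w" for i
  using that Max_ge[of "insert 0 (FV p)" i] finite_FV[of p] unfolding N_def by (auto simp: less_Suc_eq_le trans_le_add2)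
 define t X Y n where "t = N" "X = N + 1" "Y = N + 2" "n = N + 3"
 define q where "q = Exists z (Exists w (Conj (hpair z w t n) (Conj (Mem z X) p)))"
 have "FV (hpair z w t n) \<subseteq> {z, w, t}"
  by (auto simp: hpair_def hall_def hex_def hmem_def heq_def hand_def hor_def hiff_def)
 hence "Y \<notin> FV (relV q)" using N[of Y] N[of z] N[of w] unfolding q_def t_X_Y_n_def by auto
 hence "Exists Y (Forall t (Imp (Exists X (Mem t X)) (Iff (Mem t Y) (relV q)))) : C_axioms"
  by (intro C_axioms.comprehension predicative_relV) (auto simp: t_X_Y_n_def)
 moreover have "(e(X := x)) i : Dm" for i using e x KS_Dm by simp
 ultimately have "sat Dm EK (=) (e(X := x)) (Exists Y (Forall t (Imp (Exists X (Mem t X)) (Iff (Mem t Y) (relV q)))))" by (rule C)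
 then obtain F where F0: "F : Dm" and F: "!!a. a : KS ==> EK a F <-> sat KS EK (=) (e(X := x, Y := F, t := a)) q"
  unfolding sat_Exists by (auto simp: sat_relK KS_def t_X_Y_n_def)
 have sp: "sat KS EK (=) (e(X := x, Y := F, t := c, z := a, w := b)) p = sat KS EK (=) (e(z := a, w := b)) p" for a b c
 proof (rule sat_cong)
  fix i assume "i : FV p"
  hence "i < N" using N by blast
  thus "(e(X := x, Y := F, t := c, z := a, w := b)) i = (e(z := a, w := b)) i" by (auto simp: t_X_Y_n_def)
 qed
 have ne: "z ~= X" "w ~= X" "z ~= t" "w ~= t" "z < n" "w < n" "t < n" "X ~= t" "X ~= Y" using N[of z] N[of w] by (auto simp: t_X_Y_n_def)
 have F': "EK c F <-> (EX a:KS. EX b:KS. OP a b c & EK a x & sat KS EK (=) (e(z := a, w := b)) p)" if "c : KS" for c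
  unfolding F[OF that] q_def sat_Exists sat_Conj sat_hpair[OF ne(5-7)] sp using ne zw by simp
 have OPF: "OP a b c & EK c F <-> OP a b c & EK a x & sat KS EK (=) (e(z := a, w := b)) p" if "a : KS" "b : KS" "c : KS" for a b c
  using F'[OF that(3)] HPs_inj[of KS EK a b c] that by blast
 have "EX y:KS. ALL b:KS. EK b y <-> (EX a:KS. EK a x & (EX c:KS. OP a b c & EK c F))"
 proof (rule C_class_repl[OF x F0])
  fix a b c d d' assume "a : KS" "b : KS" "c : KS" "d : KS" "d' : KS" "OP a b d" "EK d F" "OP a c d'" "EK d' F"
  thus "b = c" using OPF[of a b d] OPF[of a c d'] fn[of a] by blast
 qed
 then obtain y where y: "y : KS" "!!b. b : KS ==> EK b y <-> (EX a:KS. EK a x & (EX c:KS. OP a b c & EK c F))" by blast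
 have "(EX c:KS. OP a b c & EK c F) <-> EK a x & sat KS EK (=) (e(z := a, w := b)) p" if "a : KS" "b : KS" for a b
  using OPF[OF that] OP_ex[OF that] by blast
 thus ?thesis using y by (intro bexI[of _ y]) auto
qed

lemma KS_S: assumes "p : S_axioms" "!!i. e i : KS" shows "sat KS EK (=) e p"
 using assms
proof (induction p)
 case (single p)
 have "(ALL z:KS. EK z x <-> EK z y) ==> x : KS ==> y : KS ==> x = y" for x y using C_ext KS_Dm by blast
 hence "sat KS EK (=) e (ax_ext 0)" "sat KS EK (=) e (ax_pair 0)" "sat KS EK (=) e (ax_union 0)" "sat KS EK (=) e (ax_power 0)" "sat KS EK (=) e (ax_found 0)"
  using C_found by (auto simp: sat_h ax_ext_def ax_pair_def ax_union_def ax_power_def ax_found_def C_pair C_union C_power)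
 thus ?case using single unfolding S_single_def by auto
next
 case (separation x y z p)
 define w where "w = Suc (z + Max (insert 0 (FV p)))"
 have "w \<notin> FV p"
 proof
  assume "w : FV p"
  hence "w \<le> Max (insert 0 (FV p))" using finite_FV[of p] by (intro Max_ge) auto
  thus False unfolding w_def by simp
 qed
 hence w: "w \<notin> FV p" "w ~= z" unfolding w_def by simp_all
 have s: "sat KS EK (=) (e(z := a, w := b)) (Conj p (Eql z w)) <-> sat KS EK (=) (e(z := a)) p & a = b" for a b
 proof -
  have "sat KS EK (=) (e(z := a, w := b)) p = sat KS EK (=) (e(z := a)) p" by (rule sat_cong) (use w in auto)
  thus ?thesis using w by auto
 qed
 \<comment> \<open>Separation is Replacement for a restricted identity: the formula \<open>p\<close>
   together with \<open>z = w\<close> sends each admissible \<open>z\<close> to itself.\<close>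
 have "EX Y:KS. ALL b:KS. EK b Y <-> (EX a:KS. EK a (e x) & sat KS EK (=) (e(z := a, w := b)) (Conj p (Eql z w)))"
  by (rule C_repl) (use separation.prems w s in auto)
 then obtain Y where Y: "Y : KS" "!!b. b : KS ==> EK b Y <-> EK b (e x) & sat KS EK (=) (e(z := b)) p" unfolding s by auto
 have "sat KS EK (=) (e(y := Y, z := b)) p = sat KS EK (=) (e(z := b)) p" for b
  by (rule sat_cong) (use separation.hyps in auto)
 hence "sat KS EK (=) (e(y := Y)) (Forall z (Iff (Mem z y) (Conj (Mem z x) p)))" using Y separation.hyps by auto
 thus ?case unfolding sat_Exists using Y(1) by blast
next
 case (replacement x y z w u p)
 have 1: "sat KS EK (=) (e(z := a, u := c, w := b)) p = sat KS EK (=) (e(z := a, w := b)) p" for a b c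
  by (rule sat_cong) (use replacement.hyps in auto)
 have 2: "sat KS EK (=) (e(y := c, w := b, z := a)) p = sat KS EK (=) (e(z := a, w := b)) p" for a b c
  by (rule sat_cong) (use replacement.hyps in auto)
 show ?case unfolding sat.simps(4)
 proof
  assume h: "sat KS EK (=) e (Forall z (Imp (Mem z x) (Exists u (Forall w (Imp p (Eql w u))))))"
  have "EX Y:KS. ALL b:KS. EK b Y <-> (EX a:KS. EK a (e x) & sat KS EK (=) (e(z := a, w := b)) p)"
  proof (rule C_repl)
   fix a assume "a : KS" "EK a (e x)"
   thus "EX u:KS. ALL b:KS. sat KS EK (=) (e(z := a, w := b)) p --> b = u"
    using h replacement.hyps by (auto simp: 1)
  qed (use replacement in auto)
  then obtain Y where Y: "Y : KS" "!!b. b : KS ==> EK b Y <-> (EX a:KS. EK a (e x) & sat KS EK (=) (e(z := a, w := b)) p)" by blast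
  have "sat KS EK (=) (e(y := Y)) (Forall w (Iff (Mem w y) (Exists z (Conj (Mem z x) p))))"
   using Y replacement.hyps by (auto simp: 2)
  thus "sat KS EK (=) e (Exists y (Forall w (Iff (Mem w y) (Exists z (Conj (Mem z x) p)))))" unfolding sat_Exists using Y(1) by blast
 qed
qed

sublocale q: quot KS EK "(=)"
proof
 define s where "s = (%x. SOME d. d : KS & (ALL w:KS. EK w d <-> w = x))"
 have s: "s c : KS & (ALL w:KS. EK w (s c) <-> w = c)" if "c : KS" for c
  unfolding s_def by (rule someI_ex) (use C_pair[OF that that] in auto)
 obtain x where x: "x : KS" using KS_nonempty by blast
 have "Exists 1 (Forall 2 (Iff (Mem 2 1) (Conj (Mem 2 0) (Neg (Eql 2 2))))) : S_axioms" by (rule S_axioms.separation) auto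
 from KS_S[OF this, of "%_. x"] obtain z where z: "z : KS" "!!w. w : KS ==> ~ EK w z" using x by auto
 have "ALL c:KS. s c : KS & s c ~= z" using s z by metis
 moreover have "ALL c:KS. ALL d:KS. s c = s d --> c = d" using s by metis
 ultimately show "EX W0 z s. W0 \<subseteq> KS & z : W0 & (ALL c:W0. s c : W0 & s c ~= z) & (ALL c:W0. ALL d:W0. s c = s d --> c = d)"
  using z(1) by (intro exI[of _ KS] exI[of _ z] exI[of _ s]) blast
qed simp_all

lemma sat_S: assumes "p : S_axioms" shows "sat UNIV q.EN (=) e p"
proof -
 have "ALL i. EX c. c : KS & q.proj c = e i" using q.proj_ex by blast
 then obtain f where f: "!!i. f i : KS & q.proj (f i) = e i" by metis
 have "sat KS EK (=) f p = sat UNIV q.EN (=) e p" by (rule q.sat_proj) (simp add: f)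
 thus ?thesis using KS_S[OF assms, of f] f by simp
qed

sublocale n: smodel q.EN "pdfn (fo q.EN)" by (rule smodel_fo) (rule sat_S)

end

section \<open>The theorem of C implies the consistency of S\<close>

context smodel
begin

lemma Sub_iff: "Sub q p <-> q = p | (EX y. Imm y p & Sub q y)"
 using Rch_iff[of "%_. False" p q, OF dfn_const] unfolding Sub_Rch by simp

lemma tru_hsatrel:
 "S < n ==> f < n ==> tru e (hsatrel S f n) <->
  (ALL x. x <: e S --> (EX q A. x = opair q A & Sub q (e f) & Fn A & Fin A & (ALL i. FreeV i q --> (EX a. opair i a <: A)))) &
  (ALL q A. Sub q (e f) & Fn A & Fin A & (ALL i. FreeV i q --> (EX a. opair i a <: A)) -->
   (ALL i j. q = cMem i j --> (opair q A <: e S <-> (EX a b. opair i a <: A & opair j b <: A & a <: b))) &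
   (ALL i j. q = cEql i j --> (opair q A <: e S <-> (EX a b. opair i a <: A & opair j b <: A & a = b))) &
   (ALL p. q = cNeg p --> (opair q A <: e S <-> ~ opair p A <: e S)) &
   (ALL p r. q = cImp p r --> (opair q A <: e S <-> (opair p A <: e S --> opair r A <: e S))) &
   (ALL i p. q = cAll i p --> (opair q A <: e S <-> (ALL a B. (ALL p. p <: B <-> p = opair i a | (p <: A & ~ (EX b. p = opair i b))) --> opair p B <: e S))))"
 by (simp add: hsatrel_def sat_h hassignment_def hupdate_def)

lemma satrel_emp:
 assumes "S < n" "f < n" "e S = emp" "e f = code (Forall 0 (Mem 0 0))" shows "tru e (hsatrel S f n)"
proof -
 have s: "Sub q (code (Forall 0 (Mem 0 0))) <-> q = code (Forall 0 (Mem 0 0)) | q = code (Mem 0 0)" for q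
  using Sub_iff[of q "code (Forall 0 (Mem 0 0))"] Sub_iff[of q "code (Mem 0 0)"] by (simp del: nn.simps)
 have m: "a = b" if "Fn A" "opair i a <: A" "opair i b <: A" for A i a b using that unfolding Fn_def by blast
 \<comment> \<open>Some update always exists, and it is not paired with the subformula in the empty
   class; so the right-hand side of the quantifier clause is false, like the left.\<close>
 have u: "EX a B. ALL p. p <: B <-> p = opair i a | (p <: A & ~ (EX b. p = opair i b))" for i A using mem_upd by blast
 have key: "(ALL i j. q = cMem i j --> ~ (EX a b. opair i a <: A & opair j b <: A & a <: b)) & (ALL i j. q ~= cEql i j) & (ALL p. q ~= cNeg p) & (ALL p r. q ~= cImp p r)"
  if "Sub q (code (Forall 0 (Mem 0 0)))" "Fn A" for q A
  using that(1) unfolding s by (auto simp del: nn.simps) (metis m[OF that(2)] irrefl)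
 show ?thesis unfolding tru_hsatrel[OF assms(1,2)] assms(3,4)
 proof (intro conjI allI impI, goal_cases)
  case (2 q A i k) thus ?case using key[of q A] by simp
 next
  case (3 q A i k) thus ?case using key[of q A] by simp
 next
  case (4 q A p) thus ?case using key[of q A] by simp
 next
  case (5 q A p r) thus ?case using key[of q A] by simp
 next
  case (6 q A i p) thus ?case using u[of i A] by simp
 qed simp
qed

lemma Pv_explode: assumes T: "dfn (%e. T (e 0))" and "Pv T p" "Pv T (cNeg p)" "Form p" "Form q" shows "Pv T q"
proof -
 have "Pv T (cImp (cNeg p) (cImp (cNeg q) (cNeg p)))" by (rule Pv_log[OF LogAxI(1)]) (use assms in simp_all)
 hence 1: "Pv T (cImp (cNeg q) (cNeg p))" by (rule Pv_MP[OF T _ assms(3)])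
 have "Pv T (cImp (cImp (cNeg q) (cNeg p)) (cImp p q))" by (rule Pv_log[OF LogAxI(3)]) (use assms in simp_all)
 hence "Pv T (cImp p q)" by (rule Pv_MP[OF T _ 1])
 thus ?thesis by (rule Pv_MP[OF T _ assms(2)])
qed

end

lemma (in cmodel) theta_Con:
 assumes th: "!!e. (!!i. e i : Dm) ==> sat Dm EK (=) e theorems_universally_satisfied"
 shows "n.Con n.SAx"
proof (rule ccontr)
 assume "~ n.Con n.SAx"
 then obtain x where x: "n.Pv n.SAx x" "n.Pv n.SAx (n.cNeg x)" unfolding n.Con_def by blast
 let ?f = "n.code (Forall 0 (Mem 0 0))"
 have dS: "pdfn (fo q.EN) (%e. n.SAx (e 0))" by (rule n.dfn_SAx[OF n.dt_var])
 have "n.Form x" using n.Pv_Form[OF x(1) n.SAx_Form] .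
 hence pv: "n.Pv n.SAx ?f" using n.Pv_explode[OF dS x] n.Form_code by blast
 have sn: "n.Sentence ?f" unfolding n.Sentence_def using n.Form_code[of "Forall 0 (Mem 0 0)"] by simp
 obtain f where f: "f : KS" "q.proj f = ?f" using q.proj_ex by blast
 obtain S where S: "S : KS" "q.proj S = n.emp" using q.proj_ex by blast
 have KS: "{a:Dm. EX b:Dm. EK a b} = KS" unfolding KS_def ..
 \<comment> \<open>The sentence is unfolded with \<open>f\<close> and \<open>S\<close> ranging over
   classes and everything under \<open>rel\<close> over sets. The empty set of the model is the
   class \<open>S\<close> to be inserted.\<close>
 have "ALL f:Dm. (EX b:Dm. EK f b) & sat KS EK (=) ((%_. f)(0 := f)) (hsentence 0 (Suc 0)) & sat KS EK (=) ((%_. f)(0 := f)) (hproves hS_axiom 0 (Suc 0)) -->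
   (ALL S:Dm. sat KS EK (=) ((%_. f)(0 := f, Suc 0 := S)) (hsatrel (Suc 0) 0 (Suc (Suc 0))) -->
    (EX a:KS. sat KS EK (=) ((%_. f)(0 := f, Suc 0 := S, Suc (Suc 0) := a)) (hempty (Suc (Suc 0)) (Suc (Suc (Suc 0)))) &
     sat KS EK (=) ((%_. f)(0 := f, Suc 0 := S, Suc (Suc 0) := a)) (hpairin 0 (Suc (Suc 0)) (Suc 0) (Suc (Suc (Suc 0))))))" (is ?th)
 proof
  fix g assume "g : Dm"
  hence "sat Dm EK (=) (%_. g) theorems_universally_satisfied" by (intro th) simp
  hence "ALL f:Dm. (EX b:Dm. EK f b) & sat KS EK (=) ((%_. g)(0 := f)) (hsentence 0 (Suc 0)) & sat KS EK (=) ((%_. g)(0 := f)) (hproves hS_axiom 0 (Suc 0)) -->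
   (ALL S:Dm. sat KS EK (=) ((%_. g)(0 := f, Suc 0 := S)) (hsatrel (Suc 0) 0 (Suc (Suc 0))) -->
    (EX a:KS. sat KS EK (=) ((%_. g)(0 := f, Suc 0 := S, Suc (Suc 0) := a)) (hempty (Suc (Suc 0)) (Suc (Suc (Suc 0)))) &
     sat KS EK (=) ((%_. g)(0 := f, Suc 0 := S, Suc (Suc 0) := a)) (hpairin 0 (Suc (Suc 0)) (Suc 0) (Suc (Suc (Suc 0))))))"
   by (simp only: theorems_universally_satisfied_def hunivsat_def sat_hall sat_himp sat_hand sat_hex sat_rel KS sat_hset zero_less_Suc fun_upd_same)
  from bspec[OF this \<open>g : Dm\<close>] show "(EX b:Dm. EK g b) & sat KS EK (=) ((%_. g)(0 := g)) (hsentence 0 (Suc 0)) & sat KS EK (=) ((%_. g)(0 := g)) (hproves hS_axiom 0 (Suc 0)) -->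
   (ALL S:Dm. sat KS EK (=) ((%_. g)(0 := g, Suc 0 := S)) (hsatrel (Suc 0) 0 (Suc (Suc 0))) -->
    (EX a:KS. sat KS EK (=) ((%_. g)(0 := g, Suc 0 := S, Suc (Suc 0) := a)) (hempty (Suc (Suc 0)) (Suc (Suc (Suc 0)))) &
     sat KS EK (=) ((%_. g)(0 := g, Suc 0 := S, Suc (Suc 0) := a)) (hpairin 0 (Suc (Suc 0)) (Suc 0) (Suc (Suc (Suc 0))))))" .
 qed
 note t = bspec[OF this KS_Dm[OF f(1)]]
 have tr: "sat KS EK (=) e p = sat UNIV q.EN (=) (%i. q.proj (e i)) p" if "!!i. e i : KS" for e p
  by (rule q.sat_proj) (use that in simp)
 have "sat KS EK (=) ((%_. f)(0 := f)) (hsentence 0 (Suc 0))" "sat KS EK (=) ((%_. f)(0 := f)) (hproves hS_axiom 0 (Suc 0))"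
  by (subst tr, use f in simp, use f sn pv in \<open>simp add: n.tru_hsentence n.tru_provesS\<close>)+
 moreover have "sat KS EK (=) ((%_. f)(0 := f, Suc 0 := S)) (hsatrel (Suc 0) 0 (Suc (Suc 0)))"
  by (subst tr, use f S in simp, rule n.satrel_emp) (use f S in simp_all)
 moreover have "EX b:Dm. EK f b" using f(1) unfolding KS_def by blast
 ultimately obtain a where a: "a : KS" "sat KS EK (=) ((%_. f)(0 := f, Suc 0 := S, Suc (Suc 0) := a)) (hpairin 0 (Suc (Suc 0)) (Suc 0) (Suc (Suc (Suc 0))))"
  using t S(1) KS_Dm by blast
 have "sat UNIV q.EN (=) (%i. q.proj (((%_. f)(0 := f, Suc 0 := S, Suc (Suc 0) := a)) i)) (hpairin 0 (Suc (Suc 0)) (Suc 0) (Suc (Suc (Suc 0))))"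
  using a f S by (subst tr[symmetric]) simp_all
 thus False using S by (simp add: n.tru_hpairin)
qed

section \<open>Embedding the hereditarily finite sets into the sets of the class model\<close>

definition hadj :: "nat => nat => nat => hfm" where
 "hadj x y z = (\<^bold>\<forall>w. w \<^bold>\<in> z \<^bold>\<longleftrightarrow> w \<^bold>\<in> x \<^bold>\<or> w \<^bold>= y)"

text \<open>Codes a definition, in variable 0, of the adjunction of two sets that are defined in
  variable 0 themselves. Prefixing "some 0 equal to 1" moves a definition to variable 1 without
  substitution, and likewise for variable 2.\<close>

definition qaD :: "trm => trm => trm" where
 "qaD s t = qExists (num 1) (qExists (num 2) (qConj (qExists (num 0) (qConj (qEql (num 0) (num 1)) s))
   (qConj (qExists (num 0) (qConj (qEql (num 0) (num 2)) t))
    (qForall (num 3) (qIff (qMem (num 3) (num 0)) (qImp (qNeg (qMem (num 3) (num 1))) (qEql (num 3) (num 2))))))))"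

definition hDg :: "nat => hfm" where
 "hDg = hgenerated (%E z.
   (\<^bold>\<exists>d. \<^bold>\<exists>x. quote (Forall 1 (Neg (Mem 1 0))) d \<^bold>\<and> hempty x \<^bold>\<and> hpair d x z) \<^bold>\<or>
   (\<^bold>\<exists>p. \<^bold>\<exists>q. E p \<^bold>\<and> E q \<^bold>\<and> (\<^bold>\<exists>d1. \<^bold>\<exists>x1. \<^bold>\<exists>d2. \<^bold>\<exists>x2. hpair d1 x1 p \<^bold>\<and> hpair d2 x2 q \<^bold>\<and>
    (\<^bold>\<exists>d. \<^bold>\<exists>x. qaD (V d1) (V d2) d \<^bold>\<and> hadj x1 x2 x \<^bold>\<and> hpair d x z))))"

context smodel
begin

definition eD :: 'a where "eD = cAll (nn 1) (cNeg (cMem (nn 1) (nn 0)))"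
definition aD :: "'a => 'a => 'a" where
 "aD d1 d2 = cEx (nn 1) (cEx (nn 2) (cConj (cEx (nn 0) (cConj (cEql (nn 0) (nn 1)) d1))
   (cConj (cEx (nn 0) (cConj (cEql (nn 0) (nn 2)) d2))
    (cAll (nn 3) (cIff (cMem (nn 3) (nn 0)) (cImp (cNeg (cMem (nn 3) (nn 1))) (cEql (nn 3) (nn 2))))))))"

text \<open>\<open>Dg d x\<close>: \<open>d\<close> is a formula defining the hereditarily finite set \<open>x\<close>.\<close>

definition Dg :: "'a => bool" where
 "Dg = gen (%z. z = opair eD emp) (%_ _. False)
   (%p q z. EX d1 x1 d2 x2. p = opair d1 x1 & q = opair d2 x2 & z = opair (aD d1 d2) (adj x1 x2))"

lemma dt_aD [dfnI]: "dt x ==> dt y ==> dt (%e. aD (x e) (y e))" unfolding aD_def by (intro dfnI)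
lemma dfn_Dg [dfnI]: "dt x ==> dfn (%e. Dg (x e))" unfolding Dg_def by (intro dfn_gen0 dfnI)

lemma tru_hadj [sat_h]: "x < n ==> y < n ==> z < n ==> tru e (hadj x y z n) <-> e z = adj (e x) (e y)"
 by (simp add: hadj_def sat_h adj_iff)

lemma okt_num: "okt (num k) n e" "tv (num k) n e = nn k" using den_okt[OF den_num] by blast+

lemma tru_qaD [sat_h]: "x < n ==> y < n ==> z < n ==> tru e (qaD (V x) (V y) z n) <-> e z = aD (e x) (e y)"
 unfolding qaD_def aD_def by (subst okt_sat) (simp_all add: okt_num del: num.simps nn.simps)

lemma tru_hDg [sat_h]: "z < n ==> tru e (hDg z n) <-> Dg (e z)"
 unfolding hDg_def Dg_def
proof (rule tru_hgenerated)
 fix X Ef y n' e'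
 assume *: "n \<le> n'" "y < n'" "!!a n'' e''. n' \<le> n'' ==> a < n'' ==> (!!i. i < n' ==> e'' i = e' i) ==> tru e'' (Ef a n'') <-> X (e'' a)"
 show "tru e' (((\<^bold>\<exists>d. \<^bold>\<exists>x. quote (Forall 1 (Neg (Mem 1 0))) d \<^bold>\<and> hempty x \<^bold>\<and> hpair d x y) \<^bold>\<or>
   (\<^bold>\<exists>p. \<^bold>\<exists>q. Ef p \<^bold>\<and> Ef q \<^bold>\<and> (\<^bold>\<exists>d1. \<^bold>\<exists>x1. \<^bold>\<exists>d2. \<^bold>\<exists>x2. hpair d1 x1 p \<^bold>\<and> hpair d2 x2 q \<^bold>\<and>
    (\<^bold>\<exists>d. \<^bold>\<exists>x. qaD (V d1) (V d2) d \<^bold>\<and> hadj x1 x2 x \<^bold>\<and> hpair d x y)))) n') <->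
  stp (%z. z = opair eD emp) (%_ _. False)
   (%p q z. EX d1 x1 d2 x2. p = opair d1 x1 & q = opair d2 x2 & z = opair (aD d1 d2) (adj x1 x2)) X (e' y)"
  using *(1,2) by (simp add: sat_h *(3) stp_def eD_def del: quote.simps nn.simps)
qed

lemma Form_D [simp]: "Form eD" "Form (aD d1 d2) <-> Form d1 & Form d2" unfolding eD_def aD_def by (simp_all del: nn.simps)

lemma Dg_base: "Dg (opair eD emp)" unfolding Dg_def by (rule gen_base) simp
lemma Dg_step: "Dg (opair d1 x1) ==> Dg (opair d2 x2) ==> Dg (opair (aD d1 d2) (adj x1 x2))"
 unfolding Dg_def
proof (rule gen_2[rotated 3])
 show "EX d1' x1' d2' x2'. opair d1 x1 = opair d1' x1' & opair d2 x2 = opair d2' x2' & opair (aD d1 d2) (adj x1 x2) = opair (aD d1' d2') (adj x1' x2')" by blast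
qed (intro dfnI | assumption)+

lemma Dg_induct:
 assumes "Dg (opair d x)" and dP: "dfn (%e. P (e 0) (e 1))" and "P eD emp"
  and step: "!!d1 x1 d2 x2. P d1 x1 ==> P d2 x2 ==> P (aD d1 d2) (adj x1 x2)"
 shows "P d x"
proof -
 have "ALL d' x'. opair d x = opair d' x' --> P d' x'"
 proof (rule gen_induct[OF assms(1)[unfolded Dg_def], of "%z. ALL d x. z = opair d x --> P d x"])
  show "dfn (%e. ALL d x. e 0 = opair d x --> P d x)" by (intro dfnI dfn_app2[OF dP])
  show "ALL d x. z = opair d x --> P d x" if "z = opair eD emp" for z using that assms(3) by auto
  show "ALL d x. z = opair d x --> P d x" if h: "ALL d x. p = opair d x --> P d x" "ALL d x. q = opair d x --> P d x"
   "EX d1 x1 d2 x2. p = opair d1 x1 & q = opair d2 x2 & z = opair (aD d1 d2) (adj x1 x2)" for p q z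
  proof -
   obtain d1 x1 d2 x2 where *: "p = opair d1 x1" "q = opair d2 x2" "z = opair (aD d1 d2) (adj x1 x2)" using h(3) by blast
   have "P (aD d1 d2) (adj x1 x2)" using step h(1,2) *(1,2) by blast
   thus ?thesis using *(3) by simp
  qed
 qed simp
 thus ?thesis by blast
qed

lemma Pred_intros:
 "Atom x ==> Pred x" "Pred p ==> Pred (cNeg p)"
 "Pred p ==> Nat i ==> Nat j ==> i ~= j ==> Pred (cAll i (cImp (cEx j (cMem i j)) p))"
 unfolding Pred_def by (rule gen_base, assumption, (erule gen_1, blast)+)

lemma Pred_Imp: "Pred p ==> Pred q ==> Pred (cImp p q)"
 unfolding Pred_def by (rule gen_2[rotated 3]) (intro dfnI | assumption | simp)+

end

section \<open>The embedding of the hereditarily finite sets and what it preserves\<close>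

context kmod
begin

abbreviation kc :: "nat => bool" where "kc c \<equiv> Nat c & ks c"
abbreviation rp :: "nat => nat" where "rp \<equiv> q.rep {c. Nat c}"

lemma sat_rp: "(!!i. Nat (e i)) ==> sat {c. Nat c} Mr Er e p <-> sat (rp ` {c. Nat c}) Mr (=) (%i. rp (e i)) p"
 by (rule q.sat_rep) simp

lemma sat_Dm:
 assumes V: "!!B. HF B ==> V (code p) B" and e: "!!i. e i : rp ` {c. Nat c}"
 shows "sat (rp ` {c. Nat c}) Mr (=) e p"
proof -
 have "EX c. Nat c & rp c = e i" for i using e[of i] unfolding image_def by auto
 then obtain f where f: "!!i. Nat (f i) & rp (f i) = e i" by metis
 have "sat {c. Nat c} Mr Er f p" by (rule sat_all) (use V f in simp_all)
 thus ?thesis using sat_rp[of f p] f by simp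
qed

sublocale c: cmodel "rp ` {c. Nat c}" Mr
proof
 show "sat (rp ` {c. Nat c}) Mr (=) e p" if "p : C_axioms" "!!i. e i : rp ` {c. Nat c}" for p e
  by (rule sat_Dm[OF _ that(2)]) (use CAx_V[OF CAx_code[OF that(1)]] in blast)
 show "rp ` {c. Nat c} ~= {}" using Nat_emp by blast
qed

text \<open>Passes from an element of the class structure first to its representative modulo
  \<open>Er\<close> and then to the model of S on \<open>nat\<close> formed by the sets.\<close>

definition th :: "nat => nat" where "th c = c.q.proj (rp c)"

lemma rp_KS: "Nat c ==> rp c : c.KS <-> ks c"
proof -
 assume c: "Nat c"
 have "rp c : c.KS <-> (EX d. Nat d & Mr (rp c) (rp d))" unfolding c.KS_def using c by blast
 also have "\<dots> <-> ks c" unfolding ks_def using q.Mr_rep c by auto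
 finally show ?thesis .
qed

lemma th_ex: "EX c. kc c & th c = a"
proof -
 obtain x where x: "x : c.KS" "c.q.proj x = a" using c.q.proj_ex by blast
 obtain d where d: "Nat d" "x = rp d" using c.KS_Dm[OF x(1)] by blast
 thus ?thesis using x rp_KS unfolding th_def by blast
qed

lemma th_eq: "kc c ==> kc d ==> th c = th d <-> Er c d"
 unfolding th_def using c.q.proj(2)[of "rp c" "rp d"] rp_KS q.rep_iff[of c d] by simp
lemma th_EN: "kc c ==> kc d ==> c.q.EN (th c) (th d) <-> Mr c d"
 unfolding th_def using c.q.EN_proj[of "rp c" "rp d"] rp_KS q.Mr_rep[of c d] by simp

lemma sat_th: "(!!i. i : FV p ==> kc (e i) & e' i = th (e i)) ==> sat {c. kc c} Mr Er e p <-> sat UNIV c.q.EN (=) e' p"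
proof (rule sat_iso[where W = "{c. kc c}" and h = th])
 show "th ` {c. kc c} = UNIV"
 proof (intro equalityI subset_UNIV subsetI)
  fix a obtain c where "kc c" "th c = a" using th_ex by blast
  thus "a : th ` {c. kc c}" by blast
 qed
qed (use th_eq th_EN in auto)

text \<open>The embedding as it is seen from the ground model: generated along adjunction and hence
  definable there. It is a relation because images are determined only up to
  \<open>Er\<close>.\<close>

definition Jr :: "nat => nat => bool" where
 "Jr x c <-> gen (%z. EX c. kc c & empt c & z = opair emp c) (%_ _. False)
   (%p q z. EX x c y d k. p = opair x c & q = opair y d & kc k & (ALL w. kc w --> (Mr w k <-> Mr w c | Er w d)) & z = opair (adj x y) k) (opair x c)"

lemma dfn_empt [dfnI]: "dt x ==> dfn (%e. empt (x e))" by (rule dfn_app1) (unfold empt_def, intro dfnI)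
lemma dfn_Jr [dfnI]: "dt x ==> dt y ==> dfn (%e. Jr (x e) (y e))"
 unfolding Jr_def by (intro dfn_gen0 dfnI)

lemma Jr_base: "kc c ==> empt c ==> Jr emp c" unfolding Jr_def by (rule gen_base) blast
lemma Jr_step:
 assumes "Jr x c" "Jr y d" "kc k" "!!w. kc w ==> Mr w k <-> Mr w c | Er w d" shows "Jr (adj x y) k"
 using assms(1,2) unfolding Jr_def
proof (rule gen_2[rotated 3])
 show "EX x' c' y' d' k'. opair x c = opair x' c' & opair y d = opair y' d' & kc k' & (ALL w. kc w --> (Mr w k' <-> Mr w c' | Er w d')) &
  opair (adj x y) k = opair (adj x' y') k'" using assms(3,4) by blast
qed (intro dfnI)+

lemma Jr_induct:
 assumes "Jr x c" and dP: "dfn (%e. P (e 0) (e 1))" and base: "!!c. kc c ==> empt c ==> P emp c"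
  and step: "!!x c y d k. Jr x c ==> P x c ==> Jr y d ==> P y d ==> kc k ==> (!!w. kc w ==> Mr w k <-> Mr w c | Er w d) ==> P (adj x y) k"
 shows "P x c"
proof -
 have "ALL x' c'. opair x c = opair x' c' --> Jr x' c' & P x' c'"
 proof (rule gen_induct[OF assms(1)[unfolded Jr_def], of "%z. ALL x c. z = opair x c --> Jr x c & P x c"])
  show "dfn (%e. ALL x c. e 0 = opair x c --> Jr x c & P x c)" by (intro dfnI dfn_app2[OF dP])
  show "ALL x c. z = opair x c --> Jr x c & P x c" if "EX c. kc c & empt c & z = opair emp c" for z
   using that base Jr_base by auto
  show "ALL x c. z = opair x c --> Jr x c & P x c" if h: "ALL x c. p = opair x c --> Jr x c & P x c" "ALL x c. q = opair x c --> Jr x c & P x c"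
   "EX x c y d k. p = opair x c & q = opair y d & kc k & (ALL w. kc w --> (Mr w k <-> Mr w c | Er w d)) & z = opair (adj x y) k" for p q z
  proof -
   obtain x c y d k where *: "p = opair x c" "q = opair y d" "kc k" "!!w. kc w ==> Mr w k <-> Mr w c | Er w d" "z = opair (adj x y) k"
    using h(3) by blast
   have j: "Jr x c" "P x c" "Jr y d" "P y d" using h(1,2) *(1,2) by blast+
   have "Jr (adj x y) k" by (rule Jr_step[OF j(1,3) *(3,4)])
   moreover have "P (adj x y) k" by (rule step[OF j *(3,4)])
   ultimately show ?thesis using *(5) by simp
  qed
 qed simp
 thus ?thesis by blast
qed

lemma Jr_props: "Jr x c ==> HF x & Nat c & ks c"
 by (erule Jr_induct) (intro dfnI, simp_all)

lemma adj_ex: assumes "kc c" "kc d" shows "EX k. kc k & (ALL w. kc w --> (Mr w k <-> Mr w c | Er w d))"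
proof -
 obtain k where k: "kc k" "th k = c.n.adj (th c) (th d)" using th_ex by blast
 have "Mr w k <-> Mr w c | Er w d" if w: "kc w" for w
  using c.n.mem_adj[of "th w" "th c" "th d"] unfolding k(2)[symmetric] th_EN[OF w k(1)] th_EN[OF w assms(1)] th_eq[OF w assms(2)] .
 thus ?thesis using k(1) by blast
qed

lemma Jr_ex: assumes "HF x" shows "EX c. Jr x c"
proof (rule HF_induct[OF assms, of "%x. EX c. Jr x c"])
 show "dfn (%e. EX c. Jr (e 0) c)" by (intro dfnI)
 show "EX c. Jr emp c" using op_empty Jr_base unfolding empt_def by blast
 show "EX c. Jr (adj x y) c" if h: "EX c. Jr x c" "EX c. Jr y c" for x y
 proof -
  obtain c d where j: "Jr x c" "Jr y d" using h by blast
  obtain k where k: "kc k" "!!w. kc w ==> Mr w k <-> Mr w c | Er w d" using adj_ex[of c d] Jr_props j by blast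
  show ?thesis using Jr_step[OF j k] by blast
 qed
qed

lemma kc_ext: assumes "kc c" "kc d" "!!w. kc w ==> Mr w c <-> Mr w d" shows "Er c d"
 by (rule ks_ext) (use assms in blast)+

text \<open>\<open>Jr\<close> is generated along adjunction, while its uniqueness is proved along
  membership. To let the two inductions meet, uniqueness at the members of \<open>x\<close> is kept
  as a hypothesis, which \<open>Jr_fun\<close> then supplies.\<close>

lemma Jr_mem0:
 assumes "Jr x c"
 shows "(ALL y. y <: x --> (ALL d d'. Jr y d --> Jr y d' --> Er d d')) --> (ALL w. kc w --> (Mr w c <-> (EX y d. y <: x & Jr y d & Er w d)))"
  (is "?P x c")
proof (rule Jr_induct[OF assms, of ?P])
 show "dfn (%e. ?P (e 0) (e 1))" by (intro dfnI)
 show "?P emp c" if "empt c" for c using that unfolding empt_def by auto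
 show "?P (adj x y) k" if h: "Jr x c" "?P x c" "Jr y d" "kc k" "!!w. kc w ==> Mr w k <-> Mr w c | Er w d" for x c y d k
 proof (intro impI allI)
  fix w assume u: "ALL z. z <: adj x y --> (ALL d d'. Jr z d --> Jr z d' --> Er d d')" and w: "kc w"
  have ux: "ALL z. z <: x --> (ALL d d'. Jr z d --> Jr z d' --> Er d d')" using u by simp
  have uy: "Er d' d" if "Jr y d'" for d' using u h(3) that by simp
  have 1: "Mr w c <-> (EX z d. z <: x & Jr z d & Er w d)" using h(2) ux w by blast
  have 2: "(EX d. Jr y d & Er w d) <-> Er w d"
  proof
   assume "EX d. Jr y d & Er w d"
   then obtain d' where d': "Jr y d'" "Er w d'" by blast
   thus "Er w d" using Er_trans[OF _ _ _ d'(2) uy[OF d'(1)]] w Jr_props[OF d'(1)] Jr_props[OF h(3)] by blast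
  qed (use h(3) in blast)
  have "(EX z d. z <: adj x y & Jr z d & Er w d) <-> (EX z d. z <: x & Jr z d & Er w d) | (EX d. Jr y d & Er w d)" unfolding mem_adj by blast
  thus "Mr w k <-> (EX z d. z <: adj x y & Jr z d & Er w d)" using h(5)[OF w] 1 2 by blast
 qed
qed

lemma Jr_fun: assumes "Jr x c" "Jr x d" shows "Er c d"
proof -
 have "ALL c d. Jr x c --> Jr x d --> Er c d"
 proof (rule HF_eps_induct[of "%x. ALL c d. Jr x c --> Jr x d --> Er c d"])
  show "dfn (%e. ALL c d. Jr (e 0) c --> Jr (e 0) d --> Er c d)" by (intro dfnI)
  show "HF x" using Jr_props assms by blast
  show "ALL c d. Jr x c --> Jr x d --> Er c d" if IH: "!!y. y <: x ==> ALL c d. Jr y c --> Jr y d --> Er c d" for x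
  proof (intro allI impI)
   fix c d assume j: "Jr x c" "Jr x d"
   have u: "ALL y. y <: x --> (ALL d d'. Jr y d --> Jr y d' --> Er d d')" using IH by blast
   have m: "Mr w c <-> (EX y d. y <: x & Jr y d & Er w d)" "Mr w d <-> (EX y d. y <: x & Jr y d & Er w d)" if "kc w" for w
    using mp[OF Jr_mem0[OF j(1)] u] mp[OF Jr_mem0[OF j(2)] u] that by blast+
   show "Er c d"
   proof (rule kc_ext)
    show "Mr w c <-> Mr w d" if "kc w" for w using m[OF that] by simp
   qed (use Jr_props j in blast)+
  qed
 qed
 thus ?thesis using assms by blast
qed

lemma Jr_mem: "Jr x c ==> kc w ==> Mr w c <-> (EX y d. y <: x & Jr y d & Er w d)"
 using Jr_mem0[of x c] Jr_fun by blast

definition j :: "nat => nat" where "j x = th (SOME c. Jr x c)"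

lemma j_eq: assumes "Jr x c" shows "j x = th c"
proof -
 have "Jr x (SOME c. Jr x c)" using assms by (rule someI)
 thus ?thesis unfolding j_def using th_eq Jr_fun assms Jr_props by blast
qed

lemma j_mem: assumes x: "HF x" shows "c.q.EN w (j x) <-> (EX y. y <: x & w = j y)"
proof -
 obtain c where c: "Jr x c" using Jr_ex[OF x] by blast
 obtain v where v: "kc v" "th v = w" using th_ex by blast
 have kc: "kc c" using Jr_props[OF c] by blast
 have "c.q.EN w (j x) <-> Mr v c" unfolding j_eq[OF c] using th_EN[OF v(1) kc] v(2) by simp
 also have "\<dots> <-> (EX y d. y <: x & Jr y d & Er v d)" by (rule Jr_mem[OF c v(1)])
 also have "\<dots> <-> (EX y d. y <: x & Jr y d & w = j y)"
 proof -
  have "Er v d <-> w = j y" if d: "Jr y d" for y d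
  proof -
   have "kc d" using Jr_props[OF d] by blast
   thus ?thesis unfolding j_eq[OF d] v(2)[symmetric] using th_eq[OF v(1)] by blast
  qed
  thus ?thesis by blast
 qed
 also have "\<dots> <-> (EX y. y <: x & w = j y)" using Jr_ex HF_mem[OF x] by blast
 finally show ?thesis .
qed

lemma dfn_kc: "dfn (%e. kc (e 0))" by (intro dfnI)

text \<open>\<open>j\<close> leads into another model and is no term of the ground model. Statements
  about \<open>j x\<close> become definable there because \<open>Jr\<close> is, and because the
  truth of a fixed standard formula among the sets of the class structure is.\<close>

lemma j1:
 assumes "!!a. P a <-> sat UNIV c.q.EN (=) (%_. a) \<phi>" shows "dfn (%e. HF (e 0) & P (j (e 0)))"
proof -
 have "HF x & P (j x) <-> (EX c. Jr x c & sat {c. kc c} Mr Er (%_. c) \<phi>)" for x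
 proof -
  have "P (j x) <-> sat {c. kc c} Mr Er (%_. c) \<phi>" if c: "Jr x c" for c
   unfolding assms j_eq[OF c] using sat_th[of \<phi> "%_. c" "%_. th c"] Jr_props[OF c] by simp
  thus ?thesis using Jr_ex Jr_props by blast
 qed
 moreover have "dfn (%e. EX c. Jr (e 0) c & sat {c. kc c} Mr Er (%_. c) \<phi>)"
  by (rule dfn_ex) (intro dfn_and dfn_Jr dt_var dfn_sat_in[OF dfn_kc dMr dEr, of "%i e. e 0"])
 ultimately show ?thesis by simp
qed

lemma j2:
 assumes "!!a b. P a b <-> sat UNIV c.q.EN (=) (%i. if i = 0 then a else b) \<phi>"
 shows "dfn (%e. HF (e 0) & HF (e 1) & P (j (e 0)) (j (e 1)))"
proof -
 have "HF x & HF y & P (j x) (j y) <-> (EX c d. Jr x c & Jr y d & sat {c. kc c} Mr Er (%i. if i = 0 then c else d) \<phi>)" for x y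
 proof -
  have "P (j x) (j y) <-> sat {c. kc c} Mr Er (%i. if i = 0 then c else d) \<phi>" if c: "Jr x c" "Jr y d" for c d
   unfolding assms j_eq[OF c(1)] j_eq[OF c(2)]
   using sat_th[of \<phi> "%i. if i = 0 then c else d" "%i. if i = 0 then th c else th d"] Jr_props[OF c(1)] Jr_props[OF c(2)] by simp
  thus ?thesis using Jr_ex[of x] Jr_ex[of y] Jr_props[of x] Jr_props[of y] by blast
 qed
 moreover have "dfn (%e. EX c d. Jr (e 0) c & Jr (e 1) d & sat {c. kc c} Mr Er (%i. if i = 0 then c else d) \<phi>)"
 proof (rule dfn_ex, rule dfn_ex)
  have "dfn (%e. sat {c. kc c} Mr Er (%i. e (if i = 0 then 1 else 0)) \<phi>)"
   by (rule dfn_sat_in[OF dfn_kc dMr dEr, of "%i e. e (if i = 0 then 1 else 0)"]) (rule dt_var)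
  moreover have "(%e :: nat => nat. sat {c. kc c} Mr Er (%i. e (if i = 0 then 1 else 0)) \<phi>) = (%e. sat {c. kc c} Mr Er (%i. if i = 0 then e (Suc 0) else e 0) \<phi>)"
  proof
   fix e :: "nat => nat"
   have "(%i :: nat. e (if i = 0 then 1 else 0)) = (%i. if i = 0 then e (Suc 0) else e 0)" by auto
   thus "sat {c. kc c} Mr Er (%i. e (if i = 0 then 1 else 0)) \<phi> = sat {c. kc c} Mr Er (%i. if i = 0 then e (Suc 0) else e 0) \<phi>"
    by (rule arg_cong[where f = "%E. sat {c. kc c} Mr Er E \<phi>"])
  qed
  ultimately have "dfn (%e. sat {c. kc c} Mr Er (%i. if i = 0 then e (Suc 0) else e 0) \<phi>)" by (simp only:)
  thus "dfn (%e. Jr (e (Suc (Suc 0))) (e (Suc 0)) & Jr (e (Suc (Suc 1))) (e 0) & sat {c. kc c} Mr Er (%i. if i = 0 then e (Suc 0) else e 0) \<phi>)"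
   by (intro dfn_and dfn_Jr dt_var)
 qed
 ultimately show ?thesis by simp
qed

text \<open>Induction along membership by extensionality on both sides; it is stated with
  \<open>Jr\<close>, so that the predicate is definable in the ground model.\<close>

lemma j_inj: assumes "HF x" "HF y" shows "j x = j y <-> x = y"
proof
 have "ALL y c. Jr y c --> (EX d. Jr x d & Er c d) --> x = y"
 proof (rule HF_eps_induct[of "%x. ALL y c. Jr y c --> (EX d. Jr x d & Er c d) --> x = y", OF _ _ assms(1)])
  show "dfn (%e. ALL y c. Jr y c --> (EX d. Jr (e 0) d & Er c d) --> e 0 = y)" by (intro dfnI)
  fix x assume x: "HF x" and IH: "!!z. z <: x ==> ALL y c. Jr y c --> (EX d. Jr z d & Er c d) --> z = y"
  show "ALL y c. Jr y c --> (EX d. Jr x d & Er c d) --> x = y"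
  proof (intro allI impI)
   fix y c assume c: "Jr y c" and "EX d. Jr x d & Er c d"
   then obtain d where d: "Jr x d" "Er c d" by blast
   have k: "kc c" "kc d" "HF y" using Jr_props c d by blast+
   have e: "j x = j y" using j_eq[OF c] j_eq[OF d(1)] th_eq[OF k(1,2)] d(2) by simp
   have inj: "z = z'" if h: "z <: x" "HF z'" "j z = j z'" for z z'
   proof -
    obtain a where a: "Jr z a" using Jr_ex[OF HF_mem[OF x h(1)]] by blast
    obtain b where b: "Jr z' b" using Jr_ex[OF h(2)] by blast
    have "Er b a" using h(3) th_eq[of b a] Jr_props[OF a] Jr_props[OF b] unfolding j_eq[OF a] j_eq[OF b] by simp
    thus ?thesis using IH[OF h(1)] a b by blast
   qed
   show "x = y"
   proof (rule ext)
    fix z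
    show "z <: x <-> z <: y"
    proof
     assume z: "z <: x"
     hence "c.q.EN (j z) (j y)" using j_mem[OF x] e by auto
     then obtain z' where "z' <: y" "j z = j z'" using j_mem[OF k(3)] by blast
     thus "z <: y" using inj[OF z] HF_mem[OF k(3)] by blast
    next
     assume z: "z <: y"
     hence "c.q.EN (j z) (j x)" using j_mem[OF k(3)] e by auto
     then obtain z' where "z' <: x" "j z = j z'" using j_mem[OF x] by blast
     thus "z <: x" using inj[of z' z] HF_mem[OF k(3) z] by simp
    qed
   qed
  qed
 qed
 moreover assume "j x = j y"
 moreover obtain c d where j: "Jr x d" "Jr y c" using Jr_ex assms by blast
 ultimately show "x = y" using j_eq[OF j(1)] j_eq[OF j(2)] th_eq[of c d] Jr_props[OF j(1)] Jr_props[OF j(2)] by auto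
qed simp

lemma j_emp: "j emp = c.n.emp" using c.n.emp_iff[of "j emp"] j_mem[of emp] by simp
lemma j_adj [simp]: "HF x ==> HF y ==> j (adj x y) = c.n.adj (j x) (j y)"
 using c.n.adj_iff[of "j (adj x y)" "j x" "j y"] j_mem[of "adj x y"] j_mem[of x] by auto
lemma j_opair [simp]: "HF x ==> HF y ==> j (opair x y) = c.n.opair (j x) (j y)"
 unfolding opair_def c.n.opair_def by (simp add: j_emp)
lemma j_suc: "HF x ==> j (suc x) = c.n.suc (j x)" unfolding suc_def c.n.suc_def by simp
lemma j_nn: "j (nn k) = c.n.nn k" by (induction k) (simp_all add: j_emp j_suc)
lemma j_c [simp]:
 "HF a ==> HF b ==> j (cMem a b) = c.n.cMem (j a) (j b)" "HF a ==> HF b ==> j (cEql a b) = c.n.cEql (j a) (j b)"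
 "HF a ==> j (cNeg a) = c.n.cNeg (j a)" "HF a ==> HF b ==> j (cImp a b) = c.n.cImp (j a) (j b)"
 "HF a ==> HF b ==> j (cAll a b) = c.n.cAll (j a) (j b)"
 unfolding c_defs c.n.c_defs by (simp_all add: j_nn del: nn.simps c.n.nn.simps)
lemma j_code: "j (code p) = c.n.code p" by (induction p) (simp_all add: j_nn)

lemma j_Nat: "Nat x ==> c.n.Nat (j x)"
proof -
 assume "Nat x"
 hence "HF x & c.n.Nat (j x)"
 proof (rule Nat_induct[rotated 3])
  show "dfn (%e. HF (e 0) & c.n.Nat (j (e 0)))" by (rule j1[of _ "hnat 0 1"]) (simp add: c.n.tru_hnat)
 qed (simp_all add: j_emp j_suc)
 thus ?thesis by blast
qed

lemma j_Form: "Form x ==> c.n.Form (j x)"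
proof -
 assume x: "Form x"
 have "HF x & c.n.Form (j x)"
 proof (rule Form_induct[OF x, of "%x. HF x & c.n.Form (j x)"])
  show "dfn (%e. HF (e 0) & c.n.Form (j (e 0)))" by (rule j1[of _ "hform 0 1"]) (simp add: c.n.tru_hform)
 qed (simp_all add: j_Nat)
 thus ?thesis by blast
qed

lemma j_FreeV: assumes i: "Nat i" and p: "Form p" shows "c.n.FreeV (j i) (j p) <-> FreeV i p"
proof -
 have "(HF i & HF p & c.n.FreeV (j i) (j p)) <-> FreeV i p"
 proof (rule Form_induct[OF p, of "%p. (HF i & HF p & c.n.FreeV (j i) (j p)) <-> FreeV i p"])
  have "dfn (%e. HF (e 0) & HF (e 1) & c.n.FreeV (j (e 0)) (j (e 1)))"
   by (rule j2[of _ "hfree 0 1 2"]) (simp add: c.n.tru_hfree)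
  from dfn_iff[OF dfn_app2[OF this dt_con[of i] dt_var[of 0]] dfn_FreeV[OF dt_con[of i] dt_var[of 0]]]
  show "dfn (%e. (HF i & HF (e 0) & c.n.FreeV (j i) (j (e 0))) <-> FreeV i (e 0))" .
 qed (use i in \<open>auto simp: j_inj\<close>)
 thus ?thesis using i p by simp
qed

lemma j_Pred: assumes x: "Pred x" shows "c.n.Pred (j x)"
proof -
 have "Form x & (HF x & c.n.Pred (j x))"
 proof (rule gen_induct[OF x[unfolded Pred_def], of "%x. Form x & (HF x & c.n.Pred (j x))"])
  have d: "dfn (%e. HF (e 0) & c.n.Pred (j (e 0)))" by (rule j1[of _ "hpredicative 0 1"]) (simp add: c.n.tru_hpredicative)
  show "dfn (%e. Form (e 0) & (HF (e 0) & c.n.Pred (j (e 0))))" by (intro dfn_and[OF _ d] dfnI)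
  show "Form y & (HF y & c.n.Pred (j y))" if at: "Atom y" for y
  proof -
   obtain a b where ab: "Nat a" "Nat b" "y = cMem a b | y = cEql a b" using at unfolding Atom_def by blast
   hence "c.n.Atom (j y)" unfolding c.n.Atom_def using j_Nat[OF ab(1)] j_Nat[OF ab(2)] by auto
   thus ?thesis using ab c.n.Pred_intros(1) by auto
  qed
  show "Form y & (HF y & c.n.Pred (j y))" if h: "Form p & (HF p & c.n.Pred (j p))"
   "y = cNeg p | (EX a b. Nat a & Nat b & a ~= b & y = cAll a (cImp (cEx b (cMem a b)) p))" for p y
   using h(2)
  proof (elim disjE exE conjE)
   assume "y = cNeg p" thus ?thesis using h(1) c.n.Pred_intros(2) by simp
  next
   fix a b assume ab: "Nat a" "Nat b" "a ~= b" "y = cAll a (cImp (cEx b (cMem a b)) p)"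
   have "j a ~= j b" using j_inj[of a b] ab by simp
   hence "c.n.Pred (j y)" using c.n.Pred_intros(3)[of "j p" "j a" "j b"] h(1) ab j_Nat by simp
   thus ?thesis using h(1) ab by simp
  qed
  show "Form y & (HF y & c.n.Pred (j y))" if h: "Form p & (HF p & c.n.Pred (j p))" "Form q & (HF q & c.n.Pred (j q))" "y = cImp p q" for p q y
   using h c.n.Pred_Imp[of "j p" "j q"] by simp
 qed
 thus ?thesis by blast
qed

lemma j_LogAx: assumes x: "LogAx x" shows "c.n.LogAx (j x)"
 using x unfolding LogAx_def
proof (elim disjE exE conjE)
 fix p q assume "Form p" "Form q" "x = cImp p (cImp q p)"
 thus ?thesis using c.n.LogAxI(1)[of "j p" "j q"] by (simp add: j_Form)
next
 fix p q r assume "Form p" "Form q" "Form r" "x = cImp (cImp p (cImp q r)) (cImp (cImp p q) (cImp p r))"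
 thus ?thesis using c.n.LogAxI(2)[of "j p" "j q" "j r"] by (simp add: j_Form)
next
 fix p q assume "Form p" "Form q" "x = cImp (cImp (cNeg p) (cNeg q)) (cImp q p)"
 thus ?thesis using c.n.LogAxI(3)[of "j p" "j q"] by (simp add: j_Form)
next
 fix i p q assume "Nat i" "Form p" "Form q" "x = cImp (cAll i (cImp p q)) (cImp (cAll i p) (cAll i q))"
 thus ?thesis using c.n.LogAxI(4)[of "j i" "j p" "j q"] by (simp add: j_Form j_Nat)
next
 fix i p assume "Nat i" "Form p" "x = cImp (cAll i p) p"
 thus ?thesis using c.n.LogAxI(5)[of "j i" "j p"] by (simp add: j_Form j_Nat)
next
 fix i p assume h: "Nat i" "Form p" "~ FreeV i p" "x = cImp p (cAll i p)"
 thus ?thesis using c.n.LogAxI(6)[of "j i" "j p"] j_FreeV[OF h(1,2)] by (simp add: j_Form j_Nat)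
next
 fix i k assume "Nat i" "Nat k" "x = cEx i (cEql i k)"
 thus ?thesis using c.n.LogAxI(7)[of "j i" "j k"] by (simp add: j_Nat)
next
 fix i k l assume "Nat i" "Nat k" "Nat l" "x = cImp (cEql i k) (cImp (cEql i l) (cEql k l))"
 thus ?thesis using c.n.LogAxI(8)[of "j i" "j k" "j l"] by (simp add: j_Nat)
next
 fix i k l assume "Nat i" "Nat k" "Nat l" "x = cImp (cEql i k) (cImp (cMem i l) (cMem k l))"
 thus ?thesis using c.n.LogAxI(9)[of "j i" "j k" "j l"] by (simp add: j_Nat)
next
 fix i k l assume "Nat i" "Nat k" "Nat l" "x = cImp (cEql i k) (cImp (cMem l i) (cMem l k))"
 thus ?thesis using c.n.LogAxI(10)[of "j i" "j k" "j l"] by (simp add: j_Nat)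
qed

lemma j_CAx: assumes x: "CAx x" shows "c.n.CAx (j x)"
 using x unfolding CAx_def
proof (elim disjE bexE exE conjE)
 fix p assume "p : set C_single" "x = code p"
 thus ?thesis using c.n.CAx_code[OF C_axioms.single] j_code by simp
next
 fix v y k p assume h: "Nat v" "Nat y" "Nat k" "v ~= y" "v ~= k" "Pred p" "~ FreeV y p"
  and x: "x = cEx y (cAll v (cImp (cEx k (cMem v k)) (cIff (cMem v y) p)))"
 have F: "Form p" by (rule Pred_Form[OF h(6)])
 show ?thesis unfolding c.n.CAx_def
 proof (rule disjI2, rule exI[of _ "j v"], rule exI[of _ "j y"], rule exI[of _ "j k"], rule exI[of _ "j p"], intro conjI)
  show "j v ~= j y" "j v ~= j k" using j_inj h by simp_all
  show "~ c.n.FreeV (j y) (j p)" using j_FreeV[OF h(2) F] h(7) by simp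
 qed (use h j_Nat j_Pred F x in simp_all)
qed

text \<open>Induction on the derivation shows that the image class is closed under the axioms and
  rules, so the proof sequences themselves need not be carried over. Nonstandard proofs are
  included.\<close>

lemma j_Pv: assumes x: "Pv CAx x" shows "c.n.Pv c.n.CAx (j x)"
proof -
 have dC: "pdfn (fo c.q.EN) (%e. c.n.CAx (e 0))" by (rule c.n.dfn_CAx[OF c.n.dt_var])
 have "Form x & (HF x & c.n.Pv c.n.CAx (j x))"
 proof (rule Pv_induct[OF x, of "%x. Form x & (HF x & c.n.Pv c.n.CAx (j x))"])
  have d: "dfn (%e. HF (e 0) & c.n.Pv c.n.CAx (j (e 0)))" by (rule j1[of _ "hproves hC_axiom 0 1"]) (simp add: c.n.tru_provesC)
  show "dfn (%e. Form (e 0) & (HF (e 0) & c.n.Pv c.n.CAx (j (e 0))))" by (intro dfn_and[OF _ d] dfnI)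
  show "Form y & (HF y & c.n.Pv c.n.CAx (j y))" if "LogAx y" for y
   using LogAx_Form[OF that] c.n.Pv_log[OF j_LogAx[OF that]] by simp
  show "Form y & (HF y & c.n.Pv c.n.CAx (j y))" if "CAx y" for y
   using CAx_Form[OF that] c.n.Pv_ax[of c.n.CAx, OF j_CAx[OF that]] by simp
  show "Form y & (HF y & c.n.Pv c.n.CAx (j y))" if "Form (cImp p y) & (HF (cImp p y) & c.n.Pv c.n.CAx (j (cImp p y)))"
   "Form p & (HF p & c.n.Pv c.n.CAx (j p))" for p y
  proof -
   have f: "HF p" "HF y" "Form y" using that by auto
   hence "c.n.Pv c.n.CAx (c.n.cImp (j p) (j y))" using that(1) by simp
   thus ?thesis using f that(2) c.n.Pv_MP[OF dC, of "j p" "j y"] by simp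
  qed
  show "Form (cAll i p) & (HF (cAll i p) & c.n.Pv c.n.CAx (j (cAll i p)))" if "Nat i" "Form p & (HF p & c.n.Pv c.n.CAx (j p))" for i p
   using that c.n.Pv_Gen[of c.n.CAx "j p" "j i"] j_Nat by simp
 qed
 thus ?thesis by blast
qed

lemma j_D: "j eD = c.n.eD" "Form a ==> Form b ==> j (aD a b) = c.n.aD (j a) (j b)"
 unfolding eD_def c.n.eD_def aD_def c.n.aD_def by (simp_all add: j_nn del: nn.simps c.n.nn.simps)

lemma Dg_Form: "Dg (opair d x) ==> Form d & HF x"
 by (erule Dg_induct) (intro dfnI, simp_all)

lemma j_Dg: assumes "Dg (opair d x)" shows "c.n.Dg (c.n.opair (j d) (j x))"
proof -
 have "(Form d & HF x) & (HF (opair d x) & c.n.Dg (j (opair d x)))"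
 proof (rule Dg_induct[OF assms, of "%d x. (Form d & HF x) & (HF (opair d x) & c.n.Dg (j (opair d x)))"])
  show "dfn (%e. (Form (e 0) & HF (e 1)) & (HF (opair (e 0) (e 1)) & c.n.Dg (j (opair (e 0) (e 1)))))"
  proof -
   have "dfn (%e. HF (e 0) & c.n.Dg (j (e 0)))" by (rule j1[of _ "hDg 0 1"]) (simp add: c.n.tru_hDg)
   from dfn_and[OF dfn_and[OF dfn_Form[OF dt_var[of 0]] dfn_HF[OF dt_var[of 1]]] dfn_app1[OF this dt_opair[OF dt_var[of 0] dt_var[of 1]]]] show ?thesis .
  qed
  show "(Form eD & HF emp) & (HF (opair eD emp) & c.n.Dg (j (opair eD emp)))" using c.n.Dg_base by (simp add: j_D j_emp)
  fix d1 x1 d2 x2 assume h: "(Form d1 & HF x1) & (HF (opair d1 x1) & c.n.Dg (j (opair d1 x1)))" "(Form d2 & HF x2) & (HF (opair d2 x2) & c.n.Dg (j (opair d2 x2)))"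
  have f: "Form d1" "HF x1" "Form d2" "HF x2" using h by blast+
  have "c.n.Dg (c.n.opair (j d1) (j x1))" "c.n.Dg (c.n.opair (j d2) (j x2))" using h f by simp_all
  thus "(Form (aD d1 d2) & HF (adj x1 x2)) & (HF (opair (aD d1 d2) (adj x1 x2)) & c.n.Dg (j (opair (aD d1 d2) (adj x1 x2))))"
   using c.n.Dg_step[of "j d1" "j x1" "j d2" "j x2"] f by (simp add: j_D)
 qed
 hence "Form d" "HF x" "c.n.Dg (j (opair d x))" by blast+
 thus ?thesis by simp
qed

text \<open>Induction along the generation of \<open>d\<close> covers nonstandard definitions as
  well. Extensionality turns a class with the right members into the set that represents
  \<open>x\<close>.\<close>

lemma V_Dg:
 assumes "Dg (opair d x)"
 shows "Form d & HF x & (ALL B. HF B --> (V d B <-> (EX c. Jr x c & Er (vl B (nn 0)) c)))" (is "?P d x")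
proof (rule Dg_induct[OF assms, of ?P])
 show "dfn (%e. ?P (e 0) (e 1))" by (intro dfnI)
 show "?P eD emp"
 proof (intro conjI allI impI)
  fix B assume B: "HF B"
  have "V eD B <-> (ALL c. Nat c --> ~ Mr c (vl B (nn 0)))" unfolding eD_def using B by (simp add: V_All V_Neg V_Mem vl_upd del: nn.simps)
  also have "\<dots> <-> (EX c. Jr emp c & Er (vl B (nn 0)) c)"
  proof
   assume h: "ALL c. Nat c --> ~ Mr c (vl B (nn 0))"
   obtain z where z: "kc z" "empt z" using op_empty unfolding empt_def by blast
   have "Er (vl B (nn 0)) z" by (rule ks_ext) (use z h in \<open>auto simp: empt_def\<close>)
   thus "EX c. Jr emp c & Er (vl B (nn 0)) c" using Jr_base z by blast
  next
   assume "EX c. Jr emp c & Er (vl B (nn 0)) c"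
   then obtain c where c: "Jr emp c" "Er (vl B (nn 0)) c" by blast
   have k: "kc c" using Jr_props[OF c(1)] by blast
   show "ALL w. Nat w --> ~ Mr w (vl B (nn 0))"
   proof (intro allI impI notI)
    fix w assume w: "Nat w" "Mr w (vl B (nn 0))"
    hence "Mr w c" using Mr_r[OF D_vl _ w(1) c(2) w(2)] k by blast
    moreover have "ks w" using w unfolding ks_def using D_vl by blast
    ultimately show False using Jr_mem[OF c(1), of w] w(1) by simp
   qed
  qed
  finally show "V eD B <-> (EX c. Jr emp c & Er (vl B (nn 0)) c)" .
 qed simp_all
 fix d1 x1 d2 x2 assume h1: "?P d1 x1" and h2: "?P d2 x2"
 show "?P (aD d1 d2) (adj x1 x2)"
 proof (intro conjI allI impI)
  fix B assume B: "HF B"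
  have d: "V d1 C <-> (EX c. Jr x1 c & Er (vl C (nn 0)) c)" "V d2 C <-> (EX c. Jr x2 c & Er (vl C (nn 0)) c)" if "HF C" for C
   using h1 h2 that by blast+
  let ?a = "%x a. EX c. Jr x c & Er a c"
  \<comment> \<open>Evaluates the device that moves a definition from variable 0 to another
    variable: the auxiliary \<open>z\<close> equal to \<open>a\<close> is eliminated.\<close>
  have e: "(EX z. Nat z & Er z a & ?a x z) <-> ?a x a" if a: "Nat a" for a x
  proof
   assume "EX z. Nat z & Er z a & ?a x z"
   then obtain z c where z: "Nat z" "Er z a" "Jr x c" "Er z c" by blast
   have "Nat c" using Jr_props[OF z(3)] by blast
   thus "?a x a" using Er_E[OF z(1) a _ z(2,4)] z(3) by blast
  qed (use a Er_refl in blast)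
  have "V (aD d1 d2) B <-> (EX a. Nat a & (EX b. Nat b & (EX z. Nat z & Er z a & ?a x1 z) & (EX z. Nat z & Er z b & ?a x2 z) &
    (ALL w. Nat w --> (Mr w (vl B (nn 0)) --> Mr w a | Er w b) & (Mr w a | Er w b --> Mr w (vl B (nn 0))))))"
   unfolding aD_def using B h1 h2 by (simp add: V_Ex V_Conj V_All V_Imp V_Eql V_Mem vl_upd d V_Neg[of "cMem i k" for i k] disj_imp del: nn.simps cong: conj_cong)
  also have "\<dots> <-> (EX a. Nat a & (EX b. Nat b & ?a x1 a & ?a x2 b & (ALL w. Nat w --> (Mr w (vl B (nn 0)) <-> Mr w a | Er w b))))"
   using e by (simp cong: conj_cong) blast
  also have "\<dots> <-> (EX k. Jr (adj x1 x2) k & Er (vl B (nn 0)) k)"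
  proof
   assume "EX a. Nat a & (EX b. Nat b & ?a x1 a & ?a x2 b & (ALL w. Nat w --> (Mr w (vl B (nn 0)) <-> Mr w a | Er w b)))"
   then obtain a b c c' where *: "Nat a" "Nat b" "Jr x1 c" "Er a c" "Jr x2 c'" "Er b c'" "!!w. Nat w ==> Mr w (vl B (nn 0)) <-> Mr w a | Er w b" by blast
   have k: "kc c" "kc c'" using Jr_props *(3,5) by blast+
   obtain k where k': "kc k" "!!w. kc w ==> Mr w k <-> Mr w c | Er w c'" using adj_ex[OF k] by blast
   have "Er (vl B (nn 0)) k"
   proof (rule ks_ext)
    show "Mr w (vl B (nn 0)) <-> Mr w k" if w: "Nat w" "ks w" for w
     using *(7)[OF w(1)] k'(2)[of w] w Mr_cong[OF w(1) *(1) w(1) _ Er_refl[OF w(1)] *(4)] k Er_cong[OF *(2) _ w(1) *(6)] by blast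
   qed (use k' in auto)
   thus "EX k. Jr (adj x1 x2) k & Er (vl B (nn 0)) k" using Jr_step[OF *(3,5) k'] by blast
  next
   assume "EX k. Jr (adj x1 x2) k & Er (vl B (nn 0)) k"
   then obtain k where k: "Jr (adj x1 x2) k" "Er (vl B (nn 0)) k" by blast
   have hx: "HF x1" "HF x2" using h1 h2 by simp_all
   obtain c where c1: "Jr x1 c" using Jr_ex[OF hx(1)] by blast
   obtain c' where c2: "Jr x2 c'" using Jr_ex[OF hx(2)] by blast
   note c = c1 c2
   have kk: "kc c" "kc c'" "kc k" using Jr_props c k(1) by blast+
   obtain l where l: "kc l" "!!w. kc w ==> Mr w l <-> Mr w c | Er w c'" using adj_ex[OF kk(1,2)] by blast
   have kl: "Er k l" by (rule Jr_fun[OF k(1) Jr_step[OF c l]])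
   have "Mr w (vl B (nn 0)) <-> Mr w c | Er w c'" if w: "Nat w" for w
   proof -
    have v: "Er (vl B (nn 0)) l" using Er_trans[OF D_vl _ _ k(2) kl] kk l by blast
    have 1: "Mr w (vl B (nn 0)) <-> Mr w l" using Mr_cong[OF w D_vl w _ Er_refl[OF w] v] l(1) by blast
    have "ks w" if "Mr w l | Mr w c | Er w c'"
     using that w kk l(1) ks_cong[OF _ w Er_sym[OF w], of c'] unfolding ks_def by blast
    thus ?thesis using 1 l(2)[of w] w by blast
   qed
   thus "EX a. Nat a & (EX b. Nat b & ?a x1 a & ?a x2 b & (ALL w. Nat w --> (Mr w (vl B (nn 0)) <-> Mr w a | Er w b)))"
    using c kk Er_refl by blast
  qed
  finally show "V (aD d1 d2) B <-> (EX k. Jr (adj x1 x2) k & Er (vl B (nn 0)) k)" .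
 qed (use h1 h2 in simp_all)
qed

end

section \<open>Completeness by way of the hereditarily finite sets\<close>

definition VE :: "nat => nat => bool" where "VE x y <-> x : set_decode y"
text \<open>With Ackermann's membership \<open>VE\<close> on \<open>nat\<close>, every set is
  finite; Separation and Replacement then hold for arbitrary predicates, and finite support is the
  only restriction left.\<close>

definition vdfn :: "((nat => nat) => bool) => bool" where
 "vdfn P <-> (EX m. ALL e e'. (ALL i<m. e i = e' i) --> P e = P e')"

lemma VE_set: assumes "finite A" shows "EX y. ALL x. VE x y <-> x : A"
 by (rule exI[of _ "set_encode A"]) (simp add: VE_def assms)
lemma finite_VE: "finite {x. VE x y}" unfolding VE_def by simp
lemma VE_less: "VE x y ==> x < y"
proof -
 assume "VE x y"
 hence x: "x : set_decode y" by (simp add: VE_def)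
 have "(2 :: nat) ^ x \<le> (\<Sum>i\<in>set_decode y. 2 ^ i)" by (rule member_le_sum[OF x]) auto
 hence "2 ^ x \<le> y" using set_decode_inverse[of y] unfolding set_encode_def by simp
 thus "x < y" using less_exp[of x] by linarith
qed

interpretation w: smodel VE vdfn
proof
 show "vdfn (%e. VE (e i) (e j))" "vdfn (%e. e i = e j)" for i j
  unfolding vdfn_def by (rule exI[of _ "Suc (max i j)"], auto)+
 show "vdfn (%e. ~ P e)" if "vdfn P" for P using that unfolding vdfn_def by metis
 show "vdfn (%e. P e --> Q e)" if h: "vdfn P" "vdfn Q" for P Q
 proof -
  obtain m n where "!!e e'. ALL i<m. e i = e' i ==> P e = P e'" "!!e e'. ALL i<n. e i = e' i ==> Q e = Q e'"
   using h unfolding vdfn_def by blast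
  thus ?thesis unfolding vdfn_def by (intro exI[of _ "max m n"]) (metis less_max_iff_disj)
 qed
 show "vdfn (%e. ALL a. P (e(k := a)))" if h: "vdfn P" for P k
 proof -
  obtain m where m: "!!e e'. ALL i<m. e i = e' i ==> P e = P e'" using h unfolding vdfn_def by blast
  have "P (e(k := a)) = P (e'(k := a))" if "ALL i<m. e i = e' i" for e e' a by (rule m) (use that in auto)
  thus ?thesis unfolding vdfn_def by blast
 qed
 show "EX m. ALL e e'. (ALL i<m. e i = e' i) --> P e = P e'" if "vdfn P" for P using that unfolding vdfn_def .
 show "vdfn (%e. P (e(k := c)))" if h: "vdfn P" for P k c
 proof -
  obtain m where m: "!!e e'. ALL i<m. e i = e' i ==> P e = P e'" using h unfolding vdfn_def by blast
  have "P (e(k := c)) = P (e'(k := c))" if "ALL i<m. e i = e' i" for e e' by (rule m) (use that in auto)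
  thus ?thesis unfolding vdfn_def by blast
 qed
 show "x = y" if "!!z. VE z x <-> VE z y" for x y
 proof -
  have "set_decode x = set_decode y" using that unfolding VE_def by blast
  thus ?thesis using set_decode_inverse by metis
 qed
 show "EX y. VE y x & ~ (EX z. VE z x & VE z y)" if "VE y x" for x y
 proof -
  have "VE (LEAST y. VE y x) x" using that by (rule LeastI)
  moreover have "~ (VE z x & VE z (LEAST y. VE y x))" for z using VE_less not_less_Least by blast
  ultimately show ?thesis by blast
 qed
 show "EX z. ALL w. VE w z <-> w = x | w = y" for x y using VE_set[of "{x, y}"] by simp
 show "EX u. ALL w. VE w u <-> (EX y. VE y x & VE w y)" for x
 proof -
  have "finite (\<Union>y\<in>{y. VE y x}. {w. VE w y})" using finite_VE by blast
  from VE_set[OF this] show ?thesis by auto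
 qed
 show "EX p. ALL w. VE w p <-> (ALL z. VE z w --> VE z x)" for x
 proof -
  have "{w. ALL z. VE z w --> VE z x} \<subseteq> set_encode ` Pow {z. VE z x}"
  proof
   fix w assume "w : {w. ALL z. VE z w --> VE z x}"
   hence "set_decode w : Pow {z. VE z x}" unfolding VE_def by blast
   thus "w : set_encode ` Pow {z. VE z x}" using set_decode_inverse[of w] by (metis imageI)
  qed
  hence "finite {w. ALL z. VE z w --> VE z x}" using finite_VE finite_subset by blast
  from VE_set[OF this] show ?thesis by simp
 qed
 show "EX y. ALL z. VE z y <-> VE z x & G z" for G x
  using VE_set[of "{z. VE z x & G z}"] finite_VE[of x] by simp
 show "EX y. ALL w. VE w y <-> (EX z. VE z x & F z w)" if fn: "!!z. VE z x ==> EX u. ALL w. F z w --> w = u" for F x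
 proof -
  have "{w. EX z. VE z x & F z w} \<subseteq> (%z. THE w. F z w) ` {z. VE z x}"
  proof
   fix w assume "w : {w. EX z. VE z x & F z w}"
   then obtain z where z: "VE z x" "F z w" by blast
   hence "(THE w. F z w) = w" using fn[OF z(1)] by (intro the_equality) auto
   thus "w : (%z. THE w. F z w) ` {z. VE z x}" using z(1) by blast
  qed
  hence "finite {w. EX z. VE z x & F z w}" using finite_VE finite_subset by blast
  from VE_set[OF this] show ?thesis by simp
 qed
qed

lemma vdfn1: "vdfn (%e. P (e 0))" unfolding vdfn_def by (rule exI[of _ 1]) simp

text \<open>Since \<open>vdfn\<close> admits every HOL predicate of one variable, internal induction
  is full induction and reaches standard numbers only. Consequently internal formulas and proofs of
  this model are actual ones.\<close>

lemma w_Nat: "w.Nat x ==> EX k. x = w.nn k"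
 by (rule w.Nat_induct[of "%x. EX k. x = w.nn k", OF vdfn1]) (metis w.nn.simps)+

lemma w_Form: "w.Form x ==> EX p. x = w.code p"
proof (erule w.Form_induct[of _ "%x. EX p. x = w.code p", OF _ vdfn1])
 fix i j assume "w.Nat i" "w.Nat j"
 then obtain k l where "i = w.nn k" "j = w.nn l" using w_Nat by blast
 hence "w.cMem i j = w.code (Mem k l)" "w.cEql i j = w.code (Eql k l)" by simp_all
 thus "EX p. w.cMem i j = w.code p" "EX p. w.cEql i j = w.code p" by blast+
next
 fix p assume "EX q. p = w.code q" thus "EX q. w.cNeg p = w.code q" by (metis w.code.simps(3))
next
 fix p q assume "EX r. p = w.code r" "EX r. q = w.code r" thus "EX r. w.cImp p q = w.code r" by (metis w.code.simps(4))
next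
 fix i p assume "w.Nat i" "EX q. p = w.code q" thus "EX q. w.cAll i p = w.code q" using w_Nat by (metis w.code.simps(5))
qed

lemma w_LogAx: assumes "w.LogAx x" shows "EX p. x = w.code p & logical_axiom p"
 using assms unfolding w.LogAx_def
proof (elim disjE exE conjE)
 fix p q assume h: "w.Form p" "w.Form q" and x: "x = w.cImp p (w.cImp q p)"
 obtain p' q' where "p = w.code p'" "q = w.code q'" using w_Form h by blast
 thus ?thesis using x P1[of p' q'] by (intro exI[of _ "Imp p' (Imp q' p')"]) simp
next
 fix p q r assume h: "w.Form p" "w.Form q" "w.Form r" and x: "x = w.cImp (w.cImp p (w.cImp q r)) (w.cImp (w.cImp p q) (w.cImp p r))"
 obtain p' q' r' where "p = w.code p'" "q = w.code q'" "r = w.code r'" using w_Form h by metis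
 thus ?thesis using x P2[of p' q' r'] by (intro exI[of _ "Imp (Imp p' (Imp q' r')) (Imp (Imp p' q') (Imp p' r'))"]) simp
next
 fix p q assume h: "w.Form p" "w.Form q" and x: "x = w.cImp (w.cImp (w.cNeg p) (w.cNeg q)) (w.cImp q p)"
 obtain p' q' where "p = w.code p'" "q = w.code q'" using w_Form h by blast
 thus ?thesis using x P3[of p' q'] by (intro exI[of _ "Imp (Imp (Neg p') (Neg q')) (Imp q' p')"]) simp
next
 fix i p q assume h: "w.Nat i" "w.Form p" "w.Form q" and x: "x = w.cImp (w.cAll i (w.cImp p q)) (w.cImp (w.cAll i p) (w.cAll i q))"
 obtain k p' q' where "i = w.nn k" "p = w.code p'" "q = w.code q'" using w_Form w_Nat h by metis
 thus ?thesis using x Q1[of k p' q'] by (intro exI[of _ "Imp (Forall k (Imp p' q')) (Imp (Forall k p') (Forall k q'))"]) simp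
next
 fix i p assume h: "w.Nat i" "w.Form p" and x: "x = w.cImp (w.cAll i p) p"
 obtain k p' where "i = w.nn k" "p = w.code p'" using w_Form w_Nat h by metis
 thus ?thesis using x Q2[of k p'] by (intro exI[of _ "Imp (Forall k p') p'"]) simp
next
 fix i p assume h: "w.Nat i" "w.Form p" "~ w.FreeV i p" and x: "x = w.cImp p (w.cAll i p)"
 obtain k p' where *: "i = w.nn k" "p = w.code p'" using w_Form w_Nat h by metis
 hence "k \<notin> FV p'" using h(3) w.FreeV_code by auto
 thus ?thesis using x * Q3[of k p'] by (intro exI[of _ "Imp p' (Forall k p')"]) simp
next
 fix i j assume h: "w.Nat i" "w.Nat j" and x: "x = w.cEx i (w.cEql i j)"
 obtain k l where "i = w.nn k" "j = w.nn l" using w_Nat h by metis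
 thus ?thesis using x E1[of k l] by (intro exI[of _ "Exists k (Eql k l)"]) simp
next
 fix i j k assume h: "w.Nat i" "w.Nat j" "w.Nat k" and x: "x = w.cImp (w.cEql i j) (w.cImp (w.cEql i k) (w.cEql j k))"
 obtain a b c where "i = w.nn a" "j = w.nn b" "k = w.nn c" using w_Nat h by metis
 thus ?thesis using x E2[of a b c] by (intro exI[of _ "Imp (Eql a b) (Imp (Eql a c) (Eql b c))"]) simp
next
 fix i j k assume h: "w.Nat i" "w.Nat j" "w.Nat k" and x: "x = w.cImp (w.cEql i j) (w.cImp (w.cMem i k) (w.cMem j k))"
 obtain a b c where "i = w.nn a" "j = w.nn b" "k = w.nn c" using w_Nat h by metis
 thus ?thesis using x E3[of a b c] by (intro exI[of _ "Imp (Eql a b) (Imp (Mem a c) (Mem b c))"]) simp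
next
 fix i j k assume h: "w.Nat i" "w.Nat j" "w.Nat k" and x: "x = w.cImp (w.cEql i j) (w.cImp (w.cMem k i) (w.cMem k j))"
 obtain a b c where "i = w.nn a" "j = w.nn b" "k = w.nn c" using w_Nat h by metis
 thus ?thesis using x E4[of a b c] by (intro exI[of _ "Imp (Eql a b) (Imp (Mem c a) (Mem c b))"]) simp
qed

definition Tc :: "fm set => nat => bool" where "Tc T x <-> (EX p:T. x = w.code p)"

lemma w_Pv: assumes "w.Pv T' x" "!!y. T' y ==> Tc T y" shows "EX p. x = w.code p & T \<turnstile> p"
proof (rule w.Pv_induct[OF assms(1), of "%x. EX p. x = w.code p & T \<turnstile> p", OF vdfn1])
 show "EX p. y = w.code p & T \<turnstile> p" if "w.LogAx y" for y using w_LogAx[OF that] proves.Log by blast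
 show "EX p. y = w.code p & T \<turnstile> p" if "T' y" for y using assms(2)[OF that] proves.Ax unfolding Tc_def by blast
 show "EX q. y = w.code q & T \<turnstile> q" if h: "EX r. w.cImp p y = w.code r & T \<turnstile> r" "EX q. p = w.code q & T \<turnstile> q" for p y
 proof -
  obtain r q where r: "w.cImp p y = w.code r" "T \<turnstile> r" "p = w.code q" "T \<turnstile> q" using h by blast
  then obtain q' s where s: "r = Imp q' s" "p = w.code q'" "y = w.code s" by (cases r rule: fm.exhaust) simp_all
  hence "q' = q" using r(3) w.code_inj by simp
  thus ?thesis using s r proves.MP by blast
 qed
 show "EX q. w.cAll i p = w.code q & T \<turnstile> q" if "w.Nat i" "EX q. p = w.code q & T \<turnstile> q" for i p
  using that w_Nat proves.Gen by (metis w.code.simps(5))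
qed

text \<open>The internal model existence theorem, read in the standard hereditarily finite sets, is
  Goedel's completeness theorem; \<open>T\<close> can be any set of formulas because every predicate
  of one variable counts as definable.\<close>

lemma consistent_model:
 assumes "consistent T"
 shows "EX Mr Er. quot0 {c. w.Nat c} Mr Er & (ALL p:T. ALL e. (ALL i. w.Nat (e i)) --> sat {c. w.Nat c} Mr Er e p)"
proof -
 interpret h: hilb VE vdfn "Tc T" by unfold_locales (rule vdfn1, auto simp: Tc_def)
 have "w.Con (Tc T)" unfolding w.Con_def
 proof
  assume "EX p. w.Pv (Tc T) p & w.Pv (Tc T) (w.cNeg p)"
  then obtain x where x: "w.Pv (Tc T) x" "w.Pv (Tc T) (w.cNeg x)" by blast
  obtain p where p: "x = w.code p" "T \<turnstile> p" using w_Pv[OF x(1)] by blast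
  obtain q where q: "w.cNeg x = w.code q" "T \<turnstile> q" using w_Pv[OF x(2)] by blast
  have "q = Neg p" using p(1) q(1) w.code_inj[of "Neg p" q] by simp
  thus False using assms p q unfolding consistent_def by blast
 qed
 hence nr: "~ w.Ref (Tc T) w.Form w.emp" by (rule h.Con_not_Ref)
 have "EX V Mr Er. tarski VE vdfn w.Form w.Nat w.emp Mr Er V & (ALL p A. Tc T p --> w.Form p --> w.HF A --> V p A) &
   (ALL p A. (VE (w.pos p A) w.emp --> V p A) & (VE (w.neg p A) w.emp --> ~ V p A))"
 proof (rule w.model_existence[OF vdfn1 vdfn1 _ _ _ _ w.IV_emp nr])
  show "w.Form q" if "w.Form p" "w.Imm q p" for p q using that(1) by (cases rule: w.Form_cases) (use that(2) in auto)
 qed (simp_all add: w.mem01_def w.eq01_def)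
 then obtain V Mr Er where V: "tarski VE vdfn w.Form w.Nat w.emp Mr Er V" "!!p A. Tc T p ==> w.Form p ==> w.HF A ==> V p A" by blast
 interpret f: ftarski VE vdfn Mr Er V by (rule ftarski.intro[OF V(1)])
 have "sat {c. w.Nat c} Mr Er e p" if "p : T" "!!i. w.Nat (e i)" for p e
 proof (rule f.sat_all)
  have "Tc T (w.code p)" using that(1) unfolding Tc_def by blast
  thus "V (w.code p) B" if "w.HF B" for B using V(2) that by simp
 qed (rule that(2))
 thus ?thesis using f.q.quot0_axioms by blast
qed

section \<open>Completeness for single formulas\<close>

lemma deduction:
 assumes "insert p T \<turnstile> q" "FV p = {}" shows "T \<turnstile> Imp p q"
 using assms(1)
proof induction
 case (Log q) thus ?case by (meson P1 proves.Log proves.MP)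
next
 case (Ax q)
 show ?case
 proof (cases "q = p")
  case True
  have "T \<turnstile> Imp (Imp p (Imp (Imp p p) p)) (Imp (Imp p (Imp p p)) (Imp p p))" by (rule proves.Log[OF P2])
  thus ?thesis unfolding True by (meson P1 proves.Log proves.MP)
 next
  case False thus ?thesis using Ax by (meson P1 proves.Ax proves.Log proves.MP insertE)
 qed
next
 case (MP q r) thus ?case by (meson P2 proves.Log proves.MP)
next
 case (Gen q i)
 have 1: "T \<turnstile> Imp (Forall i p) (Forall i q)" by (rule proves.MP[OF proves.Log[OF Q1] proves.Gen[OF Gen.IH]])
 have 2: "T \<turnstile> Imp p (Forall i p)" by (rule proves.Log[OF Q3]) (simp add: assms(2))
 have "T \<turnstile> Imp p (Imp (Forall i p) (Forall i q))" by (rule proves.MP[OF proves.Log[OF P1] 1])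
 thus ?case by (rule proves.MP[OF proves.MP[OF proves.Log[OF P2]] 2])
qed

lemma explode: assumes "T \<turnstile> p" "T \<turnstile> Neg p" shows "T \<turnstile> q"
proof -
 have "T \<turnstile> Imp (Neg q) (Neg p)" by (rule proves.MP[OF proves.Log[OF P1] assms(2)])
 hence "T \<turnstile> Imp p q" by (rule proves.MP[OF proves.Log[OF P3]])
 thus ?thesis by (rule proves.MP[OF _ assms(1)])
qed

lemma completeness:
 assumes "FV p = {}" "~ T \<turnstile> p"
 shows "EX Mr Er. quot0 {c. w.Nat c} Mr Er & (ALL q:insert (Neg p) T. ALL e. (ALL i. w.Nat (e i)) --> sat {c. w.Nat c} Mr Er e q)"
proof (rule consistent_model, rule ccontr)
 assume "~ consistent (insert (Neg p) T)"
 then obtain r where "insert (Neg p) T \<turnstile> r" "insert (Neg p) T \<turnstile> Neg r" unfolding consistent_def by blast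
 let ?t = "Imp p (Imp p p)"
 have "insert (Neg p) T \<turnstile> Neg ?t" by (rule explode) fact+
 hence "T \<turnstile> Imp (Neg p) (Neg ?t)" by (rule deduction) (simp add: assms(1))
 hence "T \<turnstile> Imp ?t p" by (rule proves.MP[OF proves.Log[OF P3]])
 hence "T \<turnstile> p" by (rule proves.MP) (rule proves.Log[OF P1])
 thus False using assms(2) by blast
qed

lemma S_quot:
 assumes "quot0 W Mr Er" and W: "W ~= {}" and S: "!!p e. p : S_axioms ==> (!!i. e i : W) ==> sat W Mr Er e p"
 shows "quot W Mr Er"
proof -
 interpret quot0 W Mr Er by fact
 obtain x where x: "x : W" using W by blast
 have pair: "ALL x:W. ALL y:W. EX z:W. ALL w:W. Mr w z <-> Er w x | Er w y"
  using S[OF S_axioms.single, of "ax_pair 0" "%_. x"] x by (simp add: S_single_def ax_pair_def sat_h)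
 define s where "s = (%c. SOME d. d : W & (ALL w:W. Mr w d <-> Er w c))"
 have s: "s c : W & (ALL w:W. Mr w (s c) <-> Er w c)" if "c : W" for c
  unfolding s_def by (rule someI_ex) (use pair that in fastforce)
 have "Exists 1 (Forall 2 (Iff (Mem 2 1) (Conj (Mem 2 0) (Neg (Eql 2 2))))) : S_axioms" by (rule S_axioms.separation) auto
 from S[OF this, of "%_. x"] x obtain z where z: "z : W" "!!w. w : W ==> ~ Mr w z" using Qr by auto
 have "~ Er (s c) z" if "c : W" for c
  using Qm[of "s c" z c] s[OF that] z that Qr by blast
 moreover have "Er c d" if "c : W" "d : W" "Er (s c) (s d)" for c d
  using Qm[of "s c" "s d" c] s[OF that(1)] s[OF that(2)] that Qr by blast
 ultimately show ?thesis
  by unfold_locales (use s z(1) in \<open>intro exI[of _ W] exI[of _ z] exI[of _ s], blast\<close>)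
qed

section \<open>The diagonal argument\<close>

text \<open>Terms for hereditarily finite sets, independent of any model: a formula's code becomes
  one fixed term, which has a value in each model and a fixed defining formula.\<close>

datatype hf = HE | HA hf hf

primrec desc :: "hf => fm" where
 "desc HE = Forall 1 (Neg (Mem 1 0))"
| "desc (HA a b) = Exists 1 (Exists 2 (Conj (Exists 0 (Conj (Eql 0 1) (desc a)))
   (Conj (Exists 0 (Conj (Eql 0 2) (desc b))) (Forall 3 (Iff (Mem 3 0) (Disj (Mem 3 1) (Eql 3 2)))))))"

definition hop :: "hf => hf => hf" where "hop a b = HA (HA HE (HA HE a)) (HA (HA HE a) b)"
primrec hnum :: "nat => hf" where "hnum 0 = HE" | "hnum (Suc k) = HA (hnum k) (hnum k)"
primrec hcode :: "fm => hf" where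
 "hcode (Mem i j) = hop (hnum 0) (hop (hnum i) (hnum j))"
| "hcode (Eql i j) = hop (hnum 1) (hop (hnum i) (hnum j))"
| "hcode (Neg p) = hop (hnum 2) (hcode p)"
| "hcode (Imp p q) = hop (hnum 3) (hop (hcode p) (hcode q))"
| "hcode (Forall i p) = hop (hnum 4) (hop (hnum i) (hcode p))"

context smodel
begin

primrec ev :: "hf => 'a" where "ev HE = emp" | "ev (HA a b) = adj (ev a) (ev b)"

lemma ev_hop: "ev (hop a b) = opair (ev a) (ev b)" by (simp add: hop_def opair_def)
lemma ev_hnum: "ev (hnum k) = nn k" by (induction k) (simp_all add: suc_def)
lemma ev_hcode: "ev (hcode p) = code p"
 by (induction p) (simp_all only: hcode.simps code.simps ev_hop ev_hnum c_defs)

lemma Dg_desc: "Dg (opair (code (desc h)) (ev h))"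
proof (induction h)
 case HE
 have "code (desc HE) = eD" unfolding eD_def by simp
 thus ?case using Dg_base by simp
next
 case (HA a b)
 have "code (desc (HA a b)) = aD (code (desc a)) (code (desc b))" unfolding aD_def by (simp only: desc.simps code.simps)
 thus ?case using Dg_step[OF HA] by simp
qed

end

text \<open>The quantifiers of \<open>desc\<close> are not relativized and range over classes; by
  extensionality a class that fits the description is nevertheless the described set.\<close>

lemma (in cmodel) sat_desc:
 "(!!i. e i : Dm) ==> sat Dm EK (=) e (desc h) <-> e 0 : KS & q.proj (e 0) = n.ev h"
proof (induction h arbitrary: e)
 case HE
 obtain z where z: "z : KS" "q.proj z = n.emp" using q.proj_ex by blast
 have ze: "~ EK w z" if "w : KS" for w using q.EN_proj[OF that z(1)] z(2) by simp
 have "(ALL w:Dm. ~ EK w (e 0)) <-> e 0 = z"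
 proof
  assume h: "ALL w:Dm. ~ EK w (e 0)"
  show "e 0 = z" by (rule C_ext) (use HE KS_Dm z ze h in auto)
 next
  assume "e 0 = z"
  thus "ALL w:Dm. ~ EK w (e 0)" using ze KS_mem z(1) KS_Dm by blast
 qed
 moreover have "e 0 = z <-> e 0 : KS & q.proj (e 0) = n.emp" using z q.proj(2)[of "e 0" z] by auto
 ultimately show ?case by simp
next
 case (HA a b)
 obtain x where x: "x : KS" "q.proj x = n.ev a" using q.proj_ex by blast
 obtain y where y: "y : KS" "q.proj y = n.ev b" using q.proj_ex by blast
 obtain z where z: "z : KS" "q.proj z = n.adj (n.ev a) (n.ev b)" using q.proj_ex by blast
 have zm: "EK w z <-> EK w x | w = y" if "w : KS" for w
  using n.mem_adj[of "q.proj w" "n.ev a" "n.ev b"] q.EN_proj[OF that z(1)] q.EN_proj[OF that x(1)] q.proj(2)[OF that y(1)] z(2) x(2) y(2) by simp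
 have A: "(EX v:Dm. v = u & sat Dm EK (=) (f(0 := v)) (desc a)) <-> u = x" if "u : Dm" "!!i. f i : Dm" for u f
 proof -
  have "(f(0 := u)) i : Dm" for i using that by simp
  note 1 = HA.IH(1)[of "f(0 := u)", OF this, unfolded fun_upd_same]
  have "u : KS & q.proj u = n.ev a <-> u = x" using x q.proj(2)[of u x] by auto
  thus ?thesis using 1 that(1) by blast
 qed
 have Bb: "(EX v:Dm. v = u & sat Dm EK (=) (f(0 := v)) (desc b)) <-> u = y" if "u : Dm" "!!i. f i : Dm" for u f
 proof -
  have "(f(0 := u)) i : Dm" for i using that by simp
  note 1 = HA.IH(2)[of "f(0 := u)", OF this, unfolded fun_upd_same]
  have "u : KS & q.proj u = n.ev b <-> u = y" using y q.proj(2)[of u y] by auto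
  thus ?thesis using 1 that(1) by blast
 qed
 have "sat Dm EK (=) e (desc (HA a b)) <-> (EX u:Dm. EX v:Dm. u = x & v = y & (ALL w:Dm. EK w (e 0) <-> EK w u | w = v))"
 proof -
  have "sat Dm EK (=) (e(1 := u, 2 := v)) (Exists 0 (Conj (Eql 0 1) (desc a))) <-> u = x" if "u : Dm" "v : Dm" for u v
   using A[of u "e(1 := u, 2 := v)"] that HA.prems unfolding sat_Exists sat_Conj by simp
  moreover have "sat Dm EK (=) (e(1 := u, 2 := v)) (Exists 0 (Conj (Eql 0 2) (desc b))) <-> v = y" if "u : Dm" "v : Dm" for u v
   using Bb[of v "e(1 := u, 2 := v)"] that HA.prems unfolding sat_Exists sat_Conj by simp
  moreover have "sat Dm EK (=) (e(1 := u, 2 := v)) (Forall 3 (Iff (Mem 3 0) (Disj (Mem 3 1) (Eql 3 2)))) <-> (ALL w:Dm. EK w (e 0) <-> EK w u | w = v)" for u v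
   by (simp add: sat_Iff disj_imp) blast
  ultimately show ?thesis unfolding desc.simps sat_Exists[of Dm EK "(=)" e] sat_Exists[of Dm EK "(=)" "e(1 := u)" for u]
   sat_Conj[of Dm EK "(=)" "e(1 := u, 2 := v)" for u v] by (simp cong: conj_cong)
 qed
 also have "\<dots> <-> (ALL w:Dm. EK w (e 0) <-> EK w x | w = y)" using KS_Dm x(1) y(1) by blast
 also have "\<dots> <-> e 0 = z"
 proof
  assume h: "ALL w:Dm. EK w (e 0) <-> EK w x | w = y"
  show "e 0 = z" by (rule C_ext) (use HA.prems KS_Dm z zm h in auto)
 next
  assume ez: "e 0 = z"
  show "ALL w:Dm. EK w (e 0) <-> EK w x | w = y"
  proof
   fix w assume w: "w : Dm"
   show "EK w (e 0) <-> EK w x | w = y"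
   proof (cases "w : KS")
    case True thus ?thesis using zm ez by simp
   next
    case False thus ?thesis using KS_mem[OF w] KS_Dm z(1) x(1) y(1) ez by blast
   qed
  qed
 qed
 also have "\<dots> <-> e 0 : KS & q.proj (e 0) = n.ev (HA a b)" using z q.proj(2)[of "e 0" z] by auto
 finally show ?case .
qed

text \<open>Variable 0 holds the code of a formula \<open>x\<close>, and \<open>d\<close> any
  definition of that very code; the universally quantified implication from \<open>d\<close> to
  \<open>x\<close> then says that \<open>x\<close> holds of its own code. Admitting every such
  \<open>d\<close> lets the image of a definition under the embedding serve as a definition
  again.\<close>

definition psi0 :: fm where
 "psi0 = (hconsistent hS_axiom \<^bold>\<and> (\<^bold>\<exists>t. quote theorems_universally_satisfied t \<^bold>\<and> hproves hC_axiom t) \<^bold>\<longrightarrow>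
   \<^bold>\<not> (\<^bold>\<exists>d. \<^bold>\<exists>p. hpair d 0 p \<^bold>\<and> hDg p \<^bold>\<and> (\<^bold>\<exists>t. qForall (num 0) (qImp (V d) (V 0)) t \<^bold>\<and> hproves hC_axiom t))) 1"

definition closeq :: "nat list => fm => fm" where "closeq xs p = foldr Forall xs p"

lemma FV_closeq: "FV (closeq xs p) = FV p - set xs"
 unfolding closeq_def by (induction xs) auto
lemma proves_closeq: "T \<turnstile> closeq xs p ==> T \<turnstile> p"
 unfolding closeq_def by (induction xs) (auto intro: proves.MP[OF proves.Log[OF Q2]])
lemma sat_closeq: "~ sat D R Q e (closeq xs p) ==> (!!i. e i : D) ==> EX e'. (ALL i. e' i : D) & ~ sat D R Q e' p"
proof (induction xs arbitrary: e)
 case (Cons x xs)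
 then obtain a where a: "a : D" "~ sat D R Q (e(x := a)) (closeq xs p)" unfolding closeq_def by auto
 show ?case by (rule Cons.IH[OF a(2)]) (use a Cons.prems in auto)
qed (auto simp: closeq_def)

text \<open>The quantifiers prefixed here are vacuous; they spare the computation of the free variables of \<open>psi0\<close>.\<close>

definition psi :: fm where "psi = closeq (SOME xs. set xs = FV psi0 - {0}) psi0"

lemma FV_psi: "FV psi \<subseteq> {0}" and psi_vars: "0 \<notin> set (SOME xs. set xs = FV psi0 - {0})"
proof -
 have "EX xs. set xs = FV psi0 - {0}" by (rule finite_list) (simp add: finite_FV)
 from someI_ex[OF this] show "FV psi \<subseteq> {0}" "0 \<notin> set (SOME xs. set xs = FV psi0 - {0})" unfolding psi_def FV_closeq by auto
qed

text \<open>The relativization of \<open>psi\<close> applied to its own code by means of a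
  description, so no function symbol for substitution is called for. It is itself one of the
  sentences whose provability \<open>psi\<close> denies at that code.\<close>

definition delta :: fm where "delta = Forall 0 (Imp (desc (hcode (relV psi))) (relV psi))"

context smodel
begin

lemma tru_psi: "tru e psi <-> (Con SAx & Pv CAx (code theorems_universally_satisfied) -->
  ~ (EX d. Dg (opair d (e 0)) & Pv CAx (cAll (nn 0) (cImp d (e 0)))))"
proof -
 define R where "R x <-> (Con SAx & Pv CAx (code theorems_universally_satisfied) -->
  ~ (EX d. Dg (opair d x) & Pv CAx (cAll (nn 0) (cImp d x))))" for x
 have 0: "tru e psi0 <-> R (e 0)" for e
  unfolding psi0_def R_def by (simp add: sat_h tru_conS okt_num del: num.simps nn.simps code.simps)
 have "0 \<notin> set xs ==> tru e (closeq xs psi0) <-> R (e 0)" for xs e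
  unfolding closeq_def by (induction xs arbitrary: e) (simp_all add: 0)
 thus ?thesis using psi_vars unfolding psi_def R_def by blast
qed

end

text \<open>What the ground model proves in C is true in the class structure, so \<open>psi\<close>
  holds among its sets at the image of its code. The embedding carries both provability hypotheses
  over, and \<open>theta_Con\<close> supplies the consistency; so \<open>psi\<close> denies there
  exactly the provability that was carried over.\<close>

lemma (in kmod) diagonal_contradiction:
 assumes th: "Pv CAx (code theorems_universally_satisfied)"
  and d: "Dg (opair d (code (relV psi)))" "Pv CAx (cAll (nn 0) (cImp d (code (relV psi))))"
 shows False
proof -
 let ?r = "code (relV psi)"
 have con: "c.n.Con c.n.SAx"
  by (rule c.theta_Con, rule sat_Dm) (use Pv_CAx_V[OF th] in blast)+
 have Fd: "Form d" using Dg_Form[OF d(1)] by blast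
 obtain k where k: "Jr ?r k" using Jr_ex[of ?r] by auto
 have kc: "kc k" using Jr_props[OF k] by blast
 obtain B where B: "HF B" "ALL i<1. vl B (nn i) = k" "V ?r B <-> sat {c. Nat c} Mr Er (%_. k) (relV psi)"
  using sat_ex[of "%_. k" 1 "relV psi"] kc by blast
 have "V (cAll (nn 0) (cImp d ?r)) B" by (rule Pv_CAx_V[OF d(2) B(1)])
 hence "V (cImp d ?r) (upd B (nn 0) k)" using B(1) Fd kc by (simp add: V_All del: nn.simps code.simps)
 hence dr: "V d (upd B (nn 0) k) --> V ?r (upd B (nn 0) k)" using B(1) Fd kc by (simp add: V_Imp del: nn.simps)
 have "V d (upd B (nn 0) k) <-> (EX c. Jr ?r c & Er (vl (upd B (nn 0) k) (nn 0)) c)" using V_Dg[OF d(1)] B(1) kc by simp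
 hence "V d (upd B (nn 0) k)" using k kc Er_refl by (auto simp: vl_upd)
 hence "V ?r (upd B (nn 0) k)" using dr by blast
 moreover have "V ?r (upd B (nn 0) k) <-> V ?r B"
  by (rule V_cong) (use B kc Er_refl in \<open>auto simp: vl_upd\<close>)
 ultimately have "sat {c. Nat c} Mr Er (%_. k) (relV psi)" using B(3) by blast
 \<comment> \<open>Relativization turns truth of \<open>relV psi\<close> among all classes into
   truth of \<open>psi\<close> among the sets.\<close>
 moreover have "{a : {c. Nat c}. EX b:{c. Nat c}. Mr a b} = {c. kc c}" unfolding ks_def by auto
 ultimately have "sat {c. kc c} Mr Er (%_. k) psi" unfolding sat_relV by simp
 hence "c.n.tru (%_. th k) psi" using sat_th[of psi "%_. k" "%_. th k"] kc by simp
 hence "~ (EX d. c.n.Dg (c.n.opair d (th k)) & c.n.Pv c.n.CAx (c.n.cAll (c.n.nn 0) (c.n.cImp d (th k))))"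
  unfolding c.n.tru_psi using con j_Pv[OF th] unfolding j_code by blast
 moreover have "c.n.Dg (c.n.opair (j d) (th k))" using j_Dg[OF d(1)] j_eq[OF k] by simp
 moreover have "c.n.Pv c.n.CAx (c.n.cAll (c.n.nn 0) (c.n.cImp (j d) (th k)))"
  using j_Pv[OF d(2)] Fd j_eq[OF k] by (simp add: j_nn del: nn.simps c.n.nn.simps code.simps)
 ultimately show False by blast
qed

text \<open>Consistency of S in the given model is used for a first Henkin model, and the classes
  definable over that model for a second one, to which \<open>diagonal_contradiction\<close>
  applies.\<close>

lemma smodel_psi:
 fixes E :: "nat => nat => bool"
 assumes "smodel E dfn" "smodel.Con E (smodel.SAx E)" "smodel.Pv E (smodel.CAx E) (smodel.code E theorems_universally_satisfied)"
  "smodel.Dg E (smodel.opair E d (smodel.code E (relV psi)))"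
  "smodel.Pv E (smodel.CAx E) (smodel.cAll E (smodel.nn E 0) (smodel.cImp E d (smodel.code E (relV psi))))"
 shows False
proof -
 interpret m: smodel E dfn by fact
 obtain V Mr Er where V: "tarski E dfn m.Form m.Nat m.emp Mr Er V" "!!p A. m.SAx p ==> m.HF A ==> V p A"
  using m.con_model[OF assms(2)] by blast
 interpret N: nmod E dfn Mr Er V by (rule nmod.intro[OF V(1)]) (unfold_locales, rule V(2))
 obtain V' Mr' Er' where V': "tarski E dfn m.Form m.Nat m.emp Mr' Er' V'" "!!p B. p : set (C_single @ L_ops) ==> m.HF B ==> V' (m.code p) B"
  using N.class_model by blast
 interpret K: kmod E dfn Mr' Er' V' by (rule kmod.intro[OF ftarski.intro[OF V'(1)]]) (unfold_locales, rule V'(2))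
 show False by (rule K.diagonal_contradiction[OF assms(3-5)])
qed

lemma completeness_open:
 assumes "~ T \<turnstile> p"
 shows "EX Mr Er e. quot0 {c. w.Nat c} Mr Er & (ALL q:T. ALL e. (ALL i. w.Nat (e i)) --> sat {c. w.Nat c} Mr Er e q) &
  (ALL i. w.Nat (e i)) & ~ sat {c. w.Nat c} Mr Er e p"
proof -
 obtain xs where xs: "set xs = FV p" using finite_list[OF finite_FV] by blast
 have "FV (closeq xs p) = {}" "~ T \<turnstile> closeq xs p" using xs proves_closeq assms by (auto simp: FV_closeq)
 from completeness[OF this] obtain Mr Er where M: "quot0 {c. w.Nat c} Mr Er"
  "ALL q:insert (Neg (closeq xs p)) T. ALL e. (ALL i. w.Nat (e i)) --> sat {c. w.Nat c} Mr Er e q" by blast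
 have "~ sat {c. w.Nat c} Mr Er (%_. w.emp) (closeq xs p)" using M(2) w.Nat_emp by simp
 then obtain e where "ALL i. e i : {c. w.Nat c}" "~ sat {c. w.Nat c} Mr Er e p" using sat_closeq by fastforce
 thus ?thesis using M by blast
qed

text \<open>If \<open>delta\<close> failed in a model of C, then \<open>psi\<close> would fail among
  its sets at the code in question; the sets form a model of S, in which the assumptions of
  \<open>smodel_psi\<close> would then be true.\<close>

lemma C_proves_delta: "C_axioms \<turnstile> delta"
proof (rule ccontr)
 assume "~ C_axioms \<turnstile> delta"
 from completeness_open[OF this] obtain Mr Er e where M: "quot0 {c. w.Nat c} Mr Er"
  "!!q e. q : C_axioms ==> (!!i. w.Nat (e i)) ==> sat {c. w.Nat c} Mr Er e q" "!!i. w.Nat (e i)" "~ sat {c. w.Nat c} Mr Er e delta" by blast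
 interpret Q: quot0 "{c. w.Nat c}" Mr Er by (rule M(1))
 let ?W = "{c. w.Nat c}" let ?D = "Q.rep ?W ` ?W"
 interpret C: cmodel ?D Mr
 proof
  show "?D ~= {}" using w.Nat_emp by blast
  fix p and e :: "nat => nat" assume p: "p : C_axioms" and e: "!!i. e i : ?D"
  have "EX c. w.Nat c & Q.rep ?W c = e i" for i using e[of i] unfolding image_def by auto
  then obtain f where f: "!!i. w.Nat (f i) & Q.rep ?W (f i) = e i" by metis
  have "sat ?W Mr Er f p" by (rule M(2)[OF p]) (use f in blast)
  thus "sat ?D Mr (=) e p" using Q.sat_rep[of p f e] f by simp
 qed
 define e' where "e' = (%i. Q.rep ?W (e i))"
 have e': "e' i : ?D" for i unfolding e'_def using M(3) by blast
 have "~ sat ?D Mr (=) e' delta" using Q.sat_rep[of delta e e'] M(3,4) unfolding e'_def by simp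
 then obtain x where x: "x : ?D" "sat ?D Mr (=) (e'(0 := x)) (desc (hcode (relV psi)))" "~ sat ?D Mr (=) (e'(0 := x)) (relV psi)"
  unfolding delta_def by auto
 have "x : C.KS & C.q.proj x = C.n.ev (hcode (relV psi))" using C.sat_desc[of "e'(0 := x)"] x(1,2) e' by simp
 hence k: "x : C.KS" "C.q.proj x = C.n.code (relV psi)" using C.n.ev_hcode by simp_all
 have "~ sat C.KS Mr (=) (e'(0 := x)) psi" using x(3) unfolding C.sat_relK .
 moreover have "sat C.KS Mr (=) (e'(0 := x)) psi <-> C.n.tru (%_. C.q.proj x) psi"
  by (rule C.q.sat_proj) (use FV_psi k(1) in auto)
 ultimately have n: "~ C.n.tru (%_. C.q.proj x) psi" by blast
 show False using n unfolding C.n.tru_psi k(2) using smodel_psi[OF C.n.smodel_axioms] by blast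
qed

text \<open>\<open>delta\<close> is provable in C, so each model of S has a proof of it, and
  \<open>desc\<close> provides a definition of the code inside \<open>delta\<close>. With
  consistency added, all assumptions of \<open>smodel_psi\<close> are met.\<close>

lemma smodel_not_chi:
 fixes E :: "nat => nat => bool"
 assumes "smodel E dfn" "smodel.Pv E (smodel.CAx E) (smodel.code E theorems_universally_satisfied)"
 shows "~ smodel.Con E (smodel.SAx E)"
proof
 assume con: "smodel.Con E (smodel.SAx E)"
 interpret m: smodel E dfn by fact
 have "m.Pv m.CAx (m.code delta)"
  by (rule m.Pv_code[OF C_proves_delta m.dfn_CAx[OF m.dt_var] m.CAx_code])
 hence "m.Pv m.CAx (m.cAll (m.nn 0) (m.cImp (m.code (desc (hcode (relV psi)))) (m.code (relV psi))))"
  unfolding delta_def by simp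
 moreover have "m.Dg (m.opair (m.code (desc (hcode (relV psi)))) (m.code (relV psi)))"
  using m.Dg_desc[of "hcode (relV psi)"] unfolding m.ev_hcode .
 ultimately show False using smodel_psi[OF assms(1) con assms(2)] by blast
qed

lemma w_SAx: assumes "w.SAx x" shows "Tc S_axioms x"
 using assms unfolding w.SAx_def
proof (elim disjE bexE exE conjE)
 fix p assume "p : set S_single" "x = w.code p"
 thus ?thesis unfolding Tc_def using S_axioms.single by blast
next
 fix a b c p assume h: "w.Nat a" "w.Nat b" "w.Nat c" "distinct [a, b, c]" "w.Form p" "~ w.FreeV b p"
  and x: "x = w.cEx b (w.cAll c (w.cIff (w.cMem c b) (w.cConj (w.cMem c a) p)))"
 obtain i j k where n: "a = w.nn i" "b = w.nn j" "c = w.nn k" using w_Nat h(1-3) by metis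
 obtain q where q: "p = w.code q" using w_Form h(5) by blast
 have "Exists j (Forall k (Iff (Mem k j) (Conj (Mem k i) q))) : S_axioms"
  by (rule S_axioms.separation) (use h(4,6) n q w.FreeV_code in auto)
 thus ?thesis unfolding Tc_def by (rule rev_bexI) (simp add: x n q)
next
 fix a b c d l p assume h: "w.Nat a" "w.Nat b" "w.Nat c" "w.Nat d" "w.Nat l" "distinct [a, b, c, d, l]" "w.Form p" "~ w.FreeV b p" "~ w.FreeV l p"
  and x: "x = w.cImp (w.cAll c (w.cImp (w.cMem c a) (w.cEx l (w.cAll d (w.cImp p (w.cEql d l))))))
       (w.cEx b (w.cAll d (w.cIff (w.cMem d b) (w.cEx c (w.cConj (w.cMem c a) p)))))"
 obtain i j k where n: "a = w.nn i" "b = w.nn j" "c = w.nn k" using w_Nat h(1-3) by metis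
 obtain s t where n': "d = w.nn s" "l = w.nn t" using w_Nat h(4,5) by metis
 obtain q where q: "p = w.code q" using w_Form h(7) by blast
 have "Imp (Forall k (Imp (Mem k i) (Exists t (Forall s (Imp q (Eql s t))))))
    (Exists j (Forall s (Iff (Mem s j) (Exists k (Conj (Mem k i) q))))) : S_axioms"
  by (rule S_axioms.replacement) (use h(6,8,9) n n' q w.FreeV_code in auto)
 thus ?thesis unfolding Tc_def by (rule rev_bexI) (simp add: x n n' q)
qed

theorem theorem2p23:
  shows "(consistent S_axioms \<longrightarrow> \<not> C_axioms \<turnstile> theorems_universally_satisfied) \<and>
         S_axioms \<turnstile> (hconsistent hS_axiom \<^bold>\<longrightarrow>
           \<^bold>\<not> (\<^bold>\<exists>t. quote theorems_universally_satisfied t \<^bold>\<and> hproves hC_axiom t)) 0"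
proof (intro conjI impI notI)
 assume con: "consistent S_axioms" and C: "C_axioms \<turnstile> theorems_universally_satisfied"
 \<comment> \<open>In the standard hereditarily finite sets internal provability is provability
   itself, so the failure of \<open>w.Con w.SAx\<close> is an actual inconsistency of S.\<close>
 have "w.Pv w.CAx (w.code theorems_universally_satisfied)"
  by (rule w.Pv_code[OF C w.dfn_CAx[OF w.dt_var] w.CAx_code])
 from smodel_not_chi[OF w.smodel_axioms this] obtain x where x: "w.Pv w.SAx x" "w.Pv w.SAx (w.cNeg x)" unfolding w.Con_def by blast
 obtain p where p: "x = w.code p" "S_axioms \<turnstile> p" using w_Pv[OF x(1) w_SAx] by blast
 obtain r where r: "w.cNeg x = w.code r" "S_axioms \<turnstile> r" using w_Pv[OF x(2) w_SAx] by blast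
 have "r = Neg p" using p(1) r(1) w.code_inj[of "Neg p" r] by simp
 thus False using con p r unfolding consistent_def by blast
next
 let ?t = "(hconsistent hS_axiom \<^bold>\<longrightarrow> \<^bold>\<not> (\<^bold>\<exists>t. quote theorems_universally_satisfied t \<^bold>\<and> hproves hC_axiom t)) 0"
 show "S_axioms \<turnstile> ?t"
 proof (rule ccontr)
  assume "~ S_axioms \<turnstile> ?t"
  \<comment> \<open>By completeness it suffices that the implication holds in every model of S; a
    countermodel, transported to \<open>nat\<close>, contradicts
    \<open>smodel_not_chi\<close>.\<close>
  from completeness_open[OF this] obtain Mr Er e where M: "quot0 {c. w.Nat c} Mr Er"
   "!!q e. q : S_axioms ==> (!!i. w.Nat (e i)) ==> sat {c. w.Nat c} Mr Er e q" "!!i. w.Nat (e i)" "~ sat {c. w.Nat c} Mr Er e ?t" by blast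
  interpret Q: quot "{c. w.Nat c}" Mr Er
  proof (rule S_quot[OF M(1)])
   show "{c. w.Nat c} ~= {}" using w.Nat_emp by blast
  qed (use M(2) in blast)
  interpret m: smodel Q.EN "pdfn (fo Q.EN)"
  proof (rule smodel_fo)
   fix p and e :: "nat => nat" assume p: "p : S_axioms"
   have "EX c. w.Nat c & Q.proj c = e i" for i using Q.proj_ex[of "e i"] by auto
   then obtain f where f: "!!i. w.Nat (f i) & Q.proj (f i) = e i" by metis
   have "sat {c. w.Nat c} Mr Er f p" by (rule M(2)[OF p]) (use f in blast)
   thus "sat UNIV Q.EN (=) e p" using Q.sat_proj[of p f e] f by simp
  qed
  have "~ m.tru (%i. Q.proj (e i)) ?t" using Q.sat_proj[of ?t e "%i. Q.proj (e i)"] M(3,4) by simp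
  hence "m.Con m.SAx & m.Pv m.CAx (m.code theorems_universally_satisfied)" unfolding m.tru_target by blast
  thus False using smodel_not_chi[OF m.smodel_axioms] by blast
 qed
qed

end
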